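(* Consider the Lindbladian $\mathcal{L}$ on an $n$-qubit system and the associated collision Hamiltonians with $m$ single-qubit sub-environments described in the context, an observable $O$ on the system, an initial system state $\rho_S$, and an evolution time $t>0$, with each sub-environment initialized in the single-qubit thermal state $\rho_{E_j}=\frac{|0\rangle\langle0|+e^{-\omega}|1\rangle\langle1|}{1+e^{-\omega}}$. Let $\varepsilon,\delta\in(0,1)$ and $K=m\nu$, where $$\nu=\mathcal{O}\left(\frac{t^2m\|O\|\Gamma}{\varepsilon}\right),\qquad \Gamma=\frac{\|\mathcal{L}\|_{1\to1}^2}{m}+\Big[\max_{\ell\in[1,m]}(\beta_S,\beta_{I_\ell},\beta_{E_\ell})\Big]^4 ,$$ is a suitably chosen number of repetitions. Then, for $\varepsilon'=\varepsilon/(12K\|O\|)$, the algorithm described in the context (with a suitable choice of its LCU segment parameters) outputs, with probability at least $1-\delta$, an estimate $\mu$ such that $$\left|\mu-\mathrm{Tr}\big[O\,e^{\mathcal{L}t}[\rho_S]\big]\right|\le\varepsilon ,$$ using $T$ coherent runs of its circuit, where $$T=\mathcal{O}\left(\frac{\|O\|^2\log(1/\delta)}{\varepsilon^2}\right),$$ and the circuit depth of each run is $$\tau_d=\widetilde{\mathcal{O}}\left(\frac{m^3t^3\|O\|}{\varepsilon}\,\Gamma\,\beta_{\max}^2\right),\qquad \beta_{\max}=\max_{\ell\in[1,m]}\left(\beta_{I_\ell},\ \sqrt{\frac{t}{m^2\nu}}\,\beta_S,\ \beta_{E_\ell}\sqrt{\frac{t}{\nu}}\right).$$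
   Context: **Notation.** $\|\cdot\|$ is the spectral norm, $\|\cdot\|_1$ the trace norm, and $\|\mathcal{M}\|_{1\to1}=\sup_{\rho\ne0}\|\mathcal{M}[\rho]\|_1/\|\rho\|_1$. $g=\mathcal{O}(f)$ means $g\le k_2f$ for a constant $k_2$ once the parameters exceed a constant; $\widetilde{\mathcal{O}}$ hides polylogarithmic factors. **Lindbladian.** $\mathcal{L}[\rho]=-i[H_S,\rho]+\sum_{j=1}^m\big(A_j\rho A_j^\dagger-\frac12\{A_j^\dagger A_j,\rho\}\big)$, with system Hamiltonian $H_S=\sum_{j=1}^{L_S}\lambda_jP_j$ ($P_j$ Pauli strings, $\beta_S=\sum_j|\lambda_j|$) and jump operators $A_j$ obtained from the interaction between the system and the environment. **Collision Hamiltonians.** There are $m$ single-qubit sub-environments $E_1,\dots,E_m$ with Hamiltonians $H_{E_j}=\beta_{E_j}\sigma^z$ and thermal initial states $\rho_{E_j}=\frac{|0\rangle\langle0|+e^{-\omega}|1\rangle\langle1|}{1+e^{-\omega}}$ (inverse temperature $\omega$), each preparable in constant depth. The interaction Hamiltonian $H_{I_j}$ on $S\otimes E_j$ is a linear combination of $L_{I_j}$ Pauli strings with total absolute weight $\beta_{I_j}$ (e.g. of the form $A_j\otimes\sigma^{+}+A_j^\dagger\otimes\sigma^{-}$, $\sigma^\pm=(\sigma^x\pm i\sigma^y)/2$), and satisfies $\mathrm{Tr}_{E_j}\big[[H_{I_j},\rho\otimes\rho_{E_j}]\big]=0$ for all $j$ and system states $\rho$. For a positive integer $\nu$ put $\Delta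 t=t/\nu$ and coupling $\lambda=1/\sqrt{\Delta t}$. The $j$-th collision Hamiltonian is $\beta_j\overline{H}_j=\frac1mH_S+H_{E_j}+\lambda H_{I_j}$, where $\beta_j\le\beta_S/m+\lambda\beta_{I_j}+\beta_{E_j}$ is the total weight of its Pauli coefficients, so that $\overline{H}_j$ is a convex combination of signed Pauli strings. Let $U_j=e^{-i\beta_j\overline{H}_j\Delta t}$, $\Phi_j[\cdot]=\mathrm{Tr}_{E_j}[U_j(\cdot\otimes\rho_{E_j})U_j^\dagger]$, and define the $(m,\nu)$-collision map $\mathcal{M}_{m,\nu}=(\Phi_m\circ\cdots\circ\Phi_1)^{\circ\nu}$. **Correspondence between $\mathcal{L}$ and the collision model (standing; the paper takes it from earlier work).** The Lindbladian and the collision Hamiltonians correspond in the sense that there is a constant $C$ such that for every $\eta\in(0,1)$, whenever $\nu\ge C\,t^2m\Gamma/\eta$ (with $\Delta t=t/\nu$, $\lambda=1/\sqrt{\Delta t}$), one has $\|e^{\mathcal{L}t}-\mathcal{M}_{m,\nu}\|_{1\to1}\le\eta$. **LCU decomposition used by the algorithm.** Let $\overline{H}=\sum_{\ell=1}^Lp_\ell P_\ell$ be a convex combination of signed Pauli strings, $\tau>0$, and $r$ a positive integer with $\tau/r<1$. Truncating the Taylor series of $e^{-i\tau\overline{H}/r}$ and pairing consecutive orders gives $$\widetilde S_r=\sum_{\substack{0\le k\le q\\ k\text{ even}}}\ \sum_{\ell_1,\dots,\ell_k,s=1}^{L}\frac{(\tau/r)^k}{k!}\sqrt{1+\Big(\tfrac{\tau/r}{k+1}\Big)^2}\;p_{\ell_1}\cdots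 p_{\ell_k}p_s\;\,(-i)^kP_{\ell_1}\cdots P_{\ell_k}e^{-i\theta_kP_s},$$ with $\theta_k=\arccos\big([1+(\tfrac{\tau/r}{k+1})^2]^{-1/2}\big)$. Expanding $\widetilde U=\widetilde S_r^{\,r}=\sum_i\alpha_iW_i$ expresses $\widetilde U$ with positive coefficients in terms of unitaries $W_i$, each a product of $r$ blocks consisting of at most $q$ Pauli strings and one Pauli rotation. The truncation order is $q=\mathcal{O}\big(\log(r/\varepsilon')/\log\log(r/\varepsilon')\big)$, chosen so that $\|\widetilde U-e^{-i\tau\overline{H}}\|\le\varepsilon'$; moreover $\sum_i|\alpha_i|\le e^{\tau^2/r}$. For each $j\in[1,m]$ this is applied with $\overline{H}=\overline{H}_j$, $\tau=\beta_j\Delta t$ and segment parameter $r=r_j$ (free parameter), giving $\widetilde U_j=\sum_k\alpha_{jk}W_{jk}$ with $\|\widetilde U_j-U_j\|\le\varepsilon'$. Put $\alpha^{(j)}=\sum_k|\alpha_{jk}|$. **Algorithm.** One coherent run: (1) initialize the system in $\rho_S$ and a single ancilla qubit in $|+\rangle$. (2) For $j=0,\dots,K-1$, with $K=m\nu$: (a) set $\ell=(j\bmod m)+1$; (b) prepare the environment qubit in $\rho_{E_\ell}$; (c) draw two i.i.d. samples $X_j,Y_j$ from the distribution in which $W_{\ell k}$ has probability $\alpha_{\ell k}/\alpha^{(\ell)}$; (d) apply $X_j^{(c)}=|0\rangle\langle0|\otimes I+|1\rangle\langle1|\otimes X_j$ and then $Y_j^{(a)}=|0\rangle\langle0|\otimes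 Y_j+|1\rangle\langle1|\otimes I$, controlled on the ancilla and acting on system and environment; (e) trace out the environment. (3) Measure $\sigma^x\otimes O$ on ancilla and system and record the outcome. The run is repeated independently $T$ times with outcomes $\mu_1,\dots,\mu_T$, and the output is $\mu=\frac{\zeta^2}{T}\sum_{i=1}^T\mu_i$, where $\zeta$ is the product of the weights $\alpha^{(\ell)}$ over all $K$ collisions, i.e. $\zeta=\prod_{j=0}^{K-1}\alpha^{((j\bmod m)+1)}$. **Circuit depth convention.** Each controlled (or anti-controlled) Pauli string and each controlled Pauli rotation, and each preparation of a $\rho_{E_\ell}$, counts as $\mathcal{O}(1)$. *)

theory Defs
  imports
    "HOL-Probability.Product_PMF"
    "Jordan_Normal_Form.Schur_Decomposition"
    "Jordan_Normal_Form.Char_Poly"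
begin

definition mat_Sum :: "nat \<Rightarrow> ('i \<Rightarrow> complex mat) \<Rightarrow> 'i set \<Rightarrow> complex mat" where
  "mat_Sum d f I = Matrix.mat d d (\<lambda>ij. \<Sum>k\<in>I. f k $$ ij)"

definition mtrace :: "complex mat \<Rightarrow> complex" where
  "mtrace A = (\<Sum>i<dim_row A. A $$ (i, i))"

definition kron :: "complex mat \<Rightarrow> complex mat \<Rightarrow> complex mat" where
  "kron A B = Matrix.mat (dim_row A * dim_row B) (dim_col A * dim_col B)
     (\<lambda>(i, j). A $$ (i div dim_row B, j div dim_col B) * B $$ (i mod dim_row B, j mod dim_col B))"

definition hermitian :: "complex mat \<Rightarrow> bool" where
  "hermitian A \<longleftrightarrow> square_mat A \<and> mat_adjoint A = A"

definition psd :: "complex mat \<Rightarrow> bool" where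
  "psd A \<longleftrightarrow> hermitian A \<and> (\<forall>v\<in>carrier_vec (dim_row A). 0 \<le> Re ((A *\<^sub>v v) \<bullet>c v))"

definition density_op :: "nat \<Rightarrow> complex mat \<Rightarrow> bool" where
  "density_op d \<rho> \<longleftrightarrow> \<rho> \<in> carrier_mat d d \<and> psd \<rho> \<and> mtrace \<rho> = 1"

definition vnorm :: "complex Matrix.vec \<Rightarrow> real" where
  "vnorm v = sqrt (\<Sum>i<dim_vec v. (cmod (vec_index v i))\<^sup>2)"

definition spectral_norm :: "complex mat \<Rightarrow> real" where
  "spectral_norm A =
     (SUP v\<in>{v \<in> carrier_vec (dim_col A). vnorm v = 1}. vnorm (A *\<^sub>v v))"

definition mat_abs :: "complex mat \<Rightarrow> complex mat" where
  "mat_abs A = (THE B. B \<in> carrier_mat (dim_col A) (dim_col A) \<and> psd B \<and> B * B = mat_adjoint A * A)"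

definition trace_norm :: "complex mat \<Rightarrow> real" where
  "trace_norm A = Re (mtrace (mat_abs A))"

definition norm_1to1 :: "nat \<Rightarrow> (complex mat \<Rightarrow> complex mat) \<Rightarrow> real" where
  "norm_1to1 d \<M> =
     (SUP \<rho>\<in>{\<rho> \<in> carrier_mat d d. \<rho> \<noteq> 0\<^sub>m d d}. trace_norm (\<M> \<rho>) / trace_norm \<rho>)"

definition mexp :: "complex mat \<Rightarrow> complex mat" where
  "mexp A = Matrix.mat (dim_row A) (dim_row A) (\<lambda>ij. \<Sum>k. (A ^\<^sub>m k) $$ ij / fact k)"

definition superop_exp :: "nat \<Rightarrow> (complex mat \<Rightarrow> complex mat) \<Rightarrow> real \<Rightarrow> complex mat \<Rightarrow> complex mat" where
  "superop_exp d \<L> t \<rho> =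
     Matrix.mat d d (\<lambda>ij. \<Sum>k. complex_of_real (t ^ k / fact k) * ((\<L> ^^ k) \<rho>) $$ ij)"

text \<open>The orthogonal projection onto the (possibly trivial) eigenspace of \<open>A\<close> for the real number
  \<open>x\<close>. Measuring the observable \<open>A\<close> in state \<open>\<rho>\<close> yields \<open>x\<close> with the Born probability
  \<open>Tr (\<Pi>\<^sub>x \<rho>)\<close>; this vanishes unless \<open>x\<close> is an eigenvalue.\<close>

definition eigenprojector :: "complex mat \<Rightarrow> real \<Rightarrow> complex mat" where
  "eigenprojector A x = (THE P. P \<in> carrier_mat (dim_row A) (dim_row A) \<and> hermitian P \<and> P * P = P \<and>
     (\<forall>v\<in>carrier_vec (dim_row A). P *\<^sub>v v = v \<longleftrightarrow> A *\<^sub>v v = complex_of_real x \<cdot>\<^sub>v v))"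

definition measurement_pmf :: "complex mat \<Rightarrow> complex mat \<Rightarrow> real pmf" where
  "measurement_pmf A \<rho> = embed_pmf (\<lambda>x. Re (mtrace (eigenprojector A x * \<rho>)))"

datatype pauli = Pauli_I | Pauli_X | Pauli_Y | Pauli_Z

fun pauli_mat :: "pauli \<Rightarrow> complex mat" where
  "pauli_mat Pauli_I = 1\<^sub>m 2"
| "pauli_mat Pauli_X = mat_of_rows_list 2 [[0, 1], [1, 0]]"
| "pauli_mat Pauli_Y = mat_of_rows_list 2 [[0, - \<i>], [\<i>, 0]]"
| "pauli_mat Pauli_Z = mat_of_rows_list 2 [[1, 0], [0, - 1]]"

definition pauli_string :: "pauli list \<Rightarrow> complex mat" where
  "pauli_string P = foldr (\<lambda>a. kron (pauli_mat a)) P (1\<^sub>m 1)"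

type_synonym pauli_comb = "(real \<times> pauli list) list"

definition pauli_sum :: "nat \<Rightarrow> pauli_comb \<Rightarrow> complex mat" where
  "pauli_sum n xs =
     mat_Sum (2 ^ n) (\<lambda>i. complex_of_real (fst (xs ! i)) \<cdot>\<^sub>m pauli_string (snd (xs ! i))) {..<length xs}"

definition pauli_weight :: "pauli_comb \<Rightarrow> real" where
  "pauli_weight xs = (\<Sum>(c, P)\<leftarrow>xs. \<bar>c\<bar>)"

definition on_qubits :: "nat \<Rightarrow> pauli_comb \<Rightarrow> bool" where
  "on_qubits n xs \<longleftrightarrow> (\<forall>(c, P)\<in>set xs. length P = n)"

definition proj0 :: "complex mat" where
  "proj0 = mat_of_rows_list 2 [[1, 0], [0, 0]]"

definition proj1 :: "complex mat" where
  "proj1 = mat_of_rows_list 2 [[0, 0], [0, 1]]"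

definition plus_state :: "complex mat" where
  "plus_state = mat_of_rows_list 2 [[1/2, 1/2], [1/2, 1/2]]"

text \<open>Trace over the last qubit of a \<open>2 * d\<close>-dimensional space; the environment qubit is always
  the last tensor factor, and the ancilla of the algorithm the first one.\<close>

definition ptrace_env :: "complex mat \<Rightarrow> complex mat" where
  "ptrace_env A = Matrix.mat (dim_row A div 2) (dim_col A div 2)
     (\<lambda>(i, j). \<Sum>e<2. A $$ (2 * i + e, 2 * j + e))"

text \<open>A signed Pauli string \<open>(s, P)\<close> stands for \<open>P\<close> if \<open>s\<close> holds and for \<open>-P\<close> otherwise. A weighted
  list of them with weights \<open>p\<^sub>l \<ge> 0\<close> summing to \<open>1\<close> is a convex combination.\<close>

type_synonym convex_pauli = "(real \<times> bool \<times> pauli list) list"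

definition signed_pauli :: "bool \<times> pauli list \<Rightarrow> complex mat" where
  "signed_pauli sP = (if fst sP then pauli_string (snd sP) else - pauli_string (snd sP))"

definition convex_on_qubits :: "nat \<Rightarrow> convex_pauli \<Rightarrow> bool" where
  "convex_on_qubits n ps \<longleftrightarrow>
     (\<forall>(p, s, P)\<in>set ps. 0 \<le> p \<and> length P = n) \<and> (\<Sum>(p, s, P)\<leftarrow>ps. p) = 1"

definition convex_sum :: "nat \<Rightarrow> convex_pauli \<Rightarrow> complex mat" where
  "convex_sum n ps =
     mat_Sum (2 ^ n) (\<lambda>l. complex_of_real (fst (ps ! l)) \<cdot>\<^sub>m signed_pauli (snd (ps ! l))) {..<length ps}"

text \<open>Environments are numbered \<open>0, \<dots>, m - 1\<close>. The fields \<open>col_weight\<close> and \<open>col_terms\<close> give, for a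
  coupling \<open>\<lambda>\<close> and an environment \<open>j\<close>, the number \<open>\<beta>\<^sub>j\<close> and the convex combination
  of signed Pauli strings whose product is the \<open>j\<close>-th collision Hamiltonian.\<close>

record collision_model =
  num_qubits :: nat
  num_envs :: nat
  sys_ham :: pauli_comb
  jump :: "nat \<Rightarrow> complex mat"
  int_ham :: "nat \<Rightarrow> pauli_comb"
  env_weight :: "nat \<Rightarrow> real"
  inv_temp :: real
  col_weight :: "real \<Rightarrow> nat \<Rightarrow> real"
  col_terms :: "real \<Rightarrow> nat \<Rightarrow> convex_pauli"

abbreviation sys_dim :: "collision_model \<Rightarrow> nat" where
  "sys_dim M \<equiv> 2 ^ num_qubits M"

abbreviation sys_weight :: "collision_model \<Rightarrow> real" where
  "sys_weight M \<equiv> pauli_weight (sys_ham M)"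

abbreviation int_weight :: "collision_model \<Rightarrow> nat \<Rightarrow> real" where
  "int_weight M j \<equiv> pauli_weight (int_ham M j)"

definition lindbladian :: "collision_model \<Rightarrow> complex mat \<Rightarrow> complex mat" where
  "lindbladian M \<rho> =
     (let H = pauli_sum (num_qubits M) (sys_ham M) in
      (- \<i>) \<cdot>\<^sub>m (H * \<rho> - \<rho> * H) +
      mat_Sum (sys_dim M)
        (\<lambda>j. let A = jump M j; A' = mat_adjoint A
             in A * \<rho> * A' - (1/2) \<cdot>\<^sub>m (A' * A * \<rho> + \<rho> * (A' * A)))
        {..<num_envs M})"

definition env_state :: "collision_model \<Rightarrow> complex mat" where
  "env_state M = complex_of_real (1 / (1 + exp (- inv_temp M))) \<cdot>\<^sub>m
     (proj0 + complex_of_real (exp (- inv_temp M)) \<cdot>\<^sub>m proj1)"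

definition collision_ham :: "collision_model \<Rightarrow> real \<Rightarrow> nat \<Rightarrow> complex mat" where
  "collision_ham M lam j =
     complex_of_real (1 / real (num_envs M)) \<cdot>\<^sub>m kron (pauli_sum (num_qubits M) (sys_ham M)) (1\<^sub>m 2) +
     complex_of_real (env_weight M j) \<cdot>\<^sub>m kron (1\<^sub>m (sys_dim M)) (pauli_mat Pauli_Z) +
     complex_of_real lam \<cdot>\<^sub>m pauli_sum (Suc (num_qubits M)) (int_ham M j)"

definition wf_collision_model :: "collision_model \<Rightarrow> bool" where
  "wf_collision_model M \<longleftrightarrow>
     1 \<le> num_qubits M \<and> 1 \<le> num_envs M \<and>
     on_qubits (num_qubits M) (sys_ham M) \<and>
     (\<forall>j<num_envs M.
        jump M j \<in> carrier_mat (sys_dim M) (sys_dim M) \<and>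
        on_qubits (Suc (num_qubits M)) (int_ham M j) \<and>
        0 \<le> env_weight M j \<and>
        (\<forall>\<rho>. density_op (sys_dim M) \<rho> \<longrightarrow>
           (let H = pauli_sum (Suc (num_qubits M)) (int_ham M j); R = kron \<rho> (env_state M)
            in ptrace_env (H * R - R * H) = 0\<^sub>m (sys_dim M) (sys_dim M))) \<and>
        (\<forall>lam>0.
           0 \<le> col_weight M lam j \<and>
           col_weight M lam j \<le>
             sys_weight M / real (num_envs M) + lam * int_weight M j + env_weight M j \<and>
           convex_on_qubits (Suc (num_qubits M)) (col_terms M lam j) \<and>
           complex_of_real (col_weight M lam j) \<cdot>\<^sub>m convex_sum (Suc (num_qubits M)) (col_terms M lam j)
             = collision_ham M lam j))"

definition time_step :: "real \<Rightarrow> nat \<Rightarrow> real" where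
  "time_step t \<nu> = t / real \<nu>"

definition coupling :: "real \<Rightarrow> nat \<Rightarrow> real" where
  "coupling t \<nu> = 1 / sqrt (time_step t \<nu>)"

definition collision_unitary :: "collision_model \<Rightarrow> real \<Rightarrow> nat \<Rightarrow> nat \<Rightarrow> complex mat" where
  "collision_unitary M t \<nu> j =
     mexp ((- \<i> * complex_of_real (time_step t \<nu>)) \<cdot>\<^sub>m collision_ham M (coupling t \<nu>) j)"

definition collision_channel ::
    "collision_model \<Rightarrow> real \<Rightarrow> nat \<Rightarrow> nat \<Rightarrow> complex mat \<Rightarrow> complex mat" where
  "collision_channel M t \<nu> j \<rho> =
     (let U = collision_unitary M t \<nu> j
      in ptrace_env (U * kron \<rho> (env_state M) * mat_adjoint U))"

definition collision_map :: "collision_model \<Rightarrow> real \<Rightarrow> nat \<Rightarrow> complex mat \<Rightarrow> complex mat" where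
  "collision_map M t \<nu> = fold (collision_channel M t \<nu>) [0..<num_envs M] ^^ \<nu>"

definition Gamma_const :: "collision_model \<Rightarrow> real" where
  "Gamma_const M =
     (norm_1to1 (sys_dim M) (lindbladian M))\<^sup>2 / real (num_envs M) +
     (Max (\<Union>j\<in>{..<num_envs M}. {sys_weight M, int_weight M j, env_weight M j})) ^ 4"

definition beta_max :: "collision_model \<Rightarrow> real \<Rightarrow> nat \<Rightarrow> real" where
  "beta_max M t \<nu> =
     Max (\<Union>j\<in>{..<num_envs M}.
       {int_weight M j,
        sqrt (t / ((real (num_envs M))\<^sup>2 * real \<nu>)) * sys_weight M,
        env_weight M j * sqrt (t / real \<nu>)})"

definition corresponds :: "real \<Rightarrow> collision_model \<Rightarrow> real \<Rightarrow> bool" where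
  "corresponds C M t \<longleftrightarrow>
     (\<forall>\<eta> \<nu>. 0 < \<eta> \<and> \<eta> < 1 \<and> 0 < \<nu> \<and>
            real \<nu> \<ge> C * t\<^sup>2 * real (num_envs M) * Gamma_const M / \<eta> \<longrightarrow>
        norm_1to1 (sys_dim M)
          (\<lambda>\<rho>. superop_exp (sys_dim M) (lindbladian M) t \<rho> - collision_map M t \<nu> \<rho>) \<le> \<eta>)"

text \<open>A block \<open>(ls, s)\<close> collects the summation indices \<open>l\<^sub>1, \<dots>, l\<^sub>k, s\<close> of one summand of the
  segment operator; \<open>k\<close> is the length of \<open>ls\<close>. The parameter \<open>x\<close> is \<open>\<tau> / r\<close>. Expanding the
  \<open>r\<close>-th power of the segment operator gives summands indexed by lists of \<open>r\<close> blocks.\<close>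

type_synonym block = "nat list \<times> nat"

definition block_index :: "nat \<Rightarrow> convex_pauli \<Rightarrow> block set" where
  "block_index q ps =
     {(ls, s). length ls \<le> q \<and> even (length ls) \<and> set ls \<subseteq> {..<length ps} \<and> s < length ps}"

fun block_coeff :: "convex_pauli \<Rightarrow> real \<Rightarrow> block \<Rightarrow> real" where
  "block_coeff ps x (ls, s) =
     x ^ length ls / fact (length ls) * sqrt (1 + (x / (real (length ls) + 1))\<^sup>2) *
     (\<Prod>l\<leftarrow>ls. fst (ps ! l)) * fst (ps ! s)"

definition block_angle :: "real \<Rightarrow> nat \<Rightarrow> real" where
  "block_angle x k = arccos (1 / sqrt (1 + (x / (real k + 1))\<^sup>2))"

fun block_unitary :: "nat \<Rightarrow> convex_pauli \<Rightarrow> real \<Rightarrow> block \<Rightarrow> complex mat" where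
  "block_unitary d ps x (ls, s) =
     ((- \<i>) ^ length ls) \<cdot>\<^sub>m foldr (\<lambda>l A. signed_pauli (snd (ps ! l)) * A) ls (1\<^sub>m d) *
     mexp ((- \<i> * complex_of_real (block_angle x (length ls))) \<cdot>\<^sub>m signed_pauli (snd (ps ! s)))"

definition segment_op :: "nat \<Rightarrow> convex_pauli \<Rightarrow> nat \<Rightarrow> real \<Rightarrow> complex mat" where
  "segment_op d ps q x =
     mat_Sum d (\<lambda>b. complex_of_real (block_coeff ps x b) \<cdot>\<^sub>m block_unitary d ps x b) (block_index q ps)"

definition lcu_index :: "convex_pauli \<Rightarrow> nat \<Rightarrow> nat \<Rightarrow> block list set" where
  "lcu_index ps q r = {bs. length bs = r \<and> set bs \<subseteq> block_index q ps}"

definition lcu_coeff :: "convex_pauli \<Rightarrow> real \<Rightarrow> block list \<Rightarrow> real" where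
  "lcu_coeff ps x bs = (\<Prod>b\<leftarrow>bs. block_coeff ps x b)"

definition lcu_unitary :: "nat \<Rightarrow> convex_pauli \<Rightarrow> real \<Rightarrow> block list \<Rightarrow> complex mat" where
  "lcu_unitary d ps x bs = foldr (\<lambda>b A. block_unitary d ps x b * A) bs (1\<^sub>m d)"

definition lcu_weight :: "convex_pauli \<Rightarrow> nat \<Rightarrow> nat \<Rightarrow> real \<Rightarrow> real" where
  "lcu_weight ps q r x = (\<Sum>bs\<in>lcu_index ps q r. \<bar>lcu_coeff ps x bs\<bar>)"

definition lcu_pmf :: "convex_pauli \<Rightarrow> nat \<Rightarrow> nat \<Rightarrow> real \<Rightarrow> block list pmf" where
  "lcu_pmf ps q r x =
     embed_pmf (\<lambda>bs. if bs \<in> lcu_index ps q r then lcu_coeff ps x bs / lcu_weight ps q r x else 0)"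

text \<open>\<open>r\<close> and \<open>q\<close> give the number of segments and the truncation order for each environment.\<close>

definition col_time :: "collision_model \<Rightarrow> real \<Rightarrow> nat \<Rightarrow> nat \<Rightarrow> real" where
  "col_time M t \<nu> j = col_weight M (coupling t \<nu>) j * time_step t \<nu>"

definition segment_time :: "collision_model \<Rightarrow> real \<Rightarrow> nat \<Rightarrow> (nat \<Rightarrow> nat) \<Rightarrow> nat \<Rightarrow> real" where
  "segment_time M t \<nu> r j = col_time M t \<nu> j / real (r j)"

definition approx_unitary ::
    "collision_model \<Rightarrow> real \<Rightarrow> nat \<Rightarrow> (nat \<Rightarrow> nat) \<Rightarrow> (nat \<Rightarrow> nat) \<Rightarrow> nat \<Rightarrow> complex mat" where
  "approx_unitary M t \<nu> r q j =
     segment_op (2 * sys_dim M) (col_terms M (coupling t \<nu>) j) (q j) (segment_time M t \<nu> r j) ^\<^sub>m r j"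

definition sampled_unitary ::
    "collision_model \<Rightarrow> real \<Rightarrow> nat \<Rightarrow> (nat \<Rightarrow> nat) \<Rightarrow> nat \<Rightarrow> block list \<Rightarrow> complex mat" where
  "sampled_unitary M t \<nu> r j =
     lcu_unitary (2 * sys_dim M) (col_terms M (coupling t \<nu>) j) (segment_time M t \<nu> r j)"

definition sample_pmf ::
    "collision_model \<Rightarrow> real \<Rightarrow> nat \<Rightarrow> (nat \<Rightarrow> nat) \<Rightarrow> (nat \<Rightarrow> nat) \<Rightarrow> nat \<Rightarrow> block list pmf" where
  "sample_pmf M t \<nu> r q j =
     lcu_pmf (col_terms M (coupling t \<nu>) j) (q j) (r j) (segment_time M t \<nu> r j)"

definition zeta ::
    "collision_model \<Rightarrow> real \<Rightarrow> nat \<Rightarrow> (nat \<Rightarrow> nat) \<Rightarrow> (nat \<Rightarrow> nat) \<Rightarrow> real" where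
  "zeta M t \<nu> r q =
     (\<Prod>j<num_envs M * \<nu>.
        let l = j mod num_envs M
        in lcu_weight (col_terms M (coupling t \<nu>) l) (q l) (r l) (segment_time M t \<nu> r l))"

text \<open>A sample assigns to each collision \<open>j < K\<close> the indices of the pair \<open>X\<^sub>j, Y\<^sub>j\<close>.\<close>

type_synonym sample = "nat \<Rightarrow> block list \<times> block list"

definition samples_pmf ::
    "collision_model \<Rightarrow> real \<Rightarrow> nat \<Rightarrow> (nat \<Rightarrow> nat) \<Rightarrow> (nat \<Rightarrow> nat) \<Rightarrow> sample pmf" where
  "samples_pmf M t \<nu> r q =
     Pi_pmf {..<num_envs M * \<nu>} ([], [])
       (\<lambda>j. let p = sample_pmf M t \<nu> r q (j mod num_envs M) in pair_pmf p p)"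

definition controlled :: "complex mat \<Rightarrow> complex mat" where
  "controlled X = kron proj0 (1\<^sub>m (dim_row X)) + kron proj1 X"

definition anti_controlled :: "complex mat \<Rightarrow> complex mat" where
  "anti_controlled Y = kron proj0 Y + kron proj1 (1\<^sub>m (dim_row Y))"

primrec run_state ::
    "collision_model \<Rightarrow> real \<Rightarrow> nat \<Rightarrow> (nat \<Rightarrow> nat) \<Rightarrow> complex mat \<Rightarrow> sample \<Rightarrow> nat \<Rightarrow> complex mat" where
  "run_state M t \<nu> r \<rho>S xy 0 = kron plus_state \<rho>S"
| "run_state M t \<nu> r \<rho>S xy (Suc j) =
     (let W = sampled_unitary M t \<nu> r (j mod num_envs M);
          G = anti_controlled (W (snd (xy j))) * controlled (W (fst (xy j)))
      in ptrace_env (G * kron (run_state M t \<nu> r \<rho>S xy j) (env_state M) * mat_adjoint G))"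

definition run_pmf ::
    "collision_model \<Rightarrow> real \<Rightarrow> nat \<Rightarrow> (nat \<Rightarrow> nat) \<Rightarrow> (nat \<Rightarrow> nat) \<Rightarrow> complex mat \<Rightarrow> complex mat \<Rightarrow> real pmf" where
  "run_pmf M t \<nu> r q Obs \<rho>S =
     bind_pmf (samples_pmf M t \<nu> r q)
       (\<lambda>xy. measurement_pmf (kron (pauli_mat Pauli_X) Obs)
               (run_state M t \<nu> r \<rho>S xy (num_envs M * \<nu>)))"

definition runs_pmf ::
    "collision_model \<Rightarrow> real \<Rightarrow> nat \<Rightarrow> (nat \<Rightarrow> nat) \<Rightarrow> (nat \<Rightarrow> nat) \<Rightarrow> complex mat \<Rightarrow> complex mat \<Rightarrow>
     nat \<Rightarrow> (nat \<Rightarrow> real) pmf" where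
  "runs_pmf M t \<nu> r q Obs \<rho>S T = Pi_pmf {..<T} 0 (\<lambda>_. run_pmf M t \<nu> r q Obs \<rho>S)"

definition estimate ::
    "collision_model \<Rightarrow> real \<Rightarrow> nat \<Rightarrow> (nat \<Rightarrow> nat) \<Rightarrow> (nat \<Rightarrow> nat) \<Rightarrow> nat \<Rightarrow> (nat \<Rightarrow> real) \<Rightarrow> real" where
  "estimate M t \<nu> r q T \<mu>s = (zeta M t \<nu> r q)\<^sup>2 / real T * (\<Sum>i<T. \<mu>s i)"

text \<open>Depth of a run when a controlled Pauli string, a controlled Pauli rotation and the preparation
  of an environment state have depth \<open>cP\<close>, \<open>cR\<close> and \<open>cE\<close>. The sign \<open>(-\<i>)\<^sup>k\<close> (\<open>k\<close> even) and the signs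
  of the Pauli strings are regarded as part of these gates.\<close>

definition lcu_depth :: "real \<Rightarrow> real \<Rightarrow> block list \<Rightarrow> real" where
  "lcu_depth cP cR bs = (\<Sum>(ls, s)\<leftarrow>bs. cP * real (length ls) + cR)"

definition run_depth :: "real \<Rightarrow> real \<Rightarrow> real \<Rightarrow> nat \<Rightarrow> sample \<Rightarrow> real" where
  "run_depth cP cR cE K xy =
     (\<Sum>j<K. cE + lcu_depth cP cR (fst (xy j)) + lcu_depth cP cR (snd (xy j)))"

end

theory Submission
  imports Defs "HOL-Probability.Hoeffding"
begin

text \<open>
  The off-diagonal ancilla block of one run evolves, averaged over the samples, by
  \<open>\<rho> \<mapsto> Tr\<^sub>E (A (\<rho> \<otimes> \<rho>\<^sub>E) A\<^sup>\<dagger>)\<close> with \<open>A\<close> the truncated unitary divided by its weight, so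
  \<open>\<zeta>\<^sup>2\<close> times a measured value is an unbiased estimate of the observable after the truncated collision map.
  Passing to the dual maps on observables, where only operator norms occur, the truncation errors add up to
  at most a third of \<open>\<epsilon>\<close>; the correspondence hypothesis contributes another third.
  Taking \<open>r\<^sub>j \<ge> K \<tau>\<^sub>j\<^sup>2\<close> keeps \<open>\<zeta>\<^sup>2 \<le> e\<^sup>2 \<le> 9\<close>, hence Hoeffding's inequality pays for the last third with
  \<open>O(\<parallel>O\<parallel>\<^sup>2 log(1/\<delta>) / \<epsilon>\<^sup>2)\<close> runs. As \<open>\<tau>\<^sub>j\<^sup>2 \<le> 9 (t/\<nu>) \<beta>\<^sub>m\<^sub>a\<^sub>x\<^sup>2\<close>, the segment numbers are \<open>O(m t \<beta>\<^sub>m\<^sub>a\<^sub>x\<^sup>2)\<close>,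
  which gives the depth.
\<close>

section \<open>Adjoint, Euclidean norm and operator norm of complex matrices\<close>

text \<open>Each gate of a run is block diagonal in the ancilla, so ancilla blocks never mix: a
  block off the diagonal sees one sample on its left and the other on its right, and independence
  averages both sides separately. The 12 in \<epsilon>' is 4 * 3: K collisions use the operator
  twice each, linearizing (1 + e)^(2K) - 1 costs another 2, and a third of \<epsilon> is available.
  Every segment is a polynomial in the collision Hamiltonian, so its error is the scalar Taylor
  remainder on the spectrum. Norms, absolute values and eigenprojectors are defined by suprema and
  definite descriptions; they say something only once boundedness, existence and uniqueness are
  known, hence the spectral theorem and the crude entrywise bounds. The order bounds presuppose that
  the norm of the observable over \<epsilon> is large, whereas accuracy must hold without this;
  hence the minima with constants in the choice of \<eta> and e.\<close>

lemma dim_mat_adjoint [simp]: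
  "dim_row (mat_adjoint A) = dim_col A" "dim_col (mat_adjoint A) = dim_row A"
  by (auto simp: mat_adjoint_def)

lemma index_mat_adjoint [simp]:
  fixes A :: "complex mat"
  assumes "i < dim_col A" "j < dim_row A"
  shows "mat_adjoint A $$ (i, j) = cnj (A $$ (j, i))"
  using assms by (simp add: mat_adjoint_def mat_of_rows_index)

lemma mat_adjoint_carrier [simp, intro]:
  "A \<in> carrier_mat m n \<Longrightarrow> mat_adjoint A \<in> carrier_mat n m"
  by (metis carrier_matD carrier_matI dim_mat_adjoint)

lemma mat_adjoint_adjoint [simp]: "mat_adjoint (mat_adjoint A) = (A :: complex mat)"
  by (rule eq_matI) auto

lemma mult_mat_vec_carrier_iff [simp]: "A *\<^sub>v v \<in> carrier_vec n \<longleftrightarrow> dim_row A = n"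
  by (metis carrier_vecD carrier_vecI dim_mult_mat_vec)

lemma mult_square_mat_carrier [simp]:
  "A \<in> carrier_mat n n \<Longrightarrow> B \<in> carrier_mat n n \<Longrightarrow> A * B \<in> carrier_mat n n"
  by (rule mult_carrier_mat)

lemma index_mult_mat_sum:
  assumes "A \<in> carrier_mat m n" "B \<in> carrier_mat n k" "i < m" "j < k"
  shows "(A * B) $$ (i, j) = (\<Sum>l<n. A $$ (i, l) * B $$ (l, j))"
  using assms by (auto simp: scalar_prod_def atLeast0LessThan intro!: sum.cong)

lemma index_mult_mat_vec_sum:
  assumes "A \<in> carrier_mat m n" "v \<in> carrier_vec n" "i < m"
  shows "vec_index (A *\<^sub>v v) i = (\<Sum>l<n. A $$ (i, l) * vec_index v l)"
  using assms by (auto simp: scalar_prod_def atLeast0LessThan intro!: sum.cong)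

lemma mat_adjoint_mult:
  fixes A :: "complex mat"
  assumes "A \<in> carrier_mat m n" "B \<in> carrier_mat n k"
  shows "mat_adjoint (A * B) = mat_adjoint B * mat_adjoint A"
proof (rule eq_matI)
  fix i j assume ij: "i < dim_row (mat_adjoint B * mat_adjoint A)" "j < dim_col (mat_adjoint B * mat_adjoint A)"
  have "mat_adjoint (A * B) $$ (i, j) = cnj ((A * B) $$ (j, i))"
    using assms ij by (intro index_mat_adjoint) auto
  also have "\<dots> = (\<Sum>l<n. cnj (A $$ (j, l)) * cnj (B $$ (l, i)))"
    using assms ij by (subst index_mult_mat_sum[of _ m n _ k]) auto
  also have "\<dots> = (mat_adjoint B * mat_adjoint A) $$ (i, j)"
    using assms ij by (subst index_mult_mat_sum[of _ k n _ m]) (auto simp: mult.commute)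
  finally show "mat_adjoint (A * B) $$ (i, j) = (mat_adjoint B * mat_adjoint A) $$ (i, j)" .
qed (use assms in auto)

lemma mat_adjoint_minus:
  fixes A :: "complex mat"
  assumes "A \<in> carrier_mat m n" "B \<in> carrier_mat m n"
  shows "mat_adjoint (A - B) = mat_adjoint A - mat_adjoint B"
  using assms by (intro eq_matI) auto

lemma mat_adjoint_smult [simp]: "mat_adjoint (c \<cdot>\<^sub>m A) = cnj c \<cdot>\<^sub>m mat_adjoint A"
  by (rule eq_matI) auto

lemma mat_adjoint_uminus [simp]: "mat_adjoint (- A) = - mat_adjoint (A :: complex mat)"
  by (rule eq_matI) auto

lemma mat_adjoint_one [simp]: "mat_adjoint (1\<^sub>m n) = (1\<^sub>m n :: complex mat)"
  by (rule eq_matI) auto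

lemma hermitianD: "hermitian A \<Longrightarrow> mat_adjoint A = A"
  by (simp add: hermitian_def)

lemma hermitianI: "A \<in> carrier_mat n n \<Longrightarrow> mat_adjoint A = A \<Longrightarrow> hermitian A"
  by (auto simp: hermitian_def)

section \<open>Euclidean length and the sesquilinear product\<close>

lemma vnorm_L2_set: "vnorm v = L2_set (\<lambda>i. cmod (vec_index v i)) {..<dim_vec v}"
  by (simp add: vnorm_def L2_set_def)

lemma vnorm_nonneg [simp]: "0 \<le> vnorm v"
  by (simp add: vnorm_L2_set)

lemma vnorm_power2: "(vnorm v)\<^sup>2 = (\<Sum>i<dim_vec v. (cmod (vec_index v i))\<^sup>2)"
  by (simp add: vnorm_def sum_nonneg)

lemma vnorm_triangle:
  assumes "v \<in> carrier_vec n" "w \<in> carrier_vec n"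
  shows "vnorm (v + w) \<le> vnorm v + vnorm w"
proof -
  have "vnorm (v + w) = L2_set (\<lambda>i. cmod (vec_index v i + vec_index w i)) {..<n}"
    using assms by (auto simp: vnorm_L2_set intro!: L2_set_cong)
  also have "\<dots> \<le> L2_set (\<lambda>i. cmod (vec_index v i) + cmod (vec_index w i)) {..<n}"
    by (intro L2_set_mono norm_triangle_ineq) auto
  also have "\<dots> \<le> vnorm v + vnorm w"
    using L2_set_triangle_ineq[of "\<lambda>i. cmod (vec_index v i)" "\<lambda>i. cmod (vec_index w i)" "{..<n}"] assms
    by (auto simp: vnorm_L2_set)
  finally show ?thesis .
qed

lemma vnorm_smult [simp]: "vnorm (c \<cdot>\<^sub>v v) = cmod c * vnorm v"
proof -
  have "vnorm (c \<cdot>\<^sub>v v) = L2_set (\<lambda>i. cmod c * cmod (vec_index v i)) {..<dim_vec v}"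
    by (auto simp: vnorm_L2_set norm_mult intro!: L2_set_cong)
  thus ?thesis by (simp add: L2_set_right_distrib vnorm_L2_set)
qed

lemma vnorm_eq_0_iff: "v \<in> carrier_vec n \<Longrightarrow> vnorm v = 0 \<longleftrightarrow> v = 0\<^sub>v n"
  by (auto simp: vnorm_L2_set L2_set_eq_0_iff intro!: eq_vecI)

lemma vnorm_zero [simp]: "vnorm (0\<^sub>v n) = 0"
  by (simp add: vnorm_eq_0_iff[of _ n])

lemma cscalar_prod_sum:
  fixes v w :: "complex Matrix.vec"
  assumes "v \<in> carrier_vec n" "w \<in> carrier_vec n"
  shows "v \<bullet>c w = (\<Sum>i<n. vec_index v i * cnj (vec_index w i))"
  using assms by (auto simp: scalar_prod_def atLeast0LessThan intro!: sum.cong)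

lemma cscalar_prod_self:
  fixes v :: "complex Matrix.vec"
  shows "v \<bullet>c v = complex_of_real ((vnorm v)\<^sup>2)"
proof -
  have "v \<bullet>c v = (\<Sum>i<dim_vec v. vec_index v i * cnj (vec_index v i))"
    by (rule cscalar_prod_sum) auto
  also have "\<dots> = complex_of_real ((vnorm v)\<^sup>2)"
    unfolding vnorm_power2 of_real_sum
    by (intro sum.cong refl) (auto simp only: complex_norm_square)
  finally show ?thesis .
qed

lemma cscalar_prod_le:
  assumes "v \<in> carrier_vec n" "w \<in> carrier_vec n"
  shows "cmod (v \<bullet>c w) \<le> vnorm v * vnorm w"
proof -
  have "cmod (v \<bullet>c w) \<le> (\<Sum>i<n. \<bar>cmod (vec_index v i)\<bar> * \<bar>cmod (vec_index w i)\<bar>)"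
    unfolding cscalar_prod_sum[OF assms]
    by (rule order_trans[OF norm_sum]) (auto simp: norm_mult)
  also have "\<dots> \<le> vnorm v * vnorm w"
    using L2_set_mult_ineq[of "\<lambda>i. cmod (vec_index v i)" "\<lambda>i. cmod (vec_index w i)" "{..<n}"] assms
    by (auto simp: vnorm_L2_set)
  finally show ?thesis .
qed

lemma cscalar_prod_swap:
  fixes v w :: "complex Matrix.vec"
  assumes "v \<in> carrier_vec n" "w \<in> carrier_vec n"
  shows "w \<bullet>c v = cnj (v \<bullet>c w)"
  using assms by (simp add: cscalar_prod_sum mult.commute)

lemma cscalar_prod_adjoint:
  fixes A :: "complex mat"
  assumes A: "A \<in> carrier_mat m n" and v: "v \<in> carrier_vec n" and w: "w \<in> carrier_vec m"
  shows "(A *\<^sub>v v) \<bullet>c w = v \<bullet>c (mat_adjoint A *\<^sub>v w)"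
proof -
  have "(A *\<^sub>v v) \<bullet>c w = (\<Sum>i<m. \<Sum>j<n. A $$ (i, j) * vec_index v j * cnj (vec_index w i))"
    using assms by (subst cscalar_prod_sum[of _ m])
      (auto simp: index_mult_mat_vec_sum[OF A v] sum_distrib_right simp del: index_mult_mat_vec)
  also have "\<dots> = (\<Sum>j<n. \<Sum>i<m. A $$ (i, j) * vec_index v j * cnj (vec_index w i))"
    by (rule sum.swap)
  also have "\<dots> = (\<Sum>j<n. vec_index v j * cnj (vec_index (mat_adjoint A *\<^sub>v w) j))"
    using assms
    by (intro sum.cong refl, subst index_mult_mat_vec_sum[of _ n m])
       (auto simp: sum_distrib_left mult_ac intro!: sum.cong)
  also have "\<dots> = v \<bullet>c (mat_adjoint A *\<^sub>v w)"
    using assms by (subst cscalar_prod_sum[of _ n]) auto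
  finally show ?thesis .
qed

text \<open>An upper bound for the operator norm, as a predicate instead of a value. Sums, products
  and adjoints then obey simple rules without any supremum; \<open>opbound_spectral_norm\<close> and
  \<open>spectral_norm_le\<close> link it to \<open>spectral_norm\<close>. Nonnegativity is built in
  because it would not follow in dimension zero.\<close>

definition opbound :: "complex mat \<Rightarrow> real \<Rightarrow> bool" where
  "opbound A c \<longleftrightarrow> 0 \<le> c \<and> (\<forall>v\<in>carrier_vec (dim_col A). vnorm (A *\<^sub>v v) \<le> c * vnorm v)"

lemma opboundI:
  assumes "A \<in> carrier_mat m n" "0 \<le> c" "\<And>v. v \<in> carrier_vec n \<Longrightarrow> vnorm (A *\<^sub>v v) \<le> c * vnorm v"
  shows "opbound A c"
  using assms by (auto simp: opbound_def)

lemma opboundD: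
  assumes "opbound A c" "A \<in> carrier_mat m n" "v \<in> carrier_vec n"
  shows "vnorm (A *\<^sub>v v) \<le> c * vnorm v"
  using assms by (auto simp: opbound_def)

lemma opbound_nonneg: "opbound A c \<Longrightarrow> 0 \<le> c"
  by (simp add: opbound_def)

lemma opbound_mono: "opbound A c \<Longrightarrow> c \<le> c' \<Longrightarrow> opbound A c'"
  unfolding opbound_def by (meson mult_right_mono order_trans vnorm_nonneg)

lemma opbound_mult:
  assumes "opbound A a" "opbound B b" "A \<in> carrier_mat m n" "B \<in> carrier_mat n k"
  shows "opbound (A * B) (a * b)"
proof (rule opboundI[of _ m k])
  fix v :: "complex Matrix.vec" assume v: "v \<in> carrier_vec k"
  have "vnorm (A * B *\<^sub>v v) = vnorm (A *\<^sub>v (B *\<^sub>v v))"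
    using assms v by simp
  also have "\<dots> \<le> a * vnorm (B *\<^sub>v v)"
    using assms v by (intro opboundD[of _ _ m n]) auto
  also have "\<dots> \<le> a * (b * vnorm v)"
    using assms v by (intro mult_left_mono opboundD[of _ _ n k]) (auto simp: opbound_nonneg)
  finally show "vnorm (A * B *\<^sub>v v) \<le> a * b * vnorm v" by (simp add: mult_ac)
qed (use assms opbound_nonneg in auto)

lemma opbound_add:
  assumes "opbound A a" "opbound B b" "A \<in> carrier_mat m n" "B \<in> carrier_mat m n"
  shows "opbound (A + B) (a + b)"
proof (rule opboundI[of _ m n])
  fix v :: "complex Matrix.vec" assume v: "v \<in> carrier_vec n"
  have "vnorm ((A + B) *\<^sub>v v) = vnorm (A *\<^sub>v v + B *\<^sub>v v)"
    using assms v by (simp add: add_mult_distrib_mat_vec)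
  also have "\<dots> \<le> vnorm (A *\<^sub>v v) + vnorm (B *\<^sub>v v)"
    using assms v by (intro vnorm_triangle[of _ m]) auto
  also have "\<dots> \<le> a * vnorm v + b * vnorm v"
    using assms v by (intro add_mono opboundD[of _ _ m n]) auto
  finally show "vnorm ((A + B) *\<^sub>v v) \<le> (a + b) * vnorm v" by (simp add: algebra_simps)
qed (use assms opbound_nonneg in auto)

lemma smult_mat_mult_vec:
  fixes A :: "complex mat"
  shows "A \<in> carrier_mat m n \<Longrightarrow> v \<in> carrier_vec n \<Longrightarrow> (c \<cdot>\<^sub>m A) *\<^sub>v v = c \<cdot>\<^sub>v (A *\<^sub>v v)"
  by (intro eq_vecI) (auto simp: scalar_prod_def sum_distrib_left mult_ac intro!: sum.cong)

lemma opbound_smult: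
  assumes "opbound A a" "A \<in> carrier_mat m n"
  shows "opbound (c \<cdot>\<^sub>m A) (cmod c * a)"
proof (rule opboundI[of _ m n])
  fix v :: "complex Matrix.vec" assume v: "v \<in> carrier_vec n"
  show "vnorm (c \<cdot>\<^sub>m A *\<^sub>v v) \<le> cmod c * a * vnorm v"
    using opboundD[OF assms v] assms v
    by (simp add: smult_mat_mult_vec mult_left_mono mult.assoc)
qed (use assms opbound_nonneg in auto)

lemma uminus_mat_smult: "- A = (-1::complex) \<cdot>\<^sub>m A"
  by (rule eq_matI) auto

text \<open>For w = A^dagger v the squared length of w is <v, A w>, which Cauchy-Schwarz bounds by
  |v| a |w|; one factor |w| cancels.\<close>

lemma opbound_adjoint:
  assumes "opbound A a" "A \<in> carrier_mat m n"
  shows "opbound (mat_adjoint A) a"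
proof (rule opboundI[of _ n m])
  fix v :: "complex Matrix.vec" assume v: "v \<in> carrier_vec m"
  let ?w = "mat_adjoint A *\<^sub>v v"
  have w: "?w \<in> carrier_vec n" using assms v by simp
  have "(vnorm ?w)\<^sup>2 = cmod (?w \<bullet>c ?w)"
    by (simp only: cscalar_prod_self norm_of_real abs_power2)
  also have "?w \<bullet>c ?w = v \<bullet>c (A *\<^sub>v ?w)"
    using cscalar_prod_adjoint[of "mat_adjoint A" n m v ?w] assms v w by simp
  also have "cmod \<dots> \<le> vnorm v * vnorm (A *\<^sub>v ?w)"
    using assms w v by (intro cscalar_prod_le) auto
  also have "\<dots> \<le> vnorm v * (a * vnorm ?w)"
    using assms w by (intro mult_left_mono opboundD) auto
  finally have "vnorm ?w * vnorm ?w \<le> (a * vnorm v) * vnorm ?w"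
    by (simp add: power2_eq_square mult_ac)
  thus "vnorm ?w \<le> a * vnorm v"
    by (cases "vnorm ?w = 0")
       (auto simp: opbound_nonneg[OF assms(1)] dest!: mult_right_le_imp_le intro: order_le_neq_trans)
qed (use assms opbound_nonneg in auto)

lemma opbound_zero: "opbound (0\<^sub>m m n) 0"
proof (rule opboundI[of _ m n])
  fix v :: "complex Matrix.vec" assume v: "v \<in> carrier_vec n"
  hence "0\<^sub>m m n *\<^sub>v v = 0\<^sub>v m" by (intro eq_vecI) auto
  thus "vnorm (0\<^sub>m m n *\<^sub>v v) \<le> 0 * vnorm v" by (simp only: vnorm_zero)
qed auto

lemma isometry_vnorm:
  assumes "A \<in> carrier_mat m n" "mat_adjoint A * A = 1\<^sub>m n" "v \<in> carrier_vec n"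
  shows "vnorm (A *\<^sub>v v) = vnorm v"
proof -
  have "complex_of_real ((vnorm (A *\<^sub>v v))\<^sup>2) = v \<bullet>c (mat_adjoint A *\<^sub>v (A *\<^sub>v v))"
    unfolding cscalar_prod_self[symmetric]
    using assms by (intro cscalar_prod_adjoint[of _ m n]) auto
  also have "mat_adjoint A *\<^sub>v (A *\<^sub>v v) = v"
    using assms by (subst assoc_mult_mat_vec[symmetric, of _ n m _ n]) auto
  finally show ?thesis
    unfolding cscalar_prod_self of_real_eq_iff by simp
qed

lemma opbound_isometry:
  assumes "A \<in> carrier_mat m n" "mat_adjoint A * A = 1\<^sub>m n"
  shows "opbound A 1"
  using assms by (intro opboundI[of _ m n]) (auto simp: isometry_vnorm)

text \<open>Cauchy-Schwarz on each row. The value is far from sharp; only finiteness is wanted, so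
  that the supremum in \<open>spectral_norm\<close> ranges over a set bounded above.\<close>

lemma opbound_exists:
  assumes "A \<in> carrier_mat m n"
  shows "\<exists>c. opbound A c"
proof
  let ?c = "\<Sum>i<m. vnorm (row A i)"
  show "opbound A ?c"
  proof (rule opboundI[OF assms])
    fix v :: "complex Matrix.vec" assume v: "v \<in> carrier_vec n"
    have "vnorm (A *\<^sub>v v) \<le> (\<Sum>i<m. cmod (vec_index (A *\<^sub>v v) i))"
      using assms by (auto simp: vnorm_L2_set intro!: order_trans[OF L2_set_le_sum])
    also have "\<dots> \<le> (\<Sum>i<m. vnorm (row A i) * vnorm v)"
    proof (rule sum_mono)
      fix i assume "i \<in> {..<m}"
      \<comment> \<open>The entry is a bilinear product; conjugating \<open>v\<close> turns it into
        the sesquilinear one to which Cauchy-Schwarz applies.\<close>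
      hence "vec_index (A *\<^sub>v v) i = row A i \<bullet>c conjugate v" using assms v by simp
      also have "cmod \<dots> \<le> vnorm (row A i) * vnorm (conjugate v)"
        using assms v by (intro cscalar_prod_le[of _ n]) auto
      also have "vnorm (conjugate v) = vnorm v"
        by (simp add: vnorm_def)
      finally show "cmod (vec_index (A *\<^sub>v v) i) \<le> vnorm (row A i) * vnorm v" .
    qed
    finally show "vnorm (A *\<^sub>v v) \<le> ?c * vnorm v" by (simp add: sum_distrib_right)
  qed (auto intro: sum_nonneg)
qed

lemma unit_vec_exists:
  assumes "0 < n"
  shows "\<exists>v\<in>carrier_vec n. vnorm v = 1"
proof
  show "vnorm (unit_vec n 0) = 1"
  proof -
    have "(vnorm (unit_vec n 0))\<^sup>2 = (\<Sum>i<n. if i = 0 then 1 else 0)"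
      unfolding vnorm_power2 using assms by (intro sum.cong) (auto simp: unit_vec_def)
    also have "\<dots> = 1" using assms by simp
    finally show ?thesis using vnorm_nonneg[of "unit_vec n 0"] by (auto simp: power2_eq_1_iff)
  qed
qed auto

text \<open>The supremum dominates every unit vector because \<open>opbound_exists\<close> keeps the
  set bounded above; other vectors follow by scaling. For n = 0 there is no unit vector and the
  supremum over the empty set carries no information.\<close>

lemma opbound_spectral_norm:
  assumes A: "A \<in> carrier_mat m n" and n: "0 < n"
  shows "opbound A (spectral_norm A)"
proof (rule opboundI[OF A])
  obtain c where c: "opbound A c" using opbound_exists[OF A] by auto
  let ?S = "{v \<in> carrier_vec (dim_col A). vnorm v = 1}"
  have bdd: "bdd_above ((\<lambda>v. vnorm (A *\<^sub>v v)) ` ?S)"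
  proof (rule bdd_aboveI)
    fix x assume "x \<in> (\<lambda>v. vnorm (A *\<^sub>v v)) ` ?S"
    then obtain v where v: "v \<in> ?S" "x = vnorm (A *\<^sub>v v)" by blast
    show "x \<le> c"
      using opboundD[OF c A, of v] v carrier_matD[OF A] by auto
  qed
  have le: "vnorm (A *\<^sub>v v) \<le> spectral_norm A" if "v \<in> ?S" for v
    unfolding spectral_norm_def using that bdd by (rule cSUP_upper)
  obtain u where "u \<in> ?S" using unit_vec_exists[OF n] A by auto
  from le[OF this] show "0 \<le> spectral_norm A" by (meson order_trans vnorm_nonneg)
  fix v :: "complex Matrix.vec" assume v: "v \<in> carrier_vec n"
  show "vnorm (A *\<^sub>v v) \<le> spectral_norm A * vnorm v"
  proof (cases "vnorm v = 0")
    case True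
    hence "v = 0\<^sub>v n" using v by (simp add: vnorm_eq_0_iff[of _ n])
    hence "A *\<^sub>v v = 0\<^sub>v m" using A by (intro eq_vecI) auto
    thus ?thesis using True by simp
  next
    case False
    let ?c = "complex_of_real (1 / vnorm v)"
    have "vnorm (A *\<^sub>v (?c \<cdot>\<^sub>v v)) \<le> spectral_norm A"
      by (rule le) (use False v A in \<open>auto simp: norm_divide\<close>)
    also have "A *\<^sub>v (?c \<cdot>\<^sub>v v) = ?c \<cdot>\<^sub>v (A *\<^sub>v v)" using A v by (simp add: mult_mat_vec)
    finally have "vnorm (A *\<^sub>v v) / vnorm v \<le> spectral_norm A" by (simp add: norm_divide)
    thus ?thesis using False vnorm_nonneg[of v]
      by (simp add: divide_le_eq order.strict_iff_order)
  qed
qed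

lemma spectral_norm_le:
  assumes "opbound A c" "A \<in> carrier_mat m n" "0 < n"
  shows "spectral_norm A \<le> c"
  unfolding spectral_norm_def
proof (rule cSUP_least)
  show "{v \<in> carrier_vec (dim_col A). vnorm v = 1} \<noteq> {}"
    using unit_vec_exists[OF assms(3)] assms by auto
  show "vnorm (A *\<^sub>v v) \<le> c" if "v \<in> {v \<in> carrier_vec (dim_col A). vnorm v = 1}" for v
    using opboundD[OF assms(1,2), of v] that carrier_matD[OF assms(2)] by auto
qed

section \<open>Traces and finite sums of matrices\<close>

lemma mtrace_carrier: "A \<in> carrier_mat n k \<Longrightarrow> mtrace A = (\<Sum>i<n. A $$ (i, i))"
  by (auto simp: mtrace_def)

lemma mtrace_mult_commute:
  assumes "A \<in> carrier_mat m n" "B \<in> carrier_mat n m"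
  shows "mtrace (A * B) = mtrace (B * A)"
proof -
  have "mtrace (A * B) = (\<Sum>i<m. \<Sum>j<n. A $$ (i, j) * B $$ (j, i))"
    using assms by (subst mtrace_carrier[of _ m m]) (auto simp: index_mult_mat_sum[OF assms] simp del: index_mult_mat)
  also have "\<dots> = (\<Sum>j<n. \<Sum>i<m. B $$ (j, i) * A $$ (i, j))"
    by (subst sum.swap) (simp add: mult.commute)
  also have "\<dots> = mtrace (B * A)"
    using assms by (subst mtrace_carrier[of _ n n]) (auto simp: index_mult_mat_sum[OF assms(2,1)] simp del: index_mult_mat)
  finally show ?thesis .
qed

lemma mtrace_minus: "A \<in> carrier_mat n n \<Longrightarrow> B \<in> carrier_mat n n \<Longrightarrow> mtrace (A - B) = mtrace A - mtrace B"
  by (auto simp: mtrace_def sum_subtractf)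

lemma mtrace_smult: "A \<in> carrier_mat n n \<Longrightarrow> mtrace (c \<cdot>\<^sub>m A) = c * mtrace A"
  by (auto simp: mtrace_def sum_distrib_left)

lemma dim_mat_Sum [simp]: "dim_row (mat_Sum d f I) = d" "dim_col (mat_Sum d f I) = d"
  by (auto simp: mat_Sum_def)

lemma mat_Sum_carrier [simp, intro]: "mat_Sum d f I \<in> carrier_mat d d"
  by (simp add: mat_Sum_def)

lemma index_mat_Sum [simp]: "i < d \<Longrightarrow> j < d \<Longrightarrow> mat_Sum d f I $$ (i, j) = (\<Sum>k\<in>I. f k $$ (i, j))"
  by (simp add: mat_Sum_def)

lemma mat_Sum_cong:
  assumes "\<And>k. k \<in> I \<Longrightarrow> f k = g k"
  shows "mat_Sum d f I = mat_Sum d g I"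
  unfolding mat_Sum_def using assms by (metis (no_types, lifting) sum.cong)

lemma mult_mat_Sum:
  assumes "A \<in> carrier_mat d d" "\<And>k. k \<in> I \<Longrightarrow> f k \<in> carrier_mat d d"
  shows "A * mat_Sum d f I = mat_Sum d (\<lambda>k. A * f k) I"
proof (rule eq_matI)
  fix i j assume ij: "i < dim_row (mat_Sum d (\<lambda>k. A * f k) I)" "j < dim_col (mat_Sum d (\<lambda>k. A * f k) I)"
  have "(A * mat_Sum d f I) $$ (i, j) = (\<Sum>l<d. \<Sum>k\<in>I. A $$ (i, l) * f k $$ (l, j))"
    using assms ij by (subst index_mult_mat_sum[of _ d d _ d]) (auto simp: sum_distrib_left)
  also have "\<dots> = (\<Sum>k\<in>I. (A * f k) $$ (i, j))"
    using assms ij by (subst sum.swap) (auto simp: index_mult_mat_sum[of _ d d _ d] simp del: index_mult_mat intro!: sum.cong)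
  finally show "(A * mat_Sum d f I) $$ (i, j) = mat_Sum d (\<lambda>k. A * f k) I $$ (i, j)"
    using ij by simp
qed (use assms in auto)

lemma mat_adjoint_mat_Sum:
  assumes "\<And>k. k \<in> I \<Longrightarrow> f k \<in> carrier_mat d d"
  shows "mat_adjoint (mat_Sum d f I) = mat_Sum d (\<lambda>k. mat_adjoint (f k)) I"
proof (rule eq_matI)
  fix i j assume "i < dim_row (mat_Sum d (\<lambda>k. mat_adjoint (f k)) I)"
    "j < dim_col (mat_Sum d (\<lambda>k. mat_adjoint (f k)) I)"
  thus "mat_adjoint (mat_Sum d f I) $$ (i, j) = mat_Sum d (\<lambda>k. mat_adjoint (f k)) I $$ (i, j)"
    using assms[THEN carrier_matD(1)] assms[THEN carrier_matD(2)] by (auto intro!: sum.cong)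
qed auto

lemma mat_Sum_mult:
  assumes "A \<in> carrier_mat d d" "\<And>k. k \<in> I \<Longrightarrow> f k \<in> carrier_mat d d"
  shows "mat_Sum d f I * A = mat_Sum d (\<lambda>k. f k * A) I"
proof (rule eq_matI)
  fix i j assume ij: "i < dim_row (mat_Sum d (\<lambda>k. f k * A) I)" "j < dim_col (mat_Sum d (\<lambda>k. f k * A) I)"
  have "(mat_Sum d f I * A) $$ (i, j) = (\<Sum>l<d. \<Sum>k\<in>I. f k $$ (i, l) * A $$ (l, j))"
    using assms ij by (subst index_mult_mat_sum[of _ d d _ d]) (auto simp: sum_distrib_right)
  also have "\<dots> = (\<Sum>k\<in>I. (f k * A) $$ (i, j))"
    using assms ij by (subst sum.swap) (auto simp: index_mult_mat_sum[of _ d d _ d] simp del: index_mult_mat intro!: sum.cong)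
  finally show "(mat_Sum d f I * A) $$ (i, j) = mat_Sum d (\<lambda>k. f k * A) I $$ (i, j)"
    using ij by simp
qed (use assms in auto)

lemma mtrace_mat_Sum: 
  assumes "\<And>k. k \<in> I \<Longrightarrow> f k \<in> carrier_mat d d"
  shows "mtrace (mat_Sum d f I) = (\<Sum>k\<in>I. mtrace (f k))"
proof -
  have "mtrace (mat_Sum d f I) = (\<Sum>i<d. \<Sum>k\<in>I. f k $$ (i, i))" by (auto simp: mtrace_def)
  also have "\<dots> = (\<Sum>k\<in>I. mtrace (f k))"
    using assms by (subst sum.swap) (auto simp: mtrace_def intro!: sum.cong)
  finally show ?thesis .
qed

section \<open>Spectral theorem for Hermitian matrices\<close>

definition unitary_mat :: "nat \<Rightarrow> complex mat \<Rightarrow> bool" where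
  "unitary_mat n U \<longleftrightarrow> U \<in> carrier_mat n n \<and> mat_adjoint U * U = 1\<^sub>m n \<and> U * mat_adjoint U = 1\<^sub>m n"

lemma unitary_matD:
  assumes "unitary_mat n U"
  shows "U \<in> carrier_mat n n" "mat_adjoint U * U = 1\<^sub>m n" "U * mat_adjoint U = 1\<^sub>m n"
  using assms by (auto simp: unitary_mat_def)

lemma unitary_matI:
  assumes "U \<in> carrier_mat n n" "mat_adjoint U * U = 1\<^sub>m n"
  shows "unitary_mat n U"
  using assms mat_mult_left_right_inverse[of "mat_adjoint U" n U]
  by (auto simp: unitary_mat_def)

lemma unitary_mat_mult:
  assumes "unitary_mat n U" "unitary_mat n V"
  shows "unitary_mat n (U * V)"
proof (rule unitary_matI)
  note U = unitary_matD[OF assms(1)] and V = unitary_matD[OF assms(2)]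
  have "mat_adjoint U * (U * V) = V"
    using U V assoc_mult_mat[of "mat_adjoint U" n n U n V n] by simp
  thus "mat_adjoint (U * V) * (U * V) = 1\<^sub>m n"
    using U V by (simp add: mat_adjoint_mult[of _ n n _ n] assoc_mult_mat[of _ n n _ n _ n])
  show "U * V \<in> carrier_mat n n" using U V by simp
qed

lemma unitary_mat_adjoint: "unitary_mat n U \<Longrightarrow> unitary_mat n (mat_adjoint U)"
  by (auto simp: unitary_mat_def)

lemma unitary_mat_one: "unitary_mat n (1\<^sub>m n)"
  by (auto simp: unitary_mat_def)

lemma opbound_unitary: "unitary_mat n U \<Longrightarrow> opbound U 1"
  by (auto dest: unitary_matD intro: opbound_isometry)

text \<open>Gram-Schmidt on a basis completed from \<open>v\<close> keeps its first vector; dividing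
  the columns by their lengths makes them orthonormal. The first column is therefore only
  proportional to \<open>v\<close>.\<close>

lemma unitary_mat_with_first_column:
  fixes v :: "complex Matrix.vec"
  assumes v: "v \<in> carrier_vec n" and v0: "v \<noteq> 0\<^sub>v n"
  shows "\<exists>U c. unitary_mat n U \<and> c \<noteq> 0 \<and> col U 0 = c \<cdot>\<^sub>v v"
proof -
  interpret cof_vec_space n "TYPE(complex)" .
  define b where "b = basis_completion v"
  define ws where "ws = gram_schmidt n b"
  note b = basis_completion[OF v v0, folded b_def]
  have n: "0 < n" using v v0 by (intro Nat.gr0I) auto
  obtain vs where bv: "b = v # vs" using b(6,7) n by (cases b) auto
  from gram_schmidt_result[OF b(2,4,5) refl, folded ws_def]
  have ws: "set ws \<subseteq> carrier_vec n" "corthogonal ws" "length ws = n"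
    using b(6) by auto
  have hd: "ws ! 0 = v"
    using gram_schmidt_hd[OF v, of vs] ws(3) n
    by (metis bv hd_conv_nth length_greater_0_conv ws_def)
  have wsc: "ws ! i \<in> carrier_vec n" if "i < n" for i
    using that ws by auto
  have pos: "vnorm (ws ! i) \<noteq> 0" if "i < n" for i
    using corthogonalD[OF ws(2), of i i] that ws(3) by (auto simp: cscalar_prod_self)
  define U where "U = Matrix.mat n n (\<lambda>(i, j). vec_index (ws ! j) i / complex_of_real (vnorm (ws ! j)))"
  have U: "U \<in> carrier_mat n n" by (simp add: U_def)
  have "mat_adjoint U * U = 1\<^sub>m n"
  proof (rule eq_matI)
    fix i j assume "i < dim_row (1\<^sub>m n :: complex mat)" "j < dim_col (1\<^sub>m n :: complex mat)"
    hence ij: "i < n" "j < n" by auto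
    have "(mat_adjoint U * U) $$ (i, j) = (\<Sum>l<n. cnj (U $$ (l, i)) * U $$ (l, j))"
      using U ij by (subst index_mult_mat_sum[of _ n n _ n]) auto
    also have "\<dots> = (\<Sum>l<n. vec_index (ws ! j) l * cnj (vec_index (ws ! i) l)) /
        complex_of_real (vnorm (ws ! i) * vnorm (ws ! j))"
      using ij by (simp add: U_def sum_divide_distrib mult_ac)
    also have "\<dots> = (ws ! j \<bullet>c ws ! i) / complex_of_real (vnorm (ws ! i) * vnorm (ws ! j))"
      using wsc ij by (subst cscalar_prod_sum[of _ n]) auto
    also have "\<dots> = 1\<^sub>m n $$ (i, j)"
    proof (cases "i = j")
      case True
      with ij pos[of i] show ?thesis by (simp add: cscalar_prod_self power2_eq_square)
    next
      case False
      with ij show ?thesis using corthogonalD[OF ws(2), of j i] ws(3) by simp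
    qed
    finally show "(mat_adjoint U * U) $$ (i, j) = 1\<^sub>m n $$ (i, j)" .
  qed (use U in auto)
  with U have "unitary_mat n U" by (intro unitary_matI)
  moreover have "col U 0 = complex_of_real (1 / vnorm v) \<cdot>\<^sub>v v"
    using n v hd by (intro eq_vecI) (auto simp: U_def)
  moreover have "complex_of_real (1 / vnorm v) \<noteq> 0" using pos[OF n] hd by simp
  ultimately show ?thesis by blast
qed

section \<open>Functional calculus in a fixed orthonormal basis\<close>

definition diag_of :: "nat \<Rightarrow> (nat \<Rightarrow> complex) \<Rightarrow> complex mat" where
  "diag_of n f = Matrix.mat n n (\<lambda>(i, j). if i = j then f i else 0)"

lemma diag_of_carrier [simp]: "diag_of n f \<in> carrier_mat n n"
  by (simp add: diag_of_def)

lemma dim_diag_of [simp]: "dim_row (diag_of n f) = n" "dim_col (diag_of n f) = n"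
  by (auto simp: diag_of_def)

lemma diag_of_mult: "diag_of n f * diag_of n g = diag_of n (\<lambda>i. f i * g i)"
proof (rule eq_matI)
  fix i j assume "i < dim_row (diag_of n (\<lambda>i. f i * g i))" "j < dim_col (diag_of n (\<lambda>i. f i * g i))"
  hence ij: "i < n" "j < n" by (auto simp: diag_of_def)
  have "(diag_of n f * diag_of n g) $$ (i, j) = (\<Sum>l<n. if l = i then (if i = j then f i * g i else 0) else 0)"
    using ij by (subst index_mult_mat_sum[of _ n n _ n]) (auto simp: diag_of_def simp del: sum.delta sum.delta' intro!: sum.cong)
  thus "(diag_of n f * diag_of n g) $$ (i, j) = diag_of n (\<lambda>i. f i * g i) $$ (i, j)"
    using ij by (simp add: diag_of_def)
qed (auto simp: diag_of_def)

text \<open>This is U diag(f) U^dagger. The entrywise formula makes sums, scalar multiples and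
  adjoints in f valid for every \<open>U\<close>; unitarity enters through products and the
  identity. Matrices sharing one \<open>U\<close> are thereby compared eigenvalue by
  eigenvalue.\<close>

definition conj_diag :: "nat \<Rightarrow> complex mat \<Rightarrow> (nat \<Rightarrow> complex) \<Rightarrow> complex mat" where
  "conj_diag n U f = Matrix.mat n n (\<lambda>(i, j). \<Sum>l<n. U $$ (i, l) * f l * cnj (U $$ (j, l)))"

lemma conj_diag_carrier [simp]: "conj_diag n U f \<in> carrier_mat n n"
  by (simp add: conj_diag_def)

lemma dim_conj_diag [simp]: "dim_row (conj_diag n U f) = n" "dim_col (conj_diag n U f) = n"
  by (auto simp: conj_diag_def)

lemma conj_diag_mult_adjoint:
  assumes U: "U \<in> carrier_mat n n"
  shows "conj_diag n U f = U * diag_of n f * mat_adjoint U"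
proof (rule eq_matI)
  fix i j assume "i < dim_row (U * diag_of n f * mat_adjoint U)" "j < dim_col (U * diag_of n f * mat_adjoint U)"
  hence ij: "i < n" "j < n" using U by auto
  have 1: "(U * diag_of n f) $$ (i, l) = U $$ (i, l) * f l" if "l < n" for l
  proof -
    have "(U * diag_of n f) $$ (i, l) = (\<Sum>k<n. if k = l then U $$ (i, l) * f l else 0)"
      using ij that U by (subst index_mult_mat_sum[of _ n n _ n]) (auto simp: diag_of_def simp del: sum.delta sum.delta' intro!: sum.cong)
    thus ?thesis using that by simp
  qed
  have "(U * diag_of n f * mat_adjoint U) $$ (i, j) =
      (\<Sum>l<n. (U * diag_of n f) $$ (i, l) * mat_adjoint U $$ (l, j))"
    by (rule index_mult_mat_sum[of _ n n _ n]) (use U ij in auto)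
  also have "\<dots> = (\<Sum>l<n. U $$ (i, l) * f l * cnj (U $$ (j, l)))"
    using U ij by (intro sum.cong) (auto simp: 1 simp del: index_mult_mat)
  finally show "conj_diag n U f $$ (i, j) = (U * diag_of n f * mat_adjoint U) $$ (i, j)"
    using ij by (simp add: conj_diag_def)
qed (use U in auto)

lemma conj_diag_mult:
  assumes "unitary_mat n U"
  shows "conj_diag n U f * conj_diag n U g = conj_diag n U (\<lambda>i. f i * g i)"
proof -
  note U = unitary_matD[OF assms]
  have "conj_diag n U f * conj_diag n U g =
      U * diag_of n f * (mat_adjoint U * U) * diag_of n g * mat_adjoint U"
    using U(1) by (simp add: conj_diag_mult_adjoint assoc_mult_mat[of _ n n _ n _ n])
  also have "\<dots> = U * (diag_of n f * diag_of n g) * mat_adjoint U"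
    unfolding U(2) using U by (simp add: assoc_mult_mat[of _ n n _ n _ n] left_mult_one_mat[of _ n n])
  finally show ?thesis using U by (simp add: diag_of_mult conj_diag_mult_adjoint)
qed

lemma conj_diag_one:
  assumes "unitary_mat n U"
  shows "conj_diag n U (\<lambda>_. 1) = 1\<^sub>m n"
proof -
  note U = unitary_matD[OF assms]
  have "diag_of n (\<lambda>_. 1) = 1\<^sub>m n" by (intro eq_matI) (auto simp: diag_of_def)
  thus ?thesis using U by (simp add: conj_diag_mult_adjoint)
qed

lemma conj_diag_add: "conj_diag n U f + conj_diag n U g = conj_diag n U (\<lambda>i. f i + g i)"
  by (intro eq_matI) (auto simp: conj_diag_def sum.distrib algebra_simps)

lemma conj_diag_minus: "conj_diag n U f - conj_diag n U g = conj_diag n U (\<lambda>i. f i - g i)"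
  by (intro eq_matI) (auto simp: conj_diag_def sum_subtractf algebra_simps)

lemma conj_diag_smult: "c \<cdot>\<^sub>m conj_diag n U f = conj_diag n U (\<lambda>i. c * f i)"
  by (intro eq_matI) (auto simp: conj_diag_def sum_distrib_left algebra_simps)

lemma conj_diag_adjoint: "mat_adjoint (conj_diag n U f) = conj_diag n U (\<lambda>i. cnj (f i))"
  by (intro eq_matI) (auto simp: conj_diag_def algebra_simps)

lemma conj_diag_mat_Sum:
  "mat_Sum n (\<lambda>k. conj_diag n U (f k)) I = conj_diag n U (\<lambda>i. \<Sum>k\<in>I. f k i)"
proof (rule eq_matI)
  fix i j assume "i < dim_row (conj_diag n U (\<lambda>i. \<Sum>k\<in>I. f k i))"
    "j < dim_col (conj_diag n U (\<lambda>i. \<Sum>k\<in>I. f k i))"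
  thus "mat_Sum n (\<lambda>k. conj_diag n U (f k)) I $$ (i, j) = conj_diag n U (\<lambda>i. \<Sum>k\<in>I. f k i) $$ (i, j)"
    by (simp add: conj_diag_def sum_distrib_left sum_distrib_right) (rule sum.swap)
qed auto

lemma conj_diag_cong: "(\<And>i. i < n \<Longrightarrow> f i = g i) \<Longrightarrow> conj_diag n U f = conj_diag n U g"
  by (intro eq_matI) (auto simp: conj_diag_def intro!: sum.cong)

lemma conj_diag_pow:
  assumes "unitary_mat n U"
  shows "conj_diag n U f ^\<^sub>m k = conj_diag n U (\<lambda>i. f i ^ k)"
  by (induction k) (auto simp: conj_diag_one[OF assms] conj_diag_mult[OF assms] mult.commute)

lemma unitary_conj_diag:
  assumes "unitary_mat n U" "\<And>i. i < n \<Longrightarrow> cmod (f i) = 1"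
  shows "unitary_mat n (conj_diag n U f)"
proof (rule unitary_matI)
  have "mat_adjoint (conj_diag n U f) * conj_diag n U f = conj_diag n U (\<lambda>i. cnj (f i) * f i)"
    using assms(1) by (simp add: conj_diag_adjoint conj_diag_mult)
  also have "\<dots> = conj_diag n U (\<lambda>_. 1)"
  proof (rule conj_diag_cong)
    fix i assume "i < n"
    have "cnj (f i) * f i = complex_of_real ((cmod (f i))\<^sup>2)"
      by (simp only: complex_norm_square mult.commute)
    thus "cnj (f i) * f i = 1" using assms(2)[OF \<open>i < n\<close>] by simp
  qed
  finally show "mat_adjoint (conj_diag n U f) * conj_diag n U f = 1\<^sub>m n"
    by (simp add: conj_diag_one[OF assms(1)])
qed auto

lemma opbound_diag_of:
  assumes "\<And>i. i < n \<Longrightarrow> cmod (f i) \<le> c" "0 \<le> c"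
  shows "opbound (diag_of n f) c"
proof (rule opboundI[of _ n n])
  fix v :: "complex Matrix.vec" assume v: "v \<in> carrier_vec n"
  have *: "vec_index (diag_of n f *\<^sub>v v) i = f i * vec_index v i" if "i < n" for i
  proof -
    have "vec_index (diag_of n f *\<^sub>v v) i = (\<Sum>l<n. if l = i then f i * vec_index v i else 0)"
      using that v by (subst index_mult_mat_vec_sum[of _ n n]) (auto simp: diag_of_def simp del: sum.delta sum.delta' intro!: sum.cong)
    thus ?thesis using that by simp
  qed
  have "vnorm (diag_of n f *\<^sub>v v) = L2_set (\<lambda>i. cmod (f i) * cmod (vec_index v i)) {..<n}"
    unfolding vnorm_L2_set
    by (intro L2_set_cong) (auto simp: * norm_mult simp del: index_mult_mat_vec)
  also have "\<dots> \<le> L2_set (\<lambda>i. c * cmod (vec_index v i)) {..<n}"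
    using assms by (intro L2_set_mono mult_right_mono) auto
  also have "\<dots> = c * vnorm v" using v assms by (simp add: vnorm_L2_set L2_set_right_distrib)
  finally show "vnorm (diag_of n f *\<^sub>v v) \<le> c * vnorm v" .
qed (use assms in auto)

lemma opbound_conj_diag:
  assumes "unitary_mat n U" "\<And>i. i < n \<Longrightarrow> cmod (f i) \<le> c" "0 \<le> c"
  shows "opbound (conj_diag n U f) c"
proof -
  note U = unitary_matD[OF assms(1)]
  have "opbound (U * diag_of n f * mat_adjoint U) (1 * c * 1)"
    by (intro opbound_mult[of _ _ _ _ n n n] opbound_diag_of opbound_unitary[of n] assms
        unitary_mat_adjoint)
      (use U in auto)
  thus ?thesis using U by (simp add: conj_diag_mult_adjoint)
qed

text \<open>For f = 1 and unitary \<open>U\<close> this is the trace in the orthonormal basis of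
  columns; for f the eigenvalues of an observable it is the expectation as a mean over measured
  eigenvalues.\<close>

lemma mtrace_conj_diag_mult:
  assumes "U \<in> carrier_mat n n" "A \<in> carrier_mat n n"
  shows "mtrace (A * conj_diag n U f) = (\<Sum>l<n. f l * ((A *\<^sub>v col U l) \<bullet>c col U l))"
proof -
  have "mtrace (A * conj_diag n U f) =
      (\<Sum>i<n. \<Sum>j<n. \<Sum>l<n. A $$ (i, j) * (U $$ (j, l) * f l * cnj (U $$ (i, l))))"
    using assms by (subst mtrace_carrier[of _ n n])
      (auto simp: index_mult_mat_sum[of _ n n _ n] conj_diag_def sum_distrib_left simp del: index_mult_mat)
  also have "\<dots> = (\<Sum>i<n. \<Sum>l<n. \<Sum>j<n. A $$ (i, j) * (U $$ (j, l) * f l * cnj (U $$ (i, l))))"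
    by (intro sum.cong refl sum.swap)
  also have "\<dots> = (\<Sum>l<n. \<Sum>i<n. \<Sum>j<n. A $$ (i, j) * (U $$ (j, l) * f l * cnj (U $$ (i, l))))"
    by (rule sum.swap)
  also have "\<dots> = (\<Sum>l<n. f l * ((A *\<^sub>v col U l) \<bullet>c col U l))"
  proof (intro sum.cong refl)
    fix l assume "l \<in> {..<n}"
    hence l: "l < n" by simp
    have "(A *\<^sub>v col U l) \<bullet>c col U l = (\<Sum>i<n. (\<Sum>j<n. A $$ (i, j) * U $$ (j, l)) * cnj (U $$ (i, l)))"
      using assms l by (subst cscalar_prod_sum[of _ n])
        (auto simp: index_mult_mat_vec_sum[of _ n n] simp del: index_mult_mat_vec intro!: sum.cong)
    thus "(\<Sum>i<n. \<Sum>j<n. A $$ (i, j) * (U $$ (j, l) * f l * cnj (U $$ (i, l)))) =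
        f l * ((A *\<^sub>v col U l) \<bullet>c col U l)"
      by (simp add: sum_distrib_left sum_distrib_right mult_ac)
  qed
  finally show ?thesis .
qed

lemma unitary_col_inner:
  assumes "unitary_mat n U" "k < n" "l < n"
  shows "col U k \<bullet>c col U l = (if k = l then 1 else 0)"
proof -
  note U = unitary_matD[OF assms(1)]
  have "col U k \<bullet>c col U l = (\<Sum>i<n. cnj (U $$ (i, l)) * U $$ (i, k))"
    using U assms by (subst cscalar_prod_sum[of _ n]) (auto simp: mult.commute)
  also have "\<dots> = (mat_adjoint U * U) $$ (l, k)"
    using U(1) assms by (subst index_mult_mat_sum[of _ n n _ n]) auto
  finally show ?thesis using U assms by auto
qed

lemma vnorm_unitary_col:
  assumes "unitary_mat n U" "l < n"
  shows "vnorm (col U l) = 1"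
proof -
  have "complex_of_real ((vnorm (col U l))\<^sup>2) = 1"
    using unitary_col_inner[OF assms assms(2)] by (simp add: cscalar_prod_self)
  hence "(vnorm (col U l))\<^sup>2 = 1" by (metis of_real_eq_1_iff)
  thus ?thesis using vnorm_nonneg[of "col U l"] by (auto simp: power2_eq_1_iff)
qed

lemma conj_diag_mult_col:
  assumes "unitary_mat n U" "l < n"
  shows "conj_diag n U f *\<^sub>v col U l = f l \<cdot>\<^sub>v col U l"
proof (rule eq_vecI)
  note U = unitary_matD[OF assms(1)]
  fix i assume "i < dim_vec (f l \<cdot>\<^sub>v col U l)"
  hence i: "i < n" using U by simp
  have "vec_index (conj_diag n U f *\<^sub>v col U l) i =
      (\<Sum>j<n. \<Sum>k<n. U $$ (i, k) * f k * cnj (U $$ (j, k)) * U $$ (j, l))"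
    using i U assms by (subst index_mult_mat_vec_sum[of _ n n]) (auto simp: conj_diag_def sum_distrib_right)
  also have "\<dots> = (\<Sum>k<n. \<Sum>j<n. U $$ (i, k) * f k * cnj (U $$ (j, k)) * U $$ (j, l))"
    by (rule sum.swap)
  also have "\<dots> = (\<Sum>k<n. U $$ (i, k) * f k * (col U l \<bullet>c col U k))"
    using U assms by (intro sum.cong refl, subst cscalar_prod_sum[of _ n])
       (auto simp: sum_distrib_left mult_ac)
  also have "\<dots> = (\<Sum>k<n. if k = l then U $$ (i, l) * f l else 0)"
    using assms by (intro sum.cong) (auto simp: unitary_col_inner)
  also have "\<dots> = vec_index (f l \<cdot>\<^sub>v col U l) i"
    using assms U i by simp
  finally show "vec_index (conj_diag n U f *\<^sub>v col U l) i = vec_index (f l \<cdot>\<^sub>v col U l) i" .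
qed (use unitary_matD[OF assms(1)] in auto)

text \<open>Deflation by induction on the dimension. An eigenvector as first column of
  \<open>W\<close> clears the first column of W^dagger A W below the corner, Hermiticity clears the
  first row and makes the eigenvalue real, and the remaining block is again Hermitian.\<close>

theorem hermitian_unitary_diag:
  assumes "A \<in> carrier_mat n n" "hermitian A"
  shows "\<exists>U d. unitary_mat n U \<and> A = conj_diag n U (\<lambda>i. complex_of_real (d i))"
  using assms
proof (induction n arbitrary: A)
  case 0
  have "A = conj_diag 0 (1\<^sub>m 0) (\<lambda>i. complex_of_real ((\<lambda>_. 0) i))"
    using 0 by (intro eq_matI) auto
  thus ?case using unitary_mat_one by (intro exI conjI)
next
  case (Suc n)
  let ?N = "Suc n"
  note A = Suc.prems(1)
  obtain as where as: "char_poly A = (\<Prod>a\<leftarrow>as. [:- a, 1:])" "length as = ?N"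
    using char_poly_factorized[OF A] by blast
  obtain e as' where "as = e # as'" using as(2) by (cases as) auto
  hence "poly (char_poly A) e = 0" using as by simp
  hence "eigenvalue A e" using eigenvalue_root_char_poly[OF A] by simp
  then obtain v where "eigenvector A v e" by (auto simp: eigenvalue_def)
  hence v: "v \<in> carrier_vec ?N" "v \<noteq> 0\<^sub>v ?N" "A *\<^sub>v v = e \<cdot>\<^sub>v v"
    using A by (auto simp: eigenvector_def)
  obtain W c where W: "unitary_mat ?N W" and "c \<noteq> 0" and c: "col W 0 = c \<cdot>\<^sub>v v"
    using unitary_mat_with_first_column[OF v(1,2)] by auto
  note W' = unitary_matD[OF W]
  define B where "B = mat_adjoint W * A * W"
  have B: "B \<in> carrier_mat ?N ?N" using W' A by (auto simp: B_def)
  have Bh: "mat_adjoint B = B"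
    using W' A hermitianD[OF Suc.prems(2)]
    by (simp add: B_def mat_adjoint_mult[of _ ?N ?N _ ?N] assoc_mult_mat[of _ ?N ?N _ ?N _ ?N])
  have BA: "W * B * mat_adjoint W = A"
  proof -
    have "W * B * mat_adjoint W = (W * mat_adjoint W) * A * (W * mat_adjoint W)"
      using W'(1) A by (simp add: B_def assoc_mult_mat[of _ ?N ?N _ ?N _ ?N])
    thus ?thesis using W' A by simp
  qed
  \<comment> \<open>The first column of \<open>B\<close> is W^dagger A w with w the first column of
    \<open>W\<close>. As w is an eigenvector, this is e W^dagger w, that is e times the first unit
    vector.\<close>
  have B0: "B $$ (i, 0) = (if i = 0 then e else 0)" if "i < ?N" for i
  proof -
    have "col B 0 = (mat_adjoint W * A) *\<^sub>v col W 0"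
      using W' A by (auto simp: B_def)
    also have "\<dots> = mat_adjoint W *\<^sub>v (A *\<^sub>v (c \<cdot>\<^sub>v v))"
      using W' A v c by (subst assoc_mult_mat_vec[of _ ?N ?N _ ?N]) auto
    also have "A *\<^sub>v (c \<cdot>\<^sub>v v) = e \<cdot>\<^sub>v (c \<cdot>\<^sub>v v)"
      using A v by (simp add: mult_mat_vec smult_smult_assoc mult.commute)
    also have "mat_adjoint W *\<^sub>v (e \<cdot>\<^sub>v (c \<cdot>\<^sub>v v)) = e \<cdot>\<^sub>v (mat_adjoint W *\<^sub>v col W 0)"
      using W' v c by (metis mat_adjoint_carrier mult_mat_vec smult_carrier_vec)
    also have "mat_adjoint W *\<^sub>v col W 0 = col (mat_adjoint W * W) 0"
      using W'(1) by (auto simp: col_mult2[of _ ?N ?N _ ?N])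
    finally have "col B 0 = e \<cdot>\<^sub>v unit_vec ?N 0" using W' by simp
    hence "vec_index (col B 0) i = e * (if i = 0 then 1 else 0)"
      using that by simp
    thus ?thesis using B that by (auto split: if_splits)
  qed
  have B0': "B $$ (0, j) = (if j = 0 then cnj e else 0)" if "j < ?N" for j
    using B0[OF that] index_mat_adjoint[of 0 B j] that B Bh by auto
  \<comment> \<open>Both formulas describe the corner entry, one with e and one with its
    conjugate.\<close>
  have "cnj e = e" using B0[of 0] B0'[of 0] by simp
  then obtain e' where e': "e = complex_of_real e'" by (metis Reals_cnj_iff Reals_cases)
  define C where "C = Matrix.mat n n (\<lambda>(i, j). B $$ (Suc i, Suc j))"
  have C: "C \<in> carrier_mat n n" by (simp add: C_def)
  have "mat_adjoint C = C"
  proof (rule eq_matI)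
    fix i j assume "i < dim_row C" "j < dim_col C"
    thus "mat_adjoint C $$ (i, j) = C $$ (i, j)"
      using index_mat_adjoint[of "Suc i" B "Suc j"] B by (auto simp: C_def Bh)
  qed (auto simp: C_def)
  from Suc.IH[OF C hermitianI[OF C this]] obtain V d
    where V: "unitary_mat n V" "C = conj_diag n V (\<lambda>i. complex_of_real (d i))" by blast
  note V' = unitary_matD[OF V(1)]
  \<comment> \<open>The eigenbasis of the smaller block, extended by the coordinate that
    \<open>W\<close> has already split off.\<close>
  define X where "X = four_block_mat (1\<^sub>m 1) (0\<^sub>m 1 n) (0\<^sub>m n 1) V"
  define d' where "d' = (\<lambda>i. case i of 0 \<Rightarrow> e' | Suc i \<Rightarrow> d i)"
  have X: "X \<in> carrier_mat ?N ?N" using V' by (auto simp: X_def)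
  have Xa: "mat_adjoint X = four_block_mat (1\<^sub>m 1) (0\<^sub>m 1 n) (0\<^sub>m n 1) (mat_adjoint V)"
  proof (rule eq_matI)
    fix i j assume ij: "i < dim_row (four_block_mat (1\<^sub>m 1) (0\<^sub>m 1 n) (0\<^sub>m n 1) (mat_adjoint V))"
      "j < dim_col (four_block_mat (1\<^sub>m 1) (0\<^sub>m 1 n) (0\<^sub>m n 1) (mat_adjoint V))"
    have "mat_adjoint X $$ (i, j) = cnj (X $$ (j, i))"
      using ij X V' by (intro index_mat_adjoint) auto
    thus "mat_adjoint X $$ (i, j) = four_block_mat (1\<^sub>m 1) (0\<^sub>m 1 n) (0\<^sub>m n 1) (mat_adjoint V) $$ (i, j)"
      using ij V' by (auto simp: X_def)
  qed (use V' in \<open>auto simp: X_def\<close>)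
  have "mat_adjoint X * X = four_block_mat (1\<^sub>m 1) (0\<^sub>m 1 n) (0\<^sub>m n 1) (1\<^sub>m n)"
    unfolding Xa unfolding X_def using V'
    by (subst mult_four_block_mat[of _ 1 1 _ n _ n _ _ 1 _ n]) auto
  also have "\<dots> = 1\<^sub>m ?N" by (intro eq_matI) auto
  finally have Xu: "unitary_mat ?N X" using X by (intro unitary_matI)
  let ?D = "diag_of 1 (\<lambda>_. complex_of_real e')"
  have "diag_of ?N (\<lambda>i. complex_of_real (d' i)) =
      four_block_mat ?D (0\<^sub>m 1 n) (0\<^sub>m n 1) (diag_of n (\<lambda>i. complex_of_real (d i)))"
    by (intro eq_matI) (auto simp: diag_of_def d'_def split: nat.splits)
  hence "X * diag_of ?N (\<lambda>i. complex_of_real (d' i)) * mat_adjoint X =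
      four_block_mat ?D (0\<^sub>m 1 n) (0\<^sub>m n 1) (V * diag_of n (\<lambda>i. complex_of_real (d i)) * mat_adjoint V)"
    unfolding Xa unfolding X_def using V'
    by (simp add: mult_four_block_mat[of _ 1 1 _ n _ n _ _ 1 _ n])
  also have "\<dots> = four_block_mat ?D (0\<^sub>m 1 n) (0\<^sub>m n 1) C"
    using V V' by (simp add: conj_diag_mult_adjoint)
  also have "\<dots> = B"
  proof (rule eq_matI)
    fix i j assume "i < dim_row B" "j < dim_col B"
    thus "four_block_mat ?D (0\<^sub>m 1 n) (0\<^sub>m n 1) C $$ (i, j) = B $$ (i, j)"
      using B B0[of i] B0'[of j] e' by (auto simp: C_def diag_of_def)
  qed (use B C in auto)
  finally have "A = W * (X * diag_of ?N (\<lambda>i. complex_of_real (d' i)) * mat_adjoint X) * mat_adjoint W"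
    using BA by simp
  also have "\<dots> = (W * X) * diag_of ?N (\<lambda>i. complex_of_real (d' i)) * mat_adjoint (W * X)"
    using W'(1) X by (simp add: mat_adjoint_mult[of _ ?N ?N _ ?N] assoc_mult_mat[of _ ?N ?N _ ?N _ ?N])
  also have "\<dots> = conj_diag ?N (W * X) (\<lambda>i. complex_of_real (d' i))"
    using W'(1) X by (subst conj_diag_mult_adjoint) auto
  finally show ?case using unitary_mat_mult[OF W Xu] by (intro exI conjI)
qed

section \<open>Positive semidefinite matrices and the trace norm\<close>

lemma col_carrier_vec_iff [simp]: "col A j \<in> carrier_vec n \<longleftrightarrow> dim_row A = n"
  by (metis carrier_vecD carrier_vecI dim_col)

lemma psd_hermitian: "psd A \<Longrightarrow> mat_adjoint A = A"
  by (simp add: psd_def hermitian_def)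

lemma psdD:
  assumes "psd A" "A \<in> carrier_mat n n" "v \<in> carrier_vec n"
  shows "0 \<le> Re ((A *\<^sub>v v) \<bullet>c v)"
  using assms by (auto simp: psd_def)

lemma hermitian_form_real:
  fixes A :: "complex mat"
  assumes "mat_adjoint A = A" "A \<in> carrier_mat n n" "v \<in> carrier_vec n"
  shows "(A *\<^sub>v v) \<bullet>c v = complex_of_real (Re ((A *\<^sub>v v) \<bullet>c v))"
proof -
  have "(A *\<^sub>v v) \<bullet>c v = v \<bullet>c (A *\<^sub>v v)"
    using cscalar_prod_adjoint[OF assms(2,3,3)] unfolding assms(1) .
  also have "\<dots> = cnj ((A *\<^sub>v v) \<bullet>c v)"
    using assms by (intro cscalar_prod_swap[of _ n]) auto
  finally have "Im ((A *\<^sub>v v) \<bullet>c v) = Im (cnj ((A *\<^sub>v v) \<bullet>c v))"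
    by (rule arg_cong)
  thus ?thesis by (simp only: complex_eq_iff) simp
qed

text \<open>The form of B A B^dagger at v is the form of A at B^dagger v. \<open>B\<close> may be
  rectangular, which \<open>psd_plus_kron\<close> exploits with an isometry into a space of twice
  the dimension.\<close>

lemma psd_conjugate:
  assumes A: "psd A" "A \<in> carrier_mat n n" and B: "B \<in> carrier_mat m n"
  shows "psd (B * A * mat_adjoint B)"
  unfolding psd_def
proof (intro conjI ballI)
  have c1: "B * A \<in> carrier_mat m n"
    by (rule mult_carrier_mat[OF B A(2)])
  have c2: "B * A * mat_adjoint B \<in> carrier_mat m m"
    by (rule mult_carrier_mat[OF c1 mat_adjoint_carrier[OF B]])
  note c = c1 c2
  have "mat_adjoint (B * A * mat_adjoint B) = B * (A * mat_adjoint B)"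
    using c A B by (simp add: mat_adjoint_mult[of "B * A" m n _ m] mat_adjoint_mult[of B m n A n] psd_hermitian)
  thus "hermitian (B * A * mat_adjoint B)"
    using c A B by (intro hermitianI[of _ m]) (auto simp: assoc_mult_mat[of B m n A n _ m])
  fix v :: "complex Matrix.vec" assume "v \<in> carrier_vec (dim_row (B * A * mat_adjoint B))"
  hence v: "v \<in> carrier_vec m" using B by simp
  let ?w = "mat_adjoint B *\<^sub>v v"
  have w: "?w \<in> carrier_vec n" using B by simp
  have "B * A * mat_adjoint B *\<^sub>v v = B *\<^sub>v (A *\<^sub>v ?w)"
    using A B c v w assoc_mult_mat_vec[of "B * A" m n "mat_adjoint B" m v] assoc_mult_mat_vec[of B m n A n ?w]
    by simp
  moreover have "A *\<^sub>v ?w \<in> carrier_vec n" using A by simp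
  ultimately have "(B * A * mat_adjoint B *\<^sub>v v) \<bullet>c v = (A *\<^sub>v ?w) \<bullet>c ?w"
    using cscalar_prod_adjoint[OF B _ v] by metis
  thus "0 \<le> Re ((B * A * mat_adjoint B *\<^sub>v v) \<bullet>c v)"
    using psdD[OF A w] by metis
qed

lemma psd_one: "psd (1\<^sub>m n)"
  unfolding psd_def by (auto simp: cscalar_prod_self intro!: hermitianI[of _ n])

lemma psd_mult_adjoint: "B \<in> carrier_mat m n \<Longrightarrow> psd (B * mat_adjoint B)"
  using psd_conjugate[OF psd_one one_carrier_mat, of B m n] by simp

lemma conj_diag_form:
  assumes "unitary_mat n U" "l < n"
  shows "(conj_diag n U f *\<^sub>v col U l) \<bullet>c col U l = f l"
proof -
  have "col U l \<in> carrier_vec n" using unitary_matD[OF assms(1)] by simp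
  thus ?thesis using assms by (simp add: conj_diag_mult_col unitary_col_inner)
qed

lemma psd_unitary_diag:
  assumes "psd A" "A \<in> carrier_mat n n"
  obtains U d where "unitary_mat n U" "A = conj_diag n U (\<lambda>i. complex_of_real (d i))" "\<And>i. i < n \<Longrightarrow> 0 \<le> d i"
proof -
  have "hermitian A" using assms by (auto simp: psd_def)
  from hermitian_unitary_diag[OF assms(2) this]
  obtain U d where U: "unitary_mat n U" and A: "A = conj_diag n U (\<lambda>i. complex_of_real (d i))"
    by (elim exE conjE)
  have "0 \<le> d i" if "i < n" for i
    using psdD[OF assms, of "col U i"] conj_diag_form[OF U that] A unitary_matD(1)[OF U] by simp
  thus thesis by (rule that[OF U A])
qed

lemma psd_conj_diag:
  assumes "unitary_mat n U" "\<And>i. i < n \<Longrightarrow> 0 \<le> d i"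
  shows "psd (conj_diag n U (\<lambda>i. complex_of_real (d i)))"
proof -
  let ?B = "conj_diag n U (\<lambda>i. complex_of_real (sqrt (d i)))"
  have "?B * mat_adjoint ?B = conj_diag n U (\<lambda>i. complex_of_real (sqrt (d i)) * complex_of_real (sqrt (d i)))"
    by (simp add: conj_diag_adjoint conj_diag_mult[OF assms(1)])
  also have "\<dots> = conj_diag n U (\<lambda>i. complex_of_real (d i))"
    using assms(2) by (intro conj_diag_cong) (simp flip: of_real_mult)
  finally show ?thesis using psd_mult_adjoint[of ?B n n] by simp
qed

section \<open>Positive square roots, absolute value and trace norm\<close>

lemma index_diag_of_mult:
  assumes "X \<in> carrier_mat n m" "i < n" "j < m"
  shows "(diag_of n f * X) $$ (i, j) = f i * X $$ (i, j)"
proof -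
  have "(diag_of n f * X) $$ (i, j) = (\<Sum>l<n. if l = i then f i * X $$ (i, j) else 0)"
    using assms by (subst index_mult_mat_sum[of _ n n _ m])
      (auto simp: diag_of_def simp del: sum.delta sum.delta' intro!: sum.cong)
  thus ?thesis using assms by simp
qed

lemma index_mult_diag_of:
  assumes "X \<in> carrier_mat m n" "i < m" "j < n"
  shows "(X * diag_of n f) $$ (i, j) = X $$ (i, j) * f j"
proof -
  have "(X * diag_of n f) $$ (i, j) = (\<Sum>l<n. if l = j then X $$ (i, j) * f j else 0)"
    using assms by (subst index_mult_mat_sum[of _ m n _ n])
      (auto simp: diag_of_def simp del: sum.delta sum.delta' intro!: sum.cong)
  thus ?thesis using assms by simp
qed

text \<open>In eigenbases of \<open>B\<close> and \<open>C\<close> the change of basis X = V^dagger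
  U satisfies c_i^2 X_ij = X_ij b_j^2. Nonnegative numbers with equal squares are equal, so the
  relation holds without the squares too, which says that \<open>B\<close> and \<open>C\<close>
  agree. This makes the definite description in \<open>mat_abs\<close> legitimate.\<close>

lemma psd_sqrt_unique:
  assumes B: "psd B" "B \<in> carrier_mat n n" and C: "psd C" "C \<in> carrier_mat n n" and eq: "B * B = C * C"
  shows "B = C"
proof -
  obtain U b where U: "unitary_mat n U" and b: "B = conj_diag n U (\<lambda>i. complex_of_real (b i))"
    "\<And>i. i < n \<Longrightarrow> 0 \<le> b i" using psd_unitary_diag[OF B] by metis
  obtain V c where V: "unitary_mat n V" and c: "C = conj_diag n V (\<lambda>i. complex_of_real (c i))"
    "\<And>i. i < n \<Longrightarrow> 0 \<le> c i" using psd_unitary_diag[OF C] by metis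
  note U' = unitary_matD[OF U] and V' = unitary_matD[OF V]
  note assoc = assoc_mult_mat[of _ n n _ n _ n]
  define X where "X = mat_adjoint V * U"
  have X: "X \<in> carrier_mat n n" using U' V' by (simp add: X_def)
  have left: "mat_adjoint V * (conj_diag n V f * U) = diag_of n f * X" for f
  proof -
    have "mat_adjoint V * (conj_diag n V f * U) = (mat_adjoint V * V) * (diag_of n f * (mat_adjoint V * U))"
      using U'(1) V'(1) by (simp add: conj_diag_mult_adjoint assoc)
    thus ?thesis using V' X by (simp add: X_def)
  qed
  have right: "mat_adjoint V * (conj_diag n U f * U) = X * diag_of n f" for f
  proof -
    have "mat_adjoint V * (conj_diag n U f * U) = mat_adjoint V * (U * (diag_of n f * (mat_adjoint U * U)))"
      using U'(1) V'(1) by (simp add: conj_diag_mult_adjoint assoc)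
    also have "\<dots> = mat_adjoint V * U * diag_of n f"
      unfolding U'(2) using U'(1) V'(1) by (simp add: assoc right_mult_one_mat[of _ n n])
    finally show ?thesis by (simp add: X_def)
  qed
  have sq: "diag_of n (\<lambda>i. complex_of_real (c i) * complex_of_real (c i)) * X =
      X * diag_of n (\<lambda>i. complex_of_real (b i) * complex_of_real (b i))"
    unfolding left[symmetric] right[symmetric]
    using eq unfolding b(1) c(1) conj_diag_mult[OF U] conj_diag_mult[OF V] by (rule arg_cong2[OF refl arg_cong2[OF sym refl]])
  have "diag_of n (\<lambda>i. complex_of_real (c i)) * X = X * diag_of n (\<lambda>i. complex_of_real (b i))"
  proof (rule eq_matI)
    fix i j assume "i < dim_row (X * diag_of n (\<lambda>i. complex_of_real (b i)))"
      "j < dim_col (X * diag_of n (\<lambda>i. complex_of_real (b i)))"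
    hence ij: "i < n" "j < n" using X by auto
    have "complex_of_real ((c i)\<^sup>2) * X $$ (i, j) = complex_of_real ((b j)\<^sup>2) * X $$ (i, j)"
      using arg_cong[OF sq, of "\<lambda>A. A $$ (i, j)"]
      unfolding index_diag_of_mult[OF X ij] index_mult_diag_of[OF X ij] by (simp add: power2_eq_square mult_ac)
    hence "X $$ (i, j) = 0 \<or> (c i)\<^sup>2 = (b j)\<^sup>2" by (metis mult_cancel_right of_real_eq_iff)
    hence "X $$ (i, j) = 0 \<or> c i = b j" using b(2)[OF ij(2)] c(2)[OF ij(1)] by auto
    thus "(diag_of n (\<lambda>i. complex_of_real (c i)) * X) $$ (i, j) =
        (X * diag_of n (\<lambda>i. complex_of_real (b i))) $$ (i, j)"
      unfolding index_diag_of_mult[OF X ij] index_mult_diag_of[OF X ij] by auto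
  qed (use X in auto)
  hence "mat_adjoint V * (C * U) = mat_adjoint V * (B * U)"
    unfolding b(1) c(1) left right .
  hence "V * (mat_adjoint V * (C * U)) * mat_adjoint U = V * (mat_adjoint V * (B * U)) * mat_adjoint U"
    by simp
  moreover have "V * (mat_adjoint V * (D * U)) * mat_adjoint U = D" if "D \<in> carrier_mat n n" for D
  proof -
    have "V * (mat_adjoint V * (D * U)) * mat_adjoint U = (V * mat_adjoint V) * D * (U * mat_adjoint U)"
      using U'(1) V'(1) that by (simp add: assoc)
    thus ?thesis using U' V' that by simp
  qed
  ultimately show ?thesis using B C by simp
qed

text \<open>Existence comes from square roots of the eigenvalues of X^dagger X, uniqueness from
  \<open>psd_sqrt_unique\<close>.\<close>

lemma mat_abs:
  assumes X: "X \<in> carrier_mat n n"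
  shows "mat_abs X \<in> carrier_mat n n" "psd (mat_abs X)" "mat_abs X * mat_abs X = mat_adjoint X * X"
proof -
  have nX: "dim_col X = n" using X by simp
  have p: "psd (mat_adjoint X * X)" using psd_mult_adjoint[OF mat_adjoint_carrier[OF X]] by simp
  have XX: "mat_adjoint X * X \<in> carrier_mat n n" using X by simp
  obtain U d where U: "unitary_mat n U" and d: "mat_adjoint X * X = conj_diag n U (\<lambda>i. complex_of_real (d i))"
    "\<And>i. i < n \<Longrightarrow> 0 \<le> d i" using psd_unitary_diag[OF p XX] by metis
  define B where "B = conj_diag n U (\<lambda>i. complex_of_real (sqrt (d i)))"
  have B1: "B \<in> carrier_mat n n" by (simp add: B_def)
  have B2: "psd B" unfolding B_def using d(2) by (intro psd_conj_diag[OF U]) simp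
  have B3: "B * B = mat_adjoint X * X"
    unfolding B_def d(1) conj_diag_mult[OF U] using d(2) by (intro conj_diag_cong) (simp flip: of_real_mult)
  have "mat_abs X = B"
    unfolding mat_abs_def nX
  proof (rule the_equality, intro conjI B1 B2 B3, elim conjE)
    fix C assume C: "C \<in> carrier_mat n n" "psd C" "C * C = mat_adjoint X * X"
    show "C = B" by (rule psd_sqrt_unique[OF C(2,1) B2 B1]) (simp only: C(3) B3)
  qed
  thus "mat_abs X \<in> carrier_mat n n" "psd (mat_abs X)" "mat_abs X * mat_abs X = mat_adjoint X * X"
    using B1 B2 B3 by simp_all
qed

lemma mat_abs_psd:
  assumes "psd A" "A \<in> carrier_mat n n"
  shows "mat_abs A = A"
proof (rule psd_sqrt_unique[OF mat_abs(2,1)[OF assms(2)] assms])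
  show "mat_abs A * mat_abs A = A * A"
    using mat_abs(3)[OF assms(2)] unfolding psd_hermitian[OF assms(1)] .
qed

lemma trace_norm_density:
  assumes "density_op n \<rho>"
  shows "trace_norm \<rho> = 1"
proof -
  have "mat_abs \<rho> = \<rho>" using assms by (intro mat_abs_psd[of _ n]) (auto simp: density_op_def)
  thus ?thesis using assms by (simp add: trace_norm_def density_op_def)
qed

text \<open>In an eigenbasis of |X| the length of X u_l is the l-th singular value, because the
  squared length of X u equals <u, |X|^2 u>. This form suffices for the inequalities below and
  avoids a polar decomposition.\<close>

lemma trace_norm_singular_values:
  assumes X: "X \<in> carrier_mat n n"
  shows "\<exists>U. unitary_mat n U \<and> trace_norm X = (\<Sum>l<n. vnorm (X *\<^sub>v col U l))"
proof -
  note M = mat_abs[OF X]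
  obtain U d where U: "unitary_mat n U" and d: "mat_abs X = conj_diag n U (\<lambda>i. complex_of_real (d i))"
    "\<And>i. i < n \<Longrightarrow> 0 \<le> d i" using psd_unitary_diag[OF M(2,1)] by metis
  note U' = unitary_matD[OF U]
  have "vnorm (X *\<^sub>v col U l) = d l" if l: "l < n" for l
  proof -
    have "complex_of_real ((vnorm (X *\<^sub>v col U l))\<^sup>2) = col U l \<bullet>c (mat_adjoint X *\<^sub>v (X *\<^sub>v col U l))"
      unfolding cscalar_prod_self[symmetric] using X U' l by (intro cscalar_prod_adjoint[of _ n n]) auto
    also have "mat_adjoint X *\<^sub>v (X *\<^sub>v col U l) = (mat_abs X * mat_abs X) *\<^sub>v col U l"
      unfolding M(3) using X U' l by (subst assoc_mult_mat_vec[of _ n n _ n]) auto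
    also have "\<dots> = complex_of_real (d l * d l) \<cdot>\<^sub>v col U l"
      unfolding d(1) conj_diag_mult[OF U] using conj_diag_mult_col[OF U l] by simp
    also have "col U l \<bullet>c \<dots> = complex_of_real (d l * d l)"
      using U' l unitary_col_inner[OF U l l]
      by (simp add: conjugate_smult_vec scalar_prod_smult_distrib[of _ n])
    finally have "(vnorm (X *\<^sub>v col U l))\<^sup>2 = (d l)\<^sup>2"
      by (simp only: of_real_eq_iff power2_eq_square)
    thus ?thesis using d(2)[OF l] by simp
  qed
  moreover have "trace_norm X = (\<Sum>l<n. d l)"
  proof -
    have "mtrace (mat_abs X) = (\<Sum>l<n. complex_of_real (d l) * ((1\<^sub>m n *\<^sub>v col U l) \<bullet>c col U l))"
      using mtrace_conj_diag_mult[OF U'(1) one_carrier_mat, of "\<lambda>i. complex_of_real (d i)"] d(1)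
      by (simp add: left_mult_one_mat[of _ n n])
    also have "\<dots> = (\<Sum>l<n. complex_of_real (d l))"
    proof (intro sum.cong refl)
      fix l assume "l \<in> {..<n}"
      hence "col U l \<bullet>c col U l = 1" by (simp add: unitary_col_inner[OF U])
      moreover have "1\<^sub>m n *\<^sub>v col U l = col U l" using U' by (intro one_mult_mat_vec) simp
      ultimately show "complex_of_real (d l) * ((1\<^sub>m n *\<^sub>v col U l) \<bullet>c col U l) = complex_of_real (d l)"
        by (simp only: mult_1_right)
    qed
    finally show ?thesis by (simp add: trace_norm_def)
  qed
  ultimately have "trace_norm X = (\<Sum>l<n. vnorm (X *\<^sub>v col U l))" by simp
  with U show ?thesis by (intro exI conjI)
qed

lemma mtrace_unitary_basis:
  assumes "unitary_mat n U" "A \<in> carrier_mat n n"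
  shows "mtrace A = (\<Sum>l<n. (A *\<^sub>v col U l) \<bullet>c col U l)"
  using mtrace_conj_diag_mult[OF unitary_matD(1)[OF assms(1)] assms(2), of "\<lambda>_. 1"]
  by (simp only: conj_diag_one[OF assms(1)] right_mult_one_mat[OF assms(2)] mult_1)

text \<open>Hoelder's inequality between operator and trace norm: the trace is evaluated in the
  singular basis of \<open>X\<close>, where each term is at most the length of A X u_l.\<close>

lemma mtrace_mult_le_trace_norm:
  assumes A: "opbound A a" "A \<in> carrier_mat n n" and X: "X \<in> carrier_mat n n"
  shows "cmod (mtrace (A * X)) \<le> a * trace_norm X"
proof -
  obtain U where U: "unitary_mat n U" "trace_norm X = (\<Sum>l<n. vnorm (X *\<^sub>v col U l))"
    using trace_norm_singular_values[OF X] by (elim exE conjE)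
  have AX: "A * X \<in> carrier_mat n n" using A X by simp
  have "cmod (mtrace (A * X)) \<le> (\<Sum>l<n. cmod ((A * X *\<^sub>v col U l) \<bullet>c col U l))"
    by (subst mtrace_unitary_basis[OF U(1) AX]) (rule norm_sum)
  also have "\<dots> \<le> (\<Sum>l<n. a * vnorm (X *\<^sub>v col U l))"
  proof (rule sum_mono)
    fix l assume "l \<in> {..<n}"
    hence l: "l < n" by simp
    have u: "col U l \<in> carrier_vec n" using unitary_matD[OF U(1)] by simp
    have "cmod ((A * X *\<^sub>v col U l) \<bullet>c col U l) \<le> vnorm (A * X *\<^sub>v col U l) * vnorm (col U l)"
      using A u by (intro cscalar_prod_le[of _ n]) auto
    also have "\<dots> = vnorm (A *\<^sub>v (X *\<^sub>v col U l))"
      using vnorm_unitary_col[OF U(1) l] A X u by simp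
    also have "\<dots> \<le> a * vnorm (X *\<^sub>v col U l)"
      using A X u by (intro opboundD[of _ _ n n]) auto
    finally show "cmod ((A * X *\<^sub>v col U l) \<bullet>c col U l) \<le> a * vnorm (X *\<^sub>v col U l)" .
  qed
  finally show ?thesis by (simp add: U(2) sum_distrib_left)
qed

section \<open>Eigenprojectors and measurement statistics\<close>

lemma conj_diag_eigenvector_iff:
  assumes U: "unitary_mat n U" and v: "v \<in> carrier_vec n"
  shows "conj_diag n U f *\<^sub>v v = c \<cdot>\<^sub>v v \<longleftrightarrow> (\<forall>i<n. (f i - c) * vec_index (mat_adjoint U *\<^sub>v v) i = 0)"
proof -
  note U' = unitary_matD[OF U]
  let ?w = "mat_adjoint U *\<^sub>v v"
  have w: "?w \<in> carrier_vec n" using U' by simp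
  have Uw: "U *\<^sub>v ?w = v" and U2: "mat_adjoint U *\<^sub>v (U *\<^sub>v x) = x" if "x \<in> carrier_vec n" for x
    using U' v that assoc_mult_mat_vec[of U n n "mat_adjoint U" n v]
      assoc_mult_mat_vec[of "mat_adjoint U" n n U n x] by auto
  have dw: "diag_of n f *\<^sub>v ?w \<in> carrier_vec n" by simp
  have idx: "vec_index (diag_of n f *\<^sub>v ?w) i = f i * vec_index ?w i" if "i < n" for i
  proof -
    have "vec_index (diag_of n f *\<^sub>v ?w) i = (\<Sum>l<n. if l = i then f i * vec_index ?w i else 0)"
      using that w by (subst index_mult_mat_vec_sum[of _ n n])
        (auto simp: diag_of_def simp del: sum.delta sum.delta' index_mult_mat_vec intro!: sum.cong)
    thus ?thesis using that by simp
  qed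
  have "conj_diag n U f *\<^sub>v v = U *\<^sub>v (diag_of n f *\<^sub>v ?w)"
    using U' v w by (simp add: conj_diag_mult_adjoint assoc_mult_mat_vec[of _ n n _ n] assoc_mult_mat[of _ n n _ n _ n])
  moreover have "c \<cdot>\<^sub>v v = U *\<^sub>v (c \<cdot>\<^sub>v ?w)"
    using Uw[OF v] w U' by (simp add: mult_mat_vec[of _ n n])
  ultimately have "conj_diag n U f *\<^sub>v v = c \<cdot>\<^sub>v v \<longleftrightarrow> diag_of n f *\<^sub>v ?w = c \<cdot>\<^sub>v ?w"
    using U2[OF dw] U2[of "c \<cdot>\<^sub>v ?w"] w by (metis smult_carrier_vec)
  also have "\<dots> \<longleftrightarrow> (\<forall>i<n. f i * vec_index ?w i = c * vec_index ?w i)"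
  proof
    assume "diag_of n f *\<^sub>v ?w = c \<cdot>\<^sub>v ?w"
    thus "\<forall>i<n. f i * vec_index ?w i = c * vec_index ?w i"
      using idx w U' by (metis carrier_vecD index_smult_vec(1))
  next
    assume *: "\<forall>i<n. f i * vec_index ?w i = c * vec_index ?w i"
    show "diag_of n f *\<^sub>v ?w = c \<cdot>\<^sub>v ?w"
    proof (rule eq_vecI)
      fix i assume "i < dim_vec (c \<cdot>\<^sub>v ?w)"
      hence "i < n" using carrier_vecD[OF w] by simp
      thus "vec_index (diag_of n f *\<^sub>v ?w) i = vec_index (c \<cdot>\<^sub>v ?w) i"
        using idx[of i] * w U' index_smult_vec(1)[of i ?w c] carrier_vecD[OF w] by metis
    qed (use U' in simp)
  qed
  finally show ?thesis by (simp only: left_diff_distrib right_minus_eq)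
qed

text \<open>The spectral projection Q satisfies the description. For uniqueness, Hermitian
  idempotents P and Q with the same fixed vectors absorb each other, P Q = Q and Q P = P; taking the
  adjoint of the first gives Q = Q P = P.\<close>

lemma eigenprojector_conj_diag:
  assumes U: "unitary_mat n U"
  shows "eigenprojector (conj_diag n U (\<lambda>i. complex_of_real (d i))) x =
    conj_diag n U (\<lambda>i. if d i = x then 1 else 0)" (is "eigenprojector ?A x = ?Q")
proof -
  let ?P = "\<lambda>P. P \<in> carrier_mat (dim_row ?A) (dim_row ?A) \<and> hermitian P \<and> P * P = P \<and>
     (\<forall>v\<in>carrier_vec (dim_row ?A). P *\<^sub>v v = v \<longleftrightarrow> ?A *\<^sub>v v = complex_of_real x \<cdot>\<^sub>v v)"
  have Q: "?P ?Q"
  proof (intro conjI ballI)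
    show "hermitian ?Q"
      by (rule hermitianI[of _ n]) (auto simp: conj_diag_adjoint intro: conj_diag_cong)
    show "?Q * ?Q = ?Q"
      unfolding conj_diag_mult[OF U] by (rule conj_diag_cong) auto
    fix v :: "complex Matrix.vec" assume "v \<in> carrier_vec (dim_row ?A)"
    hence v: "v \<in> carrier_vec n" by simp
    have "?Q *\<^sub>v v = v \<longleftrightarrow> ?Q *\<^sub>v v = 1 \<cdot>\<^sub>v v" by simp
    also have "\<dots> \<longleftrightarrow> ?A *\<^sub>v v = complex_of_real x \<cdot>\<^sub>v v"
      unfolding conj_diag_eigenvector_iff[OF U v] by auto
    finally show "?Q *\<^sub>v v = v \<longleftrightarrow> ?A *\<^sub>v v = complex_of_real x \<cdot>\<^sub>v v" .
  qed auto
  \<comment> \<open>The columns of an idempotent \<open>S\<close> are fixed by \<open>S\<close>,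
    hence by \<open>R\<close>.\<close>
  have absorb: "R * S = S"
    if "R \<in> carrier_mat n n" "S \<in> carrier_mat n n" "S * S = S"
      "\<forall>v\<in>carrier_vec n. S *\<^sub>v v = v \<longrightarrow> R *\<^sub>v v = v" for R S :: "complex mat"
  proof (rule mat_col_eqI)
    fix j assume "j < dim_col S"
    hence j: "j < n" using that by simp
    have c: "col S j \<in> carrier_vec n" using that by simp
    have "S *\<^sub>v col S j = col (S * S) j" using that j by (subst col_mult2[of _ n n _ n]) auto
    hence "R *\<^sub>v col S j = col S j" using that c by metis
    thus "col (R * S) j = col S j" using that j by (subst col_mult2[of _ n n _ n]) auto
  qed (use that in auto)
  have "P = ?Q" if "?P P" for P
  proof -
    have P: "P \<in> carrier_mat n n" "mat_adjoint P = P" "P * P = P"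
      using that hermitianD[of P] by simp_all
    have eq: "\<forall>v\<in>carrier_vec n. P *\<^sub>v v = v \<longleftrightarrow> ?Q *\<^sub>v v = v" using that Q by simp
    have Q': "mat_adjoint ?Q = ?Q" "?Q * ?Q = ?Q" using Q hermitianD[of ?Q] by simp_all
    have 1: "P * ?Q = ?Q" 
      by (rule absorb[OF P(1) conj_diag_carrier Q'(2)]) (use eq in blast)
    have 2: "?Q * P = P"
      by (rule absorb[OF conj_diag_carrier P(1,3)]) (use eq in blast)
    have "?Q = mat_adjoint (P * ?Q)" unfolding 1 Q'(1) ..
    also have "\<dots> = ?Q * P" using P Q' by (simp add: mat_adjoint_mult[of _ n n _ n])
    finally show ?thesis unfolding 2 by (rule sym)
  qed
  with Q show ?thesis unfolding eigenprojector_def by (intro the_equality) auto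
qed

text \<open>In an eigenbasis of \<open>A\<close> the Born weights are the diagonal entries of the
  state, grouped by eigenvalue. They are nonnegative and sum to the trace, so
  \<open>embed_pmf\<close> yields a genuine distribution. Observed values are eigenvalues, hence
  bounded by any operator bound of \<open>A\<close>.\<close>

lemma measurement_pmf:
  assumes A: "A \<in> carrier_mat n n" "hermitian A" "opbound A c" and \<rho>: "density_op n \<rho>"
  shows "finite (set_pmf (measurement_pmf A \<rho>))"
    and "set_pmf (measurement_pmf A \<rho>) \<subseteq> {-c..c}"
    and "mtrace (A * \<rho>) = complex_of_real (measure_pmf.expectation (measurement_pmf A \<rho>) (\<lambda>x. x))"
proof -
  obtain U d where U: "unitary_mat n U" and Ad: "A = conj_diag n U (\<lambda>i. complex_of_real (d i))"
    using hermitian_unitary_diag[OF A(1,2)] by (elim exE conjE)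
  note U' = unitary_matD[OF U]
  have \<rho>': "\<rho> \<in> carrier_mat n n" "psd \<rho>" "mtrace \<rho> = 1" using \<rho> by (auto simp: density_op_def)
  have u: "col U l \<in> carrier_vec n" for l using U' by simp
  define q where "q = (\<lambda>l. Re ((\<rho> *\<^sub>v col U l) \<bullet>c col U l))"
  have q0: "0 \<le> q l" for l unfolding q_def by (rule psdD[OF \<rho>'(2,1) u])
  have qc: "(\<rho> *\<^sub>v col U l) \<bullet>c col U l = complex_of_real (q l)" for l
    unfolding q_def by (rule hermitian_form_real[OF psd_hermitian[OF \<rho>'(2)] \<rho>'(1) u])
  have tr: "mtrace (conj_diag n U f * \<rho>) = (\<Sum>l<n. f l * complex_of_real (q l))" for f
    using mtrace_conj_diag_mult[OF U'(1) \<rho>'(1), of f] mtrace_mult_commute[OF \<rho>'(1) conj_diag_carrier[of n U f]]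
    by (simp add: qc)
  let ?S = "d ` {..<n}"
  let ?f = "\<lambda>x. \<Sum>l | l < n \<and> d l = x. q l"
  have f: "Re (mtrace (eigenprojector A x * \<rho>)) = ?f x" for x
  proof -
    have "Re (mtrace (eigenprojector A x * \<rho>)) = (\<Sum>l<n. if d l = x then q l else 0)"
      unfolding Ad eigenprojector_conj_diag[OF U] tr by (auto intro!: sum.cong)
    also have "\<dots> = ?f x"
      by (rule sum.mono_neutral_cong_right) auto
    finally show ?thesis .
  qed
  have f0: "?f x = 0" if "x \<notin> ?S" for x
    using that by (intro sum.neutral) auto
  \<comment> \<open>Eigenvalues may repeat, so sums over the basis index are regrouped along the
    fibres of \<open>d\<close>.\<close>
  have group: "(\<Sum>x\<in>?S. \<Sum>l | l < n \<and> d l = x. h l) = (\<Sum>l<n. h l)" for h :: "nat \<Rightarrow> real"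
  proof -
    have "(\<Sum>l<n. h l) = (\<Sum>x\<in>?S. sum h {l \<in> {..<n}. d l = x})"
      by (rule sum.image_gen) simp
    thus ?thesis by simp
  qed
  have qsum: "(\<Sum>l<n. q l) = 1"
    using mtrace_unitary_basis[OF U \<rho>'(1)] \<rho>'(3) by (simp add: qc flip: of_real_sum)
  have nn: "(\<integral>\<^sup>+x. ennreal (?f x) \<partial>count_space UNIV) = 1"
  proof -
    have "(\<integral>\<^sup>+x. ennreal (?f x) \<partial>count_space UNIV) = (\<Sum>x\<in>?S. ennreal (?f x))"
      using f0 by (intro nn_integral_count_space') auto
    also have "\<dots> = ennreal (\<Sum>x\<in>?S. ?f x)"
      using q0 by (intro sum_ennreal sum_nonneg)
    finally show ?thesis using group[of q] qsum by simp
  qed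
  have pmf: "pmf (measurement_pmf A \<rho>) x = ?f x" for x
    unfolding measurement_pmf_def f
    by (rule pmf_embed_pmf) (use q0 nn in \<open>auto intro: sum_nonneg\<close>)
  have S: "set_pmf (measurement_pmf A \<rho>) \<subseteq> ?S"
  proof
    fix x assume "x \<in> set_pmf (measurement_pmf A \<rho>)"
    hence "?f x \<noteq> 0" unfolding set_pmf_iff pmf .
    thus "x \<in> ?S" using f0 by metis
  qed
  thus "finite (set_pmf (measurement_pmf A \<rho>))" using finite_subset by blast
  have "\<bar>d l\<bar> \<le> c" if "l < n" for l
    using opboundD[OF A(3,1) u, of l] conj_diag_mult_col[OF U that] vnorm_unitary_col[OF U that]
    by (simp add: Ad)
  with S show "set_pmf (measurement_pmf A \<rho>) \<subseteq> {-c..c}" by fastforce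
  have "measure_pmf.expectation (measurement_pmf A \<rho>) (\<lambda>x. x) = (\<Sum>x\<in>?S. x * ?f x)"
    using S by (subst integral_measure_pmf[of ?S]) (auto simp: pmf mult.commute)
  also have "\<dots> = (\<Sum>x\<in>?S. \<Sum>l | l < n \<and> d l = x. d l * q l)"
    by (auto simp: sum_distrib_left intro!: sum.cong)
  also have "\<dots> = (\<Sum>l<n. d l * q l)" by (rule group)
  finally show "mtrace (A * \<rho>) = complex_of_real (measure_pmf.expectation (measurement_pmf A \<rho>) (\<lambda>x. x))"
    by (simp add: Ad tr)
qed

section \<open>Superoperators and the correspondence with the Lindbladian\<close>

lemma kron_dim [simp]:
  "dim_row (kron A B) = dim_row A * dim_row B" "dim_col (kron A B) = dim_col A * dim_col B"
  by (auto simp: kron_def)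

lemma kron_carrier:
  "A \<in> carrier_mat a b \<Longrightarrow> B \<in> carrier_mat c d \<Longrightarrow> kron A B \<in> carrier_mat (a * c) (b * d)"
  by (auto simp: kron_def)

lemma index_kron:
  "i < dim_row A * dim_row B \<Longrightarrow> j < dim_col A * dim_col B \<Longrightarrow>
   kron A B $$ (i, j) = A $$ (i div dim_row B, j div dim_col B) * B $$ (i mod dim_row B, j mod dim_col B)"
  by (simp add: kron_def)

lemma sum_lessThan_2: "(\<Sum>i<2. f i) = f 0 + f (1::nat)"
  by (simp add: numeral_2_eq_2)

lemma ptrace_env_carrier: "A \<in> carrier_mat (2 * n) (2 * n) \<Longrightarrow> ptrace_env A \<in> carrier_mat n n"
  by (simp add: ptrace_env_def)

lemma index_ptrace_env:
  "A \<in> carrier_mat (2 * n) (2 * n) \<Longrightarrow> i < n \<Longrightarrow> j < n \<Longrightarrow>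
   ptrace_env A $$ (i, j) = A $$ (2 * i, 2 * j) + A $$ (2 * i + 1, 2 * j + 1)"
  by (simp add: ptrace_env_def sum_lessThan_2)

text \<open>Any norm would do, since only finiteness matters; the largest entry has the simplest
  rules. The carrier condition is included so that a bounded map is also known to produce matrices
  of the right size.\<close>

definition entries_le :: "nat \<Rightarrow> complex mat \<Rightarrow> real \<Rightarrow> bool" where
  "entries_le n A K \<longleftrightarrow> A \<in> carrier_mat n n \<and> 0 \<le> K \<and> (\<forall>i<n. \<forall>j<n. cmod (A $$ (i, j)) \<le> K)"

lemma entries_leD:
  assumes "entries_le n A K"
  shows "A \<in> carrier_mat n n" "0 \<le> K" "i < n \<Longrightarrow> j < n \<Longrightarrow> cmod (A $$ (i, j)) \<le> K"
  using assms by (auto simp: entries_le_def)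

lemma entries_leI:
  assumes "A \<in> carrier_mat n n" "0 \<le> K" "\<And>i j. i < n \<Longrightarrow> j < n \<Longrightarrow> cmod (A $$ (i, j)) \<le> K"
  shows "entries_le n A K"
  using assms by (auto simp: entries_le_def)

lemma entries_le_exists:
  assumes A: "A \<in> carrier_mat n n"
  shows "\<exists>K. entries_le n A K"
proof
  let ?K = "\<Sum>i<n. \<Sum>j<n. cmod (A $$ (i, j))"
  show "entries_le n A ?K"
  proof (rule entries_leI[OF A])
    show "0 \<le> ?K" by (intro sum_nonneg) simp
    fix i j assume "i < n" "j < n"
    hence "cmod (A $$ (i, j)) \<le> (\<Sum>j<n. cmod (A $$ (i, j)))" by (intro member_le_sum) auto
    also have "\<dots> \<le> ?K" using \<open>i < n\<close>
      by (intro member_le_sum[of i _ "\<lambda>i. \<Sum>j<n. cmod (A $$ (i, j))"]) (auto intro: sum_nonneg)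
    finally show "cmod (A $$ (i, j)) \<le> ?K" .
  qed
qed

lemma entries_le_mult:
  assumes A: "entries_le n A K" and B: "entries_le n B L"
  shows "entries_le n (A * B) (real n * K * L)"
proof (rule entries_leI)
  note A' = entries_leD[OF A] and B' = entries_leD[OF B]
  show "A * B \<in> carrier_mat n n" by (rule mult_square_mat_carrier[OF A'(1) B'(1)])
  show "0 \<le> real n * K * L" using A'(2) B'(2) by simp
  fix i j assume ij: "i < n" "j < n"
  have "cmod ((A * B) $$ (i, j)) \<le> (\<Sum>l<n. cmod (A $$ (i, l) * B $$ (l, j)))"
    unfolding index_mult_mat_sum[OF A'(1) B'(1) ij] by (rule norm_sum)
  also have "\<dots> \<le> (\<Sum>l<n. K * L)"
    unfolding norm_mult using A' B' ij by (intro sum_mono mult_mono) auto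
  finally show "cmod ((A * B) $$ (i, j)) \<le> real n * K * L" by simp
qed

lemma entries_le_add:
  assumes A: "entries_le n A K" and B: "entries_le n B L"
  shows "entries_le n (A + B) (K + L)"
proof (rule entries_leI)
  note A' = entries_leD[OF A] and B' = entries_leD[OF B]
  show "A + B \<in> carrier_mat n n" using A'(1) B'(1) by simp
  show "0 \<le> K + L" using A'(2) B'(2) by simp
  fix i j assume ij: "i < n" "j < n"
  have "(A + B) $$ (i, j) = A $$ (i, j) + B $$ (i, j)" using ij A'(1) B'(1) by simp
  thus "cmod ((A + B) $$ (i, j)) \<le> K + L"
    using A'(3)[OF ij] B'(3)[OF ij] norm_triangle_ineq[of "A $$ (i, j)" "B $$ (i, j)"] by simp
qed

lemma entries_le_smult:
  assumes A: "entries_le n A K"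
  shows "entries_le n (c \<cdot>\<^sub>m A) (cmod c * K)"
proof (rule entries_leI)
  note A' = entries_leD[OF A]
  show "c \<cdot>\<^sub>m A \<in> carrier_mat n n" using A'(1) by simp
  show "0 \<le> cmod c * K" using A'(2) by simp
  fix i j assume ij: "i < n" "j < n"
  thus "cmod ((c \<cdot>\<^sub>m A) $$ (i, j)) \<le> cmod c * K"
    using A'(1) A'(3)[OF ij] by (simp add: norm_mult mult_left_mono)
qed

lemma entries_le_minus:
  assumes A: "entries_le n A K" and B: "entries_le n B L"
  shows "entries_le n (A - B) (K + L)"
proof -
  have "A - B = A + (-1) \<cdot>\<^sub>m B" using entries_leD(1)[OF A] entries_leD(1)[OF B] by (intro eq_matI) auto
  thus ?thesis using entries_le_add[OF A entries_le_smult[OF B, of "-1"]] by simp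
qed

lemma entries_le_mat_Sum:
  assumes "\<And>k. k \<in> I \<Longrightarrow> entries_le n (f k) (K k)"
  shows "entries_le n (mat_Sum n f I) (\<Sum>k\<in>I. K k)"
proof (rule entries_leI)
  show "0 \<le> (\<Sum>k\<in>I. K k)" by (intro sum_nonneg entries_leD(2)[OF assms])
  fix i j assume ij: "i < n" "j < n"
  have "cmod (\<Sum>k\<in>I. f k $$ (i, j)) \<le> (\<Sum>k\<in>I. K k)"
    using entries_leD(3)[OF assms ij] by (intro sum_norm_le) blast
  thus "cmod (mat_Sum n f I $$ (i, j)) \<le> (\<Sum>k\<in>I. K k)" using ij by simp
qed simp

lemma entries_le_kron:
  assumes A: "entries_le n A K" and B: "entries_le m B L"
  shows "entries_le (n * m) (kron A B) (K * L)"
proof (rule entries_leI)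
  note A' = entries_leD[OF A] and B' = entries_leD[OF B]
  show "kron A B \<in> carrier_mat (n * m) (n * m)" by (rule kron_carrier[OF A'(1) B'(1)])
  show "0 \<le> K * L" using A'(2) B'(2) by simp
  fix i j assume ij: "i < n * m" "j < n * m"
  hence m: "0 < m" by (cases m) auto
  have "i div m < n" "j div m < n" "i mod m < m" "j mod m < m"
    using ij m by (auto simp: less_mult_imp_div_less)
  moreover have "kron A B $$ (i, j) = A $$ (i div m, j div m) * B $$ (i mod m, j mod m)"
    using ij A'(1) B'(1) index_kron[of i A B j] by simp
  ultimately show "cmod (kron A B $$ (i, j)) \<le> K * L"
    using A' B' by (simp add: norm_mult mult_mono)
qed

lemma entries_le_ptrace_env:
  assumes A: "entries_le (2 * n) A K"
  shows "entries_le n (ptrace_env A) (2 * K)"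
proof (rule entries_leI)
  note A' = entries_leD[OF A]
  show "ptrace_env A \<in> carrier_mat n n" by (rule ptrace_env_carrier[OF A'(1)])
  show "0 \<le> 2 * K" using A'(2) by simp
  fix i j assume ij: "i < n" "j < n"
  show "cmod (ptrace_env A $$ (i, j)) \<le> 2 * K"
    unfolding index_ptrace_env[OF A'(1) ij]
    using A'(3)[of "2 * i" "2 * j"] A'(3)[of "2 * i + 1" "2 * j + 1"] ij
      norm_triangle_ineq[of "A $$ (2 * i, 2 * j)" "A $$ (2 * i + 1, 2 * j + 1)"] by simp
qed

text \<open>
  The supremum in \<open>norm_1to1\<close> is meaningful only for a set that is bounded above; entrywise bounds provide this,
  and also the convergence of the series \<open>superop_exp\<close>.
\<close>
definition bounded_map :: "nat \<Rightarrow> nat \<Rightarrow> (complex mat \<Rightarrow> complex mat) \<Rightarrow> bool" where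
  "bounded_map n k F \<longleftrightarrow> (\<exists>c\<ge>0. \<forall>\<rho> K. entries_le n \<rho> K \<longrightarrow> entries_le k (F \<rho>) (c * K))"

lemma bounded_mapI:
  assumes "0 \<le> c" "\<And>\<rho> K. entries_le n \<rho> K \<Longrightarrow> entries_le k (F \<rho>) (c * K)"
  shows "bounded_map n k F"
  using assms unfolding bounded_map_def by blast

lemma bounded_mapE:
  assumes "bounded_map n k F"
  obtains c where "0 \<le> c" "\<And>\<rho> K. entries_le n \<rho> K \<Longrightarrow> entries_le k (F \<rho>) (c * K)"
  using assms unfolding bounded_map_def by blast

lemma bounded_map_id: "bounded_map n n (\<lambda>\<rho>. \<rho>)"
  by (rule bounded_mapI[of 1]) auto

lemma bounded_map_comp:
  assumes "bounded_map n m F" "bounded_map m k G"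
  shows "bounded_map n k (\<lambda>\<rho>. G (F \<rho>))"
proof -
  obtain c where c: "0 \<le> c" "\<And>\<rho> K. entries_le n \<rho> K \<Longrightarrow> entries_le m (F \<rho>) (c * K)"
    using assms(1) by (rule bounded_mapE) blast
  obtain d where d: "0 \<le> d" "\<And>\<rho> K. entries_le m \<rho> K \<Longrightarrow> entries_le k (G \<rho>) (d * K)"
    using assms(2) by (rule bounded_mapE) blast
  show ?thesis
  proof (rule bounded_mapI[of "d * c"])
    fix \<rho> K assume "entries_le n \<rho> K"
    from d(2)[OF c(2)[OF this]] show "entries_le k (G (F \<rho>)) (d * c * K)" by (simp add: mult.assoc)
  qed (use c d in simp)
qed

lemma bounded_map_mult_left:
  assumes "A \<in> carrier_mat n n"
  shows "bounded_map n n (\<lambda>\<rho>. A * \<rho>)"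
proof -
  obtain L where L: "entries_le n A L" using entries_le_exists[OF assms] by blast
  show ?thesis
  proof (rule bounded_mapI[of "real n * L"])
    show "0 \<le> real n * L" using entries_leD(2)[OF L] by simp
  qed (rule entries_le_mult[OF L])
qed

lemma bounded_map_mult_right:
  assumes "A \<in> carrier_mat n n"
  shows "bounded_map n n (\<lambda>\<rho>. \<rho> * A)"
proof -
  obtain L where L: "entries_le n A L" using entries_le_exists[OF assms] by blast
  show ?thesis
  proof (rule bounded_mapI[of "real n * L"])
    show "0 \<le> real n * L" using entries_leD(2)[OF L] by simp
    fix \<rho> K assume "entries_le n \<rho> K"
    from entries_le_mult[OF this L] show "entries_le n (\<rho> * A) (real n * L * K)" by (simp add: mult_ac)
  qed
qed

lemma bounded_map_add:
  assumes "bounded_map n k F" "bounded_map n k G"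
  shows "bounded_map n k (\<lambda>\<rho>. F \<rho> + G \<rho>)"
proof -
  obtain c where c: "0 \<le> c" "\<And>\<rho> K. entries_le n \<rho> K \<Longrightarrow> entries_le k (F \<rho>) (c * K)"
    using assms(1) by (rule bounded_mapE) blast
  obtain d where d: "0 \<le> d" "\<And>\<rho> K. entries_le n \<rho> K \<Longrightarrow> entries_le k (G \<rho>) (d * K)"
    using assms(2) by (rule bounded_mapE) blast
  show ?thesis
  proof (rule bounded_mapI[of "c + d"])
    fix \<rho> K assume "entries_le n \<rho> K"
    from entries_le_add[OF c(2)[OF this] d(2)[OF this]]
    show "entries_le k (F \<rho> + G \<rho>) ((c + d) * K)" by (simp add: algebra_simps)
  qed (use c d in simp)
qed

lemma bounded_map_minus:
  assumes "bounded_map n k F" "bounded_map n k G"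
  shows "bounded_map n k (\<lambda>\<rho>. F \<rho> - G \<rho>)"
proof -
  obtain c where c: "0 \<le> c" "\<And>\<rho> K. entries_le n \<rho> K \<Longrightarrow> entries_le k (F \<rho>) (c * K)"
    using assms(1) by (rule bounded_mapE) blast
  obtain d where d: "0 \<le> d" "\<And>\<rho> K. entries_le n \<rho> K \<Longrightarrow> entries_le k (G \<rho>) (d * K)"
    using assms(2) by (rule bounded_mapE) blast
  show ?thesis
  proof (rule bounded_mapI[of "c + d"])
    fix \<rho> K assume "entries_le n \<rho> K"
    from entries_le_minus[OF c(2)[OF this] d(2)[OF this]]
    show "entries_le k (F \<rho> - G \<rho>) ((c + d) * K)" by (simp add: algebra_simps)
  qed (use c d in simp)
qed

lemma bounded_map_smult: "bounded_map n n (\<lambda>\<rho>. c \<cdot>\<^sub>m \<rho>)"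
  by (rule bounded_mapI[of "cmod c"]) (auto intro: entries_le_smult)

lemma bounded_map_mat_Sum:
  assumes "finite I" "\<And>k. k \<in> I \<Longrightarrow> bounded_map n n (F k)"
  shows "bounded_map n n (\<lambda>\<rho>. mat_Sum n (\<lambda>k. F k \<rho>) I)"
proof -
  have "\<forall>k\<in>I. \<exists>c\<ge>0. \<forall>\<rho> K. entries_le n \<rho> K \<longrightarrow> entries_le n (F k \<rho>) (c * K)"
    using assms(2) unfolding bounded_map_def by blast
  then obtain c where c: "\<And>k. k \<in> I \<Longrightarrow> 0 \<le> c k"
    "\<And>k \<rho> K. k \<in> I \<Longrightarrow> entries_le n \<rho> K \<Longrightarrow> entries_le n (F k \<rho>) (c k * K)"
    by metis
  show ?thesis
  proof (rule bounded_mapI[of "\<Sum>k\<in>I. c k"])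
    show "0 \<le> (\<Sum>k\<in>I. c k)" using c(1) by (rule sum_nonneg)
    fix \<rho> K assume "entries_le n \<rho> K"
    hence "entries_le n (mat_Sum n (\<lambda>k. F k \<rho>) I) (\<Sum>k\<in>I. c k * K)"
      using c(2) by (intro entries_le_mat_Sum) blast
    thus "entries_le n (mat_Sum n (\<lambda>k. F k \<rho>) I) ((\<Sum>k\<in>I. c k) * K)" by (simp add: sum_distrib_right)
  qed
qed

lemma bounded_map_kron:
  assumes "E \<in> carrier_mat m m"
  shows "bounded_map n (n * m) (\<lambda>\<rho>. kron \<rho> E)"
proof -
  obtain L where L: "entries_le m E L" using entries_le_exists[OF assms] by blast
  show ?thesis
  proof (rule bounded_mapI[of L])
    fix \<rho> K assume "entries_le n \<rho> K"
    from entries_le_kron[OF this L] show "entries_le (n * m) (kron \<rho> E) (L * K)" by (simp add: mult_ac)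
  qed (rule entries_leD(2)[OF L])
qed

lemma bounded_map_ptrace_env: "bounded_map (2 * n) n ptrace_env"
  by (rule bounded_mapI[of 2]) (auto intro: entries_le_ptrace_env)

lemma bounded_map_funpow:
  assumes "bounded_map n n F"
  shows "bounded_map n n (F ^^ k)"
proof (induction k)
  case 0
  have "bounded_map n n (\<lambda>\<rho>. \<rho>)" by (rule bounded_map_id)
  thus ?case by (simp add: id_def)
next
  case (Suc k)
  from bounded_map_comp[OF this assms] show ?case by (simp add: comp_def)
qed

lemma bounded_map_fold:
  assumes "\<And>x. x \<in> set xs \<Longrightarrow> bounded_map n n (F x)"
  shows "bounded_map n n (fold F xs)"
  using assms
proof (induction xs)
  case Nil
  have "bounded_map n n (\<lambda>\<rho>. \<rho>)" by (rule bounded_map_id)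
  thus ?case by (simp add: id_def)
next
  case (Cons x xs)
  have "bounded_map n n (F x)" "bounded_map n n (fold F xs)" using Cons by simp_all
  from bounded_map_comp[OF this] show ?case by (simp add: comp_def)
qed

text \<open>If \<open>F\<close> enlarges entries by at most a factor c, its k-th iterate does so by
  at most c^k, and every entry of the series is dominated by the series of exp(|t| c).\<close>

lemma bounded_map_superop_exp:
  assumes "bounded_map n n F"
  shows "bounded_map n n (superop_exp n F t)"
proof -
  obtain c where c: "0 \<le> c" "\<And>\<rho> K. entries_le n \<rho> K \<Longrightarrow> entries_le n (F \<rho>) (c * K)"
    using assms by (rule bounded_mapE) blast
  show ?thesis
  proof (rule bounded_mapI[of "exp (\<bar>t\<bar> * c)"])
    fix \<rho> K assume \<rho>: "entries_le n \<rho> K"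
    have pow: "entries_le n ((F ^^ k) \<rho>) (c ^ k * K)" for k
    proof (induction k)
      case (Suc k)
      from c(2)[OF this] show ?case by (simp add: mult_ac)
    qed (use \<rho> in simp)
    show "entries_le n (superop_exp n F t \<rho>) (exp (\<bar>t\<bar> * c) * K)"
    proof (rule entries_leI)
      show "superop_exp n F t \<rho> \<in> carrier_mat n n" by (simp add: superop_exp_def)
      show "0 \<le> exp (\<bar>t\<bar> * c) * K" using entries_leD(2)[OF \<rho>] by simp
      fix i j assume ij: "i < n" "j < n"
      define a where "a = (\<lambda>k. complex_of_real (t ^ k / fact k) * ((F ^^ k) \<rho>) $$ (i, j))"
      define b where "b = (\<lambda>k. (\<bar>t\<bar> * c) ^ k /\<^sub>R fact k * K)"
      have ab: "cmod (a k) \<le> b k" for k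
      proof -
        have "cmod (a k) = \<bar>t\<bar> ^ k / fact k * cmod (((F ^^ k) \<rho>) $$ (i, j))"
          by (simp add: a_def norm_mult norm_divide norm_power del: of_real_divide of_real_power)
             (simp add: power_abs)
        also have "\<dots> \<le> \<bar>t\<bar> ^ k / fact k * (c ^ k * K)"
          by (intro mult_left_mono entries_leD(3)[OF pow ij]) simp
        also have "\<dots> = b k" by (simp add: b_def power_mult_distrib divide_inverse mult_ac)
        finally show ?thesis .
      qed
      have b: "b sums (exp (\<bar>t\<bar> * c) * K)"
        unfolding b_def by (intro sums_mult2 exp_converges)
      have "summable (\<lambda>k. cmod (a k))"
        by (rule summable_comparison_test'[OF sums_summable[OF b], of 0]) (use ab in simp)
      hence "cmod (suminf a) \<le> (\<Sum>k. cmod (a k))" by (rule summable_norm)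
      also have "\<dots> \<le> suminf b"
        using ab \<open>summable (\<lambda>k. cmod (a k))\<close> sums_summable[OF b] by (rule suminf_le)
      also have "suminf b = exp (\<bar>t\<bar> * c) * K" using b by (rule sums_unique[symmetric])
      finally show "cmod (superop_exp n F t \<rho> $$ (i, j)) \<le> exp (\<bar>t\<bar> * c) * K"
        using ij by (simp add: superop_exp_def a_def)
    qed
  qed simp
qed

lemma opbound_entries_le:
  assumes "entries_le n A K"
  shows "opbound A (real n * (real n * K))"
proof (rule opboundI)
  note A = entries_leD[OF assms]
  show "A \<in> carrier_mat n n" "0 \<le> real n * (real n * K)" using A by auto
  fix v :: "complex Matrix.vec" assume v: "v \<in> carrier_vec n"
  have "vnorm (A *\<^sub>v v) \<le> (\<Sum>i<n. cmod (vec_index (A *\<^sub>v v) i))"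
    using A by (auto simp: vnorm_L2_set intro!: order_trans[OF L2_set_le_sum])
  also have "\<dots> \<le> (\<Sum>i<n. real n * K * vnorm v)"
  proof (rule sum_mono)
    fix i assume "i \<in> {..<n}"
    hence i: "i < n" by simp
    have "cmod (vec_index (A *\<^sub>v v) i) \<le> (\<Sum>j<n. cmod (A $$ (i, j) * vec_index v j))"
      unfolding index_mult_mat_vec_sum[OF A(1) v i] by (rule norm_sum)
    also have "\<dots> \<le> (\<Sum>j<n. K * vnorm v)"
      unfolding norm_mult
    proof (intro sum_mono mult_mono)
      fix j assume "j \<in> {..<n}"
      hence j: "j < n" by simp
      show "cmod (A $$ (i, j)) \<le> K" by (rule A(3)[OF i j])
      show "cmod (vec_index v j) \<le> vnorm v"
        unfolding vnorm_L2_set using member_le_L2_set[of "{..<n}" j "\<lambda>i. cmod (vec_index v i)"] j v by simp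
    qed (use A in auto)
    finally show "cmod (vec_index (A *\<^sub>v v) i) \<le> real n * K * vnorm v" by simp
  qed
  finally show "vnorm (A *\<^sub>v v) \<le> real n * (real n * K) * vnorm v" by simp
qed

lemma trace_norm_le_entries:
  assumes "entries_le n A K"
  shows "trace_norm A \<le> real n * (real n * (real n * K))"
proof -
  note A = entries_leD[OF assms]
  obtain U where U: "unitary_mat n U" "trace_norm A = (\<Sum>l<n. vnorm (A *\<^sub>v col U l))"
    using trace_norm_singular_values[OF A(1)] by (elim exE conjE)
  have "(\<Sum>l<n. vnorm (A *\<^sub>v col U l)) \<le> (\<Sum>l<n. real n * (real n * K))"
  proof (rule sum_mono)
    fix l assume "l \<in> {..<n}"
    hence l: "l < n" by simp
    have "col U l \<in> carrier_vec n" using unitary_matD(1)[OF U(1)] by simp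
    from opboundD[OF opbound_entries_le[OF assms] A(1) this]
    show "vnorm (A *\<^sub>v col U l) \<le> real n * (real n * K)"
      unfolding vnorm_unitary_col[OF U(1) l] by simp
  qed
  thus ?thesis unfolding U(2) by simp
qed

text \<open>An entry is the trace against a matrix unit \<open>E\<close>, so Hoelder's inequality
  applies. With \<open>trace_norm_le_entries\<close> the two sizes are equivalent up to powers of
  the dimension, which serve finiteness alone and enter no final estimate.\<close>

lemma entries_le_trace_norm:
  assumes X: "X \<in> carrier_mat n n" "0 < n"
  shows "entries_le n X (real n * (real n * trace_norm X))"
proof -
  have e: "cmod (X $$ (i, j)) \<le> real n * (real n * trace_norm X)" if ij: "i < n" "j < n" for i j
  proof -
    define E where "E = Matrix.mat n n (\<lambda>(a, b). if a = j \<and> b = i then 1 else 0 :: complex)"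
    have E: "entries_le n E 1" by (auto simp: E_def entries_le_def)
    note E' = entries_leD[OF E]
    have "(E * X) $$ (a, a) = (if a = j then X $$ (i, j) else 0)" if "a < n" for a
    proof -
      have "(E * X) $$ (a, a) = (\<Sum>b<n. if b = i then (if a = j then X $$ (i, j) else 0) else 0)"
        unfolding index_mult_mat_sum[OF E'(1) X(1) that that]
        using that by (intro sum.cong) (auto simp: E_def)
      thus ?thesis using ij by simp
    qed
    hence "mtrace (E * X) = X $$ (i, j)"
      using ij unfolding mtrace_carrier[OF mult_square_mat_carrier[OF E'(1) X(1)]] by simp
    thus ?thesis
      using mtrace_mult_le_trace_norm[OF opbound_entries_le[OF E] E'(1) X(1)] by (simp add: mult_ac)
  qed
  have "0 \<le> real n * (real n * trace_norm X)"
    using e[of 0 0] X(2) by (meson norm_ge_zero order_trans)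
  with X e show ?thesis by (intro entries_leI)
qed

text \<open>The quotient lies below the supremum once all quotients are bounded and the denominator
  is positive; both follow from comparing trace norm and entries.\<close>

lemma trace_norm_le_norm_1to1:
  assumes F: "bounded_map n n F" and n: "0 < n" and \<rho>: "\<rho> \<in> carrier_mat n n" "\<rho> \<noteq> 0\<^sub>m n n"
  shows "trace_norm (F \<rho>) \<le> norm_1to1 n F * trace_norm \<rho>"
proof -
  obtain c where c: "0 \<le> c" "\<And>\<rho> K. entries_le n \<rho> K \<Longrightarrow> entries_le n (F \<rho>) (c * K)"
    using F by (rule bounded_mapE) blast
  have pos: "0 < trace_norm \<sigma>" if \<sigma>: "\<sigma> \<in> carrier_mat n n" "\<sigma> \<noteq> 0\<^sub>m n n" for \<sigma>
  proof (rule ccontr)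
    assume "\<not> 0 < trace_norm \<sigma>"
    note e = entries_le_trace_norm[OF \<sigma>(1) n]
    have "real n * (real n * trace_norm \<sigma>) \<le> 0"
      using \<open>\<not> 0 < trace_norm \<sigma>\<close> by (intro mult_nonneg_nonpos) auto
    hence "cmod (\<sigma> $$ (i, j)) \<le> 0" if "i < n" "j < n" for i j
      using entries_leD(3)[OF e that] by linarith
    hence "\<sigma> = 0\<^sub>m n n" using \<sigma>(1) by (intro eq_matI) auto
    with \<sigma>(2) show False by simp
  qed
  \<comment> \<open>Three powers of n are lost from entries to trace norm and two from trace norm to
    entries.\<close>
  have "trace_norm (F \<sigma>) / trace_norm \<sigma> \<le> real n ^ 5 * c"
    if \<sigma>: "\<sigma> \<in> carrier_mat n n" "\<sigma> \<noteq> 0\<^sub>m n n" for \<sigma>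
  proof -
    have "trace_norm (F \<sigma>) \<le> real n * (real n * (real n * (c * (real n * (real n * trace_norm \<sigma>)))))"
      by (rule trace_norm_le_entries[OF c(2)[OF entries_le_trace_norm[OF \<sigma>(1) n]]])
    also have "\<dots> = real n ^ 5 * c * trace_norm \<sigma>" by (simp add: numeral_eq_Suc mult_ac)
    finally show ?thesis using pos[OF \<sigma>] by (simp add: pos_divide_le_eq)
  qed
  hence "bdd_above ((\<lambda>\<rho>. trace_norm (F \<rho>) / trace_norm \<rho>) ` {\<rho> \<in> carrier_mat n n. \<rho> \<noteq> 0\<^sub>m n n})"
    by (intro bdd_aboveI[of _ "real n ^ 5 * c"]) auto
  hence "trace_norm (F \<rho>) / trace_norm \<rho> \<le> norm_1to1 n F"
    unfolding norm_1to1_def using \<rho> by (intro cSUP_upper) auto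
  thus ?thesis using pos[OF \<rho>] by (simp add: divide_le_eq)
qed

section \<open>Boundedness of the Lindblad evolution and of the collision map\<close>

lemma pauli_sum_carrier [simp]: "pauli_sum n xs \<in> carrier_mat (2 ^ n) (2 ^ n)"
  by (simp add: pauli_sum_def)

lemma bounded_map_lindbladian:
  assumes "wf_collision_model M"
  shows "bounded_map (sys_dim M) (sys_dim M) (lindbladian M)"
proof -
  let ?n = "sys_dim M"
  let ?H = "pauli_sum (num_qubits M) (sys_ham M)"
  have J: "jump M j \<in> carrier_mat ?n ?n" if "j < num_envs M" for j
    using assms that by (simp add: wf_collision_model_def)
  have H: "?H \<in> carrier_mat ?n ?n" by simp
  have "bounded_map ?n ?n (\<lambda>\<rho>. (- \<i>) \<cdot>\<^sub>m (?H * \<rho> - \<rho> * ?H))"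
    by (rule bounded_map_comp[OF bounded_map_minus[OF bounded_map_mult_left[OF H]
      bounded_map_mult_right[OF H]] bounded_map_smult])
  moreover have "bounded_map ?n ?n (\<lambda>\<rho>. mat_Sum ?n (\<lambda>j. let A = jump M j; A' = mat_adjoint A
             in A * \<rho> * A' - (1/2) \<cdot>\<^sub>m (A' * A * \<rho> + \<rho> * (A' * A))) {..<num_envs M})"
  proof (rule bounded_map_mat_Sum)
    fix j assume "j \<in> {..<num_envs M}"
    hence A: "jump M j \<in> carrier_mat ?n ?n" using J by simp
    have A': "mat_adjoint (jump M j) \<in> carrier_mat ?n ?n" by (rule mat_adjoint_carrier[OF A])
    have AA: "mat_adjoint (jump M j) * jump M j \<in> carrier_mat ?n ?n" by (rule mult_square_mat_carrier[OF A' A])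
    show "bounded_map ?n ?n (\<lambda>\<rho>. let A = jump M j; A' = mat_adjoint A
             in A * \<rho> * A' - (1/2) \<cdot>\<^sub>m (A' * A * \<rho> + \<rho> * (A' * A)))"
      unfolding Let_def
      by (rule bounded_map_minus[OF
            bounded_map_comp[OF bounded_map_mult_left[OF A] bounded_map_mult_right[OF A']]
            bounded_map_comp[OF bounded_map_add[OF bounded_map_mult_left[OF AA] bounded_map_mult_right[OF AA]]
              bounded_map_smult]])
  qed simp
  ultimately have "bounded_map ?n ?n (\<lambda>\<rho>. (- \<i>) \<cdot>\<^sub>m (?H * \<rho> - \<rho> * ?H) +
      mat_Sum ?n (\<lambda>j. let A = jump M j; A' = mat_adjoint A
             in A * \<rho> * A' - (1/2) \<cdot>\<^sub>m (A' * A * \<rho> + \<rho> * (A' * A))) {..<num_envs M})"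
    by (rule bounded_map_add)
  moreover have "lindbladian M = (\<lambda>\<rho>. (- \<i>) \<cdot>\<^sub>m (?H * \<rho> - \<rho> * ?H) +
      mat_Sum ?n (\<lambda>j. let A = jump M j; A' = mat_adjoint A
             in A * \<rho> * A' - (1/2) \<cdot>\<^sub>m (A' * A * \<rho> + \<rho> * (A' * A))) {..<num_envs M})"
    by (rule ext) (simp only: lindbladian_def Let_def)
  ultimately show ?thesis by simp
qed

lemma mexp_carrier: "A \<in> carrier_mat n n \<Longrightarrow> mexp A \<in> carrier_mat n n"
  by (simp add: mexp_def)

lemma collision_ham_carrier: "collision_ham M lam j \<in> carrier_mat (2 * sys_dim M) (2 * sys_dim M)"
  using pauli_sum_carrier[of "Suc (num_qubits M)"] by (simp add: collision_ham_def)

lemma collision_unitary_carrier: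
  "collision_unitary M t \<nu> j \<in> carrier_mat (2 * sys_dim M) (2 * sys_dim M)"
  unfolding collision_unitary_def by (intro mexp_carrier smult_carrier_mat collision_ham_carrier)

lemma proj_carrier [simp]: "proj0 \<in> carrier_mat 2 2" "proj1 \<in> carrier_mat 2 2"
  by (auto simp: proj0_def proj1_def mat_of_rows_list_def)

lemma env_state_carrier [simp]: "env_state M \<in> carrier_mat 2 2"
  by (simp add: env_state_def)

lemma bounded_map_collision_map: "bounded_map (sys_dim M) (sys_dim M) (collision_map M t \<nu>)"
proof -
  let ?n = "sys_dim M"
  have "bounded_map ?n ?n (collision_channel M t \<nu> j)" for j
  proof -
    let ?U = "collision_unitary M t \<nu> j"
    note U = collision_unitary_carrier[of M t \<nu> j]
    have "bounded_map ?n (2 * ?n) (\<lambda>\<rho>. kron \<rho> (env_state M))"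
      using bounded_map_kron[OF env_state_carrier, of ?n M] by (simp add: mult.commute)
    from bounded_map_comp[OF bounded_map_comp[OF bounded_map_comp[OF this bounded_map_mult_left[OF U]]
        bounded_map_mult_right[OF mat_adjoint_carrier[OF U]]] bounded_map_ptrace_env]
    have "bounded_map ?n ?n (\<lambda>\<rho>. ptrace_env (?U * kron \<rho> (env_state M) * mat_adjoint ?U))" .
    thus ?thesis by (simp add: collision_channel_def[abs_def] Let_def)
  qed
  thus ?thesis unfolding collision_map_def by (intro bounded_map_funpow bounded_map_fold)
qed

text \<open>A density operator has trace norm 1, so the norm distance of the two maps bounds the
  trace norm of the difference of the evolved states, and Hoelder's inequality turns this into a
  bound on expectations.\<close>

lemma corresponds_expectation:
  assumes wf: "wf_collision_model M" and c: "corresponds C M t"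
    and \<eta>: "0 < \<eta>" "\<eta> < 1" and \<nu>: "0 < \<nu>" "real \<nu> \<ge> C * t\<^sup>2 * real (num_envs M) * Gamma_const M / \<eta>"
    and A: "opbound A a" "A \<in> carrier_mat (sys_dim M) (sys_dim M)" and \<rho>: "density_op (sys_dim M) \<rho>"
  shows "cmod (mtrace (A * superop_exp (sys_dim M) (lindbladian M) t \<rho>) -
    mtrace (A * collision_map M t \<nu> \<rho>)) \<le> a * \<eta>"
proof -
  let ?n = "sys_dim M"
  let ?E = "superop_exp ?n (lindbladian M) t" and ?C = "collision_map M t \<nu>"
  have bE: "bounded_map ?n ?n ?E" by (rule bounded_map_superop_exp[OF bounded_map_lindbladian[OF wf]])
  note bC = bounded_map_collision_map[of M t \<nu>]
  note b = bounded_map_minus[OF bE bC]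
  have \<rho>c: "\<rho> \<in> carrier_mat ?n ?n" using \<rho> by (simp add: density_op_def)
  have \<rho>0: "\<rho> \<noteq> 0\<^sub>m ?n ?n" using \<rho> by (auto simp: density_op_def mtrace_def)
  obtain K where K: "entries_le ?n \<rho> K" using entries_le_exists[OF \<rho>c] by blast
  \<comment> \<open>Boundedness is used here for its size information: the image of the state is a
    square matrix of the system dimension.\<close>
  have car: "F \<rho> \<in> carrier_mat ?n ?n" if bF: "bounded_map ?n ?n F" for F
  proof -
    obtain c where "entries_le ?n (F \<rho>) (c * K)" using bF K unfolding bounded_map_def by blast
    thus ?thesis by (rule entries_leD)
  qed
  note cE = car[OF bE] and cC = car[OF bC]
  have "norm_1to1 ?n (\<lambda>\<rho>. ?E \<rho> - ?C \<rho>) \<le> \<eta>"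
    using c \<eta> \<nu> unfolding corresponds_def by blast
  moreover have "trace_norm (?E \<rho> - ?C \<rho>) \<le> norm_1to1 ?n (\<lambda>\<rho>. ?E \<rho> - ?C \<rho>) * trace_norm \<rho>"
    by (rule trace_norm_le_norm_1to1[OF b _ \<rho>c \<rho>0]) simp
  ultimately have "trace_norm (?E \<rho> - ?C \<rho>) \<le> \<eta>" by (simp add: trace_norm_density[OF \<rho>])
  hence "a * trace_norm (?E \<rho> - ?C \<rho>) \<le> a * \<eta>"
    using opbound_nonneg[OF A(1)] by (rule mult_left_mono)
  moreover have "mtrace (A * ?E \<rho>) - mtrace (A * ?C \<rho>) = mtrace (A * (?E \<rho> - ?C \<rho>))"
    by (simp add: mult_minus_distrib_mat[OF A(2) cE cC]
        mtrace_minus[OF mult_square_mat_carrier[OF A(2) cE] mult_square_mat_carrier[OF A(2) cC]])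
  ultimately show ?thesis
    using mtrace_mult_le_trace_norm[OF A(1,2) car[OF b]] by (metis order.trans)
qed

section \<open>Kronecker products, Pauli strings and the truncated Taylor series\<close>

text \<open>Splits an index into two digits. With b = 2 this separates the environment qubit, with a
  = 2 the ancilla.\<close>

lemma sum_lessThan_mult:
  fixes f :: "nat \<Rightarrow> 'a::comm_monoid_add"
  shows "(\<Sum>k<a * b. f k) = (\<Sum>i<a. \<Sum>j<b. f (i * b + j))"
proof -
  have "(\<Sum>k<a * b. f k) = (\<Sum>i<a. sum f {i * b..<i * b + b})"
    by (rule sum.nat_group[symmetric])
  also have "\<dots> = (\<Sum>i<a. \<Sum>j<b. f (i * b + j))"
  proof (rule sum.cong)
    fix i
    show "sum f {i * b..<i * b + b} = (\<Sum>j<b. f (i * b + j))"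
      using sum.atLeastLessThan_shift_0[of f "i * b" "i * b + b"] by (simp add: atLeast0LessThan comp_def)
  qed simp
  finally show ?thesis .
qed

lemma block_index_less: "i < a \<Longrightarrow> j < b \<Longrightarrow> i * b + j < a * (b::nat)"
proof -
  assume "i < a" "j < b"
  hence "i * b + j < Suc i * b" by simp
  also have "\<dots> \<le> a * b" using \<open>i < a\<close> by (intro mult_le_mono1) simp
  finally show ?thesis .
qed

lemma kron_mult:
  assumes A: "A \<in> carrier_mat a a" and C: "C \<in> carrier_mat a a"
    and B: "B \<in> carrier_mat b b" and D: "D \<in> carrier_mat b b"
  shows "kron A B * kron C D = kron (A * C) (B * D)"
proof (rule eq_matI)
  have AC: "A * C \<in> carrier_mat a a" and BD: "B * D \<in> carrier_mat b b"
    using assms by simp_all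
  note k1 = kron_carrier[OF A B] and k2 = kron_carrier[OF C D] and k3 = kron_carrier[OF AC BD]
  fix i j assume "i < dim_row (kron (A * C) (B * D))" "j < dim_col (kron (A * C) (B * D))"
  hence ij: "i < a * b" "j < a * b" using k3 by auto
  hence b: "0 < b" by (cases b) auto
  have lt: "i div b < a" "j div b < a" "i mod b < b" "j mod b < b"
    using ij b by (auto simp: less_mult_imp_div_less)
  have "(kron A B * kron C D) $$ (i, j) = (\<Sum>k<a * b. kron A B $$ (i, k) * kron C D $$ (k, j))"
    by (rule index_mult_mat_sum[OF k1 k2 ij])
  also have "\<dots> = (\<Sum>x<a. \<Sum>y<b. kron A B $$ (i, x * b + y) * kron C D $$ (x * b + y, j))"
    by (rule sum_lessThan_mult)
  also have "\<dots> = (\<Sum>x<a. \<Sum>y<b. (A $$ (i div b, x) * C $$ (x, j div b)) * (B $$ (i mod b, y) * D $$ (y, j mod b)))"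
  proof (intro sum.cong refl)
    fix x y assume "x \<in> {..<a}" "y \<in> {..<b}"
    hence xy: "x < a" "y < b" by auto
    note l = block_index_less[OF this]
    have "kron A B $$ (i, x * b + y) = A $$ (i div b, x) * B $$ (i mod b, y)"
      using index_kron[of i A B "x * b + y"] ij l A B xy by simp
    moreover have "kron C D $$ (x * b + y, j) = C $$ (x, j div b) * D $$ (y, j mod b)"
      using index_kron[of "x * b + y" C D j] ij l C D xy by simp
    ultimately show "kron A B $$ (i, x * b + y) * kron C D $$ (x * b + y, j) =
        (A $$ (i div b, x) * C $$ (x, j div b)) * (B $$ (i mod b, y) * D $$ (y, j mod b))"
      by (simp add: mult_ac)
  qed
  also have "\<dots> = (A * C) $$ (i div b, j div b) * (B * D) $$ (i mod b, j mod b)"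
    unfolding index_mult_mat_sum[OF A C lt(1,2)] index_mult_mat_sum[OF B D lt(3,4)]
    by (simp add: sum_product)
  also have "\<dots> = kron (A * C) (B * D) $$ (i, j)"
    using index_kron[of i "A * C" "B * D" j] ij A B C D by simp
  finally show "(kron A B * kron C D) $$ (i, j) = kron (A * C) (B * D) $$ (i, j)" .
qed (use assms in auto)

lemma kron_adjoint: "mat_adjoint (kron A B) = kron (mat_adjoint A) (mat_adjoint B)"
proof (rule eq_matI)
  fix i j assume "i < dim_row (kron (mat_adjoint A) (mat_adjoint B))"
    "j < dim_col (kron (mat_adjoint A) (mat_adjoint B))"
  hence ij: "i < dim_col A * dim_col B" "j < dim_row A * dim_row B" by auto
  hence pos: "0 < dim_col B" "0 < dim_row B" by (auto intro!: Nat.gr0I)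
  have lt: "i div dim_col B < dim_col A" "j div dim_row B < dim_row A"
    "i mod dim_col B < dim_col B" "j mod dim_row B < dim_row B"
    using ij pos by (auto simp: less_mult_imp_div_less)
  have "mat_adjoint (kron A B) $$ (i, j) = cnj (kron A B $$ (j, i))"
    using ij by (intro index_mat_adjoint) auto
  thus "mat_adjoint (kron A B) $$ (i, j) = kron (mat_adjoint A) (mat_adjoint B) $$ (i, j)"
    using ij lt by (simp add: index_kron)
qed auto

lemma kron_one: "kron (1\<^sub>m a) (1\<^sub>m b) = 1\<^sub>m (a * b)"
proof (rule eq_matI)
  fix i j assume "i < dim_row (1\<^sub>m (a * b) :: complex mat)" "j < dim_col (1\<^sub>m (a * b) :: complex mat)"
  hence ij: "i < a * b" "j < a * b" by auto
  hence b: "0 < b" by (cases b) auto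
  have lt: "i div b < a" "j div b < a" "i mod b < b" "j mod b < b"
    using ij b by (auto simp: less_mult_imp_div_less)
  have "i div b = j div b \<and> i mod b = j mod b \<longleftrightarrow> i = j"
    by (metis div_mult_mod_eq)
  thus "kron (1\<^sub>m a) (1\<^sub>m b) $$ (i, j) = 1\<^sub>m (a * b) $$ (i, j)"
    using ij lt by (auto simp: index_kron)
qed auto

lemma kron_unitary:
  assumes A: "unitary_mat a A" and B: "unitary_mat b B"
  shows "unitary_mat (a * b) (kron A B)"
proof (rule unitary_matI)
  note A' = unitary_matD[OF A] and B' = unitary_matD[OF B]
  show "kron A B \<in> carrier_mat (a * b) (a * b)" by (rule kron_carrier[OF A'(1) B'(1)])
  have "mat_adjoint (kron A B) * kron A B = kron (mat_adjoint A * A) (mat_adjoint B * B)"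
    unfolding kron_adjoint
    by (rule kron_mult[OF mat_adjoint_carrier[OF A'(1)] A'(1) mat_adjoint_carrier[OF B'(1)] B'(1)])
  thus "mat_adjoint (kron A B) * kron A B = 1\<^sub>m (a * b)" by (simp only: A' B' kron_one)
qed

section \<open>Pauli strings as Hermitian involutions\<close>

lemma pauli_mat_carrier [simp]: "pauli_mat a \<in> carrier_mat 2 2"
  by (cases a) (auto simp: mat_of_rows_list_def)

lemma dim_pauli_mat [simp]: "dim_row (pauli_mat a) = 2" "dim_col (pauli_mat a) = 2"
  using pauli_mat_carrier[of a] by (blast dest: carrier_matD)+

lemma pauli_mat_adjoint: "mat_adjoint (pauli_mat a) = pauli_mat a"
proof (rule eq_matI)
  fix i j assume "i < dim_row (pauli_mat a)" "j < dim_col (pauli_mat a)"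
  hence ij: "i < 2" "j < 2" using pauli_mat_carrier[of a] by auto
  have "mat_adjoint (pauli_mat a) $$ (i, j) = cnj (pauli_mat a $$ (j, i))"
    using ij by (intro index_mat_adjoint) simp_all
  thus "mat_adjoint (pauli_mat a) $$ (i, j) = pauli_mat a $$ (i, j)"
    using less_2_cases[OF ij(1)] less_2_cases[OF ij(2)]
    by (cases a) (auto simp: mat_of_rows_list_def)
qed simp_all

lemma pauli_mat_square: "pauli_mat a * pauli_mat a = 1\<^sub>m 2"
proof (rule eq_matI)
  fix i j assume "i < dim_row (1\<^sub>m 2 :: complex mat)" "j < dim_col (1\<^sub>m 2 :: complex mat)"
  hence ij: "i < 2" "j < 2" by auto
  show "(pauli_mat a * pauli_mat a) $$ (i, j) = 1\<^sub>m 2 $$ (i, j)"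
    unfolding index_mult_mat_sum[OF pauli_mat_carrier pauli_mat_carrier ij] sum_lessThan_2
    using less_2_cases[OF ij(1)] less_2_cases[OF ij(2)]
    by (cases a) (auto simp: mat_of_rows_list_def)
qed simp_all

lemma pauli_string:
  "pauli_string P \<in> carrier_mat (2 ^ length P) (2 ^ length P)"
  "mat_adjoint (pauli_string P) = pauli_string P"
  "pauli_string P * pauli_string P = 1\<^sub>m (2 ^ length P)"
proof (induction P)
  case (Cons a P)
  have eq: "pauli_string (a # P) = kron (pauli_mat a) (pauli_string P)" by (simp add: pauli_string_def)
  show "pauli_string (a # P) \<in> carrier_mat (2 ^ length (a # P)) (2 ^ length (a # P))"
    using kron_carrier[OF pauli_mat_carrier Cons(1), of a] by (simp add: eq)
  show "mat_adjoint (pauli_string (a # P)) = pauli_string (a # P)"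
    by (simp only: eq kron_adjoint Cons(2) pauli_mat_adjoint)
  show "pauli_string (a # P) * pauli_string (a # P) = 1\<^sub>m (2 ^ length (a # P))"
    unfolding eq kron_mult[OF pauli_mat_carrier pauli_mat_carrier Cons(1) Cons(1)]
    by (simp add: Cons(3) pauli_mat_square kron_one)
qed (auto simp: pauli_string_def)

lemma signed_pauli:
  assumes "length P = n"
  shows "signed_pauli (s, P) \<in> carrier_mat (2 ^ n) (2 ^ n)"
    "mat_adjoint (signed_pauli (s, P)) = signed_pauli (s, P)"
    "signed_pauli (s, P) * signed_pauli (s, P) = 1\<^sub>m (2 ^ n)"
proof -
  note p = pauli_string[of P, unfolded assms]
  show "signed_pauli (s, P) \<in> carrier_mat (2 ^ n) (2 ^ n)"
    "mat_adjoint (signed_pauli (s, P)) = signed_pauli (s, P)"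
    using p by (auto simp: signed_pauli_def)
  have "- pauli_string P * - pauli_string P = pauli_string P * pauli_string P"
    using p(1) by (simp add: uminus_mat_smult mult_smult_assoc_mat[of _ "2 ^ n" "2 ^ n" _ "2 ^ n"]
      mult_smult_distrib[of _ "2 ^ n" "2 ^ n" _ "2 ^ n"])
       (intro eq_matI; simp)
  thus "signed_pauli (s, P) * signed_pauli (s, P) = 1\<^sub>m (2 ^ n)"
    using p by (auto simp: signed_pauli_def)
qed

section \<open>Exponentials of Hermitian matrices\<close>

lemma mexp_conj_diag:
  assumes U: "unitary_mat n U"
  shows "mexp (conj_diag n U f) = conj_diag n U (\<lambda>i. exp (f i))"
proof (rule eq_matI)
  fix i j assume "i < dim_row (conj_diag n U (\<lambda>i. exp (f i)))" "j < dim_col (conj_diag n U (\<lambda>i. exp (f i)))"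
  hence ij: "i < n" "j < n" by auto
  \<comment> \<open>The series of the eigenvalues converge, and each matrix entry is a fixed finite
    combination of them.\<close>
  have "(\<lambda>k. \<Sum>l<n. U $$ (i, l) * (f l ^ k /\<^sub>R fact k) * cnj (U $$ (j, l))) sums
      (\<Sum>l<n. U $$ (i, l) * exp (f l) * cnj (U $$ (j, l)))"
    by (intro sums_sum sums_mult sums_mult2 exp_converges)
  also have "(\<lambda>k. \<Sum>l<n. U $$ (i, l) * (f l ^ k /\<^sub>R fact k) * cnj (U $$ (j, l))) =
      (\<lambda>k. (conj_diag n U f ^\<^sub>m k) $$ (i, j) / fact k)"
  proof
    fix k
    have "(conj_diag n U f ^\<^sub>m k) $$ (i, j) = (\<Sum>l<n. U $$ (i, l) * f l ^ k * cnj (U $$ (j, l)))"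
      unfolding conj_diag_pow[OF U] using ij by (simp add: conj_diag_def)
    thus "(\<Sum>l<n. U $$ (i, l) * (f l ^ k /\<^sub>R fact k) * cnj (U $$ (j, l))) =
        (conj_diag n U f ^\<^sub>m k) $$ (i, j) / fact k"
      by (simp add: sum_divide_distrib sum_distrib_left scaleR_conv_of_real divide_inverse mult_ac)
  qed
  finally have "(\<Sum>k. (conj_diag n U f ^\<^sub>m k) $$ (i, j) / fact k) =
      (\<Sum>l<n. U $$ (i, l) * exp (f l) * cnj (U $$ (j, l)))"
    by (rule sums_unique[symmetric])
  thus "mexp (conj_diag n U f) $$ (i, j) = conj_diag n U (\<lambda>i. exp (f i)) $$ (i, j)"
    using ij by (simp add: mexp_def conj_diag_def)
qed (auto simp: mexp_def)

lemma unitary_mexp_hermitian: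
  assumes A: "A \<in> carrier_mat n n" "hermitian A"
  shows "unitary_mat n (mexp ((- \<i> * complex_of_real s) \<cdot>\<^sub>m A))"
proof -
  obtain U d where U: "unitary_mat n U" and Ad: "A = conj_diag n U (\<lambda>i. complex_of_real (d i))"
    using hermitian_unitary_diag[OF A] by (elim exE conjE)
  show ?thesis
    unfolding Ad conj_diag_smult mexp_conj_diag[OF U]
    by (rule unitary_conj_diag[OF U]) (simp add: norm_exp_eq_Re)
qed

text \<open>The eigenvalues d of \<open>P\<close> are 1 or -1, and exp(-i \<theta> d) equals cos
  \<theta> - i d sin \<theta> for both, since cosine is even and sine is odd.\<close>

lemma mexp_involution:
  assumes P: "P \<in> carrier_mat n n" "mat_adjoint P = P" "P * P = 1\<^sub>m n"
  shows "mexp ((- \<i> * complex_of_real \<theta>) \<cdot>\<^sub>m P) =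
    complex_of_real (cos \<theta>) \<cdot>\<^sub>m 1\<^sub>m n + (- \<i> * complex_of_real (sin \<theta>)) \<cdot>\<^sub>m P"
proof -
  obtain U d where U: "unitary_mat n U" and Pd: "P = conj_diag n U (\<lambda>i. complex_of_real (d i))"
    using hermitian_unitary_diag[OF P(1) hermitianI[OF P(1,2)]] by (elim exE conjE)
  have "d i = 1 \<or> d i = -1" if "i < n" for i
  proof -
    have "conj_diag n U (\<lambda>i. complex_of_real (d i) * complex_of_real (d i)) = conj_diag n U (\<lambda>_. 1)"
      unfolding conj_diag_one[OF U] P(3)[symmetric] unfolding Pd conj_diag_mult[OF U] ..
    hence "complex_of_real (d i) * complex_of_real (d i) = 1"
      using conj_diag_form[OF U that, of "\<lambda>i. complex_of_real (d i) * complex_of_real (d i)"]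
        conj_diag_form[OF U that, of "\<lambda>_. 1"] by metis
    hence "d i * d i = 1" by (metis of_real_eq_1_iff of_real_mult)
    thus ?thesis by (simp add: square_eq_1_iff)
  qed
  hence *: "exp (- \<i> * complex_of_real \<theta> * complex_of_real (d i)) =
      complex_of_real (cos \<theta>) * 1 + - \<i> * complex_of_real (sin \<theta>) * complex_of_real (d i)" if "i < n" for i
    using that by (fastforce simp: exp_Euler cis_conv_exp[symmetric] complex_eq_iff Re_exp Im_exp)
  have "mexp ((- \<i> * complex_of_real \<theta>) \<cdot>\<^sub>m P) =
      conj_diag n U (\<lambda>i. exp (- \<i> * complex_of_real \<theta> * complex_of_real (d i)))"
    unfolding Pd conj_diag_smult mexp_conj_diag[OF U] ..
  also have "\<dots> = conj_diag n U (\<lambda>i. complex_of_real (cos \<theta>) * 1 +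
      - \<i> * complex_of_real (sin \<theta>) * complex_of_real (d i))"
    by (rule conj_diag_cong) (rule *)
  also have "\<dots> = complex_of_real (cos \<theta>) \<cdot>\<^sub>m 1\<^sub>m n + (- \<i> * complex_of_real (sin \<theta>)) \<cdot>\<^sub>m P"
    unfolding conj_diag_one[OF U, symmetric] Pd conj_diag_smult conj_diag_add ..
  finally show ?thesis .
qed

text \<open>The angle with cosine 1/sqrt(1 + y^2) has sine y/sqrt(1 + y^2); multiplying by the root
  clears both denominators. A weighted Pauli rotation thus represents two consecutive Taylor orders
  exactly.\<close>

lemma scaled_rotation:
  assumes P: "P \<in> carrier_mat n n" "mat_adjoint P = P" "P * P = 1\<^sub>m n" and y: "0 \<le> y"
  shows "complex_of_real (sqrt (1 + y\<^sup>2)) \<cdot>\<^sub>m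
      mexp ((- \<i> * complex_of_real (arccos (1 / sqrt (1 + y\<^sup>2)))) \<cdot>\<^sub>m P) =
    1\<^sub>m n + (- \<i> * complex_of_real y) \<cdot>\<^sub>m P"
proof -
  let ?c = "1 / sqrt (1 + y\<^sup>2)"
  let ?s = "sqrt (1 + y\<^sup>2)"
  have s: "1 \<le> ?s" "?s\<^sup>2 = 1 + y\<^sup>2" by auto
  have "0 \<le> ?c" by simp
  moreover have "0 < ?s" using s(1) by linarith
  hence "?c \<le> 1" using s(1) by (simp only: divide_le_eq_1_pos)
  ultimately have c: "-1 \<le> ?c" "?c \<le> 1" by linarith+
  have "sin (arccos ?c) = sqrt (1 - ?c\<^sup>2)" using c by (rule sin_arccos)
  also have "1 - ?c\<^sup>2 = (y / ?s)\<^sup>2"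
    unfolding power_divide s(2) using s by (simp add: field_simps add_nonneg_eq_0_iff)
  finally have sin: "sin (arccos ?c) = y / ?s" using y s by simp
  have cos: "cos (arccos ?c) = ?c" using c by simp
  have "?s \<noteq> 0" using s(1) by linarith
  hence cancel: "?s * (b / ?s) = b" for b by simp
  note e = cancel[of 1] cancel[of y]
  have "complex_of_real ?s \<cdot>\<^sub>m (complex_of_real ?c \<cdot>\<^sub>m 1\<^sub>m n + (- \<i> * complex_of_real (y / ?s)) \<cdot>\<^sub>m P) =
      complex_of_real (?s * ?c) \<cdot>\<^sub>m 1\<^sub>m n + (- \<i> * complex_of_real (?s * (y / ?s))) \<cdot>\<^sub>m P"
    using P(1) by (intro eq_matI) (auto simp: algebra_simps simp del: real_sqrt_eq_1_iff)
  moreover have "complex_of_real 1 \<cdot>\<^sub>m 1\<^sub>m n = 1\<^sub>m n" by (intro eq_matI) auto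
  ultimately show ?thesis
    unfolding mexp_involution[OF P] sin cos e by simp
qed

lemma smult_smult_mat: "a \<cdot>\<^sub>m (b \<cdot>\<^sub>m A) = (a * b) \<cdot>\<^sub>m (A :: complex mat)"
  by (intro eq_matI) auto

lemma smult_mult_smult:
  fixes A B :: "complex mat"
  assumes "A \<in> carrier_mat n n" "B \<in> carrier_mat n n"
  shows "(a \<cdot>\<^sub>m A) * (b \<cdot>\<^sub>m B) = (a * b) \<cdot>\<^sub>m (A * B)"
proof -
  have "(a \<cdot>\<^sub>m A) * (b \<cdot>\<^sub>m B) = a \<cdot>\<^sub>m (A * (b \<cdot>\<^sub>m B))"
    using assms by (intro mult_smult_assoc_mat[of _ n n _ n]) auto
  also have "A * (b \<cdot>\<^sub>m B) = b \<cdot>\<^sub>m (A * B)"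
    using assms by (intro mult_smult_distrib[of _ n n _ n]) auto
  finally show ?thesis by (simp add: smult_smult_mat)
qed

lemma smult_mat_Sum:
  assumes "\<And>k. k \<in> I \<Longrightarrow> f k \<in> carrier_mat n n"
  shows "c \<cdot>\<^sub>m mat_Sum n f I = mat_Sum n (\<lambda>k. c \<cdot>\<^sub>m f k) I"
proof (rule eq_matI)
  fix i j assume "i < dim_row (mat_Sum n (\<lambda>k. c \<cdot>\<^sub>m f k) I)" "j < dim_col (mat_Sum n (\<lambda>k. c \<cdot>\<^sub>m f k) I)"
  hence ij: "i < n" "j < n" by auto
  have "(\<Sum>k\<in>I. c * f k $$ (i, j)) = (\<Sum>k\<in>I. (c \<cdot>\<^sub>m f k) $$ (i, j))"
  proof (rule sum.cong)
    fix k assume "k \<in> I"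
    from carrier_matD[OF assms[OF this]] show "c * f k $$ (i, j) = (c \<cdot>\<^sub>m f k) $$ (i, j)"
      using ij by simp
  qed simp
  thus "(c \<cdot>\<^sub>m mat_Sum n f I) $$ (i, j) = mat_Sum n (\<lambda>k. c \<cdot>\<^sub>m f k) I $$ (i, j)"
    using ij by (simp add: sum_distrib_left)
qed auto

lemma pow_mat_commute:
  fixes A :: "complex mat"
  assumes A: "A \<in> carrier_mat n n"
  shows "A * A ^\<^sub>m k = A ^\<^sub>m k * A"
proof (induction k)
  case (Suc k)
  have p: "A ^\<^sub>m k \<in> carrier_mat n n" by (rule pow_carrier_mat[OF A])
  show ?case using assoc_mult_mat[OF A p A] Suc by simp
qed (use A in simp)

section \<open>Products over index lists and expansion of powers\<close>

lemma foldr_mult_carrier: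
  assumes "\<And>l. l \<in> set ls \<Longrightarrow> W l \<in> carrier_mat d d"
  shows "foldr (\<lambda>l A. W l * A) ls (1\<^sub>m d) \<in> carrier_mat d d"
  using assms by (induction ls) auto

lemma foldr_mult_unitary:
  assumes "\<And>l. l \<in> set ls \<Longrightarrow> unitary_mat d (W l)"
  shows "unitary_mat d (foldr (\<lambda>l A. W l * A) ls (1\<^sub>m d))"
  using assms by (induction ls) (auto simp: unitary_mat_one unitary_mat_mult)

lemma sum_lists_Suc:
  "(\<Sum>ls | set ls \<subseteq> A \<and> length ls = Suc k. f ls) = (\<Sum>ls | set ls \<subseteq> A \<and> length ls = k. \<Sum>l\<in>A. f (l # ls))"
proof -
  have "(\<Sum>ls | set ls \<subseteq> A \<and> length ls = Suc k. f ls) =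
      sum f ((\<lambda>(xs, n). n # xs) ` ({xs. set xs \<subseteq> A \<and> length xs = k} \<times> A))"
    by (simp only: lists_length_Suc_eq)
  also have "\<dots> = (\<Sum>(xs, n)\<in>{xs. set xs \<subseteq> A \<and> length xs = k} \<times> A. f (n # xs))"
    by (subst sum.reindex) (auto simp: inj_on_def case_prod_unfold)
  also have "\<dots> = (\<Sum>ls | set ls \<subseteq> A \<and> length ls = k. \<Sum>l\<in>A. f (l # ls))"
    by (rule sum.cartesian_product[symmetric])
  finally show ?thesis .
qed

lemma sum_prod_lists:
  fixes c :: "'i \<Rightarrow> 'a::comm_semiring_1"
  shows "(\<Sum>ls | set ls \<subseteq> A \<and> length ls = k. \<Prod>l\<leftarrow>ls. c l) = (\<Sum>l\<in>A. c l) ^ k"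
proof (induction k)
  case 0
  have "{ls. set ls \<subseteq> A \<and> length ls = 0} = {[]}" by auto
  thus ?case by simp
next
  case (Suc k)
  show ?case unfolding sum_lists_Suc
    by (simp add: sum_distrib_right[symmetric] sum_distrib_left[symmetric] Suc)
qed

text \<open>The non-commutative expansion of a power of a sum. It serves twice: for the Pauli
  strings inside a segment, and for the blocks when the segment operator is raised to the power
  r.\<close>

lemma mat_Sum_lists:
  assumes W: "\<And>l. l \<in> A \<Longrightarrow> W l \<in> carrier_mat d d"
  shows "mat_Sum d (\<lambda>ls. complex_of_real (\<Prod>l\<leftarrow>ls. c l) \<cdot>\<^sub>m foldr (\<lambda>l X. W l * X) ls (1\<^sub>m d))
      {ls. set ls \<subseteq> A \<and> length ls = k} =
    mat_Sum d (\<lambda>l. complex_of_real (c l) \<cdot>\<^sub>m W l) A ^\<^sub>m k"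
proof (induction k)
  case 0
  have "{ls. set ls \<subseteq> A \<and> length ls = 0} = {[]}" by auto
  thus ?case by (intro eq_matI) auto
next
  case (Suc k)
  let ?S = "mat_Sum d (\<lambda>l. complex_of_real (c l) \<cdot>\<^sub>m W l) A"
  let ?L = "{ls. set ls \<subseteq> A \<and> length ls = k}"
  let ?F = "\<lambda>ls. foldr (\<lambda>l X. W l * X) ls (1\<^sub>m d)"
  let ?G = "\<lambda>ls. complex_of_real (\<Prod>l\<leftarrow>ls. c l) \<cdot>\<^sub>m ?F ls"
  have F: "?F ls \<in> carrier_mat d d" if "ls \<in> ?L" for ls
    by (rule foldr_mult_carrier) (use that W in auto)
  have G: "?G ls \<in> carrier_mat d d" if "ls \<in> ?L" for ls using F[OF that] by simp
  have S: "?S \<in> carrier_mat d d" by simp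
  have "mat_Sum d ?G {ls. set ls \<subseteq> A \<and> length ls = Suc k} = mat_Sum d (\<lambda>ls. mat_Sum d (\<lambda>l. ?G (l # ls)) A) ?L"
    by (intro eq_matI) (simp_all add: sum_lists_Suc)
  also have "\<dots> = mat_Sum d (\<lambda>ls. ?S * ?G ls) ?L"
  proof (rule mat_Sum_cong)
    fix ls assume ls: "ls \<in> ?L"
    have "?S * ?G ls = mat_Sum d (\<lambda>l. (complex_of_real (c l) \<cdot>\<^sub>m W l) * ?G ls) A"
      by (rule mat_Sum_mult[OF G[OF ls]]) (simp add: W)
    also have "\<dots> = mat_Sum d (\<lambda>l. ?G (l # ls)) A"
      by (rule mat_Sum_cong) (simp add: smult_mult_smult[OF W F[OF ls]])
    finally show "mat_Sum d (\<lambda>l. ?G (l # ls)) A = ?S * ?G ls" by (rule sym)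
  qed
  also have "\<dots> = ?S * mat_Sum d ?G ?L"
    by (rule mult_mat_Sum[symmetric, OF S G])
  \<comment> \<open>Lists grow at the front while matrix powers grow at the back, so
    \<open>?S\<close> is moved past its own power.\<close>
  also have "\<dots> = ?S ^\<^sub>m Suc k"
    unfolding Suc using pow_mat_commute[OF S] by simp
  finally show ?case .
qed

section \<open>Convex combinations of signed Pauli strings\<close>

lemma convex_on_qubitsD:
  assumes "convex_on_qubits n ps"
  shows "l < length ps \<Longrightarrow> 0 \<le> fst (ps ! l)"
    "l < length ps \<Longrightarrow> length (snd (snd (ps ! l))) = n"
    "(\<Sum>l<length ps. fst (ps ! l)) = 1"
proof -
  have *: "0 \<le> p \<and> length P = n" if "(p, s, P) \<in> set ps" for p s P
    using assms that by (auto simp: convex_on_qubits_def)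
  show "l < length ps \<Longrightarrow> 0 \<le> fst (ps ! l)" "l < length ps \<Longrightarrow> length (snd (snd (ps ! l))) = n"
    using *[of "fst (ps ! l)" "fst (snd (ps ! l))" "snd (snd (ps ! l))"] by auto
  have "(\<Sum>(p, s, P)\<leftarrow>ps. p) = (\<Sum>l<length ps. fst (ps ! l))"
    by (simp add: sum_list_sum_nth case_prod_unfold atLeast0LessThan)
  thus "(\<Sum>l<length ps. fst (ps ! l)) = 1"
    using assms by (simp add: convex_on_qubits_def)
qed

lemma convex_pauli:
  assumes "convex_on_qubits n ps" "l < length ps"
  shows "signed_pauli (snd (ps ! l)) \<in> carrier_mat (2 ^ n) (2 ^ n)"
    "mat_adjoint (signed_pauli (snd (ps ! l))) = signed_pauli (snd (ps ! l))"
    "signed_pauli (snd (ps ! l)) * signed_pauli (snd (ps ! l)) = 1\<^sub>m (2 ^ n)"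
    "unitary_mat (2 ^ n) (signed_pauli (snd (ps ! l)))"
proof -
  note sp = signed_pauli[OF convex_on_qubitsD(2)[OF assms], of "fst (snd (ps ! l))", simplified]
  show "signed_pauli (snd (ps ! l)) \<in> carrier_mat (2 ^ n) (2 ^ n)"
    "mat_adjoint (signed_pauli (snd (ps ! l))) = signed_pauli (snd (ps ! l))"
    "signed_pauli (snd (ps ! l)) * signed_pauli (snd (ps ! l)) = 1\<^sub>m (2 ^ n)"
    by (rule sp)+
  show "unitary_mat (2 ^ n) (signed_pauli (snd (ps ! l)))"
    by (rule unitary_matI[OF sp(1)]) (simp only: sp)
qed

lemma opbound_mat_Sum:
  assumes "finite I" "\<And>k. k \<in> I \<Longrightarrow> f k \<in> carrier_mat n n \<and> opbound (f k) (a k)"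
  shows "opbound (mat_Sum n f I) (\<Sum>k\<in>I. a k)"
  using assms
proof (induction I)
  case empty
  have "mat_Sum n f {} = 0\<^sub>m n n" by (intro eq_matI) auto
  thus ?case by (simp add: opbound_zero)
next
  case (insert x I)
  have f: "f x \<in> carrier_mat n n" using insert by simp
  have "mat_Sum n f (insert x I) = f x + mat_Sum n f I"
    using f insert by (intro eq_matI) auto
  moreover have "opbound (f x + mat_Sum n f I) (a x + (\<Sum>k\<in>I. a k))"
    using insert by (intro opbound_add[of _ _ _ _ n n]) auto
  ultimately show ?case using insert by simp
qed

text \<open>A convex combination of unitaries has operator norm at most 1, which confines the real
  eigenvalues to [-1, 1]. The Taylor remainder is later estimated on this interval.\<close>

lemma convex_sum_diag:
  assumes ps: "convex_on_qubits n ps"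
  shows "\<exists>U h. unitary_mat (2 ^ n) U \<and> convex_sum n ps = conj_diag (2 ^ n) U (\<lambda>i. complex_of_real (h i)) \<and>
    (\<forall>i<2 ^ n. \<bar>h i\<bar> \<le> 1)"
proof -
  let ?H = "convex_sum n ps"
  have H: "?H \<in> carrier_mat (2 ^ n) (2 ^ n)" by (simp add: convex_sum_def)
  have "mat_adjoint ?H = ?H"
    unfolding convex_sum_def
    by (subst mat_adjoint_mat_Sum) (auto simp: convex_pauli[OF ps] intro: mat_Sum_cong)
  then obtain U h where U: "unitary_mat (2 ^ n) U" and h: "?H = conj_diag (2 ^ n) U (\<lambda>i. complex_of_real (h i))"
    using hermitian_unitary_diag[OF H hermitianI[OF H]] by metis
  have "opbound ?H (\<Sum>l<length ps. fst (ps ! l))"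
    unfolding convex_sum_def
  proof (rule opbound_mat_Sum, simp, intro conjI)
    fix l assume "l \<in> {..<length ps}"
    hence l: "l < length ps" by simp
    show "complex_of_real (fst (ps ! l)) \<cdot>\<^sub>m signed_pauli (snd (ps ! l)) \<in> carrier_mat (2 ^ n) (2 ^ n)"
      using convex_pauli(1)[OF ps l] by simp
    show "opbound (complex_of_real (fst (ps ! l)) \<cdot>\<^sub>m signed_pauli (snd (ps ! l))) (fst (ps ! l))"
      using opbound_smult[OF opbound_unitary[OF convex_pauli(4)[OF ps l]] convex_pauli(1)[OF ps l],
        of "complex_of_real (fst (ps ! l))"] convex_on_qubitsD(1)[OF ps l] by simp
  qed
  hence b: "opbound ?H 1" by (simp add: convex_on_qubitsD(3)[OF ps])
  have "\<bar>h i\<bar> \<le> 1" if i: "i < 2 ^ n" for i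
  proof -
    have u: "col U i \<in> carrier_vec (2 ^ n)" using unitary_matD(1)[OF U] by simp
    have "?H *\<^sub>v col U i = complex_of_real (h i) \<cdot>\<^sub>v col U i"
      unfolding h by (rule conj_diag_mult_col[OF U i])
    thus ?thesis using opboundD[OF b H u] vnorm_unitary_col[OF U i] by simp
  qed
  with U h show ?thesis by (intro exI conjI allI impI)
qed

section \<open>The segment operator as a Taylor polynomial\<close>

lemma block_index_finite: "finite (block_index q ps)"
proof -
  have "finite ({ls. set ls \<subseteq> {..<length ps} \<and> length ls \<le> q} \<times> {..<length ps})"
    by (intro finite_cartesian_product finite_lists_length_le) auto
  moreover have "block_index q ps \<subseteq> {ls. set ls \<subseteq> {..<length ps} \<and> length ls \<le> q} \<times> {..<length ps}"
    by (auto simp: block_index_def)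
  ultimately show ?thesis by (rule rev_finite_subset)
qed

lemma sum_block_index:
  fixes f :: "block \<Rightarrow> 'a::comm_monoid_add"
  shows "(\<Sum>b\<in>block_index (2 * p) ps. f b) =
    (\<Sum>j\<le>p. \<Sum>ls | set ls \<subseteq> {..<length ps} \<and> length ls = 2 * j. \<Sum>s<length ps. f (ls, s))"
proof -
  let ?L = "\<lambda>j. {ls. set ls \<subseteq> {..<length ps} \<and> length ls = 2 * j}"
  have "block_index (2 * p) ps = (\<Union>j\<in>{..p}. ?L j) \<times> {..<length ps}"
    by (auto simp: block_index_def elim!: evenE)
  hence "(\<Sum>b\<in>block_index (2 * p) ps. f b) = (\<Sum>ls\<in>(\<Union>j\<in>{..p}. ?L j). \<Sum>s<length ps. f (ls, s))"
    by (simp add: sum.cartesian_product)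
  also have "\<dots> = (\<Sum>j\<le>p. \<Sum>ls\<in>?L j. \<Sum>s<length ps. f (ls, s))"
    by (rule sum.UNION_disjoint) (auto intro: finite_lists_length_eq)
  finally show ?thesis .
qed

text \<open>The rotation angle depends on the length k of \<open>ls\<close> alone, so by
  \<open>scaled_rotation\<close> the root in the coefficient and the rotation combine into 1 - i
  (x/(k+1)) P_s. Up to a scalar depending on k, the summand becomes a factor for \<open>ls\<close>
  times a factor for \<open>s\<close>, and the two sums can be carried out separately.\<close>

lemma block_term:
  assumes ps: "convex_on_qubits n ps" and x: "0 \<le> x"
    and ls: "set ls \<subseteq> {..<length ps}" and s: "s < length ps"
  shows "complex_of_real (block_coeff ps x (ls, s)) \<cdot>\<^sub>m block_unitary (2 ^ n) ps x (ls, s) =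
    (complex_of_real (x ^ length ls / fact (length ls)) * (- \<i>) ^ length ls) \<cdot>\<^sub>m
    ((complex_of_real (\<Prod>l\<leftarrow>ls. fst (ps ! l)) \<cdot>\<^sub>m foldr (\<lambda>l A. signed_pauli (snd (ps ! l)) * A) ls (1\<^sub>m (2 ^ n))) *
     (complex_of_real (fst (ps ! s)) \<cdot>\<^sub>m (1\<^sub>m (2 ^ n) +
       (- \<i> * complex_of_real (x / (real (length ls) + 1))) \<cdot>\<^sub>m signed_pauli (snd (ps ! s)))))"
proof -
  let ?k = "length ls" let ?d = "2 ^ n :: nat"
  let ?y = "x / (real ?k + 1)"
  let ?F = "foldr (\<lambda>l A. signed_pauli (snd (ps ! l)) * A) ls (1\<^sub>m ?d)"
  let ?P = "signed_pauli (snd (ps ! s))"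
  let ?R = "mexp ((- \<i> * complex_of_real (arccos (1 / sqrt (1 + ?y\<^sup>2)))) \<cdot>\<^sub>m ?P)"
  let ?a = "complex_of_real (x ^ ?k / fact ?k)" let ?r = "complex_of_real (sqrt (1 + ?y\<^sup>2))"
  let ?b = "complex_of_real (\<Prod>l\<leftarrow>ls. fst (ps ! l))" let ?c = "complex_of_real (fst (ps ! s))"
  note P = convex_pauli[OF ps s]
  have F: "?F \<in> carrier_mat ?d ?d" using ls by (intro foldr_mult_carrier convex_pauli(1)[OF ps]) auto
  have R: "?R \<in> carrier_mat ?d ?d" by (intro mexp_carrier smult_carrier_mat P)
  have y: "0 \<le> ?y" using x by simp
  have "complex_of_real (block_coeff ps x (ls, s)) = ?a * ?r * ?b * ?c" by simp
  moreover have "block_unitary ?d ps x (ls, s) = ((- \<i>) ^ ?k \<cdot>\<^sub>m ?F) * (1 \<cdot>\<^sub>m ?R)"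
  proof -
    have "1 \<cdot>\<^sub>m ?R = ?R" by (intro eq_matI) auto
    thus ?thesis by (simp only: block_unitary.simps block_angle_def)
  qed
  ultimately have "complex_of_real (block_coeff ps x (ls, s)) \<cdot>\<^sub>m block_unitary ?d ps x (ls, s) =
      (?a * ?r * ?b * ?c * ((- \<i>) ^ ?k * 1)) \<cdot>\<^sub>m (?F * ?R)"
    by (simp only: smult_mult_smult[OF F R] smult_smult_mat)
  also have "\<dots> = (?a * (- \<i>) ^ ?k * (?b * (?c * ?r))) \<cdot>\<^sub>m (?F * ?R)" by (simp only: mult_ac mult_1_right mult_1_left)
  also have "\<dots> = (?a * (- \<i>) ^ ?k) \<cdot>\<^sub>m ((?b \<cdot>\<^sub>m ?F) * ((?c * ?r) \<cdot>\<^sub>m ?R))"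
    by (simp only: smult_mult_smult[OF F R] smult_smult_mat)
  also have "(?c * ?r) \<cdot>\<^sub>m ?R = ?c \<cdot>\<^sub>m (?r \<cdot>\<^sub>m ?R)" by (simp only: smult_smult_mat)
  also have "?r \<cdot>\<^sub>m ?R = 1\<^sub>m ?d + (- \<i> * complex_of_real ?y) \<cdot>\<^sub>m ?P"
    by (rule scaled_rotation[OF P(1-3) y])
  finally show ?thesis .
qed

lemma taylor_pair:
  fixes z :: complex
  shows "z ^ m / fact m * (1 + z / (of_nat m + 1)) = z ^ m / fact m + z ^ Suc m / fact (Suc m)"
proof -
  have f: "fact (Suc m) = fact m * (of_nat m + 1 :: complex)" by (simp add: algebra_simps)
  show ?thesis unfolding f by (simp only: distrib_left mult_1_right times_divide_times_eq power_Suc2)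
qed

text \<open>Each even order 2j brings the order 2j + 1 with it, which is why truncation at 2p yields
  the Taylor polynomial of degree 2p + 1.\<close>

lemma pairs_taylor:
  fixes z :: complex
  shows "(\<Sum>j\<le>p. z ^ (2 * j) / fact (2 * j) * (1 + z / (of_nat (2 * j) + 1))) = (\<Sum>k\<le>2 * p + 1. z ^ k / fact k)"
proof (induction p)
  case (Suc p)
  have e: "2 * Suc p + 1 = Suc (Suc (2 * p + 1))" "2 * Suc p = Suc (2 * p + 1)" by simp_all
  have "(\<Sum>j\<le>Suc p. z ^ (2 * j) / fact (2 * j) * (1 + z / (of_nat (2 * j) + 1))) =
      (\<Sum>k\<le>2 * p + 1. z ^ k / fact k) + (z ^ (2 * Suc p) / fact (2 * Suc p) +
        z ^ Suc (2 * Suc p) / fact (Suc (2 * Suc p)))"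
    by (simp only: sum.atMost_Suc Suc.IH taylor_pair[of z "2 * Suc p"])
  moreover have "(\<Sum>k\<le>2 * Suc p + 1. z ^ k / fact k) = (\<Sum>k\<le>2 * p + 1. z ^ k / fact k) +
      (z ^ Suc (2 * p + 1) / fact (Suc (2 * p + 1)) + z ^ Suc (Suc (2 * p + 1)) / fact (Suc (Suc (2 * p + 1))))"
    by (simp only: e(1) sum.atMost_Suc add.assoc)
  ultimately show ?case by (simp only: e(2))
qed simp

text \<open>Summing over \<open>s\<close> gives 1 - i y H because the weights add up to 1; summing
  over lists of length 2j gives H^(2j). All factors are functions of one matrix H, so the operator
  acts on each eigenvalue as the scalar Taylor polynomial.\<close>

lemma segment_op_conj_diag:
  assumes ps: "convex_on_qubits n ps" and x: "0 \<le> x" and U: "unitary_mat (2 ^ n) U"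
    and h: "convex_sum n ps = conj_diag (2 ^ n) U h"
  shows "segment_op (2 ^ n) ps (2 * p) x =
    conj_diag (2 ^ n) U (\<lambda>i. \<Sum>k\<le>2 * p + 1. (- \<i> * complex_of_real x * h i) ^ k / fact k)"
proof -
  let ?d = "2 ^ n :: nat" let ?H = "convex_sum n ps"
  let ?L = "\<lambda>j. {ls. set ls \<subseteq> {..<length ps} \<and> length ls = 2 * j}"
  let ?P = "\<lambda>l. signed_pauli (snd (ps ! l))" let ?p = "\<lambda>l. fst (ps ! l)"
  let ?X = "\<lambda>ls. complex_of_real (\<Prod>l\<leftarrow>ls. ?p l) \<cdot>\<^sub>m foldr (\<lambda>l A. ?P l * A) ls (1\<^sub>m ?d)"
  let ?Y = "\<lambda>y s. complex_of_real (?p s) \<cdot>\<^sub>m (1\<^sub>m ?d + (- \<i> * complex_of_real y) \<cdot>\<^sub>m ?P s)"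
  let ?c = "\<lambda>k. complex_of_real (x ^ k / fact k) * (- \<i>) ^ k"
  let ?y = "\<lambda>j. x / (real (2 * j) + 1)"
  have P: "?P l \<in> carrier_mat ?d ?d" if "l < length ps" for l by (rule convex_pauli(1)[OF ps that])
  have X: "?X ls \<in> carrier_mat ?d ?d" if "ls \<in> ?L j" for ls j
    using that P by (intro smult_carrier_mat foldr_mult_carrier) auto
  have Y: "?Y y s \<in> carrier_mat ?d ?d" if "s < length ps" for y s using P[OF that] by simp
  have Ysum: "mat_Sum ?d (?Y y) {..<length ps} = conj_diag ?d U (\<lambda>i. 1 + (- \<i> * complex_of_real y) * h i)" for y
  proof -
    have "mat_Sum ?d (?Y y) {..<length ps} = 1\<^sub>m ?d + (- \<i> * complex_of_real y) \<cdot>\<^sub>m ?H"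
    proof (rule eq_matI)
      fix i j assume "i < dim_row (1\<^sub>m ?d + (- \<i> * complex_of_real y) \<cdot>\<^sub>m ?H)"
        "j < dim_col (1\<^sub>m ?d + (- \<i> * complex_of_real y) \<cdot>\<^sub>m ?H)"
      hence ij: "i < ?d" "j < ?d" by (auto simp: convex_sum_def)
      have "(\<Sum>s<length ps. ?Y y s $$ (i, j)) = (\<Sum>s<length ps. complex_of_real (?p s) * 1\<^sub>m ?d $$ (i, j) +
          (- \<i> * complex_of_real y) * (complex_of_real (?p s) \<cdot>\<^sub>m ?P s) $$ (i, j))"
      proof (intro sum.cong refl)
        fix s assume "s \<in> {..<length ps}"
        hence "?P s \<in> carrier_mat ?d ?d" using P by simp
        thus "?Y y s $$ (i, j) = complex_of_real (?p s) * 1\<^sub>m ?d $$ (i, j) +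
          (- \<i> * complex_of_real y) * (complex_of_real (?p s) \<cdot>\<^sub>m ?P s) $$ (i, j)"
          using ij by (simp add: algebra_simps)
      qed
      also have "\<dots> = complex_of_real (\<Sum>s<length ps. ?p s) * 1\<^sub>m ?d $$ (i, j) +
          (- \<i> * complex_of_real y) * ?H $$ (i, j)"
        unfolding sum.distrib sum_distrib_left[symmetric] sum_distrib_right[symmetric] of_real_sum
        using ij by (simp add: convex_sum_def)
      also have "\<dots> = 1\<^sub>m ?d $$ (i, j) + (- \<i> * complex_of_real y) * ?H $$ (i, j)"
        unfolding convex_on_qubitsD(3)[OF ps] by simp
      finally show "mat_Sum ?d (?Y y) {..<length ps} $$ (i, j) =
          (1\<^sub>m ?d + (- \<i> * complex_of_real y) \<cdot>\<^sub>m ?H) $$ (i, j)"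
        using ij by (simp add: convex_sum_def del: index_one_mat)
    qed (auto simp: convex_sum_def)
    thus ?thesis unfolding conj_diag_one[OF U, symmetric] h conj_diag_smult conj_diag_add .
  qed
  have Xsum: "mat_Sum ?d ?X (?L j) = conj_diag ?d U (\<lambda>i. h i ^ (2 * j))" for j
  proof -
    have "mat_Sum ?d ?X (?L j) = ?H ^\<^sub>m (2 * j)"
      using mat_Sum_lists[of "{..<length ps}" ?P ?d ?p "2 * j"] P by (simp add: convex_sum_def)
    thus ?thesis by (simp only: h conj_diag_pow[OF U])
  qed
  have "segment_op ?d ps (2 * p) x = mat_Sum ?d (\<lambda>j. mat_Sum ?d (\<lambda>ls. mat_Sum ?d (\<lambda>s.
      complex_of_real (block_coeff ps x (ls, s)) \<cdot>\<^sub>m block_unitary ?d ps x (ls, s)) {..<length ps}) (?L j)) {..p}"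
    unfolding segment_op_def by (intro eq_matI) (simp_all add: sum_block_index)
  also have "\<dots> = mat_Sum ?d (\<lambda>j. ?c (2 * j) \<cdot>\<^sub>m
      (conj_diag ?d U (\<lambda>i. h i ^ (2 * j)) * conj_diag ?d U (\<lambda>i. 1 + (- \<i> * complex_of_real (?y j)) * h i))) {..p}"
  proof (rule mat_Sum_cong)
    fix j assume "j \<in> {..p}"
    have "mat_Sum ?d (\<lambda>ls. mat_Sum ?d (\<lambda>s.
        complex_of_real (block_coeff ps x (ls, s)) \<cdot>\<^sub>m block_unitary ?d ps x (ls, s)) {..<length ps}) (?L j) =
      mat_Sum ?d (\<lambda>ls. mat_Sum ?d (\<lambda>s. ?c (2 * j) \<cdot>\<^sub>m (?X ls * ?Y (?y j) s)) {..<length ps}) (?L j)"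
    proof (intro mat_Sum_cong)
      fix ls s assume "ls \<in> ?L j" "s \<in> {..<length ps}"
      thus "complex_of_real (block_coeff ps x (ls, s)) \<cdot>\<^sub>m block_unitary ?d ps x (ls, s) =
          ?c (2 * j) \<cdot>\<^sub>m (?X ls * ?Y (?y j) s)"
        using block_term[OF ps x, of ls s] by auto
    qed
    also have "\<dots> = mat_Sum ?d (\<lambda>ls. ?c (2 * j) \<cdot>\<^sub>m (?X ls * mat_Sum ?d (?Y (?y j)) {..<length ps})) (?L j)"
    proof (rule mat_Sum_cong)
      fix ls assume ls: "ls \<in> ?L j"
      have "?X ls * mat_Sum ?d (?Y (?y j)) {..<length ps} = mat_Sum ?d (\<lambda>s. ?X ls * ?Y (?y j) s) {..<length ps}"
        using Y by (intro mult_mat_Sum[OF X[OF ls]]) blast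
      moreover have "?c (2 * j) \<cdot>\<^sub>m \<dots> = mat_Sum ?d (\<lambda>s. ?c (2 * j) \<cdot>\<^sub>m (?X ls * ?Y (?y j) s)) {..<length ps}"
        using X[OF ls] Y by (intro smult_mat_Sum mult_square_mat_carrier) blast+
      ultimately show "mat_Sum ?d (\<lambda>s. ?c (2 * j) \<cdot>\<^sub>m (?X ls * ?Y (?y j) s)) {..<length ps} =
          ?c (2 * j) \<cdot>\<^sub>m (?X ls * mat_Sum ?d (?Y (?y j)) {..<length ps})" by (simp only:)
    qed
    also have "\<dots> = ?c (2 * j) \<cdot>\<^sub>m (mat_Sum ?d ?X (?L j) * mat_Sum ?d (?Y (?y j)) {..<length ps})"
    proof -
      have V: "mat_Sum ?d (?Y (?y j)) {..<length ps} \<in> carrier_mat ?d ?d" by simp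
      have "mat_Sum ?d ?X (?L j) * mat_Sum ?d (?Y (?y j)) {..<length ps} =
          mat_Sum ?d (\<lambda>ls. ?X ls * mat_Sum ?d (?Y (?y j)) {..<length ps}) (?L j)"
        using X by (intro mat_Sum_mult[OF V]) blast
      moreover have "?c (2 * j) \<cdot>\<^sub>m \<dots> = mat_Sum ?d (\<lambda>ls. ?c (2 * j) \<cdot>\<^sub>m (?X ls * mat_Sum ?d (?Y (?y j)) {..<length ps})) (?L j)"
        using X V by (intro smult_mat_Sum mult_square_mat_carrier) blast+
      ultimately show ?thesis by (simp only:)
    qed
    finally show "mat_Sum ?d (\<lambda>ls. mat_Sum ?d (\<lambda>s.
        complex_of_real (block_coeff ps x (ls, s)) \<cdot>\<^sub>m block_unitary ?d ps x (ls, s)) {..<length ps}) (?L j) =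
      ?c (2 * j) \<cdot>\<^sub>m (conj_diag ?d U (\<lambda>i. h i ^ (2 * j)) * conj_diag ?d U (\<lambda>i. 1 + (- \<i> * complex_of_real (?y j)) * h i))"
      unfolding Xsum Ysum .
  qed
  also have "\<dots> = conj_diag ?d U (\<lambda>i. \<Sum>j\<le>p. ?c (2 * j) * (h i ^ (2 * j) * (1 + (- \<i> * complex_of_real (?y j)) * h i)))"
    unfolding conj_diag_mult[OF U] conj_diag_smult conj_diag_mat_Sum ..
  also have "\<dots> = conj_diag ?d U (\<lambda>i. \<Sum>k\<le>2 * p + 1. (- \<i> * complex_of_real x * h i) ^ k / fact k)"
  proof (rule conj_diag_cong)
    fix i
    let ?z = "- \<i> * complex_of_real x * h i"
    have "?c (2 * j) * (h i ^ (2 * j) * (1 + (- \<i> * complex_of_real (?y j)) * h i)) =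
        ?z ^ (2 * j) / fact (2 * j) * (1 + ?z / (of_nat (2 * j) + 1))" for j
    proof -
      have w: "(- \<i> * complex_of_real (?y j)) * h i = ?z / (of_nat (2 * j) + 1)" by simp
      have "?z ^ k = (- \<i>) ^ k * complex_of_real x ^ k * h i ^ k" for k
        by (simp only: power_mult_distrib)
      thus ?thesis unfolding w by (simp only: of_real_divide of_real_mult of_real_inverse of_real_power of_real_fact divide_inverse mult_ac)
    qed
    thus "(\<Sum>j\<le>p. ?c (2 * j) * (h i ^ (2 * j) * (1 + (- \<i> * complex_of_real (?y j)) * h i))) =
        (\<Sum>k\<le>2 * p + 1. ?z ^ k / fact k)"
      unfolding pairs_taylor[symmetric] by (intro sum.cong refl)
  qed
  finally show ?thesis .
qed

text \<open>Telescoping with a^(r+1) - w^(r+1) = a (a^r - w^r) + (a - w) w^r. The truncated value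
  \<open>a\<close> may lie outside the unit circle, so only 1 + \<kappa> is available as a bound for
  its modulus.\<close>

lemma power_diff_bound:
  fixes a w :: complex
  assumes "cmod w = 1" "cmod (a - w) \<le> \<kappa>"
  shows "cmod (a ^ r - w ^ r) \<le> (1 + \<kappa>) ^ r - 1"
proof (induction r)
  case (Suc r)
  have a: "cmod a \<le> 1 + \<kappa>" using norm_triangle_ineq[of w "a - w"] assms by simp
  have k: "0 \<le> \<kappa>" using assms(2) norm_ge_zero order_trans by blast
  have "a ^ Suc r - w ^ Suc r = a * (a ^ r - w ^ r) + (a - w) * w ^ r" by (simp add: algebra_simps)
  also have "cmod \<dots> \<le> cmod a * cmod (a ^ r - w ^ r) + cmod (a - w) * cmod (w ^ r)"
    by (metis norm_mult norm_triangle_ineq)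
  also have "\<dots> \<le> (1 + \<kappa>) * ((1 + \<kappa>) ^ r - 1) + \<kappa> * 1"
    using a Suc assms k by (intro add_mono mult_mono) (auto simp: norm_power)
  also have "\<dots> = (1 + \<kappa>) ^ Suc r - 1" by (simp add: algebra_simps)
  finally show ?case .
qed simp

text \<open>From 1 + s <= e^s, and e^s <= 1 + s + s^2 for 0 <= s <= 1. It linearizes the compound
  error twice, over the segments of one collision and over the collisions of a run, each time at the
  cost of a factor 2.\<close>

lemma one_plus_power_le:
  fixes \<kappa> :: real
  assumes "0 \<le> \<kappa>" "real r * \<kappa> \<le> 1"
  shows "(1 + \<kappa>) ^ r - 1 \<le> 2 * (real r * \<kappa>)"
proof -
  have "(1 + \<kappa>) ^ r \<le> exp \<kappa> ^ r" using assms by (intro power_mono exp_ge_add_one_self) auto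
  also have "\<dots> = exp (real r * \<kappa>)" by (simp add: exp_of_nat_mult)
  also have "\<dots> \<le> 1 + real r * \<kappa> + (real r * \<kappa>)\<^sup>2" using assms by (intro exp_bound) auto
  also have "(real r * \<kappa>)\<^sup>2 \<le> real r * \<kappa> * 1"
    unfolding power2_eq_square using assms by (intro mult_left_mono) auto
  finally show ?thesis by linarith
qed

text \<open>On the spectrum z = -i x h is purely imaginary with modulus at most 1. The remainder
  after degree 2p + 1 is then at most 1/(2p+1)!, and since e^z has modulus 1,
  \<open>power_diff_bound\<close> handles the r-th power.\<close>

lemma segment_power_error:
  assumes ps: "convex_on_qubits n ps" and x: "0 \<le> x" "x \<le> 1"
  shows "opbound (segment_op (2 ^ n) ps (2 * p) x ^\<^sub>m r -
      mexp ((- \<i> * complex_of_real (real r * x)) \<cdot>\<^sub>m convex_sum n ps)) ((1 + 1 / fact (2 * p + 1)) ^ r - 1)"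
proof -
  let ?d = "2 ^ n :: nat"
  obtain U h where U: "unitary_mat ?d U" and h: "convex_sum n ps = conj_diag ?d U (\<lambda>i. complex_of_real (h i))"
    and h1: "\<And>i. i < ?d \<Longrightarrow> \<bar>h i\<bar> \<le> 1"
    using convex_sum_diag[OF ps] by metis
  define z where "z = (\<lambda>i. - \<i> * complex_of_real x * complex_of_real (h i))"
  define T where "T = (\<lambda>z::complex. \<Sum>k\<le>2 * p + 1. z ^ k / fact k)"
  have seg: "segment_op ?d ps (2 * p) x ^\<^sub>m r = conj_diag ?d U (\<lambda>i. T (z i) ^ r)"
    unfolding segment_op_conj_diag[OF ps x(1) U h] conj_diag_pow[OF U] T_def z_def ..
  have "mexp ((- \<i> * complex_of_real (real r * x)) \<cdot>\<^sub>m convex_sum n ps) =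
      conj_diag ?d U (\<lambda>i. exp (- \<i> * complex_of_real (real r * x) * complex_of_real (h i)))"
    unfolding h conj_diag_smult mexp_conj_diag[OF U] ..
  also have "\<dots> = conj_diag ?d U (\<lambda>i. exp (z i) ^ r)"
    by (rule conj_diag_cong) (simp add: z_def exp_of_nat_mult[symmetric] mult_ac)
  finally have ex: "mexp ((- \<i> * complex_of_real (real r * x)) \<cdot>\<^sub>m convex_sum n ps) =
      conj_diag ?d U (\<lambda>i. exp (z i) ^ r)" .
  show ?thesis
    unfolding seg ex conj_diag_minus
  proof (rule opbound_conj_diag[OF U])
    fix i assume i: "i < ?d"
    have zn: "cmod (z i) \<le> 1" "Re (z i) = 0"
      using h1[OF i] x by (auto simp: z_def norm_mult abs_mult mult_le_one)
    have "cmod (exp (z i) - (\<Sum>k\<le>2 * p + 1. z i ^ k / fact k)) \<le>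
        exp \<bar>Re (z i)\<bar> * (cmod (z i) ^ Suc (2 * p + 1)) / fact (2 * p + 1)"
      by (rule Taylor_exp)
    also have "\<dots> \<le> 1 / fact (2 * p + 1)"
    proof (rule divide_right_mono)
      have "cmod (z i) ^ Suc (2 * p + 1) \<le> 1" using zn by (intro power_le_one) auto
      thus "exp \<bar>Re (z i)\<bar> * cmod (z i) ^ Suc (2 * p + 1) \<le> 1"
        unfolding zn(2) by (simp only: abs_zero exp_zero mult_1_left)
    qed simp
    finally have "cmod (T (z i) - exp (z i)) \<le> 1 / fact (2 * p + 1)"
      by (simp only: T_def norm_minus_commute)
    moreover have "cmod (exp (z i)) = 1" using zn by (simp add: norm_exp_eq_Re)
    ultimately show "cmod (T (z i) ^ r - exp (z i) ^ r) \<le> (1 + 1 / fact (2 * p + 1)) ^ r - 1"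
      by (intro power_diff_bound)
  qed (simp add: one_le_power)
qed

section \<open>Weights and sampling distribution of the expansion\<close>

lemma block_coeff_nonneg:
  assumes ps: "convex_on_qubits n ps" and x: "0 \<le> x" and b: "b \<in> block_index q ps"
  shows "0 \<le> block_coeff ps x b"
proof -
  obtain ls s where b': "b = (ls, s)" "set ls \<subseteq> {..<length ps}" "s < length ps"
    using b by (auto simp: block_index_def)
  have "0 \<le> (\<Prod>l\<leftarrow>ls. fst (ps ! l))"
    using b'(2) by (induction ls) (auto intro!: mult_nonneg_nonneg convex_on_qubitsD(1)[OF ps])
  thus ?thesis unfolding b' using x convex_on_qubitsD(1)[OF ps b'(3)] by simp
qed

text \<open>The convex weights sum out, so the total coefficient of a segment does not depend on the
  number of Pauli terms.\<close>

lemma sum_block_coeff: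
  assumes ps: "convex_on_qubits n ps"
  shows "(\<Sum>b\<in>block_index (2 * p) ps. block_coeff ps x b) =
    (\<Sum>j\<le>p. x ^ (2 * j) / fact (2 * j) * sqrt (1 + (x / (real (2 * j) + 1))\<^sup>2))"
proof -
  let ?L = "\<lambda>j. {ls. set ls \<subseteq> {..<length ps} \<and> length ls = 2 * j}"
  have "(\<Sum>ls\<in>?L j. \<Sum>s<length ps. block_coeff ps x (ls, s)) =
      x ^ (2 * j) / fact (2 * j) * sqrt (1 + (x / (real (2 * j) + 1))\<^sup>2)" for j
  proof -
    have "(\<Sum>ls\<in>?L j. \<Sum>s<length ps. block_coeff ps x (ls, s)) =
        (\<Sum>ls\<in>?L j. \<Sum>s<length ps. x ^ (2 * j) / fact (2 * j) * sqrt (1 + (x / (real (2 * j) + 1))\<^sup>2) *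
          ((\<Prod>l\<leftarrow>ls. fst (ps ! l)) * fst (ps ! s)))"
      by (intro sum.cong refl) auto
    also have "\<dots> = x ^ (2 * j) / fact (2 * j) * sqrt (1 + (x / (real (2 * j) + 1))\<^sup>2) *
        ((\<Sum>ls\<in>?L j. \<Prod>l\<leftarrow>ls. fst (ps ! l)) * (\<Sum>s<length ps. fst (ps ! s)))"
      unfolding sum_product by (simp only: sum_distrib_left)
    finally show ?thesis unfolding sum_prod_lists convex_on_qubitsD(3)[OF ps] by simp
  qed
  thus ?thesis unfolding sum_block_index by simp
qed

lemma fact_double_ge: "2 ^ j * fact j \<le> (fact (2 * j) :: real)"
proof (induction j)
  case (Suc j)
  have "2 ^ Suc j * fact (Suc j) = (2 * (real j + 1)) * (2 ^ j * fact j)" by (simp add: algebra_simps)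
  also have "\<dots> \<le> (2 * (real j + 1)) * fact (2 * j)" using Suc by (intro mult_left_mono) auto
  also have "\<dots> \<le> (2 * (real j + 1)) * (2 * real j + 1) * fact (2 * j)" by (intro mult_right_mono) auto
  also have "\<dots> = fact (2 * Suc j)" by (simp add: algebra_simps)
  finally show ?case .
qed simp

text \<open>The lower bound is the term j = 0. For the upper bound, (2j)! >= 2^j j! compares the
  powers with the series of exp(x^2/2), and each root is at most exp(x^2/2). That the exponent is
  quadratic in x is what lets many short segments keep the total weight bounded.\<close>

lemma sum_block_coeff_bounds:
  assumes ps: "convex_on_qubits n ps" and x: "0 \<le> x"
  shows "1 \<le> (\<Sum>b\<in>block_index (2 * p) ps. block_coeff ps x b)"
    "(\<Sum>b\<in>block_index (2 * p) ps. block_coeff ps x b) \<le> exp (x\<^sup>2)"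
proof -
  let ?f = "\<lambda>j. x ^ (2 * j) / fact (2 * j) * sqrt (1 + (x / (real (2 * j) + 1))\<^sup>2)"
  have "1 \<le> ?f 0" by simp
  also have "?f 0 \<le> (\<Sum>j\<le>p. ?f j)"
    using x by (intro member_le_sum) auto
  finally show "1 \<le> (\<Sum>b\<in>block_index (2 * p) ps. block_coeff ps x b)"
    unfolding sum_block_coeff[OF ps] .
  let ?u = "x\<^sup>2 / 2"
  have "?f j \<le> ?u ^ j /\<^sub>R fact j * exp ?u" for j
  proof (intro mult_mono)
    have "x ^ (2 * j) / fact (2 * j) \<le> x ^ (2 * j) / (2 ^ j * fact j)"
      using x fact_double_ge[of j] by (intro divide_left_mono) auto
    also have "\<dots> = ?u ^ j /\<^sub>R fact j" 
      unfolding power_divide power_mult[symmetric] real_scaleR_def by (simp add: field_simps)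
    finally show "x ^ (2 * j) / fact (2 * j) \<le> ?u ^ j /\<^sub>R fact j" .
    have "x / (real (2 * j) + 1) \<le> x / 1" using x by (intro divide_left_mono) auto
    hence "(x / (real (2 * j) + 1))\<^sup>2 \<le> x\<^sup>2" using x by (intro power_mono) auto
    hence "1 + (x / (real (2 * j) + 1))\<^sup>2 \<le> exp (x\<^sup>2)" using exp_ge_add_one_self[of "x\<^sup>2"] by linarith
    hence "sqrt (1 + (x / (real (2 * j) + 1))\<^sup>2) \<le> sqrt (exp (x\<^sup>2))" by (rule real_sqrt_le_mono)
    also have "sqrt (exp (x\<^sup>2)) = exp ?u"
      by (rule real_sqrt_unique) (simp_all add: power2_eq_square exp_add[symmetric])
    finally show "sqrt (1 + (x / (real (2 * j) + 1))\<^sup>2) \<le> exp ?u" .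
  qed (use x in auto)
  hence "(\<Sum>j\<le>p. ?f j) \<le> (\<Sum>j\<le>p. ?u ^ j /\<^sub>R fact j * exp ?u)" by (rule sum_mono)
  also have "\<dots> = (\<Sum>j\<le>p. ?u ^ j /\<^sub>R fact j) * exp ?u" by (rule sum_distrib_right[symmetric])
  also have "(\<Sum>j\<le>p. ?u ^ j /\<^sub>R fact j) \<le> exp ?u"
  proof -
    have "(\<Sum>j\<le>p. ?u ^ j /\<^sub>R fact j) \<le> (\<Sum>j. ?u ^ j /\<^sub>R fact j)"
      by (rule sum_le_suminf[OF summable_exp_generic]) auto
    thus ?thesis by (simp only: exp_def)
  qed
  finally have "(\<Sum>j\<le>p. ?f j) \<le> exp ?u * exp ?u" by (simp add: mult_right_mono)
  also have "\<dots> = exp (x\<^sup>2)" by (simp add: exp_add[symmetric])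
  finally show "(\<Sum>b\<in>block_index (2 * p) ps. block_coeff ps x b) \<le> exp (x\<^sup>2)"
    unfolding sum_block_coeff[OF ps] .
qed

lemma lcu_coeff_nonneg:
  assumes ps: "convex_on_qubits n ps" and x: "0 \<le> x" and bs: "bs \<in> lcu_index ps q r"
  shows "0 \<le> lcu_coeff ps x bs"
proof -
  have "set bs \<subseteq> block_index q ps" using bs by (simp add: lcu_index_def)
  thus ?thesis unfolding lcu_coeff_def
    by (induction bs) (auto intro!: mult_nonneg_nonneg block_coeff_nonneg[OF ps x])
qed

lemma lcu_index_eq: "lcu_index ps q r = {bs. set bs \<subseteq> block_index q ps \<and> length bs = r}"
  by (auto simp: lcu_index_def)

lemma lcu_index_finite: "finite (lcu_index ps q r)"
  unfolding lcu_index_eq by (rule finite_lists_length_eq[OF block_index_finite])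

lemma lcu_weight_eq:
  assumes ps: "convex_on_qubits n ps" and x: "0 \<le> x"
  shows "lcu_weight ps q r x = (\<Sum>b\<in>block_index q ps. block_coeff ps x b) ^ r"
proof -
  have "lcu_weight ps q r x = (\<Sum>bs\<in>lcu_index ps q r. lcu_coeff ps x bs)"
    unfolding lcu_weight_def by (intro sum.cong refl abs_of_nonneg lcu_coeff_nonneg[OF ps x])
  thus ?thesis unfolding lcu_index_eq lcu_coeff_def sum_prod_lists .
qed

lemma lcu_weight_bounds:
  assumes ps: "convex_on_qubits n ps" and x: "0 \<le> x"
  shows "1 \<le> lcu_weight ps (2 * p) r x" "lcu_weight ps (2 * p) r x \<le> exp (real r * x\<^sup>2)"
proof -
  note b = sum_block_coeff_bounds[OF ps x, of p]
  show "1 \<le> lcu_weight ps (2 * p) r x" unfolding lcu_weight_eq[OF ps x] using b(1) by (rule one_le_power)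
  have "lcu_weight ps (2 * p) r x \<le> exp (x\<^sup>2) ^ r"
    unfolding lcu_weight_eq[OF ps x] using b by (intro power_mono) auto
  thus "lcu_weight ps (2 * p) r x \<le> exp (real r * x\<^sup>2)" by (simp add: exp_of_nat_mult)
qed

lemma block_unitary:
  assumes ps: "convex_on_qubits n ps" and b: "b \<in> block_index q ps"
  shows "unitary_mat (2 ^ n) (block_unitary (2 ^ n) ps x b)"
proof -
  let ?d = "2 ^ n :: nat"
  obtain ls s where b': "b = (ls, s)" "set ls \<subseteq> {..<length ps}" "s < length ps"
    using b by (auto simp: block_index_def)
  note P = convex_pauli[OF ps b'(3)]
  let ?F = "foldr (\<lambda>l A. signed_pauli (snd (ps ! l)) * A) ls (1\<^sub>m ?d)"
  have F: "unitary_mat ?d ?F"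
    using b'(2) by (intro foldr_mult_unitary convex_pauli(4)[OF ps]) auto
  note F' = unitary_matD[OF F]
  have "unitary_mat ?d ((- \<i>) ^ length ls \<cdot>\<^sub>m ?F)"
  proof (rule unitary_matI)
    have c: "cnj ((- \<i>) ^ length ls) * (- \<i>) ^ length ls = 1"
      by (simp flip: power_mult_distrib)
    show "mat_adjoint ((- \<i>) ^ length ls \<cdot>\<^sub>m ?F) * ((- \<i>) ^ length ls \<cdot>\<^sub>m ?F) = 1\<^sub>m ?d"
      unfolding mat_adjoint_smult smult_mult_smult[OF mat_adjoint_carrier[OF F'(1)] F'(1)] F'(2) c
      by (intro eq_matI) auto
  qed (use F' in simp)
  moreover have "unitary_mat ?d (mexp ((- \<i> * complex_of_real (block_angle x (length ls))) \<cdot>\<^sub>m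
      signed_pauli (snd (ps ! s))))"
    by (rule unitary_mexp_hermitian[OF P(1) hermitianI[OF P(1,2)]])
  ultimately show ?thesis unfolding b' block_unitary.simps by (rule unitary_mat_mult)
qed

lemma lcu_unitary:
  assumes ps: "convex_on_qubits n ps" and bs: "bs \<in> lcu_index ps q r"
  shows "unitary_mat (2 ^ n) (lcu_unitary (2 ^ n) ps x bs)"
  unfolding lcu_unitary_def
  using bs by (intro foldr_mult_unitary block_unitary[OF ps]) (auto simp: lcu_index_def)

lemma lcu_expansion:
  assumes ps: "convex_on_qubits n ps"
  shows "mat_Sum (2 ^ n) (\<lambda>bs. complex_of_real (lcu_coeff ps x bs) \<cdot>\<^sub>m lcu_unitary (2 ^ n) ps x bs) (lcu_index ps q r) =
    segment_op (2 ^ n) ps q x ^\<^sub>m r"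
  unfolding lcu_index_eq lcu_coeff_def lcu_unitary_def segment_op_def
  by (rule mat_Sum_lists) (rule unitary_matD(1)[OF block_unitary[OF ps]])

text \<open>The coefficients are nonnegative, so the weight, defined with absolute values, is their
  plain sum and the quotients add up to 1. The lower bound 1 on the weight excludes division by
  zero.\<close>

lemma lcu_pmf:
  assumes ps: "convex_on_qubits n ps" and x: "0 \<le> x"
  shows "pmf (lcu_pmf ps (2 * p) r x) bs =
      (if bs \<in> lcu_index ps (2 * p) r then lcu_coeff ps x bs / lcu_weight ps (2 * p) r x else 0)"
    and "set_pmf (lcu_pmf ps (2 * p) r x) \<subseteq> lcu_index ps (2 * p) r"
proof -
  let ?I = "lcu_index ps (2 * p) r" let ?w = "lcu_weight ps (2 * p) r x"
  let ?f = "\<lambda>bs. if bs \<in> ?I then lcu_coeff ps x bs / ?w else 0"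
  have w: "1 \<le> ?w" by (rule lcu_weight_bounds[OF ps x])
  have f: "0 \<le> ?f bs" for bs using w lcu_coeff_nonneg[OF ps x, of bs "2 * p" r] by auto
  have "(\<integral>\<^sup>+bs. ennreal (?f bs) \<partial>count_space UNIV) = (\<Sum>bs\<in>?I. ennreal (?f bs))"
    by (rule nn_integral_count_space') (auto simp: lcu_index_finite)
  also have "\<dots> = ennreal (\<Sum>bs\<in>?I. ?f bs)" using f by (intro sum_ennreal)
  also have "(\<Sum>bs\<in>?I. ?f bs) = (\<Sum>bs\<in>?I. lcu_coeff ps x bs) / ?w" by (simp add: sum_divide_distrib)
  also have "(\<Sum>bs\<in>?I. lcu_coeff ps x bs) = ?w"
    unfolding lcu_weight_def by (intro sum.cong refl abs_of_nonneg[symmetric] lcu_coeff_nonneg[OF ps x])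
  finally have nn: "(\<integral>\<^sup>+bs. ennreal (?f bs) \<partial>count_space UNIV) = 1" using w by simp
  show pmf: "pmf (lcu_pmf ps (2 * p) r x) bs = ?f bs" for bs
    unfolding lcu_pmf_def by (rule pmf_embed_pmf[OF f nn])
  show "set_pmf (lcu_pmf ps (2 * p) r x) \<subseteq> ?I"
    by (auto simp: set_pmf_iff pmf split: if_splits)
qed

section \<open>Environment channels, their duals, and ancilla blocks\<close>

text \<open>Covers the thermal environment state and also the identity on the environment qubit,
  whose weights are constantly 1; hence no normalization is included.\<close>

definition qubit_diag :: "complex mat \<Rightarrow> (nat \<Rightarrow> real) \<Rightarrow> bool" where
  "qubit_diag E w \<longleftrightarrow> E \<in> carrier_mat 2 2 \<and>
    (\<forall>i<2. \<forall>j<2. E $$ (i, j) = (if i = j then complex_of_real (w i) else 0))"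

lemma qubit_diagD:
  assumes "qubit_diag E w"
  shows "E \<in> carrier_mat 2 2"
    "i < 2 \<Longrightarrow> j < 2 \<Longrightarrow> E $$ (i, j) = (if i = j then complex_of_real (w i) else 0)"
  using assms by (auto simp: qubit_diag_def)

lemma qubit_diag_one: "qubit_diag (1\<^sub>m 2) (\<lambda>_. 1)"
  by (auto simp: qubit_diag_def)

text \<open>In a joint index the environment qubit is the least significant digit and the ancilla the most significant one.\<close>
definition env_embed :: "nat \<Rightarrow> nat \<Rightarrow> complex Matrix.vec \<Rightarrow> complex Matrix.vec" where
  "env_embed n e v = Matrix.vec (2 * n) (\<lambda>k. if k mod 2 = e then vec_index v (k div 2) else 0)"

definition env_slice :: "nat \<Rightarrow> nat \<Rightarrow> complex Matrix.vec \<Rightarrow> complex Matrix.vec" where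
  "env_slice n e v = Matrix.vec n (\<lambda>i. vec_index v (2 * i + e))"

lemma env_embed_carrier [simp]: "env_embed n e v \<in> carrier_vec (2 * n)"
  by (simp add: env_embed_def)

lemma env_slice_carrier [simp]: "env_slice n e v \<in> carrier_vec n"
  by (simp add: env_slice_def)

lemma sum_lessThan_double:
  fixes f :: "nat \<Rightarrow> 'a::comm_monoid_add"
  shows "(\<Sum>k<2 * n. f k) = (\<Sum>i<n. f (2 * i) + f (2 * i + 1))"
  using sum_lessThan_mult[of f n 2] by (simp add: sum_lessThan_2 mult.commute)

lemma cscalar_env_slice:
  assumes "v \<in> carrier_vec (2 * n)" "w \<in> carrier_vec (2 * n)"
  shows "v \<bullet>c w = env_slice n 0 v \<bullet>c env_slice n 0 w + env_slice n 1 v \<bullet>c env_slice n 1 w"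
  unfolding cscalar_prod_sum[OF assms] cscalar_prod_sum[OF env_slice_carrier env_slice_carrier] sum_lessThan_double
  by (simp add: env_slice_def sum.distrib)

lemma vnorm_env_slice:
  assumes "v \<in> carrier_vec (2 * n)"
  shows "(vnorm v)\<^sup>2 = (vnorm (env_slice n 0 v))\<^sup>2 + (vnorm (env_slice n 1 v))\<^sup>2"
  using cscalar_env_slice[OF assms assms] unfolding cscalar_prod_self
  by (simp only: of_real_add[symmetric] of_real_eq_iff)

lemma vnorm_env_slice_le:
  assumes "v \<in> carrier_vec (2 * n)" "e < 2"
  shows "vnorm (env_slice n e v) \<le> vnorm v"
proof -
  have "(vnorm (env_slice n e v))\<^sup>2 \<le> (vnorm v)\<^sup>2"
    unfolding vnorm_env_slice[OF assms(1)] using less_2_cases[OF assms(2)] by auto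
  thus ?thesis by (rule power2_le_imp_le) simp
qed

lemma env_slice_embed:
  assumes "v \<in> carrier_vec n" "e < 2" "f < 2"
  shows "env_slice n f (env_embed n e v) = (if e = f then v else 0\<^sub>v n)"
  using assms by (intro eq_vecI) (auto simp: env_slice_def env_embed_def)

lemma vnorm_env_embed:
  assumes "v \<in> carrier_vec n" "e < 2"
  shows "vnorm (env_embed n e v) = vnorm v"
proof -
  have "(vnorm (env_embed n e v))\<^sup>2 = (vnorm v)\<^sup>2"
    unfolding vnorm_env_slice[OF env_embed_carrier]
    using less_2_cases[OF assms(2)] by (auto simp: env_slice_embed[OF assms])
  thus ?thesis by simp
qed

text \<open>The operator-sum form of the partial trace; it reduces norm bounds and positivity to
  vectors of the joint space.\<close>

lemma ptrace_env_mult_vec: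
  assumes Z: "Z \<in> carrier_mat (2 * n) (2 * n)" and v: "v \<in> carrier_vec n"
  shows "ptrace_env Z *\<^sub>v v = env_slice n 0 (Z *\<^sub>v env_embed n 0 v) + env_slice n 1 (Z *\<^sub>v env_embed n 1 v)"
proof (rule eq_vecI)
  note p = ptrace_env_carrier[OF Z]
  fix i assume "i < dim_vec (env_slice n 0 (Z *\<^sub>v env_embed n 0 v) + env_slice n 1 (Z *\<^sub>v env_embed n 1 v))"
  hence i: "i < n" by (simp add: env_slice_def)
  have e: "vec_index (Z *\<^sub>v env_embed n e v) (2 * i + e) = (\<Sum>j<n. Z $$ (2 * i + e, 2 * j + e) * vec_index v j)"
    if e: "e < 2" for e
  proof -
    have ie: "2 * i + e < 2 * n" using i e by simp
    have "vec_index (Z *\<^sub>v env_embed n e v) (2 * i + e) =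
        (\<Sum>k<2 * n. Z $$ (2 * i + e, k) * vec_index (env_embed n e v) k)"
      by (rule index_mult_mat_vec_sum[OF Z env_embed_carrier ie])
    also have "\<dots> = (\<Sum>j<n. Z $$ (2 * i + e, 2 * j + e) * vec_index v j)"
      unfolding sum_lessThan_double using less_2_cases[OF e]
      by (intro sum.cong refl) (auto simp: env_embed_def)
    finally show ?thesis .
  qed
  have "vec_index (ptrace_env Z *\<^sub>v v) i = (\<Sum>j<n. ptrace_env Z $$ (i, j) * vec_index v j)"
    by (rule index_mult_mat_vec_sum[OF p v i])
  also have "\<dots> = (\<Sum>j<n. Z $$ (2 * i, 2 * j) * vec_index v j) + (\<Sum>j<n. Z $$ (2 * i + 1, 2 * j + 1) * vec_index v j)"
    unfolding sum.distrib[symmetric] using i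
    by (intro sum.cong refl) (simp add: index_ptrace_env[OF Z i] algebra_simps)
  also have "\<dots> = vec_index (Z *\<^sub>v env_embed n 0 v) (2 * i) + vec_index (Z *\<^sub>v env_embed n 1 v) (2 * i + 1)"
    using e[of 0] e[of 1] by simp
  also have "\<dots> = vec_index (env_slice n 0 (Z *\<^sub>v env_embed n 0 v) + env_slice n 1 (Z *\<^sub>v env_embed n 1 v)) i"
    using i by (simp add: env_slice_def del: index_mult_mat_vec)
  finally show "vec_index (ptrace_env Z *\<^sub>v v) i =
      vec_index (env_slice n 0 (Z *\<^sub>v env_embed n 0 v) + env_slice n 1 (Z *\<^sub>v env_embed n 1 v)) i" .
qed (use ptrace_env_carrier[OF Z] in \<open>simp add: env_slice_def\<close>)

text \<open>A diagonal second factor keeps the environment slices apart.\<close>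

lemma env_slice_kron_mult_vec:
  assumes R: "R \<in> carrier_mat n n" and E: "qubit_diag E w" and v: "v \<in> carrier_vec (2 * n)" and e: "e < 2"
  shows "env_slice n e (kron R E *\<^sub>v v) = complex_of_real (w e) \<cdot>\<^sub>v (R *\<^sub>v env_slice n e v)"
proof (rule eq_vecI)
  note E' = qubit_diagD[OF E]
  have k: "kron R E \<in> carrier_mat (2 * n) (2 * n)"
    using kron_carrier[OF R E'(1)] by (simp add: mult.commute)
  fix i assume "i < dim_vec (complex_of_real (w e) \<cdot>\<^sub>v (R *\<^sub>v env_slice n e v))"
  hence i: "i < n" using R by simp
  hence ie: "2 * i + e < 2 * n" using e by simp
  have entry: "kron R E $$ (2 * i + e, 2 * j + f) = R $$ (i, j) * E $$ (e, f)" if "j < n" "f < 2" for j f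
    using index_kron[of "2 * i + e" R E "2 * j + f"] R E'(1) i e that by simp
  have "vec_index (env_slice n e (kron R E *\<^sub>v v)) i = vec_index (kron R E *\<^sub>v v) (2 * i + e)"
    using i by (simp add: env_slice_def del: index_mult_mat_vec)
  also have "\<dots> = (\<Sum>k<2 * n. kron R E $$ (2 * i + e, k) * vec_index v k)"
    by (rule index_mult_mat_vec_sum[OF k v ie])
  also have "\<dots> = (\<Sum>j<n. complex_of_real (w e) * (R $$ (i, j) * vec_index v (2 * j + e)))"
    unfolding sum_lessThan_double
  proof (intro sum.cong refl)
    fix j assume "j \<in> {..<n}"
    hence j: "j < n" by simp
    show "kron R E $$ (2 * i + e, 2 * j) * vec_index v (2 * j) +
        kron R E $$ (2 * i + e, 2 * j + 1) * vec_index v (2 * j + 1) =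
        complex_of_real (w e) * (R $$ (i, j) * vec_index v (2 * j + e))"
      using entry[OF j, of 0] entry[OF j, of 1] E'(2)[OF e, of 0] E'(2)[OF e, of 1] less_2_cases[OF e]
      by (auto simp: algebra_simps)
  qed
  also have "\<dots> = complex_of_real (w e) * vec_index (R *\<^sub>v env_slice n e v) i"
    unfolding index_mult_mat_vec_sum[OF R env_slice_carrier i] sum_distrib_left
    by (intro sum.cong refl) (simp add: env_slice_def)
  also have "\<dots> = vec_index (complex_of_real (w e) \<cdot>\<^sub>v (R *\<^sub>v env_slice n e v)) i"
    using R i by (simp del: index_mult_mat_vec)
  finally show "vec_index (env_slice n e (kron R E *\<^sub>v v)) i =
      vec_index (complex_of_real (w e) \<cdot>\<^sub>v (R *\<^sub>v env_slice n e v)) i" .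
qed (use R in \<open>simp add: env_slice_def\<close>)

lemma kron_env_carrier: "R \<in> carrier_mat n n \<Longrightarrow> E \<in> carrier_mat 2 2 \<Longrightarrow> kron R E \<in> carrier_mat (2 * n) (2 * n)"
  using kron_carrier[of R n n E 2 2] by (simp add: mult.commute)

lemma opbound_kron_one:
  assumes X: "opbound X c" "X \<in> carrier_mat n n"
  shows "opbound (kron X (1\<^sub>m 2)) c"
proof (rule opboundI[OF kron_env_carrier[OF X(2) one_carrier_mat] opbound_nonneg[OF X(1)]])
  fix v :: "complex Matrix.vec" assume v: "v \<in> carrier_vec (2 * n)"
  let ?k = "kron X (1\<^sub>m 2) *\<^sub>v v"
  have k: "?k \<in> carrier_vec (2 * n)" using X by simp
  have s: "(vnorm (env_slice n e ?k))\<^sup>2 \<le> c\<^sup>2 * (vnorm (env_slice n e v))\<^sup>2" if "e < 2" for e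
    unfolding env_slice_kron_mult_vec[OF X(2) qubit_diag_one v that] power_mult_distrib[symmetric]
    using opboundD[OF X env_slice_carrier, of e v] by (intro power_mono) auto
  have "(vnorm ?k)\<^sup>2 \<le> c\<^sup>2 * (vnorm v)\<^sup>2"
    unfolding vnorm_env_slice[OF k] vnorm_env_slice[OF v] using s[of 0] s[of 1] by (simp add: distrib_left)
  hence "(vnorm ?k)\<^sup>2 \<le> (c * vnorm v)\<^sup>2" by (simp add: power_mult_distrib)
  thus "vnorm ?k \<le> c * vnorm v" by (rule power2_le_imp_le) (simp add: opbound_nonneg[OF X(1)])
qed

lemma psd_kron_env:
  assumes R: "psd R" "R \<in> carrier_mat n n" and E: "qubit_diag E w" and w: "\<And>e. 0 \<le> w e"
  shows "psd (kron R E)"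
  unfolding psd_def
proof (intro conjI ballI)
  note E' = qubit_diagD[OF E]
  have k: "kron R E \<in> carrier_mat (2 * n) (2 * n)" by (rule kron_env_carrier[OF R(2) E'(1)])
  have "mat_adjoint E = E"
  proof (rule eq_matI)
    fix i j assume "i < dim_row E" "j < dim_col E"
    hence "i < 2" "j < 2" using E' by auto
    thus "mat_adjoint E $$ (i, j) = E $$ (i, j)" using E' by auto
  qed (use E' in auto)
  thus "hermitian (kron R E)" by (intro hermitianI[OF k]) (simp only: kron_adjoint psd_hermitian[OF R(1)])
  fix v :: "complex Matrix.vec" assume "v \<in> carrier_vec (dim_row (kron R E))"
  hence v: "v \<in> carrier_vec (2 * n)" by (simp only: carrier_matD(1)[OF k])
  have kv: "kron R E *\<^sub>v v \<in> carrier_vec (2 * n)"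
    by (simp only: mult_mat_vec_carrier_iff carrier_matD(1)[OF k])
  have two: "0 < (2::nat)" "1 < (2::nat)" by simp_all
  have s: "env_slice n e (kron R E *\<^sub>v v) \<bullet>c env_slice n e v =
      complex_of_real (w e) * ((R *\<^sub>v env_slice n e v) \<bullet>c env_slice n e v)" if "e < 2" for e
    unfolding env_slice_kron_mult_vec[OF R(2) E v that]
    using R(2) by (subst smult_scalar_prod_distrib[of _ n]) simp_all
  have "Re ((kron R E *\<^sub>v v) \<bullet>c v) = w 0 * Re ((R *\<^sub>v env_slice n 0 v) \<bullet>c env_slice n 0 v) +
      w 1 * Re ((R *\<^sub>v env_slice n 1 v) \<bullet>c env_slice n 1 v)"
    unfolding cscalar_env_slice[OF kv v] s[OF two(1)] s[OF two(2)] by simp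
  thus "0 \<le> Re ((kron R E *\<^sub>v v) \<bullet>c v)"
    using w psdD[OF R env_slice_carrier] by simp
qed

text \<open>The form of the partial trace at v is the sum over e of the form of \<open>Z\<close> at
  v tensored with the basis vector e.\<close>

lemma psd_ptrace_env:
  assumes Z: "psd Z" "Z \<in> carrier_mat (2 * n) (2 * n)"
  shows "psd (ptrace_env Z)"
  unfolding psd_def
proof (intro conjI ballI)
  note p = ptrace_env_carrier[OF Z(2)]
  have "mat_adjoint (ptrace_env Z) = ptrace_env Z"
  proof (rule eq_matI)
    fix i j assume "i < dim_row (ptrace_env Z)" "j < dim_col (ptrace_env Z)"
    hence ij: "i < n" "j < n" using p by auto
    have a: "Z $$ (k, l) = cnj (Z $$ (l, k))" if "k < 2 * n" "l < 2 * n" for k l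
      using index_mat_adjoint[of k Z l] that Z(2) unfolding psd_hermitian[OF Z(1)] by simp
    have "mat_adjoint (ptrace_env Z) $$ (i, j) = cnj (ptrace_env Z $$ (j, i))"
      using ij p by (intro index_mat_adjoint) auto
    also have "\<dots> = ptrace_env Z $$ (i, j)"
      unfolding index_ptrace_env[OF Z(2) ij] index_ptrace_env[OF Z(2) ij(2,1)]
      using a[of "2 * i" "2 * j"] a[of "2 * i + 1" "2 * j + 1"] ij by simp
    finally show "mat_adjoint (ptrace_env Z) $$ (i, j) = ptrace_env Z $$ (i, j)" .
  qed (use p in auto)
  thus "hermitian (ptrace_env Z)" by (rule hermitianI[OF p])
  fix v :: "complex Matrix.vec" assume "v \<in> carrier_vec (dim_row (ptrace_env Z))"
  hence v: "v \<in> carrier_vec n" using p by simp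
  have s: "env_slice n e (Z *\<^sub>v env_embed n e v) \<bullet>c v = (Z *\<^sub>v env_embed n e v) \<bullet>c env_embed n e v" if e: "e < 2" for e
  proof -
    have "Z *\<^sub>v env_embed n e v \<in> carrier_vec (2 * n)" using Z by simp
    from cscalar_env_slice[OF this env_embed_carrier, of e v] show ?thesis
      using less_2_cases[OF e] v env_slice_embed[OF v e, of 0] env_slice_embed[OF v e, of 1] by (auto simp: conjugate_zero_vec)
  qed
  have two: "0 < (2::nat)" "1 < (2::nat)" by simp_all
  have "(ptrace_env Z *\<^sub>v v) \<bullet>c v =
      (Z *\<^sub>v env_embed n 0 v) \<bullet>c env_embed n 0 v + (Z *\<^sub>v env_embed n 1 v) \<bullet>c env_embed n 1 v"
    unfolding ptrace_env_mult_vec[OF Z(2) v] s[OF two(1), symmetric] s[OF two(2), symmetric]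
    using v by (intro add_scalar_prod_distrib[of _ n]) simp_all
  thus "0 \<le> Re ((ptrace_env Z *\<^sub>v v) \<bullet>c v)"
    using psdD[OF Z env_embed_carrier, of 0 v] psdD[OF Z env_embed_carrier, of 1 v] by simp
qed

text \<open>The characterizing property of the partial trace. It lifts a reduced expectation to the
  joint space, where cyclicity of the trace can be used on the collision operators.\<close>

lemma mtrace_mult_ptrace_env:
  assumes X: "X \<in> carrier_mat n n" and Z: "Z \<in> carrier_mat (2 * n) (2 * n)"
  shows "mtrace (X * ptrace_env Z) = mtrace (kron X (1\<^sub>m 2) * Z)"
proof -
  note p = ptrace_env_carrier[OF Z] and k = kron_env_carrier[OF X one_carrier_mat]
  have entry: "kron X (1\<^sub>m 2) $$ (2 * i + e, 2 * j + f) = (if e = f then X $$ (i, j) else 0)"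
    if "i < n" "j < n" "e < 2" "f < 2" for i j e f
    using index_kron[of "2 * i + e" X "1\<^sub>m 2" "2 * j + f"] X that by simp
  have "mtrace (kron X (1\<^sub>m 2) * Z) = (\<Sum>k<2 * n. \<Sum>l<2 * n. kron X (1\<^sub>m 2) $$ (k, l) * Z $$ (l, k))"
    unfolding mtrace_carrier[OF mult_square_mat_carrier[OF k Z]]
    by (intro sum.cong refl index_mult_mat_sum[OF k Z]) auto
  also have "\<dots> = (\<Sum>i<n. \<Sum>j<n. X $$ (i, j) * ptrace_env Z $$ (j, i))"
    unfolding sum_lessThan_double sum.distrib[symmetric]
  proof (intro sum.cong refl)
    fix i j assume "i \<in> {..<n}" "j \<in> {..<n}"
    hence ij: "i < n" "j < n" by auto
    show "kron X (1\<^sub>m 2) $$ (2 * i, 2 * j) * Z $$ (2 * j, 2 * i) +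
        kron X (1\<^sub>m 2) $$ (2 * i, 2 * j + 1) * Z $$ (2 * j + 1, 2 * i) +
        (kron X (1\<^sub>m 2) $$ (2 * i + 1, 2 * j) * Z $$ (2 * j, 2 * i + 1) +
        kron X (1\<^sub>m 2) $$ (2 * i + 1, 2 * j + 1) * Z $$ (2 * j + 1, 2 * i + 1)) =
        X $$ (i, j) * ptrace_env Z $$ (j, i)"
      unfolding index_ptrace_env[OF Z ij(2,1)]
      using entry[OF ij, of 0 0] entry[OF ij, of 0 1] entry[OF ij, of 1 0] entry[OF ij, of 1 1]
      by (simp add: algebra_simps)
  qed
  also have "\<dots> = mtrace (X * ptrace_env Z)"
    unfolding mtrace_carrier[OF mult_square_mat_carrier[OF X p]]
    by (intro sum.cong refl index_mult_mat_sum[OF X p, symmetric]) auto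
  finally show ?thesis by (rule sym)
qed

lemma mtrace_kron_env:
  assumes R: "R \<in> carrier_mat n n" and E: "qubit_diag E w"
  shows "mtrace (kron R E) = complex_of_real (w 0 + w 1) * mtrace R"
proof -
  note E' = qubit_diagD[OF E]
  have entry: "kron R E $$ (2 * i + e, 2 * i + e) = complex_of_real (w e) * R $$ (i, i)" if "i < n" "e < 2" for i e
    using index_kron[of "2 * i + e" R E "2 * i + e"] R E'(1) E'(2)[OF that(2,2)] that by simp
  show ?thesis
    unfolding mtrace_carrier[OF kron_env_carrier[OF R E'(1)]] mtrace_carrier[OF R] sum_lessThan_double sum_distrib_left
    using entry[of _ 0] entry[of _ 1] by (intro sum.cong refl) (simp add: algebra_simps)
qed

text \<open>Left and right operators may differ, because an off-diagonal ancilla block is multiplied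
  by one sampled unitary on the left and by the adjoint of the other on the right. Equal unitaries
  give a collision channel.\<close>

definition env_channel :: "complex mat \<Rightarrow> complex mat \<Rightarrow> complex mat \<Rightarrow> complex mat \<Rightarrow> complex mat" where
  "env_channel E A B R = ptrace_env (A * kron R E * mat_adjoint B)"

text \<open>The Heisenberg-picture counterpart of \<open>env_channel\<close>: the observable is
  pulled back to the joint space and the environment is then averaged with the state E.\<close>

definition env_dual :: "nat \<Rightarrow> complex mat \<Rightarrow> complex mat \<Rightarrow> complex mat \<Rightarrow> complex mat \<Rightarrow> complex mat" where
  "env_dual n E A B X = ptrace_env (mat_adjoint B * kron X (1\<^sub>m 2) * A * kron (1\<^sub>m n) E)"

lemma env_channel_carrier:
  assumes "A \<in> carrier_mat (2 * n) (2 * n)" "B \<in> carrier_mat (2 * n) (2 * n)" "R \<in> carrier_mat n n" "E \<in> carrier_mat 2 2"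
  shows "env_channel E A B R \<in> carrier_mat n n"
  unfolding env_channel_def
  by (intro ptrace_env_carrier mult_square_mat_carrier kron_env_carrier mat_adjoint_carrier assms)

lemma env_dual_carrier:
  assumes "A \<in> carrier_mat (2 * n) (2 * n)" "B \<in> carrier_mat (2 * n) (2 * n)" "X \<in> carrier_mat n n" "E \<in> carrier_mat 2 2"
  shows "env_dual n E A B X \<in> carrier_mat n n"
  unfolding env_dual_def
  by (intro ptrace_env_carrier mult_square_mat_carrier kron_env_carrier mat_adjoint_carrier assms one_carrier_mat)

lemma mtrace_env_channel:
  assumes A: "A \<in> carrier_mat (2 * n) (2 * n)" and B: "B \<in> carrier_mat (2 * n) (2 * n)"
    and R: "R \<in> carrier_mat n n" and E: "E \<in> carrier_mat 2 2" and X: "X \<in> carrier_mat n n"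
  shows "mtrace (X * env_channel E A B R) = mtrace (kron X (1\<^sub>m 2) * (A * kron R E * mat_adjoint B))"
  unfolding env_channel_def
  by (rule mtrace_mult_ptrace_env[OF X])
    (intro mult_square_mat_carrier kron_env_carrier mat_adjoint_carrier assms)

text \<open>R tensor E splits into (1 tensor E)(R tensor 1); cyclicity then collects everything
  except \<open>R\<close> into one joint operator, whose partial trace is the dual.\<close>

lemma mtrace_env_dual:
  assumes A: "A \<in> carrier_mat (2 * n) (2 * n)" and B: "B \<in> carrier_mat (2 * n) (2 * n)"
    and R: "R \<in> carrier_mat n n" and E: "E \<in> carrier_mat 2 2" and X: "X \<in> carrier_mat n n"
  shows "mtrace (X * env_channel E A B R) = mtrace (env_dual n E A B X * R)"
proof -
  let ?d = "2 * n"
  let ?X = "kron X (1\<^sub>m 2)" and ?E = "kron (1\<^sub>m n) E" and ?R = "kron R (1\<^sub>m 2)" and ?B = "mat_adjoint B"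
  have c: "?X \<in> carrier_mat ?d ?d" "?E \<in> carrier_mat ?d ?d" "?R \<in> carrier_mat ?d ?d" "?B \<in> carrier_mat ?d ?d"
    by (intro kron_env_carrier mat_adjoint_carrier X R E B one_carrier_mat)+
  have Y: "?B * ?X * A * ?E \<in> carrier_mat ?d ?d" by (intro mult_square_mat_carrier c A)
  have ER: "kron R E = ?E * ?R"
    unfolding kron_mult[OF one_carrier_mat R E one_carrier_mat] using R E by simp
  have car: "?X * (A * (?E * ?R)) \<in> carrier_mat ?d ?d" by (intro mult_square_mat_carrier c A)
  have "mtrace (X * env_channel E A B R) = mtrace (?X * (A * (?E * ?R) * ?B))"
    unfolding mtrace_env_channel[OF assms] ER ..
  also have "?X * (A * (?E * ?R) * ?B) = (?X * (A * (?E * ?R))) * ?B"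
    using c A by (simp add: assoc_mult_mat[of _ ?d ?d _ ?d _ ?d])
  also have "mtrace \<dots> = mtrace (?B * (?X * (A * (?E * ?R))))"
    by (rule mtrace_mult_commute[OF car c(4)])
  also have "?B * (?X * (A * (?E * ?R))) = (?B * ?X * A * ?E) * ?R"
    using c A by (simp add: assoc_mult_mat[of _ ?d ?d _ ?d _ ?d])
  also have "mtrace \<dots> = mtrace (?R * (?B * ?X * A * ?E))" by (rule mtrace_mult_commute[OF Y c(3)])
  also have "\<dots> = mtrace (R * env_dual n E A B X)"
    unfolding env_dual_def by (rule mtrace_mult_ptrace_env[OF R Y, symmetric])
  also have "\<dots> = mtrace (env_dual n E A B X * R)"
    by (rule mtrace_mult_commute[OF R env_dual_carrier[OF A B X E]])
  finally show ?thesis .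
qed

text \<open>Applied to v, the dual is the sum over e of w_e times a slice of an operator of norm a b
  x at an embedded vector. Embedding keeps lengths, slicing does not increase them, and the weights
  sum to 1, so no dimension factor arises.\<close>

lemma opbound_env_dual:
  assumes A: "opbound A a" "A \<in> carrier_mat (2 * n) (2 * n)" and B: "opbound B b" "B \<in> carrier_mat (2 * n) (2 * n)"
    and X: "opbound X x" "X \<in> carrier_mat n n"
    and E: "qubit_diag E w" and w: "0 \<le> w 0" "0 \<le> w 1" "w 0 + w 1 = 1"
  shows "opbound (env_dual n E A B X) (a * b * x)"
proof -
  let ?d = "2 * n"
  note E' = qubit_diagD[OF E]
  let ?Y = "mat_adjoint B * kron X (1\<^sub>m 2) * A"
  note kX = kron_env_carrier[OF X(2) one_carrier_mat] and kE = kron_env_carrier[OF one_carrier_mat[of n] E'(1)]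
  have Y: "?Y \<in> carrier_mat ?d ?d" by (intro mult_square_mat_carrier kX mat_adjoint_carrier A(2) B(2))
  have "opbound (mat_adjoint B * kron X (1\<^sub>m 2)) (b * x)"
    by (rule opbound_mult[OF opbound_adjoint[OF B] opbound_kron_one[OF X] mat_adjoint_carrier[OF B(2)] kX])
  hence Yb: "opbound ?Y (b * x * a)"
    by (rule opbound_mult[OF _ A(1) mult_square_mat_carrier[OF mat_adjoint_carrier[OF B(2)] kX] A(2)])
  have YE: "?Y * kron (1\<^sub>m n) E \<in> carrier_mat ?d ?d" by (rule mult_square_mat_carrier[OF Y kE])
  show ?thesis
  proof (rule opboundI[OF env_dual_carrier[OF A(2) B(2) X(2) E'(1)]])
    show "0 \<le> a * b * x" using A B X by (simp add: opbound_nonneg)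
    fix v :: "complex Matrix.vec" assume v: "v \<in> carrier_vec n"
    \<comment> \<open>Since E is diagonal, embedded vectors are eigenvectors of 1 tensor E.\<close>
    have emb: "kron (1\<^sub>m n) E *\<^sub>v env_embed n e v = complex_of_real (w e) \<cdot>\<^sub>v env_embed n e v" if e: "e < 2" for e
    proof (rule eq_vecI)
      fix k assume "k < dim_vec (complex_of_real (w e) \<cdot>\<^sub>v env_embed n e v)"
      hence k: "k < 2 * n" by (simp add: env_embed_def)
      let ?f = "k mod 2" let ?i = "k div 2"
      have fi: "?f < 2" "?i < n" "k = 2 * ?i + ?f" using k by auto
      have "vec_index (kron (1\<^sub>m n) E *\<^sub>v env_embed n e v) k =
          vec_index (env_slice n ?f (kron (1\<^sub>m n) E *\<^sub>v env_embed n e v)) ?i"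
        using fi by (simp add: env_slice_def del: index_mult_mat_vec)
      also have "\<dots> = vec_index (complex_of_real (w ?f) \<cdot>\<^sub>v (if e = ?f then v else 0\<^sub>v n)) ?i"
        unfolding env_slice_kron_mult_vec[OF one_carrier_mat E env_embed_carrier fi(1)] env_slice_embed[OF v e fi(1)]
        using v by simp
      also have "\<dots> = vec_index (complex_of_real (w e) \<cdot>\<^sub>v env_embed n e v) k"
        using v fi k by (auto simp: env_embed_def)
      finally show "vec_index (kron (1\<^sub>m n) E *\<^sub>v env_embed n e v) k =
          vec_index (complex_of_real (w e) \<cdot>\<^sub>v env_embed n e v) k" .
    qed (use E'(1) in \<open>simp add: env_embed_def\<close>)
    have part: "vnorm (env_slice n e (?Y * kron (1\<^sub>m n) E *\<^sub>v env_embed n e v)) \<le> w e * (a * b * x * vnorm v)"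
      if e: "e < 2" for e
    proof -
      have we: "0 \<le> w e" using w less_2_cases[OF e] by auto
      have "?Y * kron (1\<^sub>m n) E *\<^sub>v env_embed n e v = ?Y *\<^sub>v (kron (1\<^sub>m n) E *\<^sub>v env_embed n e v)"
        by (rule assoc_mult_mat_vec[OF Y kE env_embed_carrier])
      also have "\<dots> = complex_of_real (w e) \<cdot>\<^sub>v (?Y *\<^sub>v env_embed n e v)"
        unfolding emb[OF e] by (rule mult_mat_vec[OF Y env_embed_carrier])
      finally have "vnorm (?Y * kron (1\<^sub>m n) E *\<^sub>v env_embed n e v) = w e * vnorm (?Y *\<^sub>v env_embed n e v)"
        using we by simp
      also have "\<dots> \<le> w e * (b * x * a * vnorm (env_embed n e v))"
        by (rule mult_left_mono[OF opboundD[OF Yb Y env_embed_carrier] we])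
      finally have "vnorm (?Y * kron (1\<^sub>m n) E *\<^sub>v env_embed n e v) \<le> w e * (a * b * x * vnorm v)"
        unfolding vnorm_env_embed[OF v e] by (simp add: mult_ac)
      moreover have "?Y * kron (1\<^sub>m n) E *\<^sub>v env_embed n e v \<in> carrier_vec (2 * n)"
        using carrier_matD(1)[OF YE] by simp
      ultimately show ?thesis using vnorm_env_slice_le[OF _ e] by (meson order_trans)
    qed
    have "vnorm (env_dual n E A B X *\<^sub>v v) \<le> vnorm (env_slice n 0 (?Y * kron (1\<^sub>m n) E *\<^sub>v env_embed n 0 v)) +
        vnorm (env_slice n 1 (?Y * kron (1\<^sub>m n) E *\<^sub>v env_embed n 1 v))"
      unfolding env_dual_def ptrace_env_mult_vec[OF YE v] by (rule vnorm_triangle[OF env_slice_carrier env_slice_carrier])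
    also have "\<dots> \<le> w 0 * (a * b * x * vnorm v) + w 1 * (a * b * x * vnorm v)"
      using part[of 0] part[of 1] by (intro add_mono) auto
    also have "\<dots> = a * b * x * vnorm v" unfolding distrib_right[symmetric] w(3) by simp
    finally show "vnorm (env_dual n E A B X *\<^sub>v v) \<le> a * b * x * vnorm v" .
  qed
qed

text \<open>The channel is additive in either operator. Read from right to left, this double sum
  collects the two independent samples into their separate means.\<close>

lemma mtrace_env_channel_mat_Sum:
  assumes f: "\<And>i. i \<in> I \<Longrightarrow> f i \<in> carrier_mat (2 * n) (2 * n)" and g: "\<And>j. j \<in> J \<Longrightarrow> g j \<in> carrier_mat (2 * n) (2 * n)"
    and R: "R \<in> carrier_mat n n" and E: "E \<in> carrier_mat 2 2" and X: "X \<in> carrier_mat n n"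
  shows "mtrace (X * env_channel E (mat_Sum (2 * n) f I) (mat_Sum (2 * n) g J) R) =
    (\<Sum>i\<in>I. \<Sum>j\<in>J. mtrace (X * env_channel E (f i) (g j) R))"
proof -
  let ?d = "2 * n" let ?X = "kron X (1\<^sub>m 2)" let ?S = "kron R E"
  have c: "?X \<in> carrier_mat ?d ?d" "?S \<in> carrier_mat ?d ?d"
    by (intro kron_env_carrier X R E one_carrier_mat)+
  have fS: "f i * ?S \<in> carrier_mat ?d ?d" if "i \<in> I" for i by (intro mult_square_mat_carrier f c that)
  have ga: "mat_adjoint (g j) \<in> carrier_mat ?d ?d" if "j \<in> J" for j by (intro mat_adjoint_carrier g that)
  let ?G = "mat_Sum ?d (\<lambda>j. mat_adjoint (g j)) J"
  have "mat_Sum ?d f I * ?S * mat_adjoint (mat_Sum ?d g J) = mat_Sum ?d (\<lambda>i. f i * ?S) I * ?G"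
    by (simp only: mat_Sum_mult[OF c(2) f] mat_adjoint_mat_Sum[OF g])
  also have "\<dots> = mat_Sum ?d (\<lambda>i. f i * ?S * ?G) I"
    by (rule mat_Sum_mult[OF mat_Sum_carrier fS])
  also have "?X * \<dots> = mat_Sum ?d (\<lambda>i. ?X * (f i * ?S * ?G)) I"
    by (rule mult_mat_Sum[OF c(1)]) (intro mult_square_mat_carrier f c mat_Sum_carrier)
  also have "mtrace \<dots> = (\<Sum>i\<in>I. mtrace (?X * (f i * ?S * ?G)))"
    by (rule mtrace_mat_Sum) (intro mult_square_mat_carrier f c mat_Sum_carrier)
  also have "\<dots> = (\<Sum>i\<in>I. \<Sum>j\<in>J. mtrace (?X * (f i * ?S * mat_adjoint (g j))))"
  proof (rule sum.cong[OF refl])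
    fix i assume i: "i \<in> I"
    have "f i * ?S * ?G = mat_Sum ?d (\<lambda>j. f i * ?S * mat_adjoint (g j)) J"
      by (rule mult_mat_Sum[OF fS[OF i] ga])
    also have "?X * \<dots> = mat_Sum ?d (\<lambda>j. ?X * (f i * ?S * mat_adjoint (g j))) J"
      by (rule mult_mat_Sum[OF c(1)]) (intro mult_square_mat_carrier f i c ga)
    also have "mtrace \<dots> = (\<Sum>j\<in>J. mtrace (?X * (f i * ?S * mat_adjoint (g j))))"
      by (rule mtrace_mat_Sum) (intro mult_square_mat_carrier f i c ga)
    finally show "mtrace (?X * (f i * ?S * ?G)) = (\<Sum>j\<in>J. mtrace (?X * (f i * ?S * mat_adjoint (g j))))" .
  qed
  also have "\<dots> = (\<Sum>i\<in>I. \<Sum>j\<in>J. mtrace (X * env_channel E (f i) (g j) R))"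
    by (intro sum.cong refl) (rule mtrace_env_channel[OF f g R E X, symmetric])
  finally show ?thesis
    unfolding mtrace_env_channel[OF mat_Sum_carrier mat_Sum_carrier R E X] .
qed

lemma mtrace_env_channel_smult:
  assumes A: "A \<in> carrier_mat (2 * n) (2 * n)" and B: "B \<in> carrier_mat (2 * n) (2 * n)"
    and R: "R \<in> carrier_mat n n" and E: "E \<in> carrier_mat 2 2" and X: "X \<in> carrier_mat n n"
  shows "mtrace (X * env_channel E (complex_of_real a \<cdot>\<^sub>m A) (complex_of_real b \<cdot>\<^sub>m B) R) =
    complex_of_real (a * b) * mtrace (X * env_channel E A B R)"
proof -
  let ?d = "2 * n" let ?X = "kron X (1\<^sub>m 2)" let ?S = "kron R E"
  have c: "?X \<in> carrier_mat ?d ?d" "?S \<in> carrier_mat ?d ?d" "mat_adjoint B \<in> carrier_mat ?d ?d"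
    by (intro kron_env_carrier mat_adjoint_carrier X R E B one_carrier_mat)+
  have AS: "A * ?S \<in> carrier_mat ?d ?d" by (rule mult_square_mat_carrier[OF A c(2)])
  have ASB: "A * ?S * mat_adjoint B \<in> carrier_mat ?d ?d" by (rule mult_square_mat_carrier[OF AS c(3)])
  have "(complex_of_real a \<cdot>\<^sub>m A) * ?S * mat_adjoint (complex_of_real b \<cdot>\<^sub>m B) =
      (complex_of_real a \<cdot>\<^sub>m (A * ?S)) * (complex_of_real b \<cdot>\<^sub>m mat_adjoint B)"
    by (simp only: mult_smult_assoc_mat[OF A c(2)] mat_adjoint_smult complex_cnj_complex_of_real)
  also have "\<dots> = complex_of_real (a * b) \<cdot>\<^sub>m (A * ?S * mat_adjoint B)"
    by (simp only: smult_mult_smult[OF AS c(3)] of_real_mult)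
  also have "?X * \<dots> = complex_of_real (a * b) \<cdot>\<^sub>m (?X * (A * ?S * mat_adjoint B))"
    by (rule mult_smult_distrib[OF c(1) ASB])
  finally show ?thesis
    unfolding mtrace_env_channel[OF A B R E X]
      mtrace_env_channel[OF smult_carrier_mat[OF A] smult_carrier_mat[OF B] R E X]
    by (simp only: mtrace_smult[OF mult_square_mat_carrier[OF c(1) ASB]])
qed

text \<open>The case X = 1 of \<open>mtrace_env_channel\<close>; cyclicity removes the
  unitary.\<close>

lemma mtrace_env_channel_isometry:
  assumes A: "unitary_mat (2 * n) A" and R: "R \<in> carrier_mat n n" and E: "qubit_diag E w" and w: "w 0 + w 1 = 1"
  shows "mtrace (env_channel E A A R) = mtrace R"
proof -
  note A' = unitary_matD[OF A] and E' = qubit_diagD[OF E]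
  let ?d = "2 * n" let ?S = "kron R E"
  have S: "?S \<in> carrier_mat ?d ?d" by (rule kron_env_carrier[OF R E'(1)])
  have ec: "env_channel E A A R \<in> carrier_mat n n" by (rule env_channel_carrier[OF A'(1) A'(1) R E'(1)])
  have ASA: "A * ?S * mat_adjoint A \<in> carrier_mat ?d ?d"
    by (intro mult_square_mat_carrier A'(1) S mat_adjoint_carrier)
  have "mtrace (env_channel E A A R) = mtrace (1\<^sub>m n * env_channel E A A R)" using ec by simp
  also have "\<dots> = mtrace (kron (1\<^sub>m n) (1\<^sub>m 2) * (A * ?S * mat_adjoint A))"
    by (rule mtrace_env_channel[OF A'(1) A'(1) R E'(1) one_carrier_mat])
  also have "kron (1\<^sub>m n) (1\<^sub>m 2) = (1\<^sub>m ?d :: complex mat)" unfolding kron_one by (simp add: mult.commute)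
  also have "1\<^sub>m ?d * (A * ?S * mat_adjoint A) = (A * ?S) * mat_adjoint A"
    by (rule left_mult_one_mat[OF ASA])
  also have "mtrace \<dots> = mtrace (mat_adjoint A * (A * ?S))"
    by (rule mtrace_mult_commute[OF mult_square_mat_carrier[OF A'(1) S] mat_adjoint_carrier[OF A'(1)]])
  also have "mat_adjoint A * (A * ?S) = (mat_adjoint A * A) * ?S"
    by (rule assoc_mult_mat[OF mat_adjoint_carrier[OF A'(1)] A'(1) S, symmetric])
  also have "\<dots> = ?S" unfolding A'(2) by (rule left_mult_one_mat[OF S])
  finally show ?thesis unfolding mtrace_kron_env[OF R E] w by simp
qed

section \<open>Ancilla blocks and controlled gates\<close>

definition anc_block :: "nat \<Rightarrow> complex mat \<Rightarrow> nat \<Rightarrow> nat \<Rightarrow> complex mat" where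
  "anc_block n R a b = Matrix.mat n n (\<lambda>(i, j). R $$ (a * n + i, b * n + j))"

lemma anc_block_carrier [simp]: "anc_block n R a b \<in> carrier_mat n n"
  by (simp add: anc_block_def)

lemma dim_anc_block [simp]: "dim_row (anc_block n R a b) = n" "dim_col (anc_block n R a b) = n"
  by (simp_all add: anc_block_def)

lemma anc_index_less: "a < 2 \<Longrightarrow> i < n \<Longrightarrow> a * n + i < 2 * (n::nat)"
  using block_index_less[of a 2 i n] by simp

lemma anc_block_mult:
  assumes A: "A \<in> carrier_mat (2 * n) (2 * n)" and B: "B \<in> carrier_mat (2 * n) (2 * n)" and ab: "a < 2" "b < 2"
  shows "anc_block n (A * B) a b = anc_block n A a 0 * anc_block n B 0 b + anc_block n A a 1 * anc_block n B 1 b"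
proof (rule eq_matI)
  fix i j assume "i < dim_row (anc_block n A a 0 * anc_block n B 0 b + anc_block n A a 1 * anc_block n B 1 b)"
    "j < dim_col (anc_block n A a 0 * anc_block n B 0 b + anc_block n A a 1 * anc_block n B 1 b)"
  hence ij: "i < n" "j < n" by auto
  have "anc_block n (A * B) a b $$ (i, j) = (A * B) $$ (a * n + i, b * n + j)"
    using ij by (simp add: anc_block_def)
  also have "\<dots> = (\<Sum>k<2 * n. A $$ (a * n + i, k) * B $$ (k, b * n + j))"
    by (rule index_mult_mat_sum[OF A B anc_index_less[OF ab(1) ij(1)] anc_index_less[OF ab(2) ij(2)]])
  also have "\<dots> = (\<Sum>c<2. \<Sum>l<n. A $$ (a * n + i, c * n + l) * B $$ (c * n + l, b * n + j))"
    by (rule sum_lessThan_mult)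
  also have "\<dots> = (\<Sum>c<2. (anc_block n A a c * anc_block n B c b) $$ (i, j))"
    unfolding index_mult_mat_sum[OF anc_block_carrier anc_block_carrier ij]
    using ij by (intro sum.cong refl) (simp add: anc_block_def)
  also have "\<dots> = (anc_block n A a 0 * anc_block n B 0 b + anc_block n A a 1 * anc_block n B 1 b) $$ (i, j)"
    unfolding sum_lessThan_2 using ij by (subst index_add_mat) auto
  finally show "anc_block n (A * B) a b $$ (i, j) =
      (anc_block n A a 0 * anc_block n B 0 b + anc_block n A a 1 * anc_block n B 1 b) $$ (i, j)" .
qed auto

lemma anc_block_kron:
  assumes P: "P \<in> carrier_mat 2 2" and Z: "Z \<in> carrier_mat n n" and ab: "a < 2" "b < 2"
  shows "anc_block n (kron P Z) a b = P $$ (a, b) \<cdot>\<^sub>m Z"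
proof (rule eq_matI)
  fix i j assume "i < dim_row (P $$ (a, b) \<cdot>\<^sub>m Z)" "j < dim_col (P $$ (a, b) \<cdot>\<^sub>m Z)"
  hence ij: "i < n" "j < n" using Z by auto
  have "kron P Z $$ (a * n + i, b * n + j) = P $$ (a, b) * Z $$ (i, j)"
    using index_kron[of "a * n + i" P Z "b * n + j"] P Z ij anc_index_less[OF ab(1) ij(1)] anc_index_less[OF ab(2) ij(2)]
    by simp
  thus "anc_block n (kron P Z) a b $$ (i, j) = (P $$ (a, b) \<cdot>\<^sub>m Z) $$ (i, j)"
    using ij Z by (simp add: anc_block_def)
qed (use Z in auto)

lemma anc_block_add:
  assumes "B \<in> carrier_mat (2 * n) (2 * n)" "a < 2" "b < 2"
  shows "anc_block n (A + B) a b = anc_block n A a b + anc_block n B a b"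
  using assms anc_index_less by (intro eq_matI) (auto simp: anc_block_def)

lemma anc_block_adjoint:
  assumes "A \<in> carrier_mat (2 * n) (2 * n)" "a < 2" "b < 2"
  shows "anc_block n (mat_adjoint A) a b = mat_adjoint (anc_block n A b a)"
proof (rule eq_matI)
  fix i j assume "i < dim_row (mat_adjoint (anc_block n A b a))" "j < dim_col (mat_adjoint (anc_block n A b a))"
  hence ij: "i < n" "j < n" by auto
  have "mat_adjoint (anc_block n A b a) $$ (i, j) = cnj (anc_block n A b a $$ (j, i))"
    using ij by (intro index_mat_adjoint) auto
  moreover have "mat_adjoint A $$ (a * n + i, b * n + j) = cnj (A $$ (b * n + j, a * n + i))"
    using assms ij anc_index_less by (intro index_mat_adjoint) auto
  ultimately show "anc_block n (mat_adjoint A) a b $$ (i, j) = mat_adjoint (anc_block n A b a) $$ (i, j)"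
    using ij by (simp add: anc_block_def)
qed auto

text \<open>Ancilla and environment sit at opposite ends of the joint index, so cutting out an
  ancilla block commutes with attaching the environment and, in \<open>anc_block_ptrace_env\<close>,
  with tracing it out.\<close>

lemma anc_block_kron_env:
  assumes R: "R \<in> carrier_mat (2 * n) (2 * n)" and E: "E \<in> carrier_mat 2 2" and ab: "a < 2" "b < 2"
  shows "anc_block (2 * n) (kron R E) a b = kron (anc_block n R a b) E"
proof (rule eq_matI)
  fix i j assume "i < dim_row (kron (anc_block n R a b) E)" "j < dim_col (kron (anc_block n R a b) E)"
  hence ij: "i < 2 * n" "j < 2 * n" using E by auto
  have l: "a * (2 * n) + i < 2 * (2 * n)" "b * (2 * n) + j < 2 * (2 * n)"
    using anc_index_less ab ij by blast+
  have d: "(a * (2 * n) + i) div 2 = a * n + i div 2" "(a * (2 * n) + i) mod 2 = i mod 2"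
    "(b * (2 * n) + j) div 2 = b * n + j div 2" "(b * (2 * n) + j) mod 2 = j mod 2"
    unfolding mult.left_commute[of _ 2] by simp_all
  have "kron R E $$ (a * (2 * n) + i, b * (2 * n) + j) =
      R $$ (a * n + i div 2, b * n + j div 2) * E $$ (i mod 2, j mod 2)"
    using index_kron[of "a * (2 * n) + i" R E "b * (2 * n) + j"] R E l by (simp add: d)
  moreover have "kron (anc_block n R a b) E $$ (i, j) = anc_block n R a b $$ (i div 2, j div 2) * E $$ (i mod 2, j mod 2)"
    using index_kron[of i "anc_block n R a b" E j] E ij by simp
  ultimately show "anc_block (2 * n) (kron R E) a b $$ (i, j) = kron (anc_block n R a b) E $$ (i, j)"
    using ij by (simp add: anc_block_def less_mult_imp_div_less)
qed (use E in auto)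

lemma anc_block_ptrace_env:
  assumes Z: "Z \<in> carrier_mat (2 * (2 * n)) (2 * (2 * n))" and ab: "a < 2" "b < 2"
  shows "anc_block n (ptrace_env Z) a b = ptrace_env (anc_block (2 * n) Z a b)"
proof (rule eq_matI)
  note p = ptrace_env_carrier[OF anc_block_carrier[of "2 * n" Z a b]]
  fix i j assume "i < dim_row (ptrace_env (anc_block (2 * n) Z a b))" "j < dim_col (ptrace_env (anc_block (2 * n) Z a b))"
  hence ij: "i < n" "j < n" using p by auto
  note l = anc_index_less[OF ab(1) ij(1)] anc_index_less[OF ab(2) ij(2)]
  have "ptrace_env Z $$ (a * n + i, b * n + j) = Z $$ (2 * (a * n + i), 2 * (b * n + j)) +
      Z $$ (2 * (a * n + i) + 1, 2 * (b * n + j) + 1)"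
    by (rule index_ptrace_env[OF Z l])
  moreover have "2 * (c * n + k) = c * (2 * n) + 2 * k" "2 * (c * n + k) + 1 = c * (2 * n) + (2 * k + 1)" for c k
    by (simp_all add: algebra_simps)
  ultimately show "anc_block n (ptrace_env Z) a b $$ (i, j) = ptrace_env (anc_block (2 * n) Z a b) $$ (i, j)"
    unfolding index_ptrace_env[OF anc_block_carrier ij] using ij
    by (simp add: anc_block_def mult.left_commute[of 2])
qed (use ptrace_env_carrier[OF Z] ptrace_env_carrier[OF anc_block_carrier[of "2 * n" Z a b]] in auto)

lemma mtrace_anc_block:
  assumes "Z \<in> carrier_mat (2 * n) (2 * n)"
  shows "mtrace Z = mtrace (anc_block n Z 0 0) + mtrace (anc_block n Z 1 1)"
proof -
  have "mtrace Z = (\<Sum>a<2. \<Sum>i<n. Z $$ (a * n + i, a * n + i))"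
    unfolding mtrace_carrier[OF assms] by (rule sum_lessThan_mult)
  thus ?thesis unfolding sum_lessThan_2 mtrace_carrier[OF anc_block_carrier] by (simp add: anc_block_def)
qed

lemma proj_index:
  "proj0 $$ (0, 0) = 1" "proj0 $$ (0, 1) = 0" "proj0 $$ (1, 0) = 0" "proj0 $$ (1, 1) = 0"
  "proj1 $$ (0, 0) = 0" "proj1 $$ (0, 1) = 0" "proj1 $$ (1, 0) = 0" "proj1 $$ (1, 1) = 1"
  by (auto simp: proj0_def proj1_def mat_of_rows_list_def)

lemma smult_zero_one_mat:
  fixes A :: "complex mat"
  assumes "A \<in> carrier_mat n n"
  shows "0 \<cdot>\<^sub>m A = 0\<^sub>m n n" "1 \<cdot>\<^sub>m A = A"
  using assms by (auto intro!: eq_matI)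

text \<open>The two controls are complementary: the product acts as \<open>Y\<close> when the
  ancilla is 0 and as \<open>X\<close> when it is 1, so it is block diagonal.\<close>

definition gate :: "complex mat \<Rightarrow> complex mat \<Rightarrow> complex mat" where
  "gate X Y = anti_controlled Y * controlled X"

lemma controlled_carriers:
  assumes "X \<in> carrier_mat n n"
  shows "controlled X \<in> carrier_mat (2 * n) (2 * n)" "anti_controlled X \<in> carrier_mat (2 * n) (2 * n)"
  using assms kron_carrier[OF proj_carrier(1)] kron_carrier[OF proj_carrier(2)]
  by (auto simp: controlled_def anti_controlled_def intro!: add_carrier_mat)

lemma anc_block_controlled:
  assumes X: "X \<in> carrier_mat n n" and ab: "a < 2" "b < 2"
  shows "anc_block n (controlled X) a b = (if a = b then if a = 0 then 1\<^sub>m n else X else 0\<^sub>m n n)"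
    "anc_block n (anti_controlled X) a b = (if a = b then if a = 0 then X else 1\<^sub>m n else 0\<^sub>m n n)"
proof -
  have d: "dim_row X = n" using X by simp
  note k = kron_carrier[OF proj_carrier(2) X] kron_carrier[OF proj_carrier(2) one_carrier_mat[of n]]
  note bl = anc_block_kron[OF proj_carrier(1) X ab] anc_block_kron[OF proj_carrier(2) X ab]
    anc_block_kron[OF proj_carrier(1) one_carrier_mat ab, of n] anc_block_kron[OF proj_carrier(2) one_carrier_mat ab, of n]
  note z = smult_zero_one_mat[OF X] smult_zero_one_mat[OF one_carrier_mat[of n]]
  show "anc_block n (controlled X) a b = (if a = b then if a = 0 then 1\<^sub>m n else X else 0\<^sub>m n n)"
    unfolding controlled_def d anc_block_add[OF k(1) ab] bl
    using less_2_cases[OF ab(1)] less_2_cases[OF ab(2)] X z by (auto simp: proj_index[unfolded One_nat_def])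
  show "anc_block n (anti_controlled X) a b = (if a = b then if a = 0 then X else 1\<^sub>m n else 0\<^sub>m n n)"
    unfolding anti_controlled_def d anc_block_add[OF k(2) ab] bl
    using less_2_cases[OF ab(1)] less_2_cases[OF ab(2)] X z by (auto simp: proj_index[unfolded One_nat_def])
qed

lemma gate_carrier:
  "X \<in> carrier_mat n n \<Longrightarrow> Y \<in> carrier_mat n n \<Longrightarrow> gate X Y \<in> carrier_mat (2 * n) (2 * n)"
  unfolding gate_def by (intro mult_square_mat_carrier controlled_carriers)

lemma anc_block_gate:
  assumes X: "X \<in> carrier_mat n n" and Y: "Y \<in> carrier_mat n n" and ab: "a < 2" "b < 2"
  shows "anc_block n (gate X Y) a b = (if a = b then if a = 0 then Y else X else 0\<^sub>m n n)"
proof -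
  have two: "0 < (2::nat)" "1 < (2::nat)" by simp_all
  show ?thesis
    unfolding gate_def anc_block_mult[OF controlled_carriers(2)[OF Y] controlled_carriers(1)[OF X] ab]
      anc_block_controlled(2)[OF Y ab(1) two(1)] anc_block_controlled(2)[OF Y ab(1) two(2)]
      anc_block_controlled(1)[OF X two(1) ab(2)] anc_block_controlled(1)[OF X two(2) ab(2)]
    using less_2_cases[OF ab(1)] less_2_cases[OF ab(2)] X Y by auto
qed

text \<open>The gate is block diagonal, so no block of \<open>S\<close> leaks into another; this is
  why the four ancilla blocks of a run evolve independently.\<close>

lemma anc_block_gate_conjugate:
  assumes X: "X \<in> carrier_mat n n" and Y: "Y \<in> carrier_mat n n" and S: "S \<in> carrier_mat (2 * n) (2 * n)" and ab: "a < 2" "b < 2"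
  shows "anc_block n (gate X Y * S * mat_adjoint (gate X Y)) a b =
    (if a = 0 then Y else X) * anc_block n S a b * mat_adjoint (if b = 0 then Y else X)"
proof -
  note G = gate_carrier[OF X Y]
  have two: "0 < (2::nat)" "1 < (2::nat)" by simp_all
  have left: "anc_block n (gate X Y * S) a c = (if a = 0 then Y else X) * anc_block n S a c" if "c < 2" for c
    unfolding anc_block_mult[OF G S ab(1) that] anc_block_gate[OF X Y ab(1) two(1)] anc_block_gate[OF X Y ab(1) two(2)]
    using less_2_cases[OF ab(1)] X Y by auto
  have W: "(if a = 0 then Y else X) \<in> carrier_mat n n" for a :: nat using X Y by auto
  have zero: "mat_adjoint (0\<^sub>m n n) = (0\<^sub>m n n :: complex mat)" by (intro eq_matI) auto
  show ?thesis
    unfolding anc_block_mult[OF mult_square_mat_carrier[OF G S] mat_adjoint_carrier[OF G] ab]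
      left[OF two(1)] left[OF two(2)] anc_block_adjoint[OF G two(1) ab(2)] anc_block_adjoint[OF G two(2) ab(2)]
      anc_block_gate[OF X Y ab(2) two(1)] anc_block_gate[OF X Y ab(2) two(2)]
    using less_2_cases[OF ab(2)] X Y W by (auto simp: zero)
qed

text \<open>The matrix is B R B^dagger for the isometry \<open>B\<close> that sends v to the plus
  vector tensored with v.\<close>

lemma psd_plus_kron:
  assumes R: "psd R" "R \<in> carrier_mat n n"
  shows "psd (kron plus_state R)"
proof -
  define B where "B = Matrix.mat (2 * n) n (\<lambda>(k, i). if k mod n = i then complex_of_real (1 / sqrt 2) else 0)"
  have B: "B \<in> carrier_mat (2 * n) n" by (simp add: B_def)
  have plus: "plus_state \<in> carrier_mat 2 2" by (auto simp: plus_state_def mat_of_rows_list_def)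
  have half: "complex_of_real (1 / sqrt 2) * complex_of_real (1 / sqrt 2) = 1 / 2"
    unfolding of_real_mult[symmetric] by (simp add: real_sqrt_mult_self)
  have BR: "B * R \<in> carrier_mat (2 * n) n" by (rule mult_carrier_mat[OF B R(2)])
  have BRB: "B * R * mat_adjoint B \<in> carrier_mat (2 * n) (2 * n)"
    by (rule mult_carrier_mat[OF BR mat_adjoint_carrier[OF B]])
  have "B * R * mat_adjoint B = kron plus_state R"
  proof (rule eq_matI)
    fix k l assume "k < dim_row (kron plus_state R)" "l < dim_col (kron plus_state R)"
    hence kl: "k < 2 * n" "l < 2 * n" using plus R by auto
    hence n: "0 < n" by (cases n) auto
    have md: "k mod n < n" "l mod n < n" "k div n < 2" "l div n < 2"
      using kl n by (auto simp: less_mult_imp_div_less)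
    have 1: "(B * R) $$ (k, j) = complex_of_real (1 / sqrt 2) * R $$ (k mod n, j)" if "j < n" for j
    proof -
      have "(B * R) $$ (k, j) = (\<Sum>i<n. if i = k mod n then complex_of_real (1 / sqrt 2) * R $$ (k mod n, j) else 0)"
        unfolding index_mult_mat_sum[OF B R(2) kl(1) that] using kl by (intro sum.cong refl) (auto simp: B_def)
      thus ?thesis using md by simp
    qed
    have "(B * R * mat_adjoint B) $$ (k, l) = (\<Sum>j<n. (B * R) $$ (k, j) * mat_adjoint B $$ (j, l))"
      by (rule index_mult_mat_sum[OF BR mat_adjoint_carrier[OF B] kl])
    also have "\<dots> = (\<Sum>j<n. if j = l mod n then 1 / 2 * R $$ (k mod n, l mod n) else 0)"
    proof (intro sum.cong refl)
      fix j assume "j \<in> {..<n}"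
      hence j: "j < n" by simp
      have "mat_adjoint B $$ (j, l) = (if l mod n = j then complex_of_real (1 / sqrt 2) else 0)"
        using j kl B by (subst index_mat_adjoint) (auto simp: B_def)
      thus "(B * R) $$ (k, j) * mat_adjoint B $$ (j, l) = (if j = l mod n then 1 / 2 * R $$ (k mod n, l mod n) else 0)"
        unfolding 1[OF j] using half by (auto simp: mult_ac)
    qed
    also have "\<dots> = 1 / 2 * R $$ (k mod n, l mod n)" using md by simp
    also have "\<dots> = plus_state $$ (k div n, l div n) * R $$ (k mod n, l mod n)"
      using less_2_cases[OF md(3)] less_2_cases[OF md(4)] by (auto simp: plus_state_def mat_of_rows_list_def)
    also have "\<dots> = kron plus_state R $$ (k, l)"
      using index_kron[of k plus_state R l] plus R kl by simp
    finally show "(B * R * mat_adjoint B) $$ (k, l) = kron plus_state R $$ (k, l)" .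
  qed (use BRB plus R in auto)
  thus ?thesis using psd_conjugate[OF R B] by simp
qed

text \<open>Factorized as (X tensor 1)(1 tensor A): the first factor is unitary, and the second acts
  as \<open>A\<close> on both halves of a vector, whose squared lengths add up.\<close>

lemma opbound_kron_pauli_X:
  assumes A: "opbound A c" "A \<in> carrier_mat n n"
  shows "opbound (kron (pauli_mat Pauli_X) A) c"
proof -
  let ?X = "pauli_mat Pauli_X"
  note k1 = kron_carrier[OF pauli_mat_carrier[of Pauli_X] one_carrier_mat[of n]] and k2 = kron_carrier[OF one_carrier_mat[of 2] A(2)]
  have kA: "opbound (kron (1\<^sub>m 2) A) c"
  proof (rule opboundI[OF k2 opbound_nonneg[OF A(1)]])
    fix v :: "complex Matrix.vec" assume v: "v \<in> carrier_vec (2 * n)"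
    let ?s = "\<lambda>a. Matrix.vec n (\<lambda>i. vec_index v (a * n + i))"
    have s: "?s a \<in> carrier_vec n" for a by simp
    have kv: "kron (1\<^sub>m 2) A *\<^sub>v v \<in> carrier_vec (2 * n)"
      by (simp only: mult_mat_vec_carrier_iff carrier_matD(1)[OF k2])
    have entry: "vec_index (kron (1\<^sub>m 2) A *\<^sub>v v) (a * n + i) = vec_index (A *\<^sub>v ?s a) i" if a: "a < 2" and i: "i < n" for a i
    proof -
      have "vec_index (kron (1\<^sub>m 2) A *\<^sub>v v) (a * n + i) = (\<Sum>k<2 * n. kron (1\<^sub>m 2) A $$ (a * n + i, k) * vec_index v k)"
        by (rule index_mult_mat_vec_sum[OF k2 v anc_index_less[OF a i]])
      also have "\<dots> = (\<Sum>b<2. \<Sum>j<n. kron (1\<^sub>m 2) A $$ (a * n + i, b * n + j) * vec_index v (b * n + j))"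
        by (rule sum_lessThan_mult)
      also have "\<dots> = (\<Sum>b<2. if b = a then \<Sum>j<n. A $$ (i, j) * vec_index v (a * n + j) else 0)"
      proof (rule sum.cong[OF refl])
        fix b :: nat assume "b \<in> {..<2}"
        hence b: "b < 2" by simp
        have "kron (1\<^sub>m 2) A $$ (a * n + i, b * n + j) = (if a = b then A $$ (i, j) else 0)" if j: "j < n" for j
          using index_kron[of "a * n + i" "1\<^sub>m 2" A "b * n + j"] A(2) i j a b anc_index_less[OF a i] anc_index_less[OF b j]
          by simp
        thus "(\<Sum>j<n. kron (1\<^sub>m 2) A $$ (a * n + i, b * n + j) * vec_index v (b * n + j)) =
            (if b = a then \<Sum>j<n. A $$ (i, j) * vec_index v (a * n + j) else 0)" by simp
      qed
      also have "\<dots> = vec_index (A *\<^sub>v ?s a) i"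
        unfolding index_mult_mat_vec_sum[OF A(2) s i] using a by simp
      finally show ?thesis .
    qed
    have sq: "(vnorm u)\<^sup>2 = (\<Sum>a<2. \<Sum>i<n. (cmod (vec_index u (a * n + i)))\<^sup>2)" if "u \<in> carrier_vec (2 * n)" for u
      using that unfolding vnorm_power2 by (simp add: sum_lessThan_mult)
    have "(vnorm (kron (1\<^sub>m 2) A *\<^sub>v v))\<^sup>2 = (\<Sum>a<2. (vnorm (A *\<^sub>v ?s a))\<^sup>2)"
      unfolding sq[OF kv] vnorm_power2[of "A *\<^sub>v _"] using A(2) by (intro sum.cong) (auto simp: entry simp del: index_mult_mat_vec)
    also have "\<dots> \<le> (\<Sum>a<2. (c * vnorm (?s a))\<^sup>2)"
      by (intro sum_mono power_mono opboundD[OF A s]) simp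
    also have "\<dots> = c\<^sup>2 * (vnorm v)\<^sup>2"
      unfolding sq[OF v] power_mult_distrib sum_distrib_left[symmetric] vnorm_power2[of "?s _"] by simp
    finally have "(vnorm (kron (1\<^sub>m 2) A *\<^sub>v v))\<^sup>2 \<le> (c * vnorm v)\<^sup>2" by (simp add: power_mult_distrib)
    thus "vnorm (kron (1\<^sub>m 2) A *\<^sub>v v) \<le> c * vnorm v"
      by (rule power2_le_imp_le) (simp add: opbound_nonneg[OF A(1)])
  qed
  have "unitary_mat 2 ?X"
    by (rule unitary_matI[OF pauli_mat_carrier]) (simp only: pauli_mat_adjoint pauli_mat_square)
  hence "opbound (kron ?X (1\<^sub>m n)) 1"
    by (rule opbound_unitary[OF kron_unitary[OF _ unitary_mat_one]])
  from opbound_mult[OF this kA k1 k2] show ?thesis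
    unfolding kron_mult[OF pauli_mat_carrier one_carrier_mat one_carrier_mat A(2)]
      right_mult_one_mat[OF pauli_mat_carrier] left_mult_one_mat[OF A(2)] mult_1_left .
qed

section \<open>Randomized runs and the deterministic evolutions they average to\<close>

text \<open>The operators are arbitrary and recur with period m. The collision unitaries give the
  collision map and the truncated ones the mean of the algorithm, so both are instances of one
  recursion and can be compared step by step.\<close>

primrec env_evolution :: "complex mat \<Rightarrow> nat \<Rightarrow> (nat \<Rightarrow> complex mat) \<Rightarrow> complex mat \<Rightarrow> nat \<Rightarrow> complex mat" where
  "env_evolution E m A R 0 = R"
| "env_evolution E m A R (Suc k) = env_channel E (A (k mod m)) (A (k mod m)) (env_evolution E m A R k)"

lemma env_evolution_carrier:
  assumes "\<And>l. l < m \<Longrightarrow> A l \<in> carrier_mat (2 * n) (2 * n)" "0 < m" "R \<in> carrier_mat n n" "E \<in> carrier_mat 2 2"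
  shows "env_evolution E m A R k \<in> carrier_mat n n"
proof (induction k)
  case (Suc k)
  have "k mod m < m" using assms(2) by simp
  note A = assms(1)[OF this]
  show ?case using env_channel_carrier[OF A A Suc assms(4)] by simp
qed (use assms in simp)

text \<open>Every step is moved onto the observable until only the initial matrix is scaled. Later
  this removes the factor 1/2 carried by the initial ancilla blocks.\<close>

lemma mtrace_env_evolution_smult:
  assumes A: "\<And>l. l < m \<Longrightarrow> A l \<in> carrier_mat (2 * n) (2 * n)" and m: "0 < m"
    and R: "R \<in> carrier_mat n n" and E: "E \<in> carrier_mat 2 2" and X: "X \<in> carrier_mat n n"
  shows "mtrace (X * env_evolution E m A (c \<cdot>\<^sub>m R) k) = c * mtrace (X * env_evolution E m A R k)"
  using X
proof (induction k arbitrary: X)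
  case 0
  show ?case using mtrace_smult[OF mult_square_mat_carrier[OF 0 R]] by (simp add: mult_smult_distrib[OF 0 R])
next
  case (Suc k)
  have "k mod m < m" using m by simp
  note Ak = A[OF this]
  have cR: "c \<cdot>\<^sub>m R \<in> carrier_mat n n" using R by simp
  have c1: "env_evolution E m A (c \<cdot>\<^sub>m R) k \<in> carrier_mat n n"
    by (rule env_evolution_carrier[OF _ m cR E]) (rule A)
  have c2: "env_evolution E m A R k \<in> carrier_mat n n"
    by (rule env_evolution_carrier[OF _ m R E]) (rule A)
  show ?case
    unfolding env_evolution.simps mtrace_env_dual[OF Ak Ak c1 E Suc.prems] mtrace_env_dual[OF Ak Ak c2 E Suc.prems]
    by (rule Suc.IH[OF env_dual_carrier[OF Ak Ak Suc.prems E]])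
qed

text \<open>The splitting A S A^dagger - B S B^dagger = (A - B) S A^dagger + B S (A -
  B)^dagger.\<close>

lemma mtrace_env_channel_diff:
  assumes A: "A \<in> carrier_mat (2 * n) (2 * n)" and B: "B \<in> carrier_mat (2 * n) (2 * n)"
    and R: "R \<in> carrier_mat n n" and E: "E \<in> carrier_mat 2 2" and X: "X \<in> carrier_mat n n"
  shows "mtrace (X * env_channel E A A R) - mtrace (X * env_channel E B B R) =
    mtrace (X * env_channel E (A - B) A R) + mtrace (X * env_channel E B (A - B) R)"
proof -
  let ?d = "2 * n" let ?X = "kron X (1\<^sub>m 2)" let ?S = "kron R E"
  have X': "?X \<in> carrier_mat ?d ?d" and S: "?S \<in> carrier_mat ?d ?d"
    by (intro kron_env_carrier X R E one_carrier_mat)+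
  note A' = mat_adjoint_carrier[OF A] and B' = mat_adjoint_carrier[OF B]
  have AB: "A - B \<in> carrier_mat ?d ?d" by (rule minus_carrier_mat[OF B])
  note AS = mult_square_mat_carrier[OF A S] and BS = mult_square_mat_carrier[OF B S]
  note ASA = mult_square_mat_carrier[OF AS A'] and BSA = mult_square_mat_carrier[OF BS A'] and BSB = mult_square_mat_carrier[OF BS B']
  note t = mult_square_mat_carrier[OF X' ASA] mult_square_mat_carrier[OF X' BSA] mult_square_mat_carrier[OF X' BSB]
  have 1: "(A - B) * ?S * mat_adjoint A = A * ?S * mat_adjoint A - B * ?S * mat_adjoint A"
    unfolding minus_mult_distrib_mat[OF A B S] minus_mult_distrib_mat[OF AS BS A'] ..
  have 2: "B * ?S * mat_adjoint (A - B) = B * ?S * mat_adjoint A - B * ?S * mat_adjoint B"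
    unfolding mat_adjoint_minus[OF A B] mult_minus_distrib_mat[OF BS A' B'] ..
  show ?thesis
    unfolding mtrace_env_channel[OF A A R E X] mtrace_env_channel[OF B B R E X]
      mtrace_env_channel[OF AB A R E X] mtrace_env_channel[OF B AB R E X] 1 2
      mult_minus_distrib_mat[OF X' ASA BSA] mult_minus_distrib_mat[OF X' BSA BSB]
      mtrace_minus[OF t(1,2)] mtrace_minus[OF t(2,3)]
    by simp
qed

text \<open>The last step is moved onto the observable, so the induction ranges over all
  \<open>X\<close>; a truncated step multiplies the bound of the observable by (1 + e)^2, an exact
  one keeps it. The first claim feeds the second: one step adds the defect e(1 + e) + e = (1 + e)^2
  - 1 times the bound s = (1 + e)^(2k) of the truncated evolution, and s ((1 + e)^2 - 1) + (s - 1) =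
  s (1 + e)^2 - 1.\<close>

lemma env_evolution_error:
  assumes A: "\<And>l. l < m \<Longrightarrow> A l \<in> carrier_mat (2 * n) (2 * n)" and B: "\<And>l. l < m \<Longrightarrow> B l \<in> carrier_mat (2 * n) (2 * n)"
    and m: "0 < m" and Bb: "\<And>l. l < m \<Longrightarrow> opbound (B l) 1" and AB: "\<And>l. l < m \<Longrightarrow> opbound (A l - B l) e"
    and \<rho>: "density_op n \<rho>" and E: "qubit_diag E w" and w: "0 \<le> w 0" "0 \<le> w 1" "w 0 + w 1 = 1"
    and X: "opbound X x" "X \<in> carrier_mat n n"
  shows "cmod (mtrace (X * env_evolution E m A \<rho> k)) \<le> x * (1 + e) ^ (2 * k)"
    and "cmod (mtrace (X * env_evolution E m A \<rho> k) - mtrace (X * env_evolution E m B \<rho> k)) \<le> x * ((1 + e) ^ (2 * k) - 1)"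
  using X
proof (induction k arbitrary: X x)
  case 0
  have \<rho>c: "\<rho> \<in> carrier_mat n n" using \<rho> by (simp add: density_op_def)
  {
    case 1
    show ?case using mtrace_mult_le_trace_norm[OF 1 \<rho>c] by (simp add: trace_norm_density[OF \<rho>])
  next
    case 2
    show ?case by simp
  }
next
  case (Suc k)
  have \<rho>c: "\<rho> \<in> carrier_mat n n" using \<rho> by (simp add: density_op_def)
  note E' = qubit_diagD(1)[OF E]
  have l: "k mod m < m" using m by simp
  let ?A = "A (k mod m)" and ?B = "B (k mod m)"
  let ?a = "env_evolution E m A \<rho> k" and ?b = "env_evolution E m B \<rho> k"
  note Ac = A[OF l] and Bc = B[OF l] and Bo = Bb[OF l] and ABo = AB[OF l]
  have ABc: "?A - ?B \<in> carrier_mat (2 * n) (2 * n)" by (rule minus_carrier_mat[OF Bc])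
  note e = opbound_nonneg[OF ABo]
  have ac: "?a \<in> carrier_mat n n" by (rule env_evolution_carrier[OF _ m \<rho>c E']) (rule A)
  have bc: "?b \<in> carrier_mat n n" by (rule env_evolution_carrier[OF _ m \<rho>c E']) (rule B)
  have Ao: "opbound ?A (1 + e)"
  proof -
    have "?A = ?B + (?A - ?B)" using Ac Bc by (intro eq_matI) auto
    thus ?thesis using opbound_add[OF Bo ABo Bc ABc] by simp
  qed
  {
    case (1 X x)
    note Xc = 1(2)
    have "mtrace (X * env_evolution E m A \<rho> (Suc k)) = mtrace (env_dual n E ?A ?A X * ?a)"
      unfolding env_evolution.simps by (rule mtrace_env_dual[OF Ac Ac ac E' Xc])
    also have "cmod \<dots> \<le> (1 + e) * (1 + e) * x * (1 + e) ^ (2 * k)"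
      by (rule Suc.IH(1)[OF opbound_env_dual[OF Ao Ac Ao Ac 1 E w] env_dual_carrier[OF Ac Ac Xc E']])
    also have "\<dots> = x * (1 + e) ^ (2 * Suc k)" by simp
    finally show ?case .
  next
    case (2 X x)
    note Xc = 2(2)
    have "mtrace (X * env_evolution E m A \<rho> (Suc k)) - mtrace (X * env_evolution E m B \<rho> (Suc k)) =
        (mtrace (X * env_channel E ?A ?A ?a) - mtrace (X * env_channel E ?B ?B ?a)) +
        (mtrace (X * env_channel E ?B ?B ?a) - mtrace (X * env_channel E ?B ?B ?b))" by simp
    also have "\<dots> = mtrace (env_dual n E (?A - ?B) ?A X * ?a) + mtrace (env_dual n E ?B (?A - ?B) X * ?a) +
        (mtrace (env_dual n E ?B ?B X * ?a) - mtrace (env_dual n E ?B ?B X * ?b))"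
    proof -
      have "mtrace (X * env_channel E ?A ?A ?a) - mtrace (X * env_channel E ?B ?B ?a) =
          mtrace (env_dual n E (?A - ?B) ?A X * ?a) + mtrace (env_dual n E ?B (?A - ?B) X * ?a)"
        unfolding mtrace_env_channel_diff[OF Ac Bc ac E' Xc] mtrace_env_dual[OF ABc Ac ac E' Xc]
          mtrace_env_dual[OF Bc ABc ac E' Xc] ..
      moreover have "mtrace (X * env_channel E ?B ?B ?a) - mtrace (X * env_channel E ?B ?B ?b) =
          mtrace (env_dual n E ?B ?B X * ?a) - mtrace (env_dual n E ?B ?B X * ?b)"
        unfolding mtrace_env_dual[OF Bc Bc ac E' Xc] mtrace_env_dual[OF Bc Bc bc E' Xc] ..
      ultimately show ?thesis by (simp only:)
    qed
    also have "cmod \<dots> \<le> (e * (1 + e) * x * (1 + e) ^ (2 * k) + 1 * e * x * (1 + e) ^ (2 * k)) +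
        1 * 1 * x * ((1 + e) ^ (2 * k) - 1)"
      by (intro norm_triangle_mono Suc.IH opbound_env_dual[OF ABo ABc Ao Ac 2 E w]
          opbound_env_dual[OF Bo Bc ABo ABc 2 E w] opbound_env_dual[OF Bo Bc Bo Bc 2 E w]
          env_dual_carrier Ac Bc ABc Xc E')
    also have "\<dots> = x * ((1 + e) ^ (2 * Suc k) - 1)" by (simp add: algebra_simps power2_eq_square)
    finally show ?case .
  }
qed

section \<open>Finite expectations and the environment state\<close>

lemma expectation_finite:
  fixes f :: "'a \<Rightarrow> 'b::{banach, second_countable_topology}"
  assumes "finite S" "set_pmf p \<subseteq> S"
  shows "measure_pmf.expectation p f = (\<Sum>x\<in>S. pmf p x *\<^sub>R f x)"
  by (rule integral_measure_pmf) (use assms in auto)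

lemma expectation_pair_finite:
  fixes f :: "'a \<times> 'b \<Rightarrow> 'c::{banach, second_countable_topology}"
  assumes "finite S" "set_pmf p \<subseteq> S" "finite (set_pmf q)"
  shows "measure_pmf.expectation (pair_pmf p q) f =
    (\<Sum>y\<in>set_pmf q. pmf q y *\<^sub>R (\<Sum>x\<in>S. pmf p x *\<^sub>R f (x, y)))"
proof -
  have "measure_pmf.expectation (pair_pmf p q) f = (\<Sum>z\<in>S \<times> set_pmf q. pmf (pair_pmf p q) z *\<^sub>R f z)"
    using assms by (intro expectation_finite) auto
  also have "\<dots> = (\<Sum>x\<in>S. \<Sum>y\<in>set_pmf q. (pmf p x * pmf q y) *\<^sub>R f (x, y))"
    unfolding sum.cartesian_product by (intro sum.cong refl) (auto simp: pmf_pair)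
  also have "\<dots> = (\<Sum>y\<in>set_pmf q. \<Sum>x\<in>S. (pmf p x * pmf q y) *\<^sub>R f (x, y))" by (rule sum.swap)
  finally show ?thesis by (simp add: scaleR_sum_right mult.commute)
qed

lemma plus_state_carrier: "plus_state \<in> carrier_mat 2 2"
  by (auto simp: plus_state_def mat_of_rows_list_def)

lemma plus_state_index: "a < 2 \<Longrightarrow> b < 2 \<Longrightarrow> plus_state $$ (a, b) = 1 / 2"
  using less_2_cases[of a] less_2_cases[of b] by (auto simp: plus_state_def mat_of_rows_list_def)

lemma env_state_diag:
  "qubit_diag (env_state M) (\<lambda>e. if e = 0 then 1 / (1 + exp (- inv_temp M)) else exp (- inv_temp M) / (1 + exp (- inv_temp M)))"
proof -
  have "env_state M $$ (i, j) = (if i = j then complex_of_real (if i = 0 then 1 / (1 + exp (- inv_temp M))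
      else exp (- inv_temp M) / (1 + exp (- inv_temp M))) else 0)" if "i < 2" "j < 2" for i j
    using less_2_cases[OF that(1)] less_2_cases[OF that(2)]
    by (auto simp: env_state_def proj0_def proj1_def mat_of_rows_list_def)
  thus ?thesis by (simp add: qubit_diag_def)
qed

lemma env_state_weights:
  "1 / (1 + exp (- s)) + exp (- s) / (1 + exp (- s)) = (1::real)" "0 \<le> 1 / (1 + exp (- s :: real))"
  "0 \<le> exp (- s) / (1 + exp (- s :: real))"
proof -
  have "0 < 1 + exp (- s)" by (simp add: add_pos_pos)
  thus "1 / (1 + exp (- s)) + exp (- s) / (1 + exp (- s)) = (1::real)" by (simp add: add_divide_distrib[symmetric])
  show "0 \<le> 1 / (1 + exp (- s :: real))" "0 \<le> exp (- s) / (1 + exp (- s :: real))"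
    by (simp_all add: add_nonneg_nonneg)
qed

text \<open>The state after k collisions depends on the first k samples alone, which allows the
  sample of the next collision to be split off.\<close>

lemma run_state_cong:
  "(\<And>j. j < k \<Longrightarrow> xy j = xy' j) \<Longrightarrow> run_state M t \<nu> r \<rho> xy k = run_state M t \<nu> r \<rho> xy' k"
  by (induction k) auto

text \<open>Fixes the parameters of the algorithm. Even truncation orders have the form 2p, for
  which the segment operator is a Taylor polynomial; the sizes of \<open>r\<close> and
  \<open>q\<close> are left open and restricted only where an estimate asks for it.\<close>

locale lcu_run =
  fixes M :: collision_model and t :: real and \<nu> :: nat and r q :: "nat \<Rightarrow> nat"
  assumes wf: "wf_collision_model M" and t: "0 < t" and \<nu>: "0 < \<nu>"
    and q: "\<And>l. l < num_envs M \<Longrightarrow> even (q l)"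
begin

abbreviation "terms l \<equiv> col_terms M (coupling t \<nu>) l"
abbreviation "step_time l \<equiv> segment_time M t \<nu> r l"
abbreviation "indices l \<equiv> lcu_index (terms l) (q l) (r l)"
abbreviation "weight l \<equiv> lcu_weight (terms l) (q l) (r l) (step_time l)"
abbreviation "sampled l \<equiv> sampled_unitary M t \<nu> r l"
abbreviation "approx l \<equiv> approx_unitary M t \<nu> r q l"

lemma num_envs_pos: "0 < num_envs M"
  using wf by (simp add: wf_collision_model_def)

lemma time_step_pos: "0 < time_step t \<nu>"
  using t \<nu> by (simp add: time_step_def)

lemma coupling_pos: "0 < coupling t \<nu>"
  using time_step_pos by (simp add: coupling_def)

lemma collision_terms:
  assumes "l < num_envs M"
  shows "0 \<le> col_weight M (coupling t \<nu>) l"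
    "convex_on_qubits (Suc (num_qubits M)) (terms l)"
    "complex_of_real (col_weight M (coupling t \<nu>) l) \<cdot>\<^sub>m convex_sum (Suc (num_qubits M)) (terms l) =
      collision_ham M (coupling t \<nu>) l"
  using wf assms coupling_pos unfolding wf_collision_model_def by blast+

lemma step_time_nonneg: "l < num_envs M \<Longrightarrow> 0 \<le> step_time l"
  using collision_terms(1)[of l] time_step_pos by (simp add: segment_time_def col_time_def)

lemma collision_unitary_unitary:
  assumes l: "l < num_envs M"
  shows "unitary_mat (2 * sys_dim M) (collision_unitary M t \<nu> l)"
proof -
  note ct = collision_terms[OF l]
  obtain U h where "unitary_mat (2 ^ Suc (num_qubits M)) U"
    and h: "convex_sum (Suc (num_qubits M)) (terms l) = conj_diag (2 ^ Suc (num_qubits M)) U (\<lambda>i. complex_of_real (h i))"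
    using convex_sum_diag[OF ct(2)] by metis
  have "mat_adjoint (convex_sum (Suc (num_qubits M)) (terms l)) = convex_sum (Suc (num_qubits M)) (terms l)"
    unfolding h conj_diag_adjoint by simp
  hence "mat_adjoint (collision_ham M (coupling t \<nu>) l) = collision_ham M (coupling t \<nu>) l"
    unfolding ct(3)[symmetric] by simp
  thus ?thesis unfolding collision_unitary_def
    by (intro unitary_mexp_hermitian collision_ham_carrier hermitianI[OF collision_ham_carrier])
qed

lemma approx_carrier: "approx l \<in> carrier_mat (2 * sys_dim M) (2 * sys_dim M)"
  unfolding approx_unitary_def segment_op_def by (intro pow_carrier_mat mat_Sum_carrier)

lemma approx_error:
  assumes l: "l < num_envs M" and r: "0 < r l" and x: "step_time l \<le> 1"
  shows "opbound (approx l - collision_unitary M t \<nu> l) ((1 + 1 / fact (q l + 1)) ^ r l - 1)"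
proof -
  note ct = collision_terms[OF l]
  obtain p where p: "q l = 2 * p" using q[OF l] by (elim evenE)
  have "real (r l) * step_time l = col_weight M (coupling t \<nu>) l * time_step t \<nu>"
    using r by (simp add: segment_time_def col_time_def)
  hence "mexp ((- \<i> * complex_of_real (real (r l) * step_time l)) \<cdot>\<^sub>m convex_sum (Suc (num_qubits M)) (terms l)) =
      collision_unitary M t \<nu> l"
    unfolding collision_unitary_def ct(3)[symmetric] smult_smult_mat by (simp add: mult_ac)
  with segment_power_error[OF ct(2) step_time_nonneg[OF l] x, of p "r l"] show ?thesis
    unfolding p approx_unitary_def by simp
qed

lemma weight_ge_1:
  assumes l: "l < num_envs M"
  shows "1 \<le> weight l" "weight l \<le> exp (real (r l) * (step_time l)\<^sup>2)"
proof -
  obtain p where p: "q l = 2 * p" using q[OF l] by (elim evenE)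
  show "1 \<le> weight l" "weight l \<le> exp (real (r l) * (step_time l)\<^sup>2)"
    unfolding p by (rule lcu_weight_bounds[OF collision_terms(2)[OF l] step_time_nonneg[OF l]])+
qed

lemma sampled_unitary_unitary:
  assumes "l < num_envs M" "bs \<in> indices l"
  shows "unitary_mat (2 * sys_dim M) (sampled l bs)"
  using lcu_unitary[OF collision_terms(2)[OF assms(1)] assms(2)] by (simp add: sampled_unitary_def)

text \<open>Sampling probabilities are coefficients divided by the weight, so the mean of a sample
  is the truncated operator divided by the weight. The weights undo this through
  \<open>zeta\<close>.\<close>

lemma sample_pmf:
  assumes l: "l < num_envs M"
  shows "set_pmf (sample_pmf M t \<nu> r q l) \<subseteq> indices l"
    "mat_Sum (2 * sys_dim M) (\<lambda>bs. complex_of_real (pmf (sample_pmf M t \<nu> r q l) bs) \<cdot>\<^sub>m sampled l bs) (indices l) =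
      complex_of_real (1 / weight l) \<cdot>\<^sub>m approx l"
proof -
  note ct = collision_terms[OF l] and x = step_time_nonneg[OF l]
  obtain p where p: "q l = 2 * p" using q[OF l] by (elim evenE)
  note pm = lcu_pmf[OF ct(2) x, of p "r l", folded p]
  show "set_pmf (sample_pmf M t \<nu> r q l) \<subseteq> indices l"
    unfolding sample_pmf_def by (rule pm(2))
  let ?d = "2 * sys_dim M"
  have W: "sampled l bs \<in> carrier_mat ?d ?d" if "bs \<in> indices l" for bs
    by (rule unitary_matD(1)[OF sampled_unitary_unitary[OF l that]])
  have "mat_Sum ?d (\<lambda>bs. complex_of_real (pmf (sample_pmf M t \<nu> r q l) bs) \<cdot>\<^sub>m sampled l bs) (indices l) =
      mat_Sum ?d (\<lambda>bs. complex_of_real (1 / weight l) \<cdot>\<^sub>m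
        (complex_of_real (lcu_coeff (terms l) (step_time l) bs) \<cdot>\<^sub>m sampled l bs)) (indices l)"
    by (rule mat_Sum_cong) (simp add: sample_pmf_def pm(1) smult_smult_mat)
  also have "\<dots> = complex_of_real (1 / weight l) \<cdot>\<^sub>m
      mat_Sum ?d (\<lambda>bs. complex_of_real (lcu_coeff (terms l) (step_time l) bs) \<cdot>\<^sub>m sampled l bs) (indices l)"
    by (rule smult_mat_Sum[symmetric]) (intro smult_carrier_mat W)
  also have "mat_Sum ?d (\<lambda>bs. complex_of_real (lcu_coeff (terms l) (step_time l) bs) \<cdot>\<^sub>m sampled l bs) (indices l) = approx l"
    using lcu_expansion[OF ct(2), of "step_time l" "q l" "r l"] by (simp add: sampled_unitary_def approx_unitary_def)
  finally show "mat_Sum ?d (\<lambda>bs. complex_of_real (pmf (sample_pmf M t \<nu> r q l) bs) \<cdot>\<^sub>m sampled l bs) (indices l) =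
      complex_of_real (1 / weight l) \<cdot>\<^sub>m approx l" .
qed

text \<open>Satisfied by every sample of positive probability. Invariants of a run are proved under
  this condition, which makes all matrices applied before step k unitary.\<close>

definition valid :: "nat \<Rightarrow> sample \<Rightarrow> bool" where
  "valid k xy \<longleftrightarrow> (\<forall>j<k. fst (xy j) \<in> indices (j mod num_envs M) \<and> snd (xy j) \<in> indices (j mod num_envs M))"

lemma env_index_less: "j mod num_envs M < num_envs M"
  using num_envs_pos by simp

abbreviation "step_pmf j \<equiv> pair_pmf (sample_pmf M t \<nu> r q (j mod num_envs M)) (sample_pmf M t \<nu> r q (j mod num_envs M))"
text \<open>The law of the first k pairs, introduced so that means can be computed by induction on
  k; at k = m * \<nu> it is \<open>samples_pmf\<close>.\<close>

abbreviation "prefix_pmf k \<equiv> Pi_pmf {..<k} ([], []) step_pmf"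

lemma step_pmf_finite: "finite (indices (j mod num_envs M) \<times> indices (j mod num_envs M))"
    "set_pmf (step_pmf j) \<subseteq> indices (j mod num_envs M) \<times> indices (j mod num_envs M)"
  using sample_pmf(1)[OF env_index_less, of j] by (auto simp: lcu_index_finite)

lemma prefix_pmf:
  shows "finite (set_pmf (prefix_pmf k))" "xy \<in> set_pmf (prefix_pmf k) \<Longrightarrow> valid k xy"
proof -
  have s: "set_pmf (prefix_pmf k) = PiE_dflt {..<k} ([], []) (\<lambda>j. set_pmf (step_pmf j))"
    by (simp add: set_Pi_pmf comp_def)
  show "finite (set_pmf (prefix_pmf k))"
    unfolding s by (intro finite_PiE_dflt finite_subset[OF step_pmf_finite(2) step_pmf_finite(1)]) auto
  assume "xy \<in> set_pmf (prefix_pmf k)"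
  hence "xy j \<in> indices (j mod num_envs M) \<times> indices (j mod num_envs M)" if "j < k" for j
    using that step_pmf_finite(2)[of j] unfolding s PiE_dflt_def by blast
  thus "valid k xy" unfolding valid_def by (metis mem_Times_iff)
qed

lemma zeta_pos: "0 < zeta M t \<nu> r q"
  unfolding zeta_def Let_def
proof (intro prod_pos ballI)
  fix j
  from weight_ge_1(1)[OF env_index_less, of j] show "0 < weight (j mod num_envs M)" by linarith
qed

context
  fixes \<rho> :: "complex mat"
  assumes \<rho>: "density_op (sys_dim M) \<rho>"
begin

abbreviation "run xy k \<equiv> run_state M t \<nu> r \<rho> xy k"

lemma rho: "\<rho> \<in> carrier_mat (sys_dim M) (sys_dim M)" "psd \<rho>" "mtrace \<rho> = 1"
  using \<rho> by (auto simp: density_op_def)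

lemma run_step:
  "run xy (Suc k) = ptrace_env (gate (sampled (k mod num_envs M) (fst (xy k))) (sampled (k mod num_envs M) (snd (xy k))) *
     kron (run xy k) (env_state M) *
     mat_adjoint (gate (sampled (k mod num_envs M) (fst (xy k))) (sampled (k mod num_envs M) (snd (xy k)))))"
  by (simp add: gate_def Let_def)

lemma run_carrier_psd:
  assumes "valid k xy"
  shows "run xy k \<in> carrier_mat (2 * sys_dim M) (2 * sys_dim M) \<and> psd (run xy k)"
  using assms
proof (induction k)
  case 0
  show ?case using kron_carrier[OF plus_state_carrier rho(1)] psd_plus_kron[OF rho(2,1)] by simp
next
  case (Suc k)
  let ?d = "2 * sys_dim M"
  let ?X = "sampled (k mod num_envs M) (fst (xy k))" and ?Y = "sampled (k mod num_envs M) (snd (xy k))"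
  have "valid k xy" using Suc.prems by (simp add: valid_def)
  with Suc.IH have IH: "run xy k \<in> carrier_mat ?d ?d" "psd (run xy k)" by simp_all
  have "fst (xy k) \<in> indices (k mod num_envs M)" "snd (xy k) \<in> indices (k mod num_envs M)"
    using Suc.prems by (simp_all add: valid_def)
  hence G: "gate ?X ?Y \<in> carrier_mat (2 * ?d) (2 * ?d)"
    by (intro gate_carrier unitary_matD(1) sampled_unitary_unitary env_index_less)
  note S = kron_env_carrier[OF IH(1) env_state_carrier[of M]]
  have pS: "psd (kron (run xy k) (env_state M))"
    by (rule psd_kron_env[OF IH(2,1) env_state_diag]) (simp add: env_state_weights)
  have "gate ?X ?Y * kron (run xy k) (env_state M) * mat_adjoint (gate ?X ?Y) \<in> carrier_mat (2 * ?d) (2 * ?d)"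
    by (intro mult_square_mat_carrier G S mat_adjoint_carrier)
  thus ?case unfolding run_step
    using ptrace_env_carrier psd_ptrace_env[OF psd_conjugate[OF pS S G]] by blast
qed

text \<open>Each ancilla block passes through a channel of its own, with the sample belonging to a
  on the left and the one belonging to b on the right: \<open>Y\<close> for 0 and \<open>X\<close>
  for 1.\<close>

lemma run_block_step:
  assumes v: "valid (Suc k) xy" and ab: "a < 2" "b < 2"
  shows "anc_block (sys_dim M) (run xy (Suc k)) a b = env_channel (env_state M)
    (sampled (k mod num_envs M) (if a = 0 then snd (xy k) else fst (xy k)))
    (sampled (k mod num_envs M) (if b = 0 then snd (xy k) else fst (xy k))) (anc_block (sys_dim M) (run xy k) a b)"
proof -
  let ?d = "2 * sys_dim M" let ?l = "k mod num_envs M"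
  let ?X = "sampled ?l (fst (xy k))" and ?Y = "sampled ?l (snd (xy k))"
  have "valid k xy" using v by (simp add: valid_def)
  hence R: "run xy k \<in> carrier_mat ?d ?d" using run_carrier_psd by blast
  have i: "fst (xy k) \<in> indices ?l" "snd (xy k) \<in> indices ?l" using v by (simp_all add: valid_def)
  note X = unitary_matD(1)[OF sampled_unitary_unitary[OF env_index_less i(1)]]
  note Y = unitary_matD(1)[OF sampled_unitary_unitary[OF env_index_less i(2)]]
  note G = gate_carrier[OF X Y] and S = kron_env_carrier[OF R env_state_carrier[of M]]
  have GSG: "gate ?X ?Y * kron (run xy k) (env_state M) * mat_adjoint (gate ?X ?Y) \<in> carrier_mat (2 * ?d) (2 * ?d)"
    by (intro mult_square_mat_carrier G S mat_adjoint_carrier)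
  show ?thesis
    unfolding run_step anc_block_ptrace_env[OF GSG ab] anc_block_gate_conjugate[OF X Y S ab]
      anc_block_kron_env[OF R env_state_carrier ab] env_channel_def
    using ab by (simp only: if_distrib[of "sampled ?l"])
qed

lemma run_block_0:
  assumes "a < 2" "b < 2"
  shows "anc_block (sys_dim M) (run xy 0) a b = (1 / 2) \<cdot>\<^sub>m \<rho>"
  using anc_block_kron[OF plus_state_carrier rho(1) assms] plus_state_index[OF assms] by simp

text \<open>A diagonal block sees the same unitary on both sides and so keeps its trace 1/2. Being a
  state is what the Born statistics of the final measurement require.\<close>

lemma run_density:
  assumes "valid k xy"
  shows "density_op (2 * sys_dim M) (run xy k)"
proof -
  have half: "mtrace (anc_block (sys_dim M) (run xy k) a a) = 1 / 2" if a: "a < 2" for a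
    using assms
  proof (induction k)
    case 0
    show ?case unfolding run_block_0[OF a a] mtrace_smult[OF rho(1)] rho(3) by simp
  next
    case (Suc k)
    let ?l = "k mod num_envs M"
    have v: "valid k xy" using Suc.prems by (simp add: valid_def)
    have "(if a = 0 then snd (xy k) else fst (xy k)) \<in> indices ?l" using Suc.prems by (simp add: valid_def)
    from sampled_unitary_unitary[OF env_index_less this]
    show ?case unfolding run_block_step[OF Suc.prems a a]
      using mtrace_env_channel_isometry[OF _ anc_block_carrier env_state_diag] Suc.IH[OF v] by (simp add: env_state_weights)
  qed
  have two: "0 < (2::nat)" "1 < (2::nat)" by simp_all
  have c: "run xy k \<in> carrier_mat (2 * sys_dim M) (2 * sys_dim M)" "psd (run xy k)"
    using run_carrier_psd[OF assms] by blast+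
  moreover have "mtrace (run xy k) = 1"
    unfolding mtrace_anc_block[OF c(1)] half[OF two(1)] half[OF two(2)] by simp
  ultimately show ?thesis by (simp add: density_op_def)
qed

text \<open>The expression is bilinear in the two sampled unitaries and the samples are independent,
  so both may be replaced by their mean. The result is put on the observable side, ready for
  induction.\<close>

lemma mean_step:
  assumes R: "R \<in> carrier_mat (sys_dim M) (sys_dim M)" and X: "X \<in> carrier_mat (sys_dim M) (sys_dim M)" and l: "l < num_envs M"
  shows "(\<Sum>x\<in>indices l. \<Sum>y\<in>indices l. complex_of_real (pmf (sample_pmf M t \<nu> r q l) x * pmf (sample_pmf M t \<nu> r q l) y) *
      mtrace (X * env_channel (env_state M) (sampled l x) (sampled l y) R)) =
    complex_of_real (1 / (weight l)\<^sup>2) * mtrace (env_dual (sys_dim M) (env_state M) (approx l) (approx l) X * R)"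
proof -
  let ?p = "pmf (sample_pmf M t \<nu> r q l)" and ?E = "env_state M"
  let ?f = "\<lambda>x. complex_of_real (?p x) \<cdot>\<^sub>m sampled l x"
  have W: "sampled l x \<in> carrier_mat (2 * sys_dim M) (2 * sys_dim M)" if "x \<in> indices l" for x
    by (rule unitary_matD(1)[OF sampled_unitary_unitary[OF l that]])
  have f: "?f x \<in> carrier_mat (2 * sys_dim M) (2 * sys_dim M)" if "x \<in> indices l" for x
    by (intro smult_carrier_mat W that)
  note V = approx_carrier[of l]
  have "(\<Sum>x\<in>indices l. \<Sum>y\<in>indices l. complex_of_real (?p x * ?p y) * mtrace (X * env_channel ?E (sampled l x) (sampled l y) R)) =
      (\<Sum>x\<in>indices l. \<Sum>y\<in>indices l. mtrace (X * env_channel ?E (?f x) (?f y) R))"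
    by (intro sum.cong refl) (rule mtrace_env_channel_smult[OF W W R env_state_carrier X, symmetric])
  also have "\<dots> = mtrace (X * env_channel ?E (mat_Sum (2 * sys_dim M) ?f (indices l)) (mat_Sum (2 * sys_dim M) ?f (indices l)) R)"
    by (rule mtrace_env_channel_mat_Sum[OF f f R env_state_carrier X, symmetric])
  also have "\<dots> = complex_of_real (1 / weight l * (1 / weight l)) * mtrace (X * env_channel ?E (approx l) (approx l) R)"
    unfolding sample_pmf(2)[OF l] by (rule mtrace_env_channel_smult[OF V V R env_state_carrier X])
  also have "mtrace (X * env_channel ?E (approx l) (approx l) R) = mtrace (env_dual (sys_dim M) ?E (approx l) (approx l) X * R)"
    by (rule mtrace_env_dual[OF V V R env_state_carrier X])
  finally show ?thesis by (simp add: power2_eq_square)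
qed

text \<open>Induction over the collisions for all \<open>X\<close>: averaging over the last pair
  replaces \<open>X\<close> by its dual and contributes the inverse square of the weight; what is
  left is an expectation over a shorter prefix.\<close>

lemma expectation_block:
  assumes ab: "(a, b) = (0, 1) \<or> (a, b) = (1, 0)" and X: "X \<in> carrier_mat (sys_dim M) (sys_dim M)"
  shows "measure_pmf.expectation (prefix_pmf k) (\<lambda>xy. mtrace (X * anc_block (sys_dim M) (run xy k) a b)) =
    complex_of_real (\<Prod>j<k. 1 / (weight (j mod num_envs M))\<^sup>2) *
    mtrace (X * env_evolution (env_state M) (num_envs M) approx ((1 / 2) \<cdot>\<^sub>m \<rho>) k)"
  using X
proof (induction k arbitrary: X)
  case 0
  have "a < 2" "b < 2" using ab by auto
  from run_block_0[OF this] show ?case by simp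
next
  case (Suc k)
  let ?n = "sys_dim M" let ?l = "k mod num_envs M" let ?E = "env_state M"
  let ?I = "indices ?l" let ?p = "pmf (sample_pmf M t \<nu> r q ?l)" let ?w = "weight ?l"
  let ?X = "env_dual ?n ?E (approx ?l) (approx ?l) X"
  have ab2: "a < 2" "b < 2" using ab by auto
  note l = env_index_less[of k] and V = approx_carrier[of ?l]
  note X = Suc.prems
  have Xc: "?X \<in> carrier_mat ?n ?n" by (rule env_dual_carrier[OF V V X env_state_carrier])
  have step: "(\<Sum>z\<in>?I \<times> ?I. pmf (step_pmf k) z *\<^sub>R mtrace (X * anc_block ?n (run (f(k := z)) (Suc k)) a b)) =
      complex_of_real (1 / ?w\<^sup>2) * mtrace (?X * anc_block ?n (run f k) a b)" if f: "f \<in> set_pmf (prefix_pmf k)" for f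
  proof -
    let ?R = "anc_block ?n (run f k) a b"
    have vf: "valid k f" by (rule prefix_pmf(2)[OF f])
    have "(\<Sum>z\<in>?I \<times> ?I. pmf (step_pmf k) z *\<^sub>R mtrace (X * anc_block ?n (run (f(k := z)) (Suc k)) a b)) =
        (\<Sum>x\<in>?I. \<Sum>y\<in>?I. complex_of_real (?p x * ?p y) *
          mtrace (X * env_channel ?E (sampled ?l (if a = 0 then y else x)) (sampled ?l (if b = 0 then y else x)) ?R))"
      unfolding sum.cartesian_product
    proof (intro sum.cong refl)
      fix z assume z: "z \<in> ?I \<times> ?I"
      obtain x y where xy: "z = (x, y)" by (cases z)
      have v: "valid (Suc k) (f(k := z))"
        using vf z by (auto simp: valid_def less_Suc_eq xy)
      have "run (f(k := z)) k = run f k" by (rule run_state_cong) simp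
      hence "anc_block ?n (run (f(k := z)) (Suc k)) a b =
          env_channel ?E (sampled ?l (if a = 0 then y else x)) (sampled ?l (if b = 0 then y else x)) ?R"
        unfolding run_block_step[OF v ab2] by (simp add: xy)
      thus "pmf (step_pmf k) z *\<^sub>R mtrace (X * anc_block ?n (run (f(k := z)) (Suc k)) a b) =
          (case z of (x, y) \<Rightarrow> complex_of_real (?p x * ?p y) *
          mtrace (X * env_channel ?E (sampled ?l (if a = 0 then y else x)) (sampled ?l (if b = 0 then y else x)) ?R))"
        unfolding xy by (simp add: pmf_pair scaleR_conv_of_real)
    qed
    \<comment> \<open>Both samples have the same law, so exchanging their names reduces block (0, 1)
      to block (1, 0).\<close>
    also have "\<dots> = (\<Sum>x\<in>?I. \<Sum>y\<in>?I. complex_of_real (?p x * ?p y) *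
          mtrace (X * env_channel ?E (sampled ?l x) (sampled ?l y) ?R))"
      using ab
    proof
      assume "(a, b) = (0, 1)"
      hence "(\<Sum>x\<in>?I. \<Sum>y\<in>?I. complex_of_real (?p x * ?p y) *
          mtrace (X * env_channel ?E (sampled ?l (if a = 0 then y else x)) (sampled ?l (if b = 0 then y else x)) ?R)) =
          (\<Sum>x\<in>?I. \<Sum>y\<in>?I. complex_of_real (?p y * ?p x) * mtrace (X * env_channel ?E (sampled ?l y) (sampled ?l x) ?R))"
        by (simp add: mult.commute)
      also have "\<dots> = (\<Sum>x\<in>?I. \<Sum>y\<in>?I. complex_of_real (?p x * ?p y) * mtrace (X * env_channel ?E (sampled ?l x) (sampled ?l y) ?R))"
        by (rule sum.swap)
      finally show ?thesis .
    qed simp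
    also have "\<dots> = complex_of_real (1 / ?w\<^sup>2) * mtrace (?X * ?R)"
      by (rule mean_step[OF anc_block_carrier X l])
    finally show ?thesis .
  qed
  \<comment> \<open>The pair of collision k is independent of the earlier ones and is split off; the
    resulting inner sum is the one evaluated in \<open>step\<close>.\<close>
  have "measure_pmf.expectation (prefix_pmf (Suc k)) (\<lambda>xy. mtrace (X * anc_block ?n (run xy (Suc k)) a b)) =
      measure_pmf.expectation (pair_pmf (step_pmf k) (prefix_pmf k))
        (\<lambda>z. mtrace (X * anc_block ?n (run ((snd z)(k := fst z)) (Suc k)) a b))"
    unfolding lessThan_Suc by (subst Pi_pmf_insert) (simp_all add: case_prod_unfold)
  also have "\<dots> = (\<Sum>f\<in>set_pmf (prefix_pmf k). pmf (prefix_pmf k) f *\<^sub>R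
      (\<Sum>z\<in>?I \<times> ?I. pmf (step_pmf k) z *\<^sub>R mtrace (X * anc_block ?n (run (f(k := z)) (Suc k)) a b)))"
    unfolding expectation_pair_finite[OF step_pmf_finite prefix_pmf(1)] fst_conv snd_conv ..
  also have "\<dots> = (\<Sum>f\<in>set_pmf (prefix_pmf k). pmf (prefix_pmf k) f *\<^sub>R
      (complex_of_real (1 / ?w\<^sup>2) * mtrace (?X * anc_block ?n (run f k) a b)))"
    by (intro sum.cong refl) (simp only: step)
  also have "\<dots> = complex_of_real (1 / ?w\<^sup>2) * measure_pmf.expectation (prefix_pmf k) (\<lambda>f. mtrace (?X * anc_block ?n (run f k) a b))"
    unfolding expectation_finite[OF prefix_pmf(1) order_refl] sum_distrib_left by (intro sum.cong refl) simp
  also have "\<dots> = complex_of_real (1 / ?w\<^sup>2) * (complex_of_real (\<Prod>j<k. 1 / (weight (j mod num_envs M))\<^sup>2) *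
      mtrace (?X * env_evolution ?E (num_envs M) approx ((1 / 2) \<cdot>\<^sub>m \<rho>) k))"
    unfolding Suc.IH[OF Xc] ..
  also have "mtrace (?X * env_evolution ?E (num_envs M) approx ((1 / 2) \<cdot>\<^sub>m \<rho>) k) =
      mtrace (X * env_evolution ?E (num_envs M) approx ((1 / 2) \<cdot>\<^sub>m \<rho>) (Suc k))"
    unfolding env_evolution.simps
    by (rule mtrace_env_dual[OF V V _ env_state_carrier X, symmetric])
       (intro env_evolution_carrier approx_carrier num_envs_pos smult_carrier_mat rho(1) env_state_carrier)
  finally show ?case by (simp add: mult_ac)
qed

text \<open>The Pauli matrix exchanges the ancilla levels, so the diagonal of the product consists
  of the off-diagonal blocks of the state.\<close>

lemma mtrace_pauli_X_kron:
  assumes A: "A \<in> carrier_mat n n" and R: "R \<in> carrier_mat (2 * n) (2 * n)"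
  shows "mtrace (kron (pauli_mat Pauli_X) A * R) = mtrace (A * anc_block n R 1 0) + mtrace (A * anc_block n R 0 1)"
proof -
  have k: "kron (pauli_mat Pauli_X) A \<in> carrier_mat (2 * n) (2 * n)" by (rule kron_carrier[OF pauli_mat_carrier A])
  have two: "0 < (2::nat)" "1 < (2::nat)" by simp_all
  have px: "pauli_mat Pauli_X $$ (0, 0) = 0" "pauli_mat Pauli_X $$ (0, 1) = 1" "pauli_mat Pauli_X $$ (1, 0) = 1" "pauli_mat Pauli_X $$ (1, 1) = 0"
    by (auto simp: mat_of_rows_list_def)
  note c = mult_square_mat_carrier[OF A anc_block_carrier]
  have z: "0\<^sub>m n n * anc_block n R a b = 0\<^sub>m n n" for a b by (rule left_mult_zero_mat[OF anc_block_carrier])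
  have "anc_block n (kron (pauli_mat Pauli_X) A * R) 0 0 = A * anc_block n R 1 0"
    unfolding anc_block_mult[OF k R two(1,1)] anc_block_kron[OF pauli_mat_carrier A two(1,1)]
      anc_block_kron[OF pauli_mat_carrier A two(1,2)] px smult_zero_one_mat[OF A] z by (rule left_add_zero_mat[OF c])
  moreover have "anc_block n (kron (pauli_mat Pauli_X) A * R) 1 1 = A * anc_block n R 0 1"
    unfolding anc_block_mult[OF k R two(2,2)] anc_block_kron[OF pauli_mat_carrier A two(2,1)]
      anc_block_kron[OF pauli_mat_carrier A two(2,2)] px smult_zero_one_mat[OF A] z by (rule right_add_zero_mat[OF c])
  ultimately show ?thesis unfolding mtrace_anc_block[OF mult_square_mat_carrier[OF k R]] by simp
qed

text \<open>Both off-diagonal blocks start from \<rho>/2 and have the same mean, so together they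
  give the truncated evolution of \<rho> itself, divided by the square of \<open>zeta\<close>. The
  rescaled outcome is thus exactly unbiased for the truncated evolution; all bias with respect to
  the exact one is truncation error.\<close>

lemma run_pmf:
  assumes A: "A \<in> carrier_mat (sys_dim M) (sys_dim M)" "hermitian A" "opbound A c"
  shows "set_pmf (run_pmf M t \<nu> r q A \<rho>) \<subseteq> {-c..c}"
    and "complex_of_real ((zeta M t \<nu> r q)\<^sup>2 * measure_pmf.expectation (run_pmf M t \<nu> r q A \<rho>) (\<lambda>x. x)) =
      mtrace (A * env_evolution (env_state M) (num_envs M) approx \<rho> (num_envs M * \<nu>))"
proof -
  let ?K = "num_envs M * \<nu>" let ?n = "sys_dim M"
  let ?P = "prefix_pmf ?K" let ?A = "kron (pauli_mat Pauli_X) A"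
  let ?ev = "\<lambda>R. env_evolution (env_state M) (num_envs M) approx R ?K"
  have P: "samples_pmf M t \<nu> r q = ?P" by (simp add: samples_pmf_def Let_def)
  have k: "?A \<in> carrier_mat (2 * ?n) (2 * ?n)" by (rule kron_carrier[OF pauli_mat_carrier A(1)])
  have kh: "hermitian ?A"
    by (intro hermitianI[OF k]) (simp only: kron_adjoint pauli_mat_adjoint hermitianD[OF A(2)])
  note ko = opbound_kron_pauli_X[OF A(3,1)]
  note meas = measurement_pmf[OF k kh ko run_density[OF prefix_pmf(2)]]
  show "set_pmf (run_pmf M t \<nu> r q A \<rho>) \<subseteq> {-c..c}"
    unfolding run_pmf_def P set_bind_pmf using meas(2) by blast
  have "complex_of_real (measure_pmf.expectation (run_pmf M t \<nu> r q A \<rho>) (\<lambda>x. x)) =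
      complex_of_real (\<Sum>xy\<in>set_pmf ?P. pmf ?P xy *\<^sub>R measure_pmf.expectation (measurement_pmf ?A (run xy ?K)) (\<lambda>x. x))"
  proof -
    have "measure_pmf.expectation (run_pmf M t \<nu> r q A \<rho>) (\<lambda>x. x) =
        (\<Sum>xy\<in>set_pmf ?P. pmf ?P xy *\<^sub>R measure_pmf.expectation (measurement_pmf ?A (run xy ?K)) (\<lambda>x. x))"
      unfolding run_pmf_def P by (rule pmf_expectation_bind[OF prefix_pmf(1) _ order_refl]) (rule meas(1))
    thus ?thesis by (simp only:)
  qed
  also have "\<dots> = (\<Sum>xy\<in>set_pmf ?P. pmf ?P xy *\<^sub>R mtrace (?A * run xy ?K))"
    unfolding of_real_sum
  proof (intro sum.cong refl)
    fix xy assume "xy \<in> set_pmf ?P"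
    from meas(3)[OF this] show "complex_of_real (pmf ?P xy *\<^sub>R measure_pmf.expectation (measurement_pmf ?A (run xy ?K)) (\<lambda>x. x)) =
        pmf ?P xy *\<^sub>R mtrace (?A * run xy ?K)"
      by (simp only: real_scaleR_def of_real_mult scaleR_conv_of_real[where 'a = complex])
  qed
  also have "\<dots> = (\<Sum>xy\<in>set_pmf ?P. pmf ?P xy *\<^sub>R mtrace (A * anc_block ?n (run xy ?K) 1 0)) +
      (\<Sum>xy\<in>set_pmf ?P. pmf ?P xy *\<^sub>R mtrace (A * anc_block ?n (run xy ?K) 0 1))"
    unfolding sum.distrib[symmetric]
  proof (intro sum.cong refl)
    fix xy assume "xy \<in> set_pmf ?P"
    hence "run xy ?K \<in> carrier_mat (2 * ?n) (2 * ?n)" using run_carrier_psd[OF prefix_pmf(2)] by blast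
    from mtrace_pauli_X_kron[OF A(1) this]
    show "pmf ?P xy *\<^sub>R mtrace (?A * run xy ?K) = pmf ?P xy *\<^sub>R mtrace (A * anc_block ?n (run xy ?K) 1 0) +
        pmf ?P xy *\<^sub>R mtrace (A * anc_block ?n (run xy ?K) 0 1)" by (simp only: scaleR_right_distrib)
  qed
  also have "\<dots> = complex_of_real (\<Prod>j<?K. 1 / (weight (j mod num_envs M))\<^sup>2) * (2 * mtrace (A * ?ev ((1 / 2) \<cdot>\<^sub>m \<rho>)))"
  proof -
    let ?c = "complex_of_real (\<Prod>j<?K. 1 / (weight (j mod num_envs M))\<^sup>2)"
    have "(\<Sum>xy\<in>set_pmf ?P. pmf ?P xy *\<^sub>R mtrace (A * anc_block ?n (run xy ?K) 1 0)) =
        ?c * mtrace (A * ?ev ((1 / 2) \<cdot>\<^sub>m \<rho>))"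
      using expectation_block[of 1 0 A ?K, OF disjI2[OF refl] A(1)]
      unfolding expectation_finite[OF prefix_pmf(1) order_refl] .
    moreover have "(\<Sum>xy\<in>set_pmf ?P. pmf ?P xy *\<^sub>R mtrace (A * anc_block ?n (run xy ?K) 0 1)) =
        ?c * mtrace (A * ?ev ((1 / 2) \<cdot>\<^sub>m \<rho>))"
      using expectation_block[of 0 1 A ?K, OF disjI1[OF refl] A(1)]
      unfolding expectation_finite[OF prefix_pmf(1) order_refl] .
    ultimately show ?thesis by (simp only: mult_2 distrib_left)
  qed
  also have "2 * mtrace (A * ?ev ((1 / 2) \<cdot>\<^sub>m \<rho>)) = mtrace (A * ?ev \<rho>)"
  proof -
    have h: "mtrace (A * ?ev ((1 / 2) \<cdot>\<^sub>m \<rho>)) = 1 / 2 * mtrace (A * ?ev \<rho>)"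
      by (rule mtrace_env_evolution_smult[OF _ num_envs_pos rho(1) env_state_carrier A(1)]) (rule approx_carrier)
    show ?thesis unfolding h by simp
  qed
  also have "(\<Prod>j<?K. 1 / (weight (j mod num_envs M))\<^sup>2) = 1 / (zeta M t \<nu> r q)\<^sup>2"
    by (simp only: zeta_def Let_def prod_dividef prod_power_distrib prod.neutral_const)
  finally have fin: "complex_of_real (measure_pmf.expectation (run_pmf M t \<nu> r q A \<rho>) (\<lambda>x. x)) =
      complex_of_real (1 / (zeta M t \<nu> r q)\<^sup>2) * mtrace (A * ?ev \<rho>)" .
  have "(zeta M t \<nu> r q)\<^sup>2 * (1 / (zeta M t \<nu> r q)\<^sup>2) = 1" using zeta_pos by simp
  thus "complex_of_real ((zeta M t \<nu> r q)\<^sup>2 * measure_pmf.expectation (run_pmf M t \<nu> r q A \<rho>) (\<lambda>x. x)) =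
      mtrace (A * ?ev \<rho>)"
    unfolding of_real_mult fin mult.assoc[symmetric] by (metis mult_1 of_real_1 of_real_mult)
qed

end

text \<open>One factor of the collision map is a sweep through m channels; reading the index modulo
  m lays the sweeps end to end.\<close>

lemma collision_map_evolution:
  "collision_map M t \<nu>' R = env_evolution (env_state M) (num_envs M) (collision_unitary M t \<nu>') R (num_envs M * \<nu>')"
proof -
  let ?m = "num_envs M" let ?ev = "env_evolution (env_state M) ?m (collision_unitary M t \<nu>') R"
  let ?C = "collision_channel M t \<nu>'"
  have C: "?C l S = env_channel (env_state M) (collision_unitary M t \<nu>' l) (collision_unitary M t \<nu>' l) S" for l S
    by (simp add: collision_channel_def env_channel_def Let_def)
  have sweep: "i \<le> ?m \<Longrightarrow> fold ?C [0..<i] (?ev (?m * n)) = ?ev (?m * n + i)" for n i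
    by (induction i) (simp_all add: C)
  have "(fold ?C [0..<?m] ^^ n) R = ?ev (?m * n)" for n
    by (induction n) (simp_all add: sweep add.commute)
  thus ?thesis by (simp add: collision_map_def)
qed

text \<open>A sampled product consists of r blocks, each with at most q Pauli strings and one
  rotation. Each collision applies two such products, whence the factor 2. The bound is a worst case
  over all samples of positive probability.\<close>

lemma run_depth_le:
  assumes xy: "xy \<in> set_pmf (samples_pmf M t \<nu> r q)" and c: "0 \<le> cP" "0 \<le> cR"
    and b: "\<And>l. l < num_envs M \<Longrightarrow> real (r l) \<le> B" "\<And>l. l < num_envs M \<Longrightarrow> real (q l) \<le> Q"
  shows "run_depth cP cR cE (num_envs M * \<nu>) xy \<le> real (num_envs M * \<nu>) * (cE + 2 * (B * (cP * Q + cR)))"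
proof -
  let ?K = "num_envs M * \<nu>"
  have "valid ?K xy"
    using xy prefix_pmf(2)[of xy ?K] by (simp add: samples_pmf_def Let_def)
  have d: "lcu_depth cP cR bs \<le> B * (cP * Q + cR)" if bs: "bs \<in> indices l" and l: "l < num_envs M" for bs l
  proof -
    have "lcu_depth cP cR bs \<le> (\<Sum>b\<leftarrow>bs. cP * Q + cR)"
      unfolding lcu_depth_def
    proof (rule sum_list_mono)
      fix b assume "b \<in> set bs"
      hence "b \<in> block_index (q l) (terms l)" using bs by (auto simp: lcu_index_def)
      then obtain ls s where b: "b = (ls, s)" "length ls \<le> q l" by (auto simp: block_index_def)
      hence "real (length ls) \<le> Q" using assms(5)[OF l] by linarith
      thus "(case b of (ls, s) \<Rightarrow> cP * real (length ls) + cR) \<le> cP * Q + cR"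
        using c by (simp add: b mult_left_mono)
    qed
    also have "\<dots> = real (r l) * (cP * Q + cR)"
      using bs by (simp add: lcu_index_def sum_list_triv)
    also have "\<dots> \<le> B * (cP * Q + cR)"
    proof (rule mult_right_mono[OF b(1)[OF l]])
      have "0 \<le> Q" using b(2)[OF l] by (meson of_nat_0_le_iff order_trans)
      thus "0 \<le> cP * Q + cR" using c by simp
    qed
    finally show ?thesis .
  qed
  have "run_depth cP cR cE ?K xy \<le> (\<Sum>j<?K. cE + 2 * (B * (cP * Q + cR)))"
    unfolding run_depth_def
  proof (rule sum_mono)
    fix j assume "j \<in> {..<?K}"
    with \<open>valid ?K xy\<close> have "fst (xy j) \<in> indices (j mod num_envs M)" "snd (xy j) \<in> indices (j mod num_envs M)"
      by (auto simp: valid_def)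
    from d[OF this(1) env_index_less] d[OF this(2) env_index_less]
    show "cE + lcu_depth cP cR (fst (xy j)) + lcu_depth cP cR (snd (xy j)) \<le> cE + 2 * (B * (cP * Q + cR))"
      by simp
  qed
  thus ?thesis by simp
qed

end

section \<open>Sample complexity and depth\<close>

lemma Hoeffding_mean_pmf:
  fixes p :: "real pmf"
  assumes p: "set_pmf p \<subseteq> {-c..c}" and c: "0 < c" and T: "0 < T" and s: "0 \<le> s"
  shows "measure_pmf.prob (Pi_pmf {..<T} d (\<lambda>_. p))
      {f. s \<le> \<bar>(\<Sum>i<T. f i) / real T - measure_pmf.expectation p (\<lambda>x. x)\<bar>} \<le>
    2 * exp (- 2 * real T * s\<^sup>2 / (c - - c)\<^sup>2)"
proof -
  let ?P = "Pi_pmf {..<T} d (\<lambda>_. p)"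
  have comp: "map_pmf (\<lambda>f. f i) ?P = p" if "i < T" for i
    using that by (simp add: Pi_pmf_component)
  have distr: "distr (measure_pmf ?P) borel (\<lambda>f. f i) = distr (measure_pmf p) borel (\<lambda>x. x)" if "i < T" for i
  proof -
    have "distr (measure_pmf ?P) borel (\<lambda>f. f i) = distr (measure_pmf (map_pmf (\<lambda>f. f i) ?P)) borel (\<lambda>x. x)"
      unfolding map_pmf_rep_eq by (subst distr_distr) (auto simp: o_def)
    thus ?thesis by (simp only: comp[OF that])
  qed
  \<comment> \<open>Coordinate 0 serves as the reference variable of the identically distributed
    family; it exists because T is positive.\<close>
  interpret H: Hoeffding_ineq_iid ?P "{..<T}" "\<lambda>i f. f i" "\<lambda>f. f 0" "-c" c "measure_pmf.expectation p (\<lambda>x. x)"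
  proof unfold_locales
    show "prob_space.indep_vars (measure_pmf ?P) (\<lambda>_. borel) (\<lambda>i f. f i) {..<T}"
      by (rule prob_space.indep_vars_compose2[OF _ indep_vars_Pi_pmf, where Y = "\<lambda>_ x. x"])
         (auto simp: measure_pmf.prob_space_axioms)
    show "AE f in measure_pmf ?P. f 0 \<in> {-c..c}"
    proof (rule AE_pmfI)
      fix f assume "f \<in> set_pmf ?P"
      hence "f 0 \<in> set_pmf (map_pmf (\<lambda>f. f 0) ?P)" by auto
      thus "f 0 \<in> {-c..c}" using p comp[OF T] by auto
    qed
    have "measure_pmf.expectation p (\<lambda>x. x) = measure_pmf.expectation (map_pmf (\<lambda>f. f 0) ?P) (\<lambda>x. x)"
      by (simp only: comp[OF T])
    also have "\<dots> = measure_pmf.expectation ?P (\<lambda>f. f 0)" by simp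
    finally show "measure_pmf.expectation p (\<lambda>x. x) \<equiv> measure_pmf.expectation ?P (\<lambda>f. f 0)" by simp
  qed (use distr T in auto)
  have "- c < c" "{..<T} \<noteq> {}" using c T by auto
  from H.Hoeffding_ineq_abs_ge'[OF s this] show ?thesis by simp
qed

text \<open>The k factors beyond p! are all at least p + 1.\<close>

lemma power_fact_le: "(p + 1) ^ k * fact p \<le> (fact (p + k) :: nat)"
proof (induction k)
  case (Suc k)
  have "(p + 1) ^ Suc k * fact p = (p + 1) * ((p + 1) ^ k * fact p)"
    by (simp only: power_Suc mult.assoc)
  also have "\<dots> \<le> (p + k + 1) * fact (p + k)" using Suc by (intro mult_le_mono) auto
  also have "\<dots> = fact (p + Suc k)" by simp
  finally show ?case .
qed simp

text \<open>With L = ln y the choice p near 4 L / ln L works: ln (p + 1) is at least (ln L)/2, so (p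
  + 1)^(p + 1) has logarithm at least 2 L, which exceeds ln (2 y), and (2p + 1)! dominates that
  power. The 10 is 2 * 4 plus the rounding. The threshold makes ln (ln y) at least 1; below it any
  large p will do.\<close>

lemma truncation_order:
  fixes y :: real
  shows "\<exists>p. 2 * y \<le> fact (2 * p + 1) \<and> (exp (exp 1) \<le> y \<longrightarrow> real (2 * p) \<le> 10 * (ln y / ln (ln y)))"
proof (cases "exp (exp 1) \<le> y")
  case False
  let ?p = "nat \<lceil>2 * y\<rceil>"
  have "2 * y \<le> real ?p" by linarith
  also have "\<dots> \<le> real (2 * ?p + 1)" by simp
  also have "\<dots> \<le> real (fact (2 * ?p + 1))" by (intro of_nat_mono fact_ge_self)
  finally have "2 * y \<le> fact (2 * ?p + 1)" by (simp only: of_nat_fact)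
  with False show ?thesis by blast
next
  case True
  let ?L = "ln y"
  have y: "0 < y" using True by (meson exp_gt_zero less_le_trans)
  have "exp 1 \<le> ?L" using True y by (simp add: ln_ge_iff)
  moreover have "1 \<le> exp (1::real)" by simp
  ultimately have L: "1 \<le> ?L" "0 < ?L" by linarith+
  have lL: "1 \<le> ln ?L" using \<open>exp 1 \<le> ?L\<close> L by (simp add: ln_ge_iff)
  have "ln ?L \<le> ?L - 1" using L by (intro ln_le_minus_one) auto
  hence ratio: "1 \<le> ?L / ln ?L" using lL by simp
  let ?x = "4 * (?L / ln ?L)"
  let ?p = "nat \<lceil>?x\<rceil>"
  have p: "?x \<le> real ?p + 1" "real ?p \<le> ?x + 1" using ratio by linarith+
  \<comment> \<open>The denominator of \<open>?x\<close> costs only ln (ln L) in its logarithm, at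
    most half of ln L; this half is the loss compensated by the 4.\<close>
  have "ln (ln ?L) \<le> ln ?L / 2"
  proof -
    have "ln (ln ?L / 2) \<le> ln ?L / 2 - 1" using lL by (intro ln_le_minus_one) auto
    moreover have "ln (ln ?L / 2) = ln (ln ?L) - ln 2" using lL by (simp add: ln_div)
    moreover have "ln 2 \<le> (1::real)" using ln_2_less_1 by linarith
    ultimately show ?thesis by linarith
  qed
  moreover have "ln ?x = ln 4 + (ln ?L - ln (ln ?L))"
  proof -
    have "0 < ln ?L" using lL by linarith
    thus ?thesis using L by (simp only: ln_mult_pos ln_divide_pos zero_less_numeral divide_pos_pos)
  qed
  moreover have "0 \<le> ln (4::real)" by simp
  ultimately have "ln ?L / 2 \<le> ln ?x" by linarith
  also have "ln ?x \<le> ln (real ?p + 1)" using p(1) ratio by (intro ln_mono) auto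
  finally have lp: "ln ?L / 2 \<le> ln (real ?p + 1)" .
  have "?L + ln 2 \<le> 2 * ?L" using ln_2_less_1 L by linarith
  also have "2 * ?L = ?x * (ln ?L / 2)" using lL by simp
  also have "\<dots> \<le> (real ?p + 1) * ln (real ?p + 1)"
    using p(1) lp lL by (intro mult_mono) auto
  also have "real ?p + 1 = real (?p + 1)" by simp
  also have "real (?p + 1) * ln (real (?p + 1)) = ln (real (?p + 1) ^ (?p + 1))"
    by (rule ln_realpow[symmetric])
  finally have "ln (2 * y) \<le> ln (real (?p + 1) ^ (?p + 1))"
    using y by (simp only: ln_mult_pos zero_less_numeral add.commute)
  hence "ln (2 * y) \<le> ln ((real ?p + 1) ^ (?p + 1))" by (simp only: of_nat_add of_nat_1)
  hence "2 * y \<le> (real ?p + 1) ^ (?p + 1)"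
    using y by (subst (asm) ln_le_cancel_iff) auto
  also have "\<dots> \<le> real (fact (2 * ?p + 1))"
  proof -
    have "(?p + 1) ^ (?p + 1) * 1 \<le> (?p + 1) ^ (?p + 1) * fact ?p" by (intro mult_le_mono2 fact_ge_1)
    also have "\<dots> \<le> fact (?p + (?p + 1))" by (rule power_fact_le)
    also have "?p + (?p + 1) = 2 * ?p + 1" by simp
    finally have "real ((?p + 1) ^ (?p + 1)) \<le> real (fact (2 * ?p + 1))" by (intro of_nat_mono) simp
    thus ?thesis by (simp only: of_nat_power of_nat_add of_nat_1)
  qed
  finally have "2 * y \<le> fact (2 * ?p + 1)" by (simp only: of_nat_fact)
  moreover have "real (2 * ?p) \<le> 10 * (?L / ln ?L)" 
    unfolding of_nat_mult of_nat_numeral using p(2) ratio by linarith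
  ultimately show ?thesis by blast
qed

text \<open>Unit vectors are mapped to the columns. A nonzero observable therefore has positive
  spectral norm, by which the parameters of the algorithm are divided.\<close>

lemma opbound_0_imp_zero:
  assumes A: "A \<in> carrier_mat m n" "opbound A 0"
  shows "A = 0\<^sub>m m n"
proof (rule eq_matI)
  fix i j assume "i < dim_row (0\<^sub>m m n :: complex mat)" "j < dim_col (0\<^sub>m m n :: complex mat)"
  hence ij: "i < m" "j < n" by auto
  have "vnorm (A *\<^sub>v unit_vec n j) = 0"
    using opboundD[OF A(2,1) unit_vec_carrier, of j] vnorm_nonneg[of "A *\<^sub>v unit_vec n j"] by simp
  moreover have "A *\<^sub>v unit_vec n j \<in> carrier_vec m" using A by simp
  ultimately have "A *\<^sub>v unit_vec n j = 0\<^sub>v m" by (simp only: vnorm_eq_0_iff)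
  hence "vec_index (A *\<^sub>v unit_vec n j) i = 0" using ij by (simp only: index_zero_vec)
  moreover have "vec_index (A *\<^sub>v unit_vec n j) i = (\<Sum>l<n. if l = j then A $$ (i, j) else 0)"
    unfolding index_mult_mat_vec_sum[OF A(1) unit_vec_carrier ij(1)] using ij by (intro sum.cong) auto
  ultimately show "A $$ (i, j) = 0\<^sub>m m n $$ (i, j)" using ij by simp
qed (use A in auto)

section \<open>Accuracy of the estimate and length of a collision\<close>

context lcu_run
begin

text \<open>Each of the K collisions contributes a weight of at most exp(1/K), so the product is at
  most e <= 3.\<close>

lemma zeta_power2_le:
  assumes r: "\<And>l. l < num_envs M \<Longrightarrow> real (r l) * (step_time l)\<^sup>2 \<le> 1 / real (num_envs M * \<nu>)"
  shows "(zeta M t \<nu> r q)\<^sup>2 \<le> 9"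
proof -
  let ?K = "num_envs M * \<nu>"
  have K: "0 < ?K" using num_envs_pos \<nu> by simp
  have "zeta M t \<nu> r q \<le> (\<Prod>j<?K. exp (1 / real ?K))"
    unfolding zeta_def Let_def
  proof (rule prod_mono)
    fix j
    note w = weight_ge_1[OF env_index_less, of j]
    have "exp (real (r (j mod num_envs M)) * (step_time (j mod num_envs M))\<^sup>2) \<le> exp (1 / real ?K)"
      using r[OF env_index_less, of j] by simp
    with w show "0 \<le> weight (j mod num_envs M) \<and> weight (j mod num_envs M) \<le> exp (1 / real ?K)" by linarith
  qed
  also have "\<dots> = exp (real ?K * (1 / real ?K))"
    by (simp only: prod_constant card_lessThan exp_of_nat_mult)
  also have "\<dots> = exp 1" using K by simp
  also have "\<dots> \<le> 3" by (rule exp_le)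
  finally have "(zeta M t \<nu> r q)\<^sup>2 \<le> 3\<^sup>2" using zeta_pos by (intro power_mono) auto
  thus ?thesis by simp
qed

text \<open>Rescaling by at most 9 shrinks the admissible deviation of the sample mean from
  \<epsilon>/3 to \<epsilon>/27. Hoeffding's exponent for values in [-w, w] is then T
  \<epsilon>^2/(1458 w^2); the 2916 in the hypothesis leaves a factor 2 to spare.\<close>

lemma estimate_accuracy:
  assumes \<rho>: "density_op (sys_dim M) \<rho>"
    and A: "A \<in> carrier_mat (sys_dim M) (sys_dim M)" "hermitian A" "opbound A w" and w: "0 < w"
    and corr: "corresponds C M t" and \<eta>: "0 < \<eta>" "\<eta> < 1" "w * \<eta> \<le> \<epsilon> / 3"
    and \<nu>': "real \<nu> \<ge> C * t\<^sup>2 * real (num_envs M) * Gamma_const M / \<eta>"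
    and e: "\<And>l. l < num_envs M \<Longrightarrow> opbound (approx l - collision_unitary M t \<nu> l) e"
    and e': "0 \<le> e" "real (2 * (num_envs M * \<nu>)) * e \<le> 1" "w * (4 * real (num_envs M * \<nu>) * e) \<le> \<epsilon> / 3"
    and z: "(zeta M t \<nu> r q)\<^sup>2 \<le> 9" and \<epsilon>: "0 < \<epsilon>" and T: "0 < T"
    and \<delta>: "2 * exp (- (real T * \<epsilon>\<^sup>2 / (2916 * w\<^sup>2))) \<le> \<delta>"
  shows "1 - \<delta> \<le> measure_pmf.prob (runs_pmf M t \<nu> r q A \<rho> T)
    {\<mu>s. cmod (complex_of_real (estimate M t \<nu> r q T \<mu>s) -
       mtrace (A * superop_exp (sys_dim M) (lindbladian M) t \<rho>)) \<le> \<epsilon>}"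
proof -
  let ?K = "num_envs M * \<nu>" let ?n = "sys_dim M"
  let ?p = "run_pmf M t \<nu> r q A \<rho>" let ?z = "zeta M t \<nu> r q"
  let ?E = "measure_pmf.expectation ?p (\<lambda>x. x)"
  let ?V = "env_evolution (env_state M) (num_envs M) approx \<rho> ?K"
  let ?U = "env_evolution (env_state M) (num_envs M) (collision_unitary M t \<nu>) \<rho> ?K"
  let ?L = "mtrace (A * superop_exp ?n (lindbladian M) t \<rho>)"
  note rp = run_pmf[OF \<rho> A]
  have "cmod (mtrace (A * ?V) - mtrace (A * ?U)) \<le> w * ((1 + e) ^ (2 * ?K) - 1)"
    by (rule env_evolution_error(2)[OF _ _ num_envs_pos _ _ \<rho> env_state_diag _ _ _ A(3,1)])
      (simp_all add: approx_carrier collision_unitary_carrier opbound_unitary[OF collision_unitary_unitary] e env_state_weights)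
  \<comment> \<open>The exponent 2K counts two factors per collision; linearizing the power doubles
    it to the 4K that the hypothesis on e anticipates.\<close>
  also have "\<dots> \<le> w * (2 * (real (2 * ?K) * e))"
    using w e' by (intro mult_left_mono one_plus_power_le) auto
  also have "\<dots> = w * (4 * real ?K * e)" by simp
  also have "\<dots> \<le> \<epsilon> / 3" by (rule e'(3))
  finally have 1: "cmod (mtrace (A * ?V) - mtrace (A * ?U)) \<le> \<epsilon> / 3" .
  have "cmod (?L - mtrace (A * collision_map M t \<nu> \<rho>)) \<le> w * \<eta>"
    by (rule corresponds_expectation[OF wf corr \<eta>(1,2) \<nu> \<nu>' A(3,1) \<rho>])
  hence 2: "cmod (mtrace (A * ?U) - ?L) \<le> \<epsilon> / 3"
    unfolding collision_map_evolution using \<eta>(3) by (simp add: norm_minus_commute)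
  have close: "cmod (complex_of_real (estimate M t \<nu> r q T f) - ?L) \<le> \<epsilon>"
    if f: "\<bar>(\<Sum>i<T. f i) / real T - ?E\<bar> < \<epsilon> / 27" for f
  proof -
    have "estimate M t \<nu> r q T f - ?z\<^sup>2 * ?E = ?z\<^sup>2 * ((\<Sum>i<T. f i) / real T - ?E)"
      by (simp add: estimate_def algebra_simps)
    hence "\<bar>estimate M t \<nu> r q T f - ?z\<^sup>2 * ?E\<bar> = ?z\<^sup>2 * \<bar>(\<Sum>i<T. f i) / real T - ?E\<bar>" by (simp add: abs_mult)
    also have "\<dots> \<le> 9 * (\<epsilon> / 27)" using z f by (intro mult_mono) auto
    finally have "cmod (complex_of_real (estimate M t \<nu> r q T f) - complex_of_real (?z\<^sup>2 * ?E)) \<le> \<epsilon> / 3"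
      unfolding of_real_diff[symmetric] norm_of_real by simp
    hence 3: "cmod (complex_of_real (estimate M t \<nu> r q T f) - mtrace (A * ?V)) \<le> \<epsilon> / 3"
      unfolding rp(2) .
    have "complex_of_real (estimate M t \<nu> r q T f) - ?L = (complex_of_real (estimate M t \<nu> r q T f) - mtrace (A * ?V)) +
        (mtrace (A * ?V) - mtrace (A * ?U)) + (mtrace (A * ?U) - ?L)" by simp
    also have "cmod \<dots> \<le> (\<epsilon> / 3 + \<epsilon> / 3) + \<epsilon> / 3" by (intro norm_triangle_mono 1 2 3)
    finally show ?thesis by simp
  qed
  let ?P = "runs_pmf M t \<nu> r q A \<rho> T"
  let ?bad = "{f. \<epsilon> / 27 \<le> \<bar>(\<Sum>i<T. f i) / real T - ?E\<bar>}"
  have "measure_pmf.prob ?P ?bad \<le> 2 * exp (- 2 * real T * (\<epsilon> / 27)\<^sup>2 / (w - - w)\<^sup>2)"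
    unfolding runs_pmf_def using \<epsilon> by (intro Hoeffding_mean_pmf rp(1) w T) auto
  also have "- 2 * real T * (\<epsilon> / 27)\<^sup>2 / (w - - w)\<^sup>2 = - (real T * \<epsilon>\<^sup>2 / (1458 * w\<^sup>2))"
    by (simp add: power2_eq_square field_simps)
  also have "2 * exp \<dots> \<le> 2 * exp (- (real T * \<epsilon>\<^sup>2 / (2916 * w\<^sup>2)))"
    using w by (simp add: frac_le mult_nonneg_nonneg)
  finally have bad: "measure_pmf.prob ?P ?bad \<le> \<delta>" using \<delta> by linarith
  have "1 - \<delta> \<le> 1 - measure_pmf.prob ?P ?bad" using bad by simp
  also have "\<dots> = measure_pmf.prob ?P (- ?bad)"
    using measure_pmf.prob_compl[of ?bad ?P] by (simp add: Compl_eq_Diff_UNIV)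
  also have "\<dots> \<le> measure_pmf.prob ?P {\<mu>s. cmod (complex_of_real (estimate M t \<nu> r q T \<mu>s) - ?L) \<le> \<epsilon>}"
    using close by (intro measure_pmf.finite_measure_mono) (auto simp: not_le)
  finally show ?thesis .
qed

lemma beta_max_ge:
  assumes l: "l < num_envs M"
  shows "int_weight M l \<le> beta_max M t \<nu>"
    "sqrt (t / ((real (num_envs M))\<^sup>2 * real \<nu>)) * sys_weight M \<le> beta_max M t \<nu>"
    "env_weight M l * sqrt (t / real \<nu>) \<le> beta_max M t \<nu>"
  unfolding beta_max_def using l by (auto intro!: Max_ge)

text \<open>The collision time is the time step times a sum of three weights. As the coupling is the
  inverse root of the time step, one root can be taken out of each summand, and what remains is an
  entry of \<open>beta_max\<close>. The 9 is the square of the number of summands.\<close>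

lemma col_time_power2_le:
  assumes l: "l < num_envs M"
  shows "(col_time M t \<nu> l)\<^sup>2 \<le> 9 * (t / real \<nu>) * (beta_max M t \<nu>)\<^sup>2"
proof -
  let ?\<Delta> = "t / real \<nu>" let ?m = "real (num_envs M)" let ?b = "beta_max M t \<nu>"
  have \<Delta>: "0 < ?\<Delta>" using t \<nu> by simp
  have m: "0 < ?m" using num_envs_pos by simp
  have s: "sqrt ?\<Delta> * sqrt ?\<Delta> = ?\<Delta>" "0 < sqrt ?\<Delta>"
    using \<Delta> by (simp_all only: real_sqrt_mult_self abs_of_pos real_sqrt_gt_0_iff)
  note b = beta_max_ge[OF l]
  have "col_weight M (coupling t \<nu>) l \<le> sys_weight M / ?m + coupling t \<nu> * int_weight M l + env_weight M l"
    using wf l coupling_pos unfolding wf_collision_model_def by blast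
  hence "col_time M t \<nu> l \<le> (sys_weight M / ?m + coupling t \<nu> * int_weight M l + env_weight M l) * ?\<Delta>"
    unfolding col_time_def time_step_def using \<Delta> by (intro mult_right_mono) auto
  also have "\<dots> = sqrt ?\<Delta> * (sqrt ?\<Delta> / ?m * sys_weight M) + sqrt ?\<Delta> * int_weight M l +
      sqrt ?\<Delta> * (env_weight M l * sqrt ?\<Delta>)"
  proof -
    have "coupling t \<nu> * ?\<Delta> = sqrt ?\<Delta>"
    proof -
      have "1 / sqrt ?\<Delta> * (sqrt ?\<Delta> * sqrt ?\<Delta>) = sqrt ?\<Delta>"
        using less_imp_neq[OF s(2)] by (simp only: divide_inverse mult.assoc[symmetric] mult_1_left left_inverse)
      thus ?thesis unfolding coupling_def time_step_def s(1) .
    qed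
    moreover have "(a / x + k * b + e) * d = u * (u / x * a) + u * b + u * (e * u)"
      if "k * d = u" "u * u = d" for a b d e k u x :: real
    proof -
      have "(a / x + k * b + e) * d = d * (a / x) + (k * d) * b + e * d" by (simp add: distrib_left distrib_right mult_ac)
      also have "\<dots> = u * u * (a / x) + u * b + e * (u * u)" unfolding that ..
      finally show ?thesis by (simp add: mult_ac)
    qed
    ultimately show ?thesis using s(1) by blast
  qed
  also have "sqrt ?\<Delta> / ?m = sqrt (t / (?m\<^sup>2 * real \<nu>))"
  proof -
    have "t / (?m\<^sup>2 * real \<nu>) = ?\<Delta> / ?m\<^sup>2" by simp
    thus ?thesis using m by (simp only: real_sqrt_divide) simp
  qed
  also have "sqrt ?\<Delta> * (sqrt (t / (?m\<^sup>2 * real \<nu>)) * sys_weight M) + sqrt ?\<Delta> * int_weight M l +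
      sqrt ?\<Delta> * (env_weight M l * sqrt ?\<Delta>) \<le> sqrt ?\<Delta> * ?b + sqrt ?\<Delta> * ?b + sqrt ?\<Delta> * ?b"
    using s(2) b by (intro add_mono mult_left_mono) auto
  finally have "col_time M t \<nu> l \<le> 3 * sqrt ?\<Delta> * ?b" by linarith
  moreover have "0 \<le> col_time M t \<nu> l"
    using collision_terms(1)[OF l] time_step_pos by (simp add: col_time_def)
  ultimately have "(col_time M t \<nu> l)\<^sup>2 \<le> (3 * sqrt ?\<Delta> * ?b)\<^sup>2" by (rule power_mono)
  also have "\<dots> = 9 * ?\<Delta> * ?b\<^sup>2" using \<Delta> by (simp add: power_mult_distrib)
  finally show ?thesis .
qed

end

section \<open>Arithmetic of the depth bound\<close>

lemma exp_exp_1_ge: "exp 1 \<le> exp (exp (1::real))" "2 \<le> exp (exp (1::real))"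
proof -
  show "exp 1 \<le> exp (exp (1::real))" by simp
  have "2 \<le> exp (1::real)" using exp_ge_add_one_self[of 1] by simp
  also have "\<dots> \<le> exp (exp (1::real))" by simp
  finally show "2 \<le> exp (exp (1::real))" .
qed

text \<open>Since y is at most quadratic in F, its logarithm is linear in ln F. The denominator is
  at least 1 and is simply dropped. The 252 is 12 * 21, from the 12 in \<epsilon>' and the bound 21
  B on the number of segments.\<close>

lemma log_ratio_le:
  fixes c F y Y :: real
  assumes y: "exp (exp 1) \<le> y" "y \<le> 252 * c * F\<^sup>2" and c: "1 \<le> c" and F: "exp 1 \<le> F"
  shows "10 * (ln y / ln (ln y)) \<le> 10 * (ln (252 * c) + 2) * ln F"
proof -
  have y0: "0 < y" using y(1) by (meson exp_gt_zero less_le_trans)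
  have F0: "0 < F" using F by (meson exp_gt_zero less_le_trans)
  have "exp 1 \<le> ln y" using y(1) y0 by (simp add: ln_ge_iff)
  moreover have "0 < ln y" using calculation by (meson exp_gt_zero less_le_trans)
  ultimately have l: "1 \<le> ln (ln y)" by (simp add: ln_ge_iff)
  have "ln y * 1 \<le> ln y * ln (ln y)" using \<open>0 < ln y\<close> by (intro mult_left_mono l) linarith
  hence "ln y / ln (ln y) \<le> ln y" using l by (intro mult_imp_div_pos_le) linarith+
  also have "\<dots> \<le> ln (252 * c * F\<^sup>2)" using y y0 by simp
  also have "\<dots> = ln (252 * c) + 2 * ln F" using c F0 by (simp add: ln_mult ln_realpow)
  also have "\<dots> \<le> ln (252 * c) * ln F + 2 * ln F"
  proof -
    have "1 \<le> ln F" using F F0 by (simp add: ln_ge_iff)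
    moreover have "0 \<le> ln (252 * c)" using c by simp
    ultimately have "ln (252 * c) * 1 \<le> ln (252 * c) * ln F" by (intro mult_left_mono)
    thus ?thesis by simp
  qed
  finally have "10 * (ln y / ln (ln y)) \<le> 10 * (ln (252 * c) * ln F + 2 * ln F)" by (rule mult_left_mono) simp
  also have "\<dots> = 10 * (ln (252 * c) + 2) * ln F" by (simp only: distrib_right mult.assoc)
  finally show ?thesis .
qed

text \<open>K counts collisions, R and Q bound the segments and the truncation order. The product K
  R is of order F and Q of order ln F. The cost of preparing environments is proportional to K alone
  and is absorbed because B and ln F are at least 1.\<close>

lemma depth_le:
  fixes c c' F K R Q S B cP cR cE :: real
  assumes K: "0 \<le> K" "K \<le> c * S" and R: "0 \<le> R" "R \<le> 21 * B" and Q: "Q \<le> c' * ln F" and F: "F = S * B" "exp 1 \<le> F"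
    and B: "1 \<le> B" and c: "0 \<le> cP" "0 \<le> cR" "0 \<le> cE" "0 \<le> c" "0 \<le> c'"
  shows "K * (cE + 2 * (R * (cP * Q + cR))) \<le> (c * cE + 42 * c * (cP * c' + cR)) * (F * ln F)"
proof -
  have F0: "0 < F" using F(2) by (meson exp_gt_zero less_le_trans)
  have lF: "1 \<le> ln F" using F(2) F0 by (simp add: ln_ge_iff)
  have S: "0 \<le> S" using F(1) F0 B by (metis less_eq_real_def linorder_not_less mult_nonpos_nonneg order_less_trans zero_less_one order_trans zero_le_one)
  have "S * 1 \<le> S * B" using S B by (intro mult_left_mono) auto
  hence SF: "S \<le> F" using F(1) by simp
  have "K \<le> c * F" using K(2) mult_left_mono[OF SF c(4)] by linarith
  hence "K * cE \<le> c * F * cE * 1" using c by (simp add: mult_right_mono)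
  also have "c * F * cE * 1 \<le> c * F * cE * ln F"
    using lF c F0 by (intro mult_left_mono mult_nonneg_nonneg) auto
  finally have 1: "K * cE \<le> c * cE * (F * ln F)" by (simp add: mult_ac)
  have "K * R \<le> c * S * (21 * B)" using K R c S by (intro mult_mono) auto
  hence KR: "K * R \<le> 21 * c * F" by (simp add: F(1) mult_ac)
  have "cP * Q + cR \<le> cP * (c' * ln F) + cR * ln F"
    using Q c lF by (intro add_mono mult_left_mono) (auto simp: mult_le_cancel_left1)
  hence PQ: "cP * Q + cR \<le> (cP * c' + cR) * ln F" by (simp add: algebra_simps)
  have "0 \<le> (cP * c' + cR) * ln F" using c lF by simp
  hence "(K * R) * (cP * Q + cR) \<le> (21 * c * F) * ((cP * c' + cR) * ln F)"
  \<comment> \<open>Since \<open>Q\<close> may be negative, monotonicity of products needs this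
    distinction.\<close>
  proof (cases "0 \<le> cP * Q + cR")
    case True
    have "0 \<le> 21 * c * F" using c F0 by simp
    show ?thesis by (rule mult_mono[OF KR PQ \<open>0 \<le> 21 * c * F\<close> True])
  next
    case False
    hence "(K * R) * (cP * Q + cR) \<le> 0" using K R by (intro mult_nonneg_nonpos) auto
    moreover have "0 \<le> (21 * c * F) * ((cP * c' + cR) * ln F)"
      using c F0 order_trans[OF zero_le_one lF] by (intro mult_nonneg_nonneg add_nonneg_nonneg) linarith+
    ultimately show ?thesis by linarith
  qed
  hence "2 * ((K * R) * (cP * Q + cR)) \<le> 2 * ((21 * c * F) * ((cP * c' + cR) * ln F))" by (rule mult_left_mono) simp
  also have "\<dots> = 42 * c * (cP * c' + cR) * (F * ln F)" by (simp add: algebra_simps)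
  finally have 2: "2 * ((K * R) * (cP * Q + cR)) \<le> 42 * c * (cP * c' + cR) * (F * ln F)" .
  have "K * (cE + 2 * (R * (cP * Q + cR))) = K * cE + 2 * ((K * R) * (cP * Q + cR))" by (simp add: algebra_simps)
  also have "\<dots> \<le> (c * cE + 42 * c * (cP * c' + cR)) * (F * ln F)" 
    unfolding distrib_right[of "c * cE" _ "F * ln F"] by (rule add_mono[OF 1 2])
  finally show ?thesis .
qed

lemma nat_ceiling_Suc_bounds:
  fixes x :: real
  assumes "0 \<le> x"
  shows "x < real (nat \<lceil>x\<rceil> + 1)" "real (nat \<lceil>x\<rceil> + 1) \<le> x + 2"
  using assms by linarith+

theorem theorem2:
  fixes C cP cR cE :: real
  assumes "C > 0" and "cP \<ge> 0" and "cR \<ge> 0" and "cE \<ge> 0"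
  shows "\<exists>k1>0. \<exists>k2>0. \<exists>a::nat.
    \<forall>(M::collision_model) (Obs::complex mat) (\<rho>S::complex mat) (t::real) (\<epsilon>::real) (\<delta>::real).
      wf_collision_model M \<longrightarrow> 0 < t \<longrightarrow> corresponds C M t \<longrightarrow>
      Obs \<in> carrier_mat (sys_dim M) (sys_dim M) \<longrightarrow> hermitian Obs \<longrightarrow> Obs \<noteq> 0\<^sub>m (sys_dim M) (sys_dim M) \<longrightarrow>
      density_op (sys_dim M) \<rho>S \<longrightarrow>
      0 < \<epsilon> \<longrightarrow> \<epsilon> < 1 \<longrightarrow> 0 < \<delta> \<longrightarrow> \<delta> < 1 \<longrightarrow>
      (let m = real (num_envs M); \<Gamma> = Gamma_const M; normO = spectral_norm Obs in
       \<exists>(\<nu>::nat)>0. \<exists>(r::nat \<Rightarrow> nat) (q::nat \<Rightarrow> nat). \<exists>(T::nat)>0.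
         (let K = num_envs M * \<nu>;
              \<epsilon>' = \<epsilon> / (12 * real K * normO);
              \<beta> = beta_max M t \<nu>;
              F = m ^ 3 * t ^ 3 * normO / \<epsilon> * \<Gamma> * \<beta>\<^sup>2
          in
            (\<forall>j<num_envs M.
               0 < r j \<and> col_time M t \<nu> j / real (r j) < 1 \<and>
               spectral_norm (approx_unitary M t \<nu> r q j - collision_unitary M t \<nu> j) \<le> \<epsilon>' \<and>
               (k1 \<le> normO / \<epsilon> \<and> k1 \<le> real (r j) / \<epsilon>' \<longrightarrow>
                  real (q j) \<le> k2 * (ln (real (r j) / \<epsilon>') / ln (ln (real (r j) / \<epsilon>'))))) \<and>
            measure_pmf.prob (runs_pmf M t \<nu> r q Obs \<rho>S T)
              {\<mu>s. cmod (complex_of_real (estimate M t \<nu> r q T \<mu>s) -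
                         mtrace (Obs * superop_exp (sys_dim M) (lindbladian M) t \<rho>S)) \<le> \<epsilon>} \<ge> 1 - \<delta> \<and>
            (k1 \<le> normO / \<epsilon> \<and> k1 \<le> t\<^sup>2 * m * normO * \<Gamma> / \<epsilon> \<longrightarrow>
               real \<nu> \<le> k2 * (t\<^sup>2 * m * normO * \<Gamma> / \<epsilon>)) \<and>
            (k1 \<le> normO / \<epsilon> \<and> k1 \<le> 1 / \<delta> \<longrightarrow>
               real T \<le> k2 * (normO\<^sup>2 * ln (1 / \<delta>) / \<epsilon>\<^sup>2)) \<and>
            (k1 \<le> normO / \<epsilon> \<and> k1 \<le> t\<^sup>2 * m * \<Gamma> \<and> k1 \<le> m * t * \<beta>\<^sup>2 \<longrightarrow>
               (\<forall>xy\<in>set_pmf (samples_pmf M t \<nu> r q).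
                  run_depth cP cR cE K xy \<le> k2 * (F * (ln F) ^ a)))))"
proof -
  \<comment> \<open>Above this threshold the logarithm and the iterated logarithm are at least
    1.\<close>
  define k1 where "k1 = exp (exp (1::real))"
  \<comment> \<open>The 3 C comes from \<eta> = \<epsilon>/(3 w), with w the norm of the observable;
    the 2 from rounding up.\<close>
  define c1 where "c1 = 3 * C + 2"
  define c2 where "c2 = 10 * (ln (252 * c1) + 2)"
  define c3 where "c3 = c1 * cE + 42 * c1 * (cP * c2 + cR)"
  \<comment> \<open>Here 5844 = 10 + 5834, for the truncation order and for the number of runs, the
    latter being 2 * 2916 + 2.\<close>
  define k2 where "k2 = 5844 + c1 + c3"
  note c0 = assms
  have k1: "0 < k1" "2 \<le> k1" "exp 1 \<le> k1" using exp_exp_1_ge by (auto simp: k1_def)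
  have c1: "2 \<le> c1" using c0 by (simp add: c1_def)
  have c2: "0 \<le> c2" using c1 by (simp add: c2_def)
  have c3: "0 \<le> c3" using c0 c1 c2 by (simp add: c3_def)
  have k2: "10 \<le> k2" "c1 \<le> k2" "5834 \<le> k2" "c3 \<le> k2" "0 < k2" using c1 c3 by (simp_all add: k2_def)
  show ?thesis
  proof (rule exI[of _ k1], rule conjI[OF k1(1)], rule exI[of _ k2], rule conjI[OF k2(5)], rule exI[of _ 1], intro allI impI)
    fix M :: collision_model and Obs \<rho> :: "complex mat" and t \<epsilon> \<delta> :: real
    assume wf: "wf_collision_model M" and t: "0 < t" and corr: "corresponds C M t"
      and Obs: "Obs \<in> carrier_mat (sys_dim M) (sys_dim M)" "hermitian Obs" "Obs \<noteq> 0\<^sub>m (sys_dim M) (sys_dim M)"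
      and \<rho>: "density_op (sys_dim M) \<rho>" and \<epsilon>: "0 < \<epsilon>" "\<epsilon> < 1" and \<delta>: "0 < \<delta>" "\<delta> < 1"
    let ?m = "real (num_envs M)" let ?w = "spectral_norm Obs"
    let ?Y = "?w / \<epsilon>"
    define G where "G = t\<^sup>2 * ?m * Gamma_const M"
    have Ob: "opbound Obs ?w" by (rule opbound_spectral_norm[OF Obs(1)]) simp
    have w: "0 < ?w"
    proof (rule ccontr)
      assume "\<not> 0 < ?w"
      hence "?w = 0" using opbound_nonneg[OF Ob] by linarith
      hence "Obs = 0\<^sub>m (sys_dim M) (sys_dim M)" using opbound_0_imp_zero[OF Obs(1)] Ob by (simp only:)
      with Obs(3) show False by simp
    qed
    have m: "1 \<le> ?m" using wf by (simp add: wf_collision_model_def)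
    have \<Gamma>: "0 \<le> Gamma_const M" by (simp add: Gamma_const_def)
    have G: "0 \<le> G" using \<Gamma> by (simp add: G_def)
    have Y: "0 < ?Y" using w \<epsilon> by simp
    \<comment> \<open>The second entry makes the correspondence error \<epsilon>/3 in expectation;
      the first keeps \<eta> below 1, as the correspondence demands, when the observable is
      small.\<close>
    define \<eta> where "\<eta> = min (1 / 2) (\<epsilon> / (3 * ?w))"
    have \<eta>: "0 < \<eta>" "\<eta> < 1" "\<eta> \<le> \<epsilon> / (3 * ?w)" using w \<epsilon> by (auto simp: \<eta>_def)
    have "?w * \<eta> \<le> ?w * (\<epsilon> / (3 * ?w))" using \<eta>(3) w by (intro mult_left_mono) auto
    hence w\<eta>: "?w * \<eta> \<le> \<epsilon> / 3" using w by simp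
    have CG: "0 \<le> C * G / \<eta>" using c0 G \<eta> by simp
    \<comment> \<open>The added 1 keeps the number of repetitions positive even if the required
      lower bound is 0.\<close>
    define \<nu> where "\<nu> = nat \<lceil>C * G / \<eta>\<rceil> + 1"
    have \<nu>: "0 < \<nu>" "C * G / \<eta> < real \<nu>" "real \<nu> \<le> C * G / \<eta> + 2"
      unfolding \<nu>_def using nat_ceiling_Suc_bounds[OF CG] by simp_all
    have \<nu>C: "C * t\<^sup>2 * ?m * Gamma_const M / \<eta> \<le> real \<nu>"
      using \<nu>(2) by (simp add: G_def mult.assoc)
    let ?K = "num_envs M * \<nu>"
    have K: "1 \<le> real ?K" 
    proof -
      have "1 * 1 \<le> ?m * real \<nu>" using m \<nu>(1) by (intro mult_mono) auto
      thus ?thesis by (simp only: of_nat_mult mult_1)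
    qed
    define \<tau> where "\<tau> = col_time M t \<nu>"
    have \<tau>0: "0 \<le> \<tau> l" if "l < num_envs M" for l
    proof -
      have "0 < coupling t \<nu>" using t \<nu>(1) by (simp add: coupling_def time_step_def)
      hence "0 \<le> col_weight M (coupling t \<nu>) l" using wf that unfolding wf_collision_model_def by blast
      thus ?thesis using t by (simp add: \<tau>_def col_time_def time_step_def)
    qed
    \<comment> \<open>The summand \<tau> secures \<tau>/r < 1; the summand K \<tau>^2 makes the
      exponent r (\<tau>/r)^2 of the weight at most 1/K; the added 1 gives strictness and
      positivity.\<close>
    define r where "r = (\<lambda>l. nat \<lceil>\<tau> l + real ?K * (\<tau> l)\<^sup>2\<rceil> + 1)"
    have r: "0 < r l" "\<tau> l + real ?K * (\<tau> l)\<^sup>2 < real (r l)" "real (r l) \<le> \<tau> l + real ?K * (\<tau> l)\<^sup>2 + 2"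
      if "l < num_envs M" for l
    proof -
      have "0 \<le> \<tau> l + real ?K * (\<tau> l)\<^sup>2" using \<tau>0[OF that] by simp
      from nat_ceiling_Suc_bounds[OF this]
      show "0 < r l" "\<tau> l + real ?K * (\<tau> l)\<^sup>2 < real (r l)" "real (r l) \<le> \<tau> l + real ?K * (\<tau> l)\<^sup>2 + 2"
        by (simp_all add: r_def)
    qed
    let ?\<epsilon> = "\<epsilon> / (12 * real ?K * ?w)"
    \<comment> \<open>The first entry is the promised accuracy \<epsilon>'; the second keeps 2 K e
      <= 1, needed for linearizing the error, when \<epsilon> exceeds the norm of the
      observable.\<close>
    define e where "e = min ?\<epsilon> (1 / (12 * real ?K))"
    have e: "0 < e" "e \<le> ?\<epsilon>" "e \<le> 1 / (12 * real ?K)" using \<epsilon> w K by (simp_all add: e_def)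
    have Ke: "12 * real ?K * e \<le> 1" using e(3) K by (simp add: field_simps)
    have "\<forall>l. \<exists>p. 2 * (real (r l) / e) \<le> fact (2 * p + 1) \<and>
        (exp (exp 1) \<le> real (r l) / e \<longrightarrow> real (2 * p) \<le> 10 * (ln (real (r l) / e) / ln (ln (real (r l) / e))))"
      using truncation_order by blast
    then obtain p where p: "\<And>l. 2 * (real (r l) / e) \<le> fact (2 * p l + 1)"
      "\<And>l. exp (exp 1) \<le> real (r l) / e \<Longrightarrow> real (2 * p l) \<le> 10 * (ln (real (r l) / e) / ln (ln (real (r l) / e)))"
      by metis
    \<comment> \<open>Orders of the form 2p are even, as the locale requires.\<close>
    define q where "q = (\<lambda>l. 2 * p l)"
    interpret L: lcu_run M t \<nu> r q
      by unfold_locales (use wf t \<nu>(1) in \<open>auto simp: q_def\<close>)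
    have step: "segment_time M t \<nu> r l = \<tau> l / real (r l)" for l
      by (simp add: segment_time_def \<tau>_def)
    have step_lt: "\<tau> l / real (r l) < 1" if "l < num_envs M" for l
    proof -
      have "0 \<le> real ?K * (\<tau> l)\<^sup>2" by simp
      hence "\<tau> l < real (r l)" using r(2)[OF that] by linarith
      thus ?thesis using r(1)[OF that] by simp
    qed
    have step_sq: "real (r l) * (segment_time M t \<nu> r l)\<^sup>2 \<le> 1 / real ?K" if l: "l < num_envs M" for l
    proof -
      have r0: "0 < real (r l)" using r(1)[OF l] by simp
      have "real ?K * (\<tau> l)\<^sup>2 \<le> real (r l)" using r(2)[OF l] \<tau>0[OF l] by linarith
      hence "(\<tau> l)\<^sup>2 / real (r l) \<le> 1 / real ?K" using r0 K by (simp add: field_simps)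
      moreover have "real (r l) * (segment_time M t \<nu> r l)\<^sup>2 = (\<tau> l)\<^sup>2 / real (r l)"
        unfolding step power_divide using r0 by (simp add: power2_eq_square)
      ultimately show ?thesis by linarith
    qed
    have approx: "opbound (approx_unitary M t \<nu> r q l - collision_unitary M t \<nu> l) e" if l: "l < num_envs M" for l
    proof -
      let ?f = "fact (q l + 1) :: real"
      have f0: "0 < ?f" by (rule fact_gt_zero)
      have "2 * (real (r l) / e) \<le> ?f" using p(1)[of l] by (simp only: q_def)
      \<comment> \<open>The truncation order was chosen with (q + 1)! >= 2 r/e; the 2 pays for
        linearizing the r-th power.\<close>
      hence b: "2 * (real (r l) * (1 / ?f)) \<le> e" using e(1) f0 by (simp add: field_simps)
      have "e \<le> 1"
      proof -
        have "1 * e \<le> 12 * real ?K * e" using K e(1) by (intro mult_right_mono) auto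
        thus ?thesis using Ke by linarith
      qed
      hence "real (r l) * (1 / ?f) \<le> 1" using b by linarith
      hence "(1 + 1 / ?f) ^ r l - 1 \<le> 2 * (real (r l) * (1 / ?f))" using f0 by (intro one_plus_power_le) auto
      hence "(1 + 1 / ?f) ^ r l - 1 \<le> e" using b by linarith
      moreover have "segment_time M t \<nu> r l \<le> 1" using step_lt[OF l] by (simp only: step)
      ultimately show ?thesis using L.approx_error[OF l r(1)[OF l]] opbound_mono by blast
    qed
    \<comment> \<open>Obtained by solving 2 exp(-T \<epsilon>^2/(2916 w^2)) <= \<delta> for
      T.\<close>
    define T where "T = nat \<lceil>2916 * (?w\<^sup>2 / \<epsilon>\<^sup>2) * ln (2 / \<delta>)\<rceil> + 1"
    have l\<delta>: "0 \<le> ln (2 / \<delta>)" using \<delta> by simp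
    have T_arg: "0 \<le> 2916 * (?w\<^sup>2 / \<epsilon>\<^sup>2) * ln (2 / \<delta>)" using l\<delta> by simp
    have T: "0 < T" "2916 * (?w\<^sup>2 / \<epsilon>\<^sup>2) * ln (2 / \<delta>) < real T" "real T \<le> 2916 * (?w\<^sup>2 / \<epsilon>\<^sup>2) * ln (2 / \<delta>) + 2"
      unfolding T_def using nat_ceiling_Suc_bounds[OF T_arg] by simp_all
    have T\<delta>: "2 * exp (- (real T * \<epsilon>\<^sup>2 / (2916 * ?w\<^sup>2))) \<le> \<delta>"
    proof -
      have "ln (2 / \<delta>) = 2916 * (?w\<^sup>2 / \<epsilon>\<^sup>2) * ln (2 / \<delta>) * (\<epsilon>\<^sup>2 / (2916 * ?w\<^sup>2))" using w \<epsilon> by simp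
      also have "\<dots> \<le> real T * (\<epsilon>\<^sup>2 / (2916 * ?w\<^sup>2))" using T(2) by (intro mult_right_mono) auto
      finally have "exp (- (real T * \<epsilon>\<^sup>2 / (2916 * ?w\<^sup>2))) \<le> exp (- ln (2 / \<delta>))" by simp
      also have "\<dots> = \<delta> / 2" using \<delta> by (simp add: exp_minus)
      finally show ?thesis by simp
    qed
    \<comment> \<open>If the norm of the observable is at least \<epsilon>, the minimum in \<eta> is
      its second entry, so C G/\<eta> is the promised quantity times 3 C; the rounding term 2 is
      absorbed because that quantity is at least 1.\<close>
    have nu_bound: "real \<nu> \<le> c1 * (G * ?Y)" if h: "1 \<le> ?Y" "1 \<le> G * ?Y"
    proof -
      have "\<epsilon> \<le> ?w" using h(1) \<epsilon> by (simp add: le_divide_eq)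
      hence "\<epsilon> / (3 * ?w) \<le> 1 / 2" using w by (simp add: divide_le_eq)
      hence "\<eta> = \<epsilon> / (3 * ?w)" by (simp add: \<eta>_def)
      hence "C * G / \<eta> = 3 * C * (G * ?Y)" using w \<epsilon> by simp
      hence "real \<nu> \<le> 3 * C * (G * ?Y) + 2 * (G * ?Y)" using \<nu>(3) h(2) by linarith
      thus ?thesis by (simp only: c1_def distrib_right)
    qed
    have e_eq: "e = ?\<epsilon>" if "1 \<le> ?Y"
    proof -
      have "\<epsilon> \<le> ?w" using that \<epsilon> by (simp add: le_divide_eq)
      hence "\<epsilon> / ?w \<le> 1" using w by simp
      hence "\<epsilon> / ?w / (12 * real ?K) \<le> 1 / (12 * real ?K)" using K by (intro divide_right_mono) auto
      moreover have "\<epsilon> / ?w / (12 * real ?K) = ?\<epsilon>" by (simp add: mult.commute)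
      ultimately have "?\<epsilon> \<le> 1 / (12 * real ?K)" by (simp only:)
      thus ?thesis unfolding e_def by (rule min_absorb1)
    qed
    have e4: "?w * (4 * real ?K * e) \<le> \<epsilon> / 3"
    proof -
      have "?w * (4 * real ?K * e) \<le> ?w * (4 * real ?K * ?\<epsilon>)" using w e(2) K by (intro mult_left_mono) auto
      also have "\<dots> = \<epsilon> / 3"
      proof -
        have "x * (4 * k * (\<epsilon> / (12 * k * x))) = \<epsilon> / 3" if "0 < x" "1 \<le> k" for x k :: real
          using that by (simp add: field_simps)
        thus ?thesis using w K by blast
      qed
      finally show ?thesis .
    qed
    have accuracy: "1 - \<delta> \<le> measure_pmf.prob (runs_pmf M t \<nu> r q Obs \<rho> T)
        {\<mu>s. cmod (complex_of_real (estimate M t \<nu> r q T \<mu>s) -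
          mtrace (Obs * superop_exp (sys_dim M) (lindbladian M) t \<rho>)) \<le> \<epsilon>}"
    proof (rule L.estimate_accuracy[OF \<rho> Obs(1,2) Ob w corr \<eta>(1,2) w\<eta> \<nu>C approx])
      show "0 \<le> e" using e by simp
      show "real (2 * ?K) * e \<le> 1"
      proof -
        have "0 \<le> real ?K * e" using e(1) by simp
        thus ?thesis using Ke by simp
      qed
      show "(zeta M t \<nu> r q)\<^sup>2 \<le> 9" by (rule L.zeta_power2_le[OF step_sq])
    qed (use e4 \<epsilon>(1) T(1) T\<delta> in auto)
    have depth: "run_depth cP cR cE ?K xy \<le> k2 * ((?m ^ 3 * t ^ 3 * ?w / \<epsilon> * Gamma_const M * (beta_max M t \<nu>)\<^sup>2) *
        ln (?m ^ 3 * t ^ 3 * ?w / \<epsilon> * Gamma_const M * (beta_max M t \<nu>)\<^sup>2) ^ 1)"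
      if h: "k1 \<le> ?Y" "k1 \<le> G" "k1 \<le> ?m * t * (beta_max M t \<nu>)\<^sup>2" and xy: "xy \<in> set_pmf (samples_pmf M t \<nu> r q)" for xy
    proof -
      \<comment> \<open>B governs the number of segments per collision and S the number of
        collisions; their product is the stated depth up to logarithms.\<close>
      define B where "B = ?m * t * (beta_max M t \<nu>)\<^sup>2"
      define S where "S = ?m * (G * ?Y)"
      define F where "F = S * B"
      have F_eq: "?m ^ 3 * t ^ 3 * ?w / \<epsilon> * Gamma_const M * (beta_max M t \<nu>)\<^sup>2 = F"
        by (simp add: F_def S_def B_def G_def power2_eq_square power3_eq_cube)
      have ge1: "1 \<le> ?Y" "1 \<le> G" "1 \<le> B" using h k1(2) unfolding B_def by linarith+
      have GY: "1 * ?Y \<le> G * ?Y" using ge1 by (intro mult_right_mono) auto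
      hence GY1: "1 \<le> G * ?Y" using ge1 by linarith
      have "1 * (G * ?Y) \<le> S" unfolding S_def using m GY1 by (intro mult_right_mono) auto
      hence S: "?Y \<le> S" "1 \<le> S" using GY ge1 by linarith+
      have "S * 1 \<le> F" unfolding F_def using ge1 S by (intro mult_left_mono) auto
      hence YF: "?Y \<le> F" using S by linarith
      have F: "exp 1 \<le> F" using YF h(1) k1(3) by linarith
      have KS: "real ?K \<le> c1 * S"
      proof -
        have "?m * real \<nu> \<le> ?m * (c1 * (G * ?Y))" using nu_bound[OF ge1(1) GY1] m by (intro mult_left_mono) auto
        thus ?thesis by (simp add: S_def mult_ac)
      qed
      \<comment> \<open>With K \<tau>^2 <= 9 B and \<tau> <= 1 + 9 B, the choice of r gives r <= 18
        B + 3, at most 21 B as B >= 1.\<close>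
      have rB: "real (r l) \<le> 21 * B" if l: "l < num_envs M" for l
      proof -
        have "(\<tau> l)\<^sup>2 \<le> 9 * (t / real \<nu>) * (beta_max M t \<nu>)\<^sup>2"
          unfolding \<tau>_def by (rule L.col_time_power2_le[OF l])
        hence "real ?K * (\<tau> l)\<^sup>2 \<le> real ?K * (9 * (t / real \<nu>) * (beta_max M t \<nu>)\<^sup>2)" by (intro mult_left_mono) auto
        also have "\<dots> = 9 * B" using \<nu>(1) by (simp add: B_def)
        finally have 1: "real ?K * (\<tau> l)\<^sup>2 \<le> 9 * B" .
        \<comment> \<open>The linear term in r is controlled by the quadratic one through 2 \<tau>
          <= 1 + \<tau>^2.\<close>
        have "0 \<le> (\<tau> l - 1)\<^sup>2" by simp
        hence "2 * \<tau> l \<le> 1 + (\<tau> l)\<^sup>2" by (simp add: power2_diff)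
        moreover have "1 * (\<tau> l)\<^sup>2 \<le> real ?K * (\<tau> l)\<^sup>2" using K by (intro mult_right_mono) auto
        ultimately have "\<tau> l \<le> 1 + 9 * B" using 1 \<tau>0[OF l] by linarith
        thus ?thesis using r(3)[OF l] 1 ge1(3) by linarith
      qed
      \<comment> \<open>The argument r/e equals 12 r K times the norm over \<epsilon>. Bounding r by
        21 B, K by c1 S and the last factor by F gives 252 c1 F^2, the form
        \<open>log_ratio_le\<close> expects.\<close>
      have qF: "real (q l) \<le> c2 * ln F" if l: "l < num_envs M" for l
      proof -
        let ?y = "real (r l) / e"
        have y_eq: "?y = 12 * (real (r l) * real ?K) * ?Y"
          unfolding e_eq[OF ge1(1)] using w \<epsilon> K by simp
        have r1: "1 \<le> real (r l)" using r(1)[OF l] by simp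
        have "1 * 1 \<le> real (r l) * real ?K" using r1 K by (intro mult_mono) auto
        hence "1 * ?Y \<le> 12 * (real (r l) * real ?K) * ?Y" using Y by (intro mult_right_mono) auto
        hence y1: "exp (exp 1) \<le> ?y" unfolding y_eq using h(1) unfolding k1_def by linarith
        have rK: "real (r l) * real ?K \<le> (21 * B) * (c1 * S)"
          using rB[OF l] KS K ge1 by (intro mult_mono) auto
        have "12 * (real (r l) * real ?K) * ?Y \<le> 12 * ((21 * B) * (c1 * S)) * F"
        proof (rule mult_mono[OF _ YF])
          show "12 * (real (r l) * real ?K) \<le> 12 * ((21 * B) * (c1 * S))" using rK by linarith
          show "0 \<le> 12 * ((21 * B) * (c1 * S))" using ge1 S c1 by simp
        qed (use Y in simp)
        hence y2: "?y \<le> 252 * c1 * F\<^sup>2" unfolding y_eq by (simp add: F_def power2_eq_square mult_ac)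
        have "real (q l) \<le> 10 * (ln ?y / ln (ln ?y))" using p(2)[OF y1] by (simp only: q_def)
        also have "\<dots> \<le> c2 * ln F" unfolding c2_def using c1 by (intro log_ratio_le y1 y2 F) simp
        finally show ?thesis .
      qed
      have lF: "0 \<le> F * ln F"
      proof -
        have "1 \<le> F" using F exp_ge_add_one_self[of 1] by linarith
        thus ?thesis by simp
      qed
      have "run_depth cP cR cE ?K xy \<le> real ?K * (cE + 2 * (21 * B * (cP * (c2 * ln F) + cR)))"
        by (rule L.run_depth_le[OF xy c0(2,3) rB qF])
      also have "\<dots> \<le> (c1 * cE + 42 * c1 * (cP * c2 + cR)) * (F * ln F)"
        by (rule depth_le[OF _ KS _ order_refl order_refl F_def F ge1(3) c0(2-4)]) (use ge1 c1 c2 in auto)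
      also have "\<dots> \<le> k2 * (F * ln F)"
        using k2(4) lF unfolding c3_def by (intro mult_right_mono) auto
      finally show ?thesis unfolding F_eq by simp
    qed
    show "let m = real (num_envs M); \<Gamma> = Gamma_const M; normO = spectral_norm Obs in
       \<exists>(\<nu>::nat)>0. \<exists>(r::nat \<Rightarrow> nat) (q::nat \<Rightarrow> nat). \<exists>(T::nat)>0.
         (let K = num_envs M * \<nu>;
              \<epsilon>' = \<epsilon> / (12 * real K * normO);
              \<beta> = beta_max M t \<nu>;
              F = m ^ 3 * t ^ 3 * normO / \<epsilon> * \<Gamma> * \<beta>\<^sup>2
          in
            (\<forall>j<num_envs M.
               0 < r j \<and> col_time M t \<nu> j / real (r j) < 1 \<and>
               spectral_norm (approx_unitary M t \<nu> r q j - collision_unitary M t \<nu> j) \<le> \<epsilon>' \<and>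
               (k1 \<le> normO / \<epsilon> \<and> k1 \<le> real (r j) / \<epsilon>' \<longrightarrow>
                  real (q j) \<le> k2 * (ln (real (r j) / \<epsilon>') / ln (ln (real (r j) / \<epsilon>'))))) \<and>
            measure_pmf.prob (runs_pmf M t \<nu> r q Obs \<rho> T)
              {\<mu>s. cmod (complex_of_real (estimate M t \<nu> r q T \<mu>s) -
                         mtrace (Obs * superop_exp (sys_dim M) (lindbladian M) t \<rho>)) \<le> \<epsilon>} \<ge> 1 - \<delta> \<and>
            (k1 \<le> normO / \<epsilon> \<and> k1 \<le> t\<^sup>2 * m * normO * \<Gamma> / \<epsilon> \<longrightarrow>
               real \<nu> \<le> k2 * (t\<^sup>2 * m * normO * \<Gamma> / \<epsilon>)) \<and>
            (k1 \<le> normO / \<epsilon> \<and> k1 \<le> 1 / \<delta> \<longrightarrow>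
               real T \<le> k2 * (normO\<^sup>2 * ln (1 / \<delta>) / \<epsilon>\<^sup>2)) \<and>
            (k1 \<le> normO / \<epsilon> \<and> k1 \<le> t\<^sup>2 * m * \<Gamma> \<and> k1 \<le> m * t * \<beta>\<^sup>2 \<longrightarrow>
               (\<forall>xy\<in>set_pmf (samples_pmf M t \<nu> r q).
                  run_depth cP cR cE K xy \<le> k2 * (F * (ln F) ^ 1))))"
      unfolding Let_def
    proof (rule exI[of _ \<nu>], rule conjI[OF \<nu>(1)], rule exI[of _ r], rule exI[of _ q], rule exI[of _ T],
        rule conjI[OF T(1)], intro conjI allI impI ballI)
      fix j assume j: "j < num_envs M"
      show "0 < r j" by (rule r(1)[OF j])
      show "col_time M t \<nu> j / real (r j) < 1" using step_lt[OF j] by (simp only: \<tau>_def)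
      show "spectral_norm (approx_unitary M t \<nu> r q j - collision_unitary M t \<nu> j) \<le> ?\<epsilon>"
        by (rule spectral_norm_le[OF opbound_mono[OF approx[OF j] e(2)] minus_carrier_mat[OF collision_unitary_carrier]]) simp
      assume h: "k1 \<le> ?Y \<and> k1 \<le> real (r j) / ?\<epsilon>"
      hence "1 \<le> ?Y" using k1(2) by linarith
      note ee = e_eq[OF this]
      let ?y = "real (r j) / ?\<epsilon>"
      have y: "exp (exp 1) \<le> ?y" using h by (simp only: k1_def)
      have "real (q j) \<le> 10 * (ln ?y / ln (ln ?y))"
        using p(2)[of j] y unfolding ee q_def by blast
      also have "\<dots> \<le> k2 * (ln ?y / ln (ln ?y))"
      proof (rule mult_right_mono[OF k2(1)])
        have "0 < ?y" using y by (meson exp_gt_zero less_le_trans)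
        hence "exp 1 \<le> ln ?y" using y by (simp only: ln_ge_iff)
        hence "1 \<le> ln ?y" using exp_ge_add_one_self[of 1] by linarith
        moreover have "1 \<le> ?y" using y exp_exp_1_ge(2) by linarith
        ultimately show "0 \<le> ln ?y / ln (ln ?y)" by (intro divide_nonneg_nonneg ln_ge_zero)
      qed
      finally show "real (q j) \<le> k2 * (ln ?y / ln (ln ?y))" .
    next
      show "1 - \<delta> \<le> measure_pmf.prob (runs_pmf M t \<nu> r q Obs \<rho> T)
        {\<mu>s. cmod (complex_of_real (estimate M t \<nu> r q T \<mu>s) -
          mtrace (Obs * superop_exp (sys_dim M) (lindbladian M) t \<rho>)) \<le> \<epsilon>}" by (rule accuracy)
    next
      have eq: "t\<^sup>2 * ?m * ?w * Gamma_const M / \<epsilon> = G * ?Y" by (simp add: G_def)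
      assume "k1 \<le> ?Y \<and> k1 \<le> t\<^sup>2 * ?m * ?w * Gamma_const M / \<epsilon>"
      hence h: "1 \<le> ?Y" "1 \<le> G * ?Y" unfolding eq using k1(2) by linarith+
      have "real \<nu> \<le> c1 * (G * ?Y)" by (rule nu_bound[OF h])
      also have "\<dots> \<le> k2 * (G * ?Y)" using h(2) by (intro mult_right_mono k2(2)) linarith
      finally show "real \<nu> \<le> k2 * (t\<^sup>2 * ?m * ?w * Gamma_const M / \<epsilon>)" unfolding eq .
    next
      assume "k1 \<le> ?Y \<and> k1 \<le> 1 / \<delta>"
      hence h: "k1 \<le> ?Y" "k1 \<le> 1 / \<delta>" by simp_all
      let ?z = "?w\<^sup>2 * ln (1 / \<delta>) / \<epsilon>\<^sup>2"
      have "0 < 1 / \<delta>" using \<delta> by simp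
      moreover have "exp 1 \<le> 1 / \<delta>" using h(2) k1(3) by linarith
      ultimately have l1: "1 \<le> ln (1 / \<delta>)" by (simp only: ln_ge_iff)
      have Y1: "1 \<le> ?Y" using h(1) k1(2) by linarith
      have z_eq: "?z = ?Y\<^sup>2 * ln (1 / \<delta>)" by (simp add: power_divide)
      have "1 * 1 \<le> ?Y\<^sup>2 * ln (1 / \<delta>)" using Y1 l1 by (intro mult_mono one_le_power) auto
      hence z1: "1 \<le> ?z" unfolding z_eq by simp
      \<comment> \<open>The 2 inside the logarithm stems from the two-sided tail bound; for \<delta>
        below the threshold it costs at most a factor 2.\<close>
      have "ln (2 / \<delta>) = ln 2 + ln (1 / \<delta>)" using \<delta> by (simp add: ln_div)
      also have "\<dots> \<le> 2 * ln (1 / \<delta>)" using l1 ln_2_less_1 by linarith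
      finally have "2916 * (?w\<^sup>2 / \<epsilon>\<^sup>2) * ln (2 / \<delta>) \<le> 2916 * (?w\<^sup>2 / \<epsilon>\<^sup>2) * (2 * ln (1 / \<delta>))"
        by (intro mult_left_mono) auto
      also have "\<dots> = 5832 * ?z" by simp
      finally have "real T \<le> 5832 * ?z + 2" using T(3) by linarith
      hence "real T \<le> 5834 * ?z" using z1 by linarith
      also have "\<dots> \<le> k2 * ?z" using z1 by (intro mult_right_mono k2(3)) linarith
      finally show "real T \<le> k2 * ?z" .
    next
      fix xy
      assume h: "k1 \<le> ?Y \<and> k1 \<le> t\<^sup>2 * ?m * Gamma_const M \<and> k1 \<le> ?m * t * (beta_max M t \<nu>)\<^sup>2"
        and xy: "xy \<in> set_pmf (samples_pmf M t \<nu> r q)"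
      show "run_depth cP cR cE ?K xy \<le> k2 * ((?m ^ 3 * t ^ 3 * ?w / \<epsilon> * Gamma_const M * (beta_max M t \<nu>)\<^sup>2) *
        ln (?m ^ 3 * t ^ 3 * ?w / \<epsilon> * Gamma_const M * (beta_max M t \<nu>)\<^sup>2) ^ 1)"
        using h by (intro depth xy) (simp_all add: G_def)
    qed
  qed
qed

end
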